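(* Let $\Lambda_0=a_1+\mathbb{Z}^3$ with $a_1\in K_1=(-\frac12,\frac12)^3$ (simple cubic lattice, i.e. one point per cell of period $1$). Let $\mathcal{O}\subset\mathbb{R}^3$ be a smooth bounded open set, $S$ a symmetric trace-free real $3\times3$ matrix, $f=\frac1{|\mathcal{O}|}1_{\mathcal{O}}$. For $\varepsilon>0$, let $N=N(\varepsilon)$ be the cardinality of $\{x\in-\varepsilon\Lambda_0:\ B(x,\varepsilon)\subset\mathcal{O}\}=\{x_1,\dots,x_N\}$ and $$\mathcal{V}_N:=\frac{75|\mathcal{O}|}{16\pi}\left(\frac1{N^2}\sum_{i\neq j}g_S(x_i-x_j)-\int_{\mathbb{R}^3\times\mathbb{R}^3}g_S(x-y)f(x)f(y)\,dx\,dy\right),\qquad g_S(x):=-D\left(\frac{(S:(x\otimes x))\,x}{|x|^5}\right):S.$$ Then, as $\varepsilon\to0$ (i.e. $N=N(\varepsilon)\to+\infty$), $$\lim_{N\to\infty}\mathcal{V}_N=\alpha\sum_iS_{ii}^2+\beta\sum_{i\neq j}S_{ij}^2,\qquad \alpha=\frac52(1-60a),\quad\beta=\frac52(1+40a),$$ where $a$ (numerically $a\approx-0.04655$) is the real constant defined by the expansion, as $y\to0$, $$\sum_{k\in\mathbb{Z}^3\setminus\{0\}}\frac1{16\pi^4|k|^4}e^{2i\pi k\cdot y}=-\frac1{4\pi}\left(\frac{|y|}2-c_2-\frac{c_1}6|y|^2+\frac{\pi}{30}|y|^4+aP(y)+O(|y|^6)\right),$$ with constants $c_1,c_2$ and 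$$P(y)=\frac{4\pi}3\Big(\frac58(y_1^4+y_2^4+y_3^4)-\frac{15}4(y_1^2y_2^2+y_1^2y_3^2+y_2^2y_3^2)+\frac38|y|^4\Big).$$
   Context: Notation: $A:B=\sum A_{ij}B_{ij}$, $D(u)=\frac12(\nabla u+\nabla u^T)$. The derivative in $g_S$ is taken in the sense of distributions; $f\mapsto g_S\star f$ is a Calderón–Zygmund operator on $L^2(\mathbb{R}^3)$ and the double integral means $\int(g_S\star f)f$. The displayed expansion defining $a$ is a known one (Hasimoto); $c_1$ is the same constant as in $\sum_{k\in\mathbb{Z}^3\setminus\{0\}}\frac1{4\pi^2|k|^2}e^{2i\pi k\cdot y}=\frac1{4\pi}\big(\frac1{|y|}-c_1+\frac{2\pi}3|y|^2+O(|y|^4)\big)$. *)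

theory Defs
  imports "HOL-Analysis.Analysis" "HOL-Library.Landau_Symbols"
begin

section \<open>Smooth functions and smooth domains\<close>

text \<open>Meant for open \<open>U\<close> only; \<open>g i\<close> is the \<open>i\<close>-th partial derivative of \<open>f\<close>.\<close>

fun Ck_on :: "nat \<Rightarrow> (real^3) set \<Rightarrow> (real^3 \<Rightarrow> real) \<Rightarrow> bool" where
  "Ck_on 0 U f \<longleftrightarrow> continuous_on U f"
| "Ck_on (Suc n) U f \<longleftrightarrow>
     (\<exists>g :: 3 \<Rightarrow> real^3 \<Rightarrow> real.
        (\<forall>x\<in>U. (f has_derivative (\<lambda>h. \<Sum>i\<in>UNIV. g i x * h $ i)) (at x)) \<and>
        (\<forall>i. Ck_on n U (g i)))"

definition smooth_on :: "(real^3) set \<Rightarrow> (real^3 \<Rightarrow> real) \<Rightarrow> bool" where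
  "smooth_on U f \<longleftrightarrow> (\<forall>n. Ck_on n U f)"

definition grad :: "(real^3 \<Rightarrow> real) \<Rightarrow> real^3 \<Rightarrow> real^3" where
  "grad f x = (\<chi> i. frechet_derivative f (at x) (axis i 1))"

text \<open>An open set with \<open>C\<^sup>\<infinity>\<close> boundary: near each boundary point it is the strict sublevel set of a
  smooth function with nonvanishing gradient, so it lies locally on one side of its boundary.\<close>

definition smooth_open :: "(real^3) set \<Rightarrow> bool" where
  "smooth_open \<O> \<longleftrightarrow> open \<O> \<and>
     (\<forall>x\<in>frontier \<O>. \<exists>U \<rho>. open U \<and> x \<in> U \<and> smooth_on U \<rho> \<and>
        (\<forall>y\<in>U. grad \<rho> y \<noteq> 0) \<and> \<O> \<inter> U = {y\<in>U. \<rho> y < 0})"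

definition test_function :: "(real^3 \<Rightarrow> real) \<Rightarrow> bool" where
  "test_function \<phi> \<longleftrightarrow> smooth_on UNIV \<phi> \<and> bounded {x. \<phi> x \<noteq> 0}"

section \<open>The kernel\<close>

text \<open>The contraction \<open>A : B\<close> is the inner product \<open>A \<bullet> B\<close> of \<^typ>\<open>real^3^3\<close>.\<close>

definition outer :: "real^3 \<Rightarrow> real^3 \<Rightarrow> real^3^3" where
  "outer x y = (\<chi> i j. x $ i * y $ j)"

definition sym_grad :: "(real^3 \<Rightarrow> real^3) \<Rightarrow> real^3 \<Rightarrow> real^3^3" where
  "sym_grad u x =
     (let J = matrix (frechet_derivative u (at x)) in (1/2) *\<^sub>R (J + transpose J))"

definition v_S :: "real^3^3 \<Rightarrow> real^3 \<Rightarrow> real^3" where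
  "v_S S x = ((S \<bullet> outer x x) / norm x ^ 5) *\<^sub>R x"

text \<open>The classical kernel, meaningful for \<open>x \<noteq> 0\<close>.\<close>

definition g_S :: "real^3^3 \<Rightarrow> real^3 \<Rightarrow> real" where
  "g_S S x = - (sym_grad (v_S S) x \<bullet> S)"

text \<open>The same expression \<open>- D(v) : S\<close> as a distribution on \<open>\<real>\<^sup>3\<close>, paired with \<open>\<phi>\<close>. The field \<open>v\<close> is
  locally integrable (homogeneous of degree \<open>-2\<close>); the derivative falls on \<open>\<phi>\<close> and cancels the
  minus sign. The Dirac mass at the origin is thereby included.\<close>

definition g_S_distr :: "real^3^3 \<Rightarrow> (real^3 \<Rightarrow> real) \<Rightarrow> real" where
  "g_S_distr S \<phi> =
     (LINT z|lborel.
        ((1/2) *\<^sub>R (outer (v_S S z) (grad \<phi> z) + outer (grad \<phi> z) (v_S S z))) \<bullet> S)"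

text \<open>\<open>h\<close> is a square integrable representative of the convolution of the distribution above with the
  compactly supported function \<open>f\<close>, that is
  \<open>\<langle>g_S \<star> f, \<phi>\<rangle> = \<langle>g_S, z \<mapsto> \<integral> f(y) \<phi>(z + y) dy\<rangle>\<close>.\<close>

definition is_g_S_conv :: "real^3^3 \<Rightarrow> (real^3 \<Rightarrow> real) \<Rightarrow> (real^3 \<Rightarrow> real) \<Rightarrow> bool" where
  "is_g_S_conv S f h \<longleftrightarrow>
     h \<in> borel_measurable lborel \<and> integrable lborel (\<lambda>x. (h x)\<^sup>2) \<and>
     (\<forall>\<phi>. test_function \<phi> \<longrightarrow>
        (LINT x|lborel. h x * \<phi> x) = g_S_distr S (\<lambda>z. LINT y|lborel. f y * \<phi> (z + y)))"

text \<open>Representatives agree almost everywhere, so the choice does not affect integrals.\<close>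

definition g_S_conv :: "real^3^3 \<Rightarrow> (real^3 \<Rightarrow> real) \<Rightarrow> real^3 \<Rightarrow> real" where
  "g_S_conv S f = (SOME h. is_g_S_conv S f h)"

text \<open>The double integral of \<open>g_S(x - y) f(x) f(y)\<close>.\<close>

definition g_S_energy :: "real^3^3 \<Rightarrow> (real^3 \<Rightarrow> real) \<Rightarrow> real" where
  "g_S_energy S f = (LINT x|lborel. g_S_conv S f x * f x)"

section \<open>The lattice and the functional\<close>

definition int_vec :: "int^3 \<Rightarrow> real^3" where
  "int_vec k = (\<chi> i. real_of_int (k $ i))"

definition lattice :: "real^3 \<Rightarrow> (real^3) set" where
  "lattice a1 = range (\<lambda>k. a1 + int_vec k)"

definition particles :: "real^3 \<Rightarrow> (real^3) set \<Rightarrow> real \<Rightarrow> (real^3) set" where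
  "particles a1 \<O> \<epsilon> = {x \<in> (\<lambda>p. - (\<epsilon> *\<^sub>R p)) ` lattice a1. ball x \<epsilon> \<subseteq> \<O>}"

definition V_N :: "real^3^3 \<Rightarrow> real^3 \<Rightarrow> (real^3) set \<Rightarrow> real \<Rightarrow> real" where
  "V_N S a1 \<O> \<epsilon> =
     (let X = particles a1 \<O> \<epsilon>; N = card X; vol = measure lborel \<O>;
          f = (\<lambda>x. indicator \<O> x / vol)
      in 75 * vol / (16 * pi) *
           (1 / (real N)\<^sup>2 * (\<Sum>x\<in>X. \<Sum>y\<in>X - {x}. g_S S (x - y)) - g_S_energy S f))"

section \<open>Hasimoto's constant\<close>

definition cubic_harmonic :: "real^3 \<Rightarrow> real" where
  "cubic_harmonic y = 4 * pi / 3 *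
     (5/8 * ((y$1)^4 + (y$2)^4 + (y$3)^4)
      - 15/4 * ((y$1)\<^sup>2 * (y$2)\<^sup>2 + (y$1)\<^sup>2 * (y$3)\<^sup>2 + (y$2)\<^sup>2 * (y$3)\<^sup>2)
      + 3/8 * norm y ^ 4)"

definition biharmonic_series :: "real^3 \<Rightarrow> complex" where
  "biharmonic_series y =
     (\<Sum>\<^sub>\<infinity>k\<in>UNIV - {0}.
        complex_of_real (1 / (16 * pi^4 * norm (int_vec k) ^ 4)) *
        exp (2 * \<i> * complex_of_real (pi * (int_vec k \<bullet> y))))"

text \<open>The coefficients of an expansion of this form are unique, so this determines \<open>a\<close>
  (and \<open>c1\<close>, \<open>c2\<close>).\<close>

definition is_hasimoto_constant :: "real \<Rightarrow> bool" where
  "is_hasimoto_constant a \<longleftrightarrow>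
     (\<exists>c1 c2 :: real.
        (\<lambda>y. biharmonic_series y - complex_of_real
           (- 1 / (4 * pi) * (norm y / 2 - c2 - c1 / 6 * (norm y)\<^sup>2
              + pi / 30 * norm y ^ 4 + a * cubic_harmonic y)))
        \<in> O[at 0](\<lambda>y. complex_of_real (norm y ^ 6)))"

end

theory Submission
  imports Defs "HOL-Probability.Probability"
begin

text \<open>
  Why the limit is what it is. For \<open>z \<noteq> 0\<close> the kernel is a superposition of Gaussians,
  \<open>g_S(z) = \<integral>\<^sub>0\<^sup>\<infinity> \<gamma>\<^sub>t(z) dt\<close> with
  \<open>\<gamma>\<^sub>t(z) = (4\<pi>\<^sup>2/3) t\<^bsup>3/2\<^esup> (2\<pi>t (S:zz)\<^sup>2 - 2|Sz|\<^sup>2) exp(-\<pi>t|z|\<^sup>2)\<close>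
  (\<open>stresslet_gauss\<close>, \<open>g_S_time_integral\<close>). Each piece vanishes at the origin, has integral \<open>0\<close>,
  and is minus the divergence of a Gaussian field whose time integral is \<open>S v_S\<close>. All singularities
  of the problem are thereby moved to the ends of the time interval, where decay
  in \<open>t\<close> is enough, and the double sum over particles becomes a time integral of
  \<open>\<Phi>\<^sub>\<epsilon>(t) = \<epsilon>\<^sup>6 \<Sum> \<gamma>\<^sub>t(x\<^sub>i - x\<^sub>j)\<close>, in which the diagonal may be included.

  For fixed \<open>t\<close>, \<open>\<Phi>\<^sub>\<epsilon>(t)\<close> is a Riemann sum and converges to the double integral of
  \<open>\<gamma>\<^sub>t(x - y)\<close> over the domain (\<open>pair_sum_tendsto\<close>). The time integral of these double integrals is
  the continuous energy up to normalisation (\<open>stresslet_energy\<close>). This step includes the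
  identification of the distributional convolution: the time integral of the Gaussian potentials
  of the domain is square integrable and represents it (\<open>stresslet_pot_is_conv\<close>), and two
  representatives cannot be told apart by test functions that exhaust the domain.
  The convergence is dominated for small \<open>t\<close> but not for \<open>t\<close> of order \<open>\<epsilon>\<^sup>-\<^sup>2\<close>, where \<open>\<gamma>\<^sub>t\<close> resolves single
  lattice points: there \<open>\<Phi>\<^sub>\<epsilon>(t)\<close> is close to \<open>N\<epsilon>\<^sup>3 \<epsilon>\<^sup>2 \<Gamma>(\<epsilon>\<^sup>2 t)\<close>, where
  \<open>\<Gamma>(s) = \<Sum>\<^sub>k \<gamma>\<^sub>s(k)\<close> is the sum over the whole lattice \<open>\<int>\<^sup>3\<close>. The difference is caused by the
  particles near the boundary, whose number is controlled by the volume of a tube along it, and is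
  \<open>O(t\<^bsup>-3/2\<^esup>)\<close> uniformly in \<open>\<epsilon>\<close> (\<open>inner_tube_measure\<close>, \<open>pair_sum_deviation\<close>). Subtracting this term
  for \<open>t > 1\<close> restores domination, and its own time integral converges to
  \<open>|\<O>| \<integral>\<^sub>0\<^sup>\<infinity> \<Gamma>\<close> (\<open>interaction_tendsto\<close>). The energies cancel and
  \<open>V_N\<close> tends to \<open>75/(16\<pi>) \<integral>\<^sub>0\<^sup>\<infinity> \<Gamma>\<close>.

  The integral of \<open>\<Gamma>\<close> is computed with one-dimensional theta series, since Gaussian lattice sums of
  monomials are products (\<open>lattice_coord_power\<close>). The part of \<open>\<Gamma>\<close> with full rotational symmetry is a
  total derivative in \<open>t\<close> and contributes a boundary value; the rest is a multiple of
  \<open>t\<^bsup>5/2\<^esup> \<Theta>(t)\<close>, where \<open>\<Theta>\<close> is the theta series of a harmonic polynomial of degree four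
  (\<open>lattice_stresslet_eq\<close>). Jacobi's functional equation turns \<open>\<integral> t\<^bsup>5/2\<^esup> \<Theta>(t) dt\<close> into
  \<open>\<integral> t \<Theta>(t) dt\<close> (\<open>theta_harm_integral_duality\<close>). Because \<open>|k|\<^bsup>-4\<^esup> = \<pi>\<^sup>2 \<integral> t exp(-\<pi>t|k|\<^sup>2) dt\<close>, the
  latter is a regularised sum of the harmonic polynomial over \<open>|k|\<^sup>4\<close>, which is what one reads off from
  Hasimoto's series when all of its radial terms are removed by subtracting a reflected copy
  (\<open>hasimoto_constant_theta\<close>); its value is \<open>-20a/\<pi>\<^sup>2\<close>.
\<close>

section \<open>Integration lemmas\<close>

text \<open>
  Fubini's hypothesis in the form in which it is met below: a bound on the inner integrals of the
  norm that depends integrably on the outer variable.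
\<close>

lemma (in pair_sigma_finite) integrable_prod_bounded:
  fixes f :: "'a \<Rightarrow> 'b \<Rightarrow> 'c::{banach, second_countable_topology}"
  assumes f: "case_prod f \<in> borel_measurable (M1 \<Otimes>\<^sub>M M2)"
    and int: "AE x in M1. integrable M2 (f x)"
    and bd: "AE x in M1. (\<integral>y. norm (f x y) \<partial>M2) \<le> g x"
    and g: "integrable M1 g"
  shows "integrable (M1 \<Otimes>\<^sub>M M2) (case_prod f)"
proof (rule Fubini_integrable[OF f])
  note f[measurable]
  show "integrable M1 (\<lambda>x. \<integral>y. norm (case (x, y) of (x, y) \<Rightarrow> f x y) \<partial>M2)"
    by (rule Bochner_Integration.integrable_bound[OF g]) (use bd in \<open>auto elim!: eventually_mono\<close>)
qed (use int in auto)

lemma norm_integral_le: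
  fixes f :: "'a \<Rightarrow> 'b::{banach, second_countable_topology}"
  assumes g: "integrable M g" and le: "\<And>x. x \<in> space M \<Longrightarrow> norm (f x) \<le> g x"
  shows "norm (integral\<^sup>L M f) \<le> integral\<^sup>L M g"
proof (cases "integrable M f")
  case True
  have "norm (integral\<^sup>L M f) \<le> (\<integral>x. norm (f x) \<partial>M)" by (rule integral_norm_bound)
  also have "\<dots> \<le> integral\<^sup>L M g"
    by (rule integral_mono) (use True g le in auto)
  finally show ?thesis .
next
  case False
  then show ?thesis
    using le by (auto simp: not_integrable_integral_eq intro!: Bochner_Integration.integral_nonneg intro: order_trans[OF norm_ge_zero])
qed

lemma sigma_finite_count_int: "sigma_finite_measure (count_space (UNIV :: int set))"
  by (rule sigma_finite_measure_count_space_countable) auto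

text \<open>
  Splitting \<open>\<int>\<close> into the fibres of \<open>k \<mapsto> |k|\<close>, each of which has at most two elements.
\<close>

lemma integrable_int_of_nat:
  fixes g :: "nat \<Rightarrow> real"
  assumes "summable (\<lambda>n. \<bar>g n\<bar>)"
  shows "integrable (count_space UNIV) (\<lambda>k::int. g (nat \<bar>k\<bar>))"
proof -
  have 1: "Infinite_Set_Sum.abs_summable_on (\<lambda>k. g (nat \<bar>k\<bar>)) (range int)"
    by (subst abs_summable_on_reindex_iff[symmetric]) (auto simp: abs_summable_on_nat_iff' assms)
  have 2: "Infinite_Set_Sum.abs_summable_on (\<lambda>k. g (nat \<bar>k\<bar>)) (range (\<lambda>n. - int n))"
    by (subst abs_summable_on_reindex_iff[symmetric]) (auto simp: abs_summable_on_nat_iff' assms inj_def)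
  have "Infinite_Set_Sum.abs_summable_on (\<lambda>k. g (nat \<bar>k\<bar>)) (range int \<union> range (\<lambda>n. - int n))"
    using 1 2 by (rule abs_summable_on_union)
  also have "range int \<union> range (\<lambda>n. - int n) = UNIV"
  proof safe
    fix x :: int assume "x \<notin> range (\<lambda>n. - int n)"
    then show "x \<in> range int" by (metis int_cases2 rangeI)
  qed auto
  finally show ?thesis by (simp add: abs_summable_on_def)
qed

lemma integrable_geometric_int:
  fixes q :: real
  assumes "0 \<le> q" "q < 1"
  shows "integrable (count_space UNIV) (\<lambda>k::int. q ^ nat \<bar>k\<bar>)"
  by (rule integrable_int_of_nat) (use assms in simp)

text \<open>
  A single term of the exponential series of \<open>c x\<close>.
\<close>

lemma power_le_fact_exp:
  fixes x c :: real
  assumes "0 \<le> x" "0 < c"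
  shows "x ^ p \<le> fact p / c ^ p * exp (c * x)"
proof -
  have "(\<Sum>n\<in>{p}. (c*x)^n / fact n) \<le> (\<Sum>n. (c*x)^n / fact n)"
    by (intro sum_le_suminf) (use assms summable_exp[of "c*x"] in \<open>auto simp: field_simps\<close>)
  then have "(c*x)^p / fact p \<le> exp (c*x)"
    by (simp add: exp_def scaleR_conv_of_real field_simps)
  then show ?thesis using assms by (simp add: field_simps)
qed

section \<open>Moments of the theta series\<close>

definition theta_moment :: "nat \<Rightarrow> real \<Rightarrow> real" where
  "theta_moment p t =
     (\<integral>k. real_of_int k ^ p * exp (- (pi * t * (real_of_int k)\<^sup>2)) \<partial>count_space UNIV)"

text \<open>
  A geometric majorant: \<open>k\<^sup>2 \<ge> |k|\<close>, and half of the exponent absorbs the power of \<open>k\<close>.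
\<close>

lemma theta_moment_bound:
  fixes k :: int and t :: real
  assumes "t > 0"
  shows "\<bar>real_of_int k ^ p * exp (- (pi * t * (real_of_int k)\<^sup>2))\<bar>
      \<le> fact p / (pi * t / 2) ^ p * exp (- (pi * t / 2)) ^ nat \<bar>k\<bar>"
proof -
  let ?x = "real_of_int \<bar>k\<bar>"
  have x: "?x \<le> ?x\<^sup>2"
    by (metis of_int_le_iff of_int_power abs_ge_zero int_one_le_iff_zero_less linorder_not_less nle_le power2_eq_square self_le_power zero_le_power2 zero_power2 verit_la_disequality le_less pos2)
  have "\<bar>real_of_int k ^ p * exp (- (pi * t * (real_of_int k)\<^sup>2))\<bar> = ?x ^ p * exp (- (pi * t * ?x\<^sup>2))"
    by (simp add: abs_mult power_abs)
  also have "\<dots> \<le> (fact p / (pi * t / 2) ^ p * exp (pi * t / 2 * ?x)) * exp (- (pi * t * ?x\<^sup>2))"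
    by (intro mult_right_mono power_le_fact_exp) (use assms in auto)
  also have "\<dots> = fact p / (pi * t / 2) ^ p * exp (pi * t / 2 * ?x - (pi * t * ?x\<^sup>2))"
    by (simp only: exp_diff exp_minus divide_inverse mult.assoc)
  also have "\<dots> \<le> fact p / (pi * t / 2) ^ p * exp (- (pi * t / 2) * ?x)"
  proof (intro mult_left_mono)
    have "pi * t * ?x \<le> pi * t * ?x\<^sup>2" using x assms by (intro mult_left_mono) auto
    then show "exp (pi * t / 2 * ?x - (pi * t * ?x\<^sup>2)) \<le> exp (- (pi * t / 2) * ?x)"
      by (simp add: field_simps)
  qed (use assms in auto)
  also have "exp (- (pi * t / 2) * ?x) = exp (- (pi * t / 2)) ^ nat \<bar>k\<bar>"
    by (simp add: exp_of_nat_mult[symmetric] mult.commute)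
  finally show ?thesis .
qed

lemma integrable_theta_moment:
  assumes "t > 0"
  shows "integrable (count_space UNIV) (\<lambda>k::int. real_of_int k ^ p * exp (- (pi * t * (real_of_int k)\<^sup>2)))"
proof (rule Bochner_Integration.integrable_bound)
  show "integrable (count_space UNIV) (\<lambda>k::int. fact p / (pi * t / 2) ^ p * exp (- (pi * t / 2)) ^ nat \<bar>k\<bar>)"
    by (intro integrable_mult_right integrable_geometric_int) (use assms in auto)
  show "AE k in count_space (UNIV::int set). norm (real_of_int k ^ p * exp (- (pi * t * (real_of_int k)\<^sup>2)))
     \<le> norm (fact p / (pi * t / 2) ^ p * exp (- (pi * t / 2)) ^ nat \<bar>k\<bar>)"
    using theta_moment_bound[OF assms, of _ p] unfolding real_norm_def
    by (intro AE_I2) (rule order_trans[OF _ abs_ge_self])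
qed auto

lemma theta_moment_odd:
  assumes "odd p"
  shows "theta_moment p t = 0"
proof -
  have "theta_moment p t = (\<integral>k. real_of_int (- k) ^ p * exp (- (pi * t * (real_of_int (- k))\<^sup>2)) \<partial>count_space (UNIV::int set))"
    unfolding theta_moment_def
    by (rule integral_bij_count_space[symmetric]) (auto simp: bij_betw_def inj_def surj_def intro: exI[of _ "- _"])
  also have "\<dots> = - theta_moment p t"
    using assms unfolding theta_moment_def by (simp add: power_minus_odd)
  finally show ?thesis by simp
qed

lemma exp_second_order:
  fixes u :: real
  shows "\<bar>exp u - 1 - u\<bar> \<le> u\<^sup>2 / 2 * exp \<bar>u\<bar>"
proof -
  obtain s where s: "\<bar>s\<bar> \<le> \<bar>u\<bar>" "exp u = (\<Sum>m<2. u ^ m / fact m) + exp s / fact 2 * u ^ 2"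
    using Maclaurin_exp_le[of u 2] by auto
  then have "\<bar>exp u - 1 - u\<bar> = u\<^sup>2 / 2 * exp s" by (simp add: eval_nat_numeral field_simps)
  also have "\<dots> \<le> u\<^sup>2 / 2 * exp \<bar>u\<bar>" using s by (intro mult_left_mono) auto
  finally show ?thesis .
qed

text \<open>
  An estimate with quadratic error can be summed or integrated term by term, unlike the mere
  existence of a derivative; this lemma converts the result back into a derivative.
\<close>

lemma DERIV_quadratic_remainder:
  fixes f :: "real \<Rightarrow> real"
  assumes "d > 0" "\<And>h. \<bar>h\<bar> \<le> d \<Longrightarrow> \<bar>f (x + h) - f x - h * D\<bar> \<le> C * h\<^sup>2"
  shows "(f has_real_derivative D) (at x)"
  unfolding DERIV_def
proof (rule Lim_null_comparison[THEN LIM_zero_cancel])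
  show "\<forall>\<^sub>F h in at 0. norm ((f (x + h) - f x) / h - D) \<le> \<bar>C\<bar> * \<bar>h\<bar>"
    using eventually_at_in_open'[of "{-d<..<d}" "0::real"] eventually_neq_at_within[of "0::real"]
  proof (rule eventually_elim2[of _ "at (0::real)"])
    fix h :: real assume "h \<in> {-d<..<d}" "h \<noteq> 0"
    then have "f (x + h) - f x - h * D = h * ((f (x + h) - f x) / h - D)" by (simp add: field_simps)
    then have "\<bar>h\<bar> * \<bar>(f (x + h) - f x) / h - D\<bar> \<le> C * h\<^sup>2"
      using assms(2)[of h] \<open>h \<in> {-d<..<d}\<close> by (simp add: abs_mult abs_le_iff)
    also have "\<dots> \<le> \<bar>h\<bar> * (\<bar>C\<bar> * \<bar>h\<bar>)"
      using mult_right_mono[of C "\<bar>C\<bar>" "h\<^sup>2"] by (simp add: power2_eq_square mult.left_commute)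
    finally show "norm ((f (x + h) - f x) / h - D) \<le> \<bar>C\<bar> * \<bar>h\<bar>"
      using \<open>h \<noteq> 0\<close> by simp
  qed (use assms in auto)
  show "((\<lambda>h. \<bar>C\<bar> * \<bar>h\<bar>) \<longlongrightarrow> 0) (at 0)" by (intro tendsto_eq_intros) auto
qed

text \<open>
  Termwise differentiation: on \<open>|h| \<le> t/2\<close> the second order remainders of the terms are dominated by
  the terms of a theta series at time \<open>t/2\<close>.
\<close>

lemma theta_moment_deriv:
  assumes t: "t > 0"
  shows "(theta_moment p has_real_derivative - pi * theta_moment (p + 2) t) (at t)"
proof (rule DERIV_quadratic_remainder)
  let ?e = "\<lambda>t k. exp (- (pi * t * (real_of_int k)\<^sup>2))"
  fix h :: real assume h: "\<bar>h\<bar> \<le> t / 2"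
  have th: "t + h > 0" using h t by auto
  note int = integrable_theta_moment[OF t] integrable_theta_moment[OF th] integrable_theta_moment[of "t/2"]
  have eq: "theta_moment p (t + h) - theta_moment p t - h * (- pi * theta_moment (p + 2) t)
     = (\<integral>k. real_of_int k ^ p * ?e (t+h) k - real_of_int k ^ p * ?e t k + h * pi * (real_of_int k ^ (p + 2) * ?e t k) \<partial>count_space UNIV)"
    unfolding theta_moment_def
    by (subst Bochner_Integration.integral_add Bochner_Integration.integral_diff, (intro Bochner_Integration.integrable_diff Bochner_Integration.integrable_add integrable_mult_right int; fail)+)+ simp
  have bd: "norm (real_of_int k ^ p * ?e (t+h) k - real_of_int k ^ p * ?e t k + h * pi * (real_of_int k ^ (p + 2) * ?e t k))
     \<le> pi\<^sup>2 / 2 * h\<^sup>2 * \<bar>real_of_int k ^ (p + 4) * ?e (t/2) k\<bar>" for k :: int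
  proof -
    let ?x = "real_of_int k"
    define u where "u = - (pi * h * ?x\<^sup>2)"
    have e: "?e (t+h) k = ?e t k * exp u" by (simp add: u_def exp_add[symmetric] algebra_simps)
    have "\<bar>u\<bar> \<le> pi * (t/2) * ?x\<^sup>2"
      using mult_right_mono[OF h, of "?x\<^sup>2"] by (simp add: u_def abs_mult mult.assoc)
    then have e2: "?e t k * exp \<bar>u\<bar> \<le> ?e (t/2) k"
      by (simp add: exp_add[symmetric])
    have "real_of_int k ^ p * ?e (t+h) k - real_of_int k ^ p * ?e t k + h * pi * (real_of_int k ^ (p + 2) * ?e t k)
       = ?x ^ p * ?e t k * (exp u - 1 - u)"
      unfolding e by (simp add: u_def algebra_simps power_add power2_eq_square)
    then have "norm (real_of_int k ^ p * ?e (t+h) k - real_of_int k ^ p * ?e t k + h * pi * (real_of_int k ^ (p + 2) * ?e t k))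
        = \<bar>?x ^ p\<bar> * ?e t k * \<bar>exp u - 1 - u\<bar>" by (simp add: abs_mult)
    also have "\<dots> \<le> \<bar>?x ^ p\<bar> * ?e t k * (u\<^sup>2 / 2 * exp \<bar>u\<bar>)"
      by (intro mult_left_mono exp_second_order) auto
    also have "\<dots> = \<bar>?x ^ p\<bar> * (u\<^sup>2 / 2) * (?e t k * exp \<bar>u\<bar>)" by simp
    also have "\<dots> \<le> \<bar>?x ^ p\<bar> * (u\<^sup>2 / 2) * ?e (t/2) k"
      by (intro mult_left_mono e2) auto
    also have "\<dots> = pi\<^sup>2 / 2 * h\<^sup>2 * \<bar>real_of_int k ^ (p + 4) * ?e (t/2) k\<bar>"
      by (simp add: u_def abs_mult power_add power_mult_distrib power_abs power_even_abs field_simps)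
    finally show ?thesis .
  qed
  have "\<bar>theta_moment p (t + h) - theta_moment p t - h * (- pi * theta_moment (p + 2) t)\<bar>
    \<le> (\<integral>k. pi\<^sup>2 / 2 * h\<^sup>2 * \<bar>real_of_int k ^ (p + 4) * ?e (t/2) k\<bar> \<partial>count_space UNIV)"
    unfolding eq real_norm_def[symmetric]
  proof (rule norm_integral_le)
    show "integrable (count_space UNIV) (\<lambda>k::int. pi\<^sup>2 / 2 * h\<^sup>2 * norm (real_of_int k ^ (p + 4) * ?e (t/2) k))"
      by (intro integrable_mult_right integrable_norm integrable_theta_moment) (use t in auto)
  qed (use bd in \<open>simp only: real_norm_def\<close>)
  also have "\<dots> = (pi\<^sup>2 / 2 * (\<integral>k. \<bar>real_of_int k ^ (p + 4) * ?e (t/2) k\<bar> \<partial>count_space UNIV)) * h\<^sup>2"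
    by simp
  finally show "\<bar>theta_moment p (t + h) - theta_moment p t - h * (- pi * theta_moment (p + 2) t)\<bar>
     \<le> (pi\<^sup>2 / 2 * (\<integral>k. \<bar>real_of_int k ^ (p + 4) * ?e (t/2) k\<bar> \<partial>count_space UNIV)) * h\<^sup>2" .
qed (use t in auto)

section \<open>Gaussian integrals\<close>

lemma gauss_scale:
  assumes "t > 0"
  shows "std_normal_density (sqrt (2*pi*t) * x) * (sqrt (2*pi*t) * x)^p
     = sqrt (2*pi*t)^p / sqrt (2*pi) * (x^p * exp (-(pi*t*x\<^sup>2)))"
  using assms by (simp add: std_normal_density_def power_mult_distrib field_simps)

lemma integrable_gauss_moment:
  assumes "t > 0"
  shows "integrable lborel (\<lambda>x::real. x^p * exp (-(pi*t*x\<^sup>2)))"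
proof -
  have "integrable lborel (\<lambda>x. std_normal_density (0 + sqrt (2*pi*t) * x) * (0 + sqrt (2*pi*t) * x)^p)"
    by (rule lborel_integrable_real_affine[OF integrable_std_normal_moment]) (use assms in auto)
  then have "integrable lborel (\<lambda>x. sqrt (2*pi)/ sqrt (2*pi*t)^p * (sqrt (2*pi*t)^p / sqrt (2*pi) * (x^p * exp (-(pi*t*x\<^sup>2)))))"
    unfolding add_0 gauss_scale[OF assms] by (rule integrable_mult_right)
  then show ?thesis using assms by simp
qed

definition gauss_moment :: "nat \<Rightarrow> real \<Rightarrow> real" where
  "gauss_moment p t = (\<integral>x. x^p * exp (-(pi*t*x\<^sup>2)) \<partial>lborel)"

lemma gauss_moment_even:
  assumes "t > 0"
  shows "gauss_moment (2*k) t = fact (2*k) / (2^k * fact k * (2*pi*t)^k * sqrt t)"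
proof -
  let ?c = "sqrt (2*pi*t)"
  have "fact (2*k) / (2^k * fact k) = ?c * (\<integral>x. std_normal_density (0 + ?c * x) * (0 + ?c * x)^(2*k) \<partial>lborel)"
    unfolding integral_std_normal_moment_even[symmetric]
    by (subst lborel_integral_real_affine[of ?c _ 0]) (use assms in auto)
  also have "\<dots> = ?c * (?c^(2*k) / sqrt (2*pi) * gauss_moment (2*k) t)"
    using assms by (simp add: gauss_scale gauss_moment_def)
  also have "\<dots> = (2*pi*t)^k * sqrt t * gauss_moment (2*k) t"
  proof -
    have "?c^(2*k) = (2*pi*t)^k" using assms by (simp only: power_mult) simp
    then show ?thesis by (simp add: real_sqrt_mult)
  qed
  finally show ?thesis using assms by (simp add: field_simps)
qed

lemma gauss_moment_odd:
  assumes "odd p"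
  shows "gauss_moment p t = 0"
proof -
  have "gauss_moment p t = (\<integral>x. (0 + (-1) * x)^p * exp (-(pi*t*(0 + (-1) * x)\<^sup>2)) \<partial>lborel)"
    unfolding gauss_moment_def by (subst lborel_integral_real_affine[of "-1" _ 0]) auto
  also have "\<dots> = - gauss_moment p t"
    unfolding gauss_moment_def using assms by (simp add: power_minus_odd)
  finally show ?thesis by simp
qed

text \<open>
  A rescaling of the characteristic function of the normal distribution.
\<close>

lemma gauss_fourier:
  assumes "t > 0"
  shows "(\<integral>x. exp (-(pi*t*x\<^sup>2)) * cos (2*pi*\<xi>*x) \<partial>lborel) = exp (- (pi*\<xi>\<^sup>2/t)) / sqrt t"
proof -
  let ?c = "sqrt (2*pi*t)"
  define s where "s = 2*pi*\<xi> / ?c"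
  have i1: "integrable std_normal_distribution (\<lambda>x. iexp (s * x))"
    using prob_space.integrable_iexp[OF prob_space_normal_density, of 1 "\<lambda>x. s * x" 0] by simp
  have "exp (- (s^2) / 2) = Re (char std_normal_distribution s)"
    by (simp add: char_std_normal_distribution)
  also have "\<dots> = (\<integral>x. cos (s*x) \<partial>std_normal_distribution)"
    unfolding char_def using i1 by (simp del: Re_exp flip: integral_Re) (simp add: Re_exp)
  also have "\<dots> = (\<integral>x. std_normal_density x * cos (s*x) \<partial>lborel)"
    by (subst integral_density) (auto simp: normal_density_nonneg)
  also have "\<dots> = ?c * (\<integral>x. std_normal_density (0 + ?c*x) * cos (s*(0 + ?c*x)) \<partial>lborel)"
    by (subst lborel_integral_real_affine[of ?c _ 0]) (use assms in auto)
  also have "\<dots> = ?c * (\<integral>x. 1/sqrt (2*pi) * (exp (-(pi*t*x\<^sup>2)) * cos (2*pi*\<xi>*x)) \<partial>lborel)"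
    using assms gauss_scale[of t _ 0]  by (simp add: s_def mult.assoc)
  also have "\<dots> = sqrt t * (\<integral>x. exp (-(pi*t*x\<^sup>2)) * cos (2*pi*\<xi>*x) \<partial>lborel)"
    by (simp add: real_sqrt_mult)
  finally have "exp (- (s^2) / 2) = sqrt t * (\<integral>x. exp (-(pi*t*x\<^sup>2)) * cos (2*pi*\<xi>*x) \<partial>lborel)" .
  moreover have "- (s^2)/2 = - (pi*\<xi>\<^sup>2/t)" using assms by (simp add: s_def power_divide power_mult_distrib power2_eq_square field_simps)
  ultimately have "exp (- (pi*\<xi>\<^sup>2/t)) = sqrt t * (\<integral>x. exp (-(pi*t*x\<^sup>2)) * cos (2*pi*\<xi>*x) \<partial>lborel)" by (simp only:)
  then show ?thesis using assms by simp
qed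

section \<open>The functional equation of the theta function\<close>

text \<open>
  The Poisson kernel of the circle \<open>\<real>/\<int>\<close>. It is \<open>1 + 2 \<Sum>\<^bsub>n\<ge>1\<^esub> r\<^sup>n cos(2\<pi>nx)\<close>, and as \<open>r \<rightarrow> 1\<close>
  it concentrates on the integers with mass \<open>1\<close> each. Evaluating the integral of a Gaussian against
  it in these two ways gives the functional equation of the theta function.
\<close>

definition poisson_kernel :: "real \<Rightarrow> real \<Rightarrow> real" where
  "poisson_kernel r x = (1 - r\<^sup>2) / ((1 - r)\<^sup>2 + 4 * r * (sin (pi * x))\<^sup>2)"

lemma poisson_kernel_sums:
  assumes "0 \<le> r" "r < 1"
  shows "(\<lambda>n. r ^ Suc n * cos (2 * pi * real (Suc n) * x)) sums ((poisson_kernel r x - 1) / 2)"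
proof -
  define z where "z = complex_of_real r * cis (2 * pi * x)"
  have nz: "norm z < 1" using assms by (simp add: z_def norm_mult)
  then have z1: "1 - z \<noteq> 0" by auto
  have "(\<lambda>n. z ^ Suc n) sums (z * (1 / (1 - z)))"
    using sums_mult[OF geometric_sums[OF nz], of z] by simp
  then have "(\<lambda>n. Re (z ^ Suc n)) sums Re (z * (1 / (1 - z)))" by (rule sums_Re)
  moreover have "Re (z ^ Suc n) = r ^ Suc n * cos (2 * pi * real (Suc n) * x)" for n
  proof -
    have "z ^ Suc n = complex_of_real (r ^ Suc n) * cis (real (Suc n) * (2 * pi * x))"
      by (simp only: z_def power_mult_distrib Complex.DeMoivre of_real_power)
    then show ?thesis by (simp del: power_Suc of_nat_Suc of_real_power add: mult_ac)
  qed
  moreover have "Re (z * (1 / (1 - z))) = (poisson_kernel r x - 1) / 2"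
  proof -
    have c: "cos (2 * pi * x) = 1 - 2 * (sin (pi * x))\<^sup>2"
      using cos_double_sin[of "pi * x"] by (simp add: mult_ac)
    have s: "(sin (2*pi*x))\<^sup>2 + (cos (2*pi*x))\<^sup>2 = 1" by simp
    define u where "u = cos (2*pi*x)"
    define v where "v = sin (2*pi*x)"
    have uv: "v\<^sup>2 = 1 - u\<^sup>2" using s unfolding u_def v_def by linarith
    have d: "(1 - r)\<^sup>2 + 4 * r * (sin (pi * x))\<^sup>2 = (1 - r*u)\<^sup>2 + (r * v)\<^sup>2"
    proof -
      have "(1 - r*u)\<^sup>2 + (r * v)\<^sup>2 = 1 - 2 * r * u + r\<^sup>2"
        unfolding power_mult_distrib uv by (simp add: power2_eq_square algebra_simps)
      also have "\<dots> = 1 - 2 * r * (1 - 2 * (sin (pi * x))\<^sup>2) + r\<^sup>2" by (simp only: u_def c)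
      also have "\<dots> = (1 - r)\<^sup>2 + 4 * r * (sin (pi * x))\<^sup>2" by (simp add: power2_eq_square algebra_simps)
      finally show ?thesis by simp
    qed
    have z: "Re z = r * u" "Im z = r * v" by (auto simp: z_def u_def v_def)
    have pos: "(1 - r*u)\<^sup>2 + (r * v)\<^sup>2 \<noteq> 0"
      using z1 z by (auto simp: sum_power2_eq_zero_iff complex_eq_iff)
    have "Re (z * (1 / (1 - z))) = (r * u * (1 - r * u) - (r * v)\<^sup>2) / ((1 - r * u)\<^sup>2 + (r * v)\<^sup>2)"
      by (simp add: Re_divide z power2_eq_square)
    also have "\<dots> = (poisson_kernel r x - 1) / 2"
      unfolding poisson_kernel_def d using pos uv
      by (simp add: divide_simps) (simp add: power2_eq_square algebra_simps)
    finally show ?thesis .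
  qed
  ultimately show ?thesis by (simp only:)
qed

lemma poisson_kernel_denom_pos: "0 \<le> r \<Longrightarrow> r < 1 \<Longrightarrow> (1 - r)\<^sup>2 + 4 * r * (sin (pi * x))\<^sup>2 > 0"
  by (intro add_pos_nonneg) auto

lemma poisson_kernel_nonneg: "0 \<le> r \<Longrightarrow> r < 1 \<Longrightarrow> 0 \<le> poisson_kernel r x"
  unfolding poisson_kernel_def using poisson_kernel_denom_pos[of r x]
  by (intro divide_nonneg_pos) (auto simp: abs_square_le_1)

lemma measurable_poisson_kernel [measurable]: "poisson_kernel r \<in> borel_measurable borel"
  unfolding poisson_kernel_def by measurable

lemma poisson_kernel_even: "poisson_kernel r (- x) = poisson_kernel r x"
  by (simp add: poisson_kernel_def)

lemma poisson_kernel_periodic: "poisson_kernel r (x + real_of_int m) = poisson_kernel r x"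
proof -
  have "(sin (pi * (x + real_of_int m)))\<^sup>2 = (sin (pi * x))\<^sup>2"
    by (simp add: distrib_left sin_add sin_integer_2pi cos_int_times_real power_mult_distrib)
  then show ?thesis by (simp add: poisson_kernel_def)
qed

lemma poisson_kernel_le:
  assumes "0 \<le> r" "r < 1"
  shows "poisson_kernel r x \<le> (1 + r) / (1 - r)"
proof -
  have "poisson_kernel r x \<le> (1 - r\<^sup>2) / (1 - r)\<^sup>2"
    unfolding poisson_kernel_def using assms
    by (intro divide_left_mono mult_pos_pos poisson_kernel_denom_pos) (auto simp: abs_square_le_1)
  also have "\<dots> = (1 + r) / (1 - r)" using assms by (simp add: power2_eq_square divide_simps) (simp add: algebra_simps)
  finally show ?thesis .
qed

lemma sin_pi_lower:
  assumes "\<bar>x\<bar> \<le> 1/2"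
  shows "2 * \<bar>x\<bar> \<le> \<bar>sin (pi * x)\<bar>"
proof -
  have *: "2 * y \<le> sin (pi * y)" if "0 \<le> y" "y \<le> 1/2" for y
  proof -
    have "convex_on {0..pi} (\<lambda>x. - sin x)"
      by (rule f''_ge0_imp_convex[where f' = "\<lambda>x. - cos x" and f'' = sin])
        (auto intro!: derivative_eq_intros sin_ge_zero)
    from convex_onD[OF this, of "2*y" 0 "pi/2"] that show ?thesis by (simp add: mult.commute)
  qed
  show ?thesis using *[of x] *[of "-x"] assms by (cases "x \<ge> 0") auto
qed

text \<open>
  Quantitative concentration: the second moment of the kernel within a period is \<open>O(1 - r)\<close>.
\<close>

lemma poisson_kernel_square_bound:
  assumes "1/2 \<le> r" "r < 1" "\<bar>x\<bar> \<le> 1/2"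
  shows "x\<^sup>2 * poisson_kernel r x \<le> 1 - r"
proof -
  have "(2 * \<bar>x\<bar>)\<^sup>2 \<le> \<bar>sin (pi * x)\<bar>\<^sup>2"
    by (intro power_mono sin_pi_lower assms) auto
  then have s: "4 * x\<^sup>2 \<le> (sin (pi * x))\<^sup>2" by (simp add: power_mult_distrib)
  have "x\<^sup>2 * (1 - r\<^sup>2) = (1 - r) * ((1 + r) * x\<^sup>2)" by (simp add: power2_eq_square algebra_simps)
  also have "\<dots> \<le> (1 - r) * ((1 - r)\<^sup>2 + 4 * r * (sin (pi * x))\<^sup>2)"
  proof (intro mult_left_mono)
    have "(1 + r) * x\<^sup>2 \<le> 2 * x\<^sup>2" using assms by (intro mult_right_mono) auto
    also have "\<dots> \<le> 2 * (sin (pi * x))\<^sup>2" using s zero_le_power2[of x] by linarith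
    also have "\<dots> \<le> 4 * r * (sin (pi * x))\<^sup>2" using assms by (intro mult_right_mono) auto
    finally show "(1 + r) * x\<^sup>2 \<le> (1 - r)\<^sup>2 + 4 * r * (sin (pi * x))\<^sup>2" by (smt (verit) zero_le_power2)
  qed (use assms in auto)
  finally show ?thesis
    using poisson_kernel_denom_pos[of r x] assms unfolding poisson_kernel_def by (simp add: divide_simps)
qed

text \<open>
  The Fourier side: the cosine expansion of the kernel is integrated termwise, which is allowed
  because the powers of \<open>r\<close> are summable.
\<close>

lemma poisson_kernel_integral_test:
  fixes \<phi> :: "real \<Rightarrow> real"
  assumes \<phi>: "integrable lborel \<phi>" and r: "0 \<le> r" "r < 1"
  shows "(\<lambda>n. r ^ Suc n * (\<integral>x. \<phi> x * cos (2 * pi * real (Suc n) * x) \<partial>lborel)) sums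
     (((\<integral>x. \<phi> x * poisson_kernel r x \<partial>lborel) - (\<integral>x. \<phi> x \<partial>lborel)) / 2)"
proof -
  let ?f = "\<lambda>n x. \<phi> x * (r ^ Suc n * cos (2 * pi * real (Suc n) * x))"
  note [measurable] = borel_measurable_integrable[OF \<phi>]
  have int: "integrable lborel (?f n)" for n
    by (rule Bochner_Integration.integrable_bound[OF \<phi>])
      (use r in \<open>auto simp: abs_mult power_le_one intro!: mult_left_le mult_le_one\<close>)
  have sm: "summable (\<lambda>n. \<integral>x. norm (?f n x) \<partial>lborel)"
  proof (rule summable_comparison_test')
    show "summable (\<lambda>n. r ^ Suc n * (\<integral>x. \<bar>\<phi> x\<bar> \<partial>lborel))"
      using r by (intro summable_mult2) (simp add: summable_mult summable_geometric)
    fix n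
    have "norm (\<integral>x. norm (?f n x) \<partial>lborel) = (\<integral>x. norm (?f n x) \<partial>lborel)" by simp
    also have "\<dots> \<le> (\<integral>x. r ^ Suc n * \<bar>\<phi> x\<bar> \<partial>lborel)"
      by (rule integral_mono[OF integrable_norm[OF int]])
        (use r \<phi> in \<open>auto simp: abs_mult mult.commute mult_left_le intro!: mult_left_mono integrable_mult_right mult_right_le_one_le mult_le_one\<close>)
    finally show "norm (\<integral>x. norm (?f n x) \<partial>lborel) \<le> r ^ Suc n * (\<integral>x. \<bar>\<phi> x\<bar> \<partial>lborel)" by simp
  qed
  have sf: "(\<lambda>n. ?f n x) sums (\<phi> x * ((poisson_kernel r x - 1) / 2))" for x
    by (intro sums_mult poisson_kernel_sums r)
  have "summable (\<lambda>n. norm (?f n x))" for x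
  proof (rule summable_comparison_test')
    show "summable (\<lambda>n. r ^ Suc n * \<bar>\<phi> x\<bar>)"
      using r by (intro summable_mult2) (simp add: summable_mult summable_geometric)
  qed (use r in \<open>auto simp: abs_mult mult.commute mult_left_le intro!: mult_left_mono mult_right_le_one_le mult_le_one\<close>)
  then have ae: "AE x in lborel. summable (\<lambda>n. norm (?f n x))" by simp
  have eq: "integral\<^sup>L lborel (?f n) = r ^ Suc n * (\<integral>x. \<phi> x * cos (2 * pi * real (Suc n) * x) \<partial>lborel)" for n
    by (subst integral_mult_right_zero[symmetric], rule Bochner_Integration.integral_cong) auto
  have "(\<lambda>n. integral\<^sup>L lborel (?f n)) sums (\<integral>x. (\<Sum>n. ?f n x) \<partial>lborel)"
    by (rule sums_integral[OF int ae sm])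
  also have "(\<integral>x. (\<Sum>n. ?f n x) \<partial>lborel) = (\<integral>x. (\<phi> x * poisson_kernel r x - \<phi> x) / 2 \<partial>lborel)"
    using sf by (intro Bochner_Integration.integral_cong) (auto simp: sums_iff algebra_simps diff_divide_distrib)
  also have "\<dots> = ((\<integral>x. \<phi> x * poisson_kernel r x \<partial>lborel) - (\<integral>x. \<phi> x \<partial>lborel)) / 2"
  proof -
    have "integrable lborel (\<lambda>x. \<phi> x * poisson_kernel r x)"
    proof (rule Bochner_Integration.integrable_bound)
      show "integrable lborel (\<lambda>x. \<phi> x * ((1 + r)/(1-r)))" using \<phi> by simp
      show "AE x in lborel. norm (\<phi> x * poisson_kernel r x) \<le> norm (\<phi> x * ((1 + r)/(1-r)))"
        unfolding norm_mult using poisson_kernel_le[OF r] poisson_kernel_nonneg[OF r] r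
        by (intro AE_I2 mult_left_mono) auto
    qed auto
    then show ?thesis using \<phi> by simp
  qed
  finally show ?thesis unfolding eq .
qed

lemma unit_cell_cos:
  "(\<integral>x. indicator {-1/2..1/2} x * cos (2 * pi * real (Suc n) * x) \<partial>lborel) = 0"
proof -
  let ?c = "2 * pi * real (Suc n)"
  have "has_bochner_integral lborel (\<lambda>x. cos (?c * x) * indicator {-1/2..1/2} x)
     (sin (?c * (1/2)) / ?c - sin (?c * (-1/2)) / ?c)"
    by (rule has_bochner_integral_FTC_Icc_real)
      (auto intro!: derivative_eq_intros continuous_intros simp del: of_nat_Suc)
  moreover have "sin (?c * (1/2)) = 0"
    using sin_npi[of "Suc n"] by (simp add: mult_ac del: of_nat_Suc sin_npi sin_npi2)
  ultimately show ?thesis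
    by (simp add: has_bochner_integral_iff mult.commute del: of_nat_Suc)
qed

lemma integrable_unit_cell:
  assumes [measurable]: "f \<in> borel_measurable borel" and "\<And>x. \<bar>x\<bar> \<le> 1/2 \<Longrightarrow> \<bar>f x\<bar> \<le> (B::real)"
  shows "integrable lborel (\<lambda>x::real. indicator {-1/2..1/2} x * f x)"
proof (rule Bochner_Integration.integrable_bound)
  show "integrable lborel (\<lambda>x::real. indicator {-1/2..1/2} x * \<bar>B\<bar>)" by simp
  show "AE x in lborel. norm (indicator {-1/2..1/2} x * f x) \<le> norm (indicator {-1/2..1/2} x * \<bar>B\<bar>)"
  proof (intro AE_I2)
    fix x :: real
    have "\<bar>x\<bar> \<le> 1/2 \<Longrightarrow> \<bar>f x\<bar> \<le> \<bar>B\<bar>" using assms(2)[of x] by simp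
    then show "norm (indicator {-1/2..1/2} x * f x) \<le> norm (indicator {-1/2..1/2} x * \<bar>B\<bar>)"
      by (auto simp: indicator_def)
  qed
qed auto

lemma poisson_kernel_cell:
  assumes r: "0 \<le> r" "r < 1"
  shows "(\<integral>x. indicator {-1/2..1/2} x * poisson_kernel r x \<partial>lborel) = 1"
proof -
  let ?\<phi> = "indicator {-1/2..1/2} :: real \<Rightarrow> real"
  have i: "integrable lborel ?\<phi>" by simp
  have "(\<lambda>n. 0) sums (((\<integral>x. ?\<phi> x * poisson_kernel r x \<partial>lborel) - (\<integral>x. ?\<phi> x \<partial>lborel)) / 2)"
    using poisson_kernel_integral_test[OF i r] by (simp only: unit_cell_cos mult_zero_right)
  from sums_unique2[OF this sums_zero] show ?thesis by simp
qed

lemma poisson_kernel_cell_odd: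
  "(\<integral>x. indicator {-1/2..1/2} x * (x * poisson_kernel r x) \<partial>lborel) = 0"
proof -
  let ?f = "\<lambda>x::real. indicator {-1/2..1/2} x * (x * poisson_kernel r x)"
  have "integral\<^sup>L lborel ?f = (\<integral>x. ?f (0 + (-1) * x) \<partial>lborel)"
    by (subst lborel_integral_real_affine[of "-1" _ 0]) auto
  also have "\<dots> = (\<integral>x. - ?f x \<partial>lborel)"
    by (intro Bochner_Integration.integral_cong) (auto simp: poisson_kernel_even indicator_def)
  finally show ?thesis by simp
qed

text \<open>
  Second order expansion of the Gaussian around an integer. The linear term is kept explicitly
  because the kernel is even and so annihilates it; the error carries the factor \<open>x\<^sup>2\<close>, which
  the second moment of the kernel turns into \<open>1 - r\<close>, and decays in \<open>m\<close>, which makes it summable.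
\<close>

lemma gauss_cell_bound:
  fixes m :: int and s x :: real
  assumes s: "s > 0" and x: "\<bar>x\<bar> \<le> 1/2"
  shows "\<bar>exp (- (s * (x + of_int m)\<^sup>2)) - exp (- (s * (of_int m)\<^sup>2)) + 2 * s * of_int m * exp (- (s * (of_int m)\<^sup>2)) * x\<bar>
    \<le> x\<^sup>2 * (s\<^sup>2 * exp (2 * s) * (4 * (of_int m)\<^sup>2 + 1) * exp (- (s/2 * (of_int m)\<^sup>2)) + s * exp (- (s * (of_int m)\<^sup>2)))"
proof -
  let ?m = "real_of_int m" let ?e = "exp (- (s * ?m\<^sup>2))"
  define u where "u = - (s * (2 * ?m * x + x\<^sup>2))"
  have xx: "x\<^sup>2 \<le> \<bar>x\<bar>"
  proof -
    have "\<bar>x\<bar> * \<bar>x\<bar> \<le> \<bar>x\<bar> * 1" using x by (intro mult_left_mono) auto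
    then show ?thesis by (simp add: power2_eq_square)
  qed
  have u1: "\<bar>u\<bar> \<le> s * (\<bar>x\<bar> * (2 * \<bar>?m\<bar> + 1))"
  proof -
    have "\<bar>2 * ?m * x + x\<^sup>2\<bar> \<le> \<bar>2 * ?m * x\<bar> + x\<^sup>2" by (smt (verit) zero_le_power2)
    also have "\<dots> \<le> \<bar>x\<bar> * (2 * \<bar>?m\<bar> + 1)" using xx by (simp add: abs_mult algebra_simps)
    finally show ?thesis using s by (simp add: u_def abs_mult mult_left_mono)
  qed
  have m1: "0 \<le> (\<bar>?m\<bar> - 1)\<^sup>2" by simp
  then have m2: "2 * \<bar>?m\<bar> \<le> ?m\<^sup>2 + 1" by (simp add: power2_eq_square algebra_simps)
  have u2: "\<bar>u\<bar> \<le> s/2 * ?m\<^sup>2 + 2 * s"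
  proof -
    have "\<bar>u\<bar> \<le> s * (1/2 * (2 * \<bar>?m\<bar> + 1))"
      by (rule order_trans[OF u1]) (use s x in \<open>intro mult_left_mono mult_right_mono, auto\<close>)
    also have "\<dots> \<le> s * (1/2 * (?m\<^sup>2 + 2))" using s m2 by (intro mult_left_mono) auto
    finally show ?thesis using s by (simp add: algebra_simps)
  qed
  have sq: "u\<^sup>2 \<le> s\<^sup>2 * (x\<^sup>2 * (8 * ?m\<^sup>2 + 2))"
  proof -
    have "\<bar>u\<bar>\<^sup>2 \<le> (s * (\<bar>x\<bar> * (2 * \<bar>?m\<bar> + 1)))\<^sup>2" using u1 by (rule power_mono) auto
    also have "\<dots> = s\<^sup>2 * (x\<^sup>2 * (4 * ?m\<^sup>2 + 4 * \<bar>?m\<bar> + 1))"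
      by (simp add: power_mult_distrib power2_sum)
    also have "\<dots> \<le> s\<^sup>2 * (x\<^sup>2 * (8 * ?m\<^sup>2 + 2))"
    proof -
      have "4 * \<bar>?m\<bar> \<le> 4 * ?m\<^sup>2 + 1"
      proof -
        have "0 \<le> (2 * \<bar>?m\<bar> - 1)\<^sup>2" by simp
        then show ?thesis by (simp add: power2_eq_square algebra_simps)
      qed
      then show ?thesis by (intro mult_left_mono) auto
    qed
    finally show ?thesis by simp
  qed
  have eq: "exp (- (s * (x + ?m)\<^sup>2)) - ?e + 2 * s * ?m * ?e * x = ?e * (exp u - 1 - u) - s * x\<^sup>2 * ?e"
  proof -
    have "exp (- (s * (x + ?m)\<^sup>2)) = ?e * exp u"
      by (simp add: exp_add[symmetric] u_def power2_eq_square algebra_simps)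
    then show ?thesis by (simp add: u_def algebra_simps)
  qed
  have "\<bar>?e * (exp u - 1 - u) - s * x\<^sup>2 * ?e\<bar> \<le> ?e * \<bar>exp u - 1 - u\<bar> + s * x\<^sup>2 * ?e"
    using s abs_triangle_ineq4[of "?e * (exp u - 1 - u)" "s * x\<^sup>2 * ?e"] by (simp add: abs_mult)
  also have "?e * \<bar>exp u - 1 - u\<bar> \<le> ?e * (u\<^sup>2 / 2 * exp \<bar>u\<bar>)"
    by (intro mult_left_mono exp_second_order) auto
  also have "\<dots> \<le> ?e * (s\<^sup>2 * (x\<^sup>2 * (8 * ?m\<^sup>2 + 2)) / 2 * exp (s/2 * ?m\<^sup>2 + 2 * s))"
    using sq u2 by (intro mult_left_mono mult_mono divide_right_mono) auto
  also have "\<dots> = x\<^sup>2 * (s\<^sup>2 * exp (2 * s) * (4 * ?m\<^sup>2 + 1) * exp (- (s/2 * ?m\<^sup>2)))"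
  proof -
    have "?e * exp (s/2 * ?m\<^sup>2 + 2 * s) = exp (2 * s) * exp (- (s/2 * ?m\<^sup>2))"
      by (simp add: exp_add[symmetric] algebra_simps)
    then show ?thesis by (simp add: algebra_simps)
  qed
  finally show ?thesis unfolding eq by (simp add: algebra_simps)
qed

text \<open>
  Cutting the line into unit cells around the integers; the kernel is the same in each.
\<close>

lemma poisson_kernel_gauss_cells:
  assumes s: "s > 0" and r: "0 \<le> r" "r < 1"
  shows "(\<integral>x. exp (- (s * x\<^sup>2)) * poisson_kernel r x \<partial>lborel) =
    (\<integral>m. (\<integral>x. indicator {-1/2..1/2} x * (exp (- (s * (x + real_of_int m)\<^sup>2)) * poisson_kernel r x) \<partial>lborel) \<partial>count_space UNIV)"
proof -
  let ?P = "poisson_kernel r" and ?J = "{-1/2..<1/2::real}"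
  let ?F = "\<lambda>x m. exp (- (s * x\<^sup>2)) * ?P x * indicator ?J (x - real_of_int m)"
  interpret pair_sigma_finite lborel "count_space (UNIV::int set)"
    unfolding pair_sigma_finite_def using lborel.sigma_finite_measure_axioms sigma_finite_count_int by blast
  have gi: "integrable lborel (\<lambda>x. exp (- (s * x\<^sup>2)))"
    using integrable_gauss_moment[of "s/pi" 0] s by simp
  have gP: "integrable lborel (\<lambda>x. exp (- (s * x\<^sup>2)) * ?P x)"
  proof (rule Bochner_Integration.integrable_bound)
    show "integrable lborel (\<lambda>x. exp (- (s * x\<^sup>2)) * ((1 + r)/(1-r)))" using gi by simp
    show "AE x in lborel. norm (exp (- (s * x\<^sup>2)) * ?P x) \<le> norm (exp (- (s * x\<^sup>2)) * ((1 + r)/(1-r)))"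
      unfolding norm_mult using poisson_kernel_le[OF r] poisson_kernel_nonneg[OF r] r
      by (intro AE_I2 mult_left_mono) auto
  qed auto
  have ind: "indicator ?J (x - real_of_int m) = (indicator {\<lfloor>x + 1/2\<rfloor>} m :: real)" for x m
    by (auto simp: indicator_def) linarith+
  have fin: "integrable (count_space UNIV) (?F x)" for x
    unfolding ind by (intro integrable_mult_right integrable_indicator) auto
  have inner: "(\<integral>m. ?F x m \<partial>count_space UNIV) = exp (- (s * x\<^sup>2)) * ?P x" for x
    unfolding ind by simp
  have inner': "(\<integral>m. norm (?F x m) \<partial>count_space UNIV) = exp (- (s * x\<^sup>2)) * ?P x" for x
    unfolding ind using poisson_kernel_nonneg[OF r] by (simp add: abs_mult)
  have "integrable (lborel \<Otimes>\<^sub>M count_space UNIV) (case_prod ?F)"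
  proof (rule integrable_prod_bounded[OF _ _ _ gP])
    show "AE x in lborel. integrable (count_space UNIV) (?F x)" by (intro AE_I2 fin)
    show "AE x in lborel. (\<integral>m. norm (?F x m) \<partial>count_space UNIV) \<le> exp (- (s * x\<^sup>2)) * ?P x"
      by (intro AE_I2) (simp only: inner' order_refl)
  qed (simp add: split_beta')
  from Fubini_integral[OF this, unfolded inner]
  have "(\<integral>x. exp (- (s * x\<^sup>2)) * ?P x \<partial>lborel) = (\<integral>m. (\<integral>x. ?F x m \<partial>lborel) \<partial>count_space UNIV)" by simp
  also have "\<dots> = (\<integral>m. (\<integral>x. indicator {-1/2..1/2} x * (exp (- (s * (x + real_of_int m)\<^sup>2)) * ?P x) \<partial>lborel) \<partial>count_space UNIV)"
  proof (rule Bochner_Integration.integral_cong)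
    fix m :: int
    have "(\<integral>x. ?F x m \<partial>lborel) = (\<integral>x. ?F (real_of_int m + 1 * x) m \<partial>lborel)"
      by (subst lborel_integral_real_affine[of 1 _ "real_of_int m"]) auto
    also have "\<dots> = (\<integral>x. indicator {-1/2..1/2} x * (exp (- (s * (x + real_of_int m)\<^sup>2)) * ?P x) \<partial>lborel)"
    proof (rule integral_cong_AE)
      have "AE x in lborel. x \<noteq> (1/2::real)" by (rule AE_lborel_singleton)
      then show "AE x in lborel. ?F (real_of_int m + 1 * x) m = indicator {-1/2..1/2} x * (exp (- (s * (x + real_of_int m)\<^sup>2)) * ?P x)"
      proof eventually_elim
        case (elim x)
        then show ?case using poisson_kernel_periodic[of r x m] by (auto simp: indicator_def add.commute)
      qed
    qed auto
    finally show "(\<integral>x. ?F x m \<partial>lborel) = (\<integral>x. indicator {-1/2..1/2} x * (exp (- (s * (x + real_of_int m)\<^sup>2)) * ?P x) \<partial>lborel)" .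
  qed simp
  finally show ?thesis .
qed

text \<open>
  Each cell contributes the value of the Gaussian at its integer, up to a summable multiple of
  \<open>1 - r\<close>.
\<close>

lemma poisson_kernel_gauss_cell:
  fixes m :: int
  assumes s: "s > 0" and r: "1/2 \<le> r" "r < 1"
  shows "\<bar>(\<integral>x. indicator {-1/2..1/2} x * (exp (- (s * (x + real_of_int m)\<^sup>2)) * poisson_kernel r x) \<partial>lborel)
     - exp (- (s * (of_int m)\<^sup>2))\<bar> \<le> (1 - r) * (s\<^sup>2 * exp (2 * s) * (4 * (of_int m)\<^sup>2 + 1) * exp (- (s/2 * (of_int m)\<^sup>2)) + s * exp (- (s * (of_int m)\<^sup>2)))"
    (is "\<bar>?I - ?e\<bar> \<le> (1 - r) * ?K")
proof -
  let ?P = "poisson_kernel r" and ?i = "indicator {-1/2..1/2} :: real \<Rightarrow> real" and ?m = "real_of_int m"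
  let ?c = "2 * s * ?m * ?e"
  have r0: "0 \<le> r" using r by auto
  have PB: "\<bar>?P x\<bar> \<le> (1 + r)/(1-r)" for x using poisson_kernel_le[OF r0 r(2)] poisson_kernel_nonneg[OF r0 r(2)] by simp
  have i1: "integrable lborel (\<lambda>x. ?i x * (exp (- (s * (x + ?m)\<^sup>2)) * ?P x))"
    by (rule integrable_unit_cell[where B="1 * ((1+r)/(1-r))"])
      (use s r in \<open>auto simp only: abs_mult intro!: mult_mono PB, auto\<close>)
  have i2: "integrable lborel (\<lambda>x. ?i x * ?P x)"
    by (rule integrable_unit_cell[OF _ PB]) auto
  have i3: "integrable lborel (\<lambda>x. ?i x * (x * ?P x))"
    by (rule integrable_unit_cell[where B="1/2 * ((1+r)/(1-r))"])
      (use r in \<open>auto simp only: abs_mult intro!: mult_mono PB, auto\<close>)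
  have "?I - ?e = ?I - ?e * (\<integral>x. ?i x * ?P x \<partial>lborel) + ?c * (\<integral>x. ?i x * (x * ?P x) \<partial>lborel)"
    unfolding poisson_kernel_cell[OF r0 r(2)] poisson_kernel_cell_odd by simp
  also have "\<dots> = (\<integral>x. ?i x * (exp (- (s * (x + ?m)\<^sup>2)) * ?P x) - ?e * (?i x * ?P x) + ?c * (?i x * (x * ?P x)) \<partial>lborel)"
    using i1 i2 i3 by simp
  finally have eq: "?I - ?e = \<dots>" .
  have "norm (?I - ?e) \<le> (\<integral>x. (1 - r) * ?K * ?i x \<partial>lborel)"
    unfolding eq
  proof (rule norm_integral_le)
    fix x :: real
    show "norm (?i x * (exp (- (s * (x + ?m)\<^sup>2)) * ?P x) - ?e * (?i x * ?P x) + ?c * (?i x * (x * ?P x)))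
      \<le> (1 - r) * ?K * ?i x"
    proof (cases "x \<in> {-1/2..1/2}")
      case True
      then have x: "\<bar>x\<bar> \<le> 1/2" by auto
      have "norm (?i x * (exp (- (s * (x + ?m)\<^sup>2)) * ?P x) - ?e * (?i x * ?P x) + ?c * (?i x * (x * ?P x)))
         = \<bar>(exp (- (s * (x + ?m)\<^sup>2)) - ?e + ?c * x) * ?P x\<bar>"
        using True by (simp add: algebra_simps)
      also have "\<dots> = \<bar>exp (- (s * (x + ?m)\<^sup>2)) - ?e + ?c * x\<bar> * ?P x"
        using poisson_kernel_nonneg[OF r0 r(2)] by (simp add: abs_mult)
      also have "\<dots> \<le> x\<^sup>2 * ?K * ?P x"
        by (intro mult_right_mono gauss_cell_bound s x poisson_kernel_nonneg r0 r)
      also have "\<dots> = (x\<^sup>2 * ?P x) * ?K" by simp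
      also have "\<dots> \<le> (1 - r) * ?K"
        by (intro mult_right_mono poisson_kernel_square_bound r x) (use s in auto)
      finally show ?thesis using True by simp
    qed auto
  qed auto
  also have "(\<integral>x. (1 - r) * ?K * ?i x \<partial>lborel) = (1 - r) * ?K" by simp
  finally show ?thesis by simp
qed

lemma integral_int_even:
  fixes f :: "int \<Rightarrow> real"
  assumes f: "integrable (count_space UNIV) f" and even: "\<And>k. f (- k) = f k"
  shows "(\<lambda>n. f (int (Suc n))) sums ((integral\<^sup>L (count_space UNIV) f - f 0) / 2)"
proof -
  have UNIV: "(UNIV :: int set) = {0} \<union> (range (\<lambda>n. int (Suc n)) \<union> range (\<lambda>n. - int (Suc n)))"
  proof -
    have "x \<in> {0} \<union> (range (\<lambda>n. int (Suc n)) \<union> range (\<lambda>n. - int (Suc n)))" for x :: int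
    proof -
      have "x = int (Suc (nat (x - 1)))" if "x > 0" using that by simp
      moreover have "x = - int (Suc (nat (- x - 1)))" if "x < 0" using that by simp
      ultimately show ?thesis by (metis UnI1 UnI2 insertI1 linorder_neqE rangeI)
    qed
    then show ?thesis by blast
  qed
  have abs: "Infinite_Set_Sum.abs_summable_on f A" for A
    using abs_summable_on_subset[of f UNIV A] f by (simp add: abs_summable_on_def)
  have sm: "summable (\<lambda>n. f (int (Suc n)))"
  proof -
    have "Infinite_Set_Sum.abs_summable_on (\<lambda>n. f (int (Suc n))) UNIV"
      by (rule abs_summable_on_reindex_iff[THEN iffD2]) (auto simp: inj_def abs)
    then show ?thesis by (auto simp: abs_summable_on_nat_iff' intro: summable_norm_cancel)
  qed
  have 1: "infsetsum f (range (\<lambda>n. int (Suc n))) = (\<Sum>n. f (int (Suc n)))"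
  proof (subst infsetsum_reindex)
    have "Infinite_Set_Sum.abs_summable_on (\<lambda>n. f (int (Suc n))) UNIV"
      by (rule abs_summable_on_reindex_iff[THEN iffD2]) (auto simp: inj_def abs)
    then show "infsetsum (\<lambda>n. f (int (Suc n))) UNIV = (\<Sum>n. f (int (Suc n)))" by (rule infsetsum_nat')
  qed (auto simp: inj_def)
  have 2: "infsetsum f (range (\<lambda>n. - int (Suc n))) = infsetsum f (range (\<lambda>n. int (Suc n)))"
    by (subst (1 2) infsetsum_reindex) (auto simp: inj_def even simp del: of_nat_Suc)
  have "integral\<^sup>L (count_space UNIV) f = infsetsum f ({0} \<union> (range (\<lambda>n. int (Suc n)) \<union> range (\<lambda>n. - int (Suc n))))"
    unfolding UNIV[symmetric] by (simp add: infsetsum_def)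
  also have "\<dots> = f 0 + 2 * (\<Sum>n. f (int (Suc n)))"
    by (subst infsetsum_Un_disjoint, use abs in \<open>force+\<close>)+ (simp add: 1 2 del: of_nat_Suc)
  finally show ?thesis using sm by (simp add: sums_iff)
qed

text \<open>
  Jacobi's identity. The integral of the Gaussian against the Poisson kernel tends to the theta
  series at \<open>1/t\<close> by concentration, and to the series of Fourier coefficients, which is the theta
  series at \<open>t\<close>, by Abel summation.
\<close>

theorem theta_functional:
  assumes t: "t > 0"
  shows "theta_moment 0 (1/t) = sqrt t * theta_moment 0 t"
proof -
  define s where "s = pi / t"
  have s: "s > 0" using t by (simp add: s_def)
  \<comment> \<open>The Gaussian is taken at scale \<open>s = \<pi>/t\<close>, so that its values at the integers form the series at \<open>1/t\<close> and its Fourier coefficients the one at \<open>t\<close>.\<close>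
  define I where "I = (\<lambda>r. \<integral>x. exp (- (s * x\<^sup>2)) * poisson_kernel r x \<partial>lborel)"
  define K where "K = (\<lambda>m::int. s\<^sup>2 * exp (2 * s) * (4 * (of_int m)\<^sup>2 + 1) * exp (- (s/2 * (of_int m)\<^sup>2)) + s * exp (- (s * (of_int m)\<^sup>2)))"
  note im = integrable_theta_moment[of "s/2/pi", simplified] integrable_theta_moment[of "s/pi", simplified]
  have s': "s / 2 / pi > 0" "s / pi > 0" using s by auto
  have iK: "integrable (count_space UNIV) K"
  proof -
    have "integrable (count_space UNIV) (\<lambda>m::int. s\<^sup>2 * exp (2 * s) * (4 * (of_int m ^ 2 * exp (- (pi * (s/2/pi) * (of_int m)\<^sup>2))) + of_int m ^ 0 * exp (- (pi * (s/2/pi) * (of_int m)\<^sup>2))) + s * (of_int m ^ 0 * exp (- (pi * (s/pi) * (of_int m)\<^sup>2))))"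
      by (intro Bochner_Integration.integrable_add integrable_mult_right integrable_theta_moment s')
    then show ?thesis unfolding K_def by (simp add: algebra_simps)
  qed
  have ie: "integrable (count_space UNIV) (\<lambda>m::int. exp (- (s * (of_int m)\<^sup>2)))"
    using integrable_theta_moment[of "s/pi" 0] s by simp
  have M: "theta_moment 0 (1/t) = (\<integral>m. exp (- (s * (real_of_int m)\<^sup>2)) \<partial>count_space UNIV)"
    by (simp add: theta_moment_def s_def)
  have upper: "\<bar>I r - theta_moment 0 (1/t)\<bar> \<le> (1 - r) * integral\<^sup>L (count_space UNIV) K"
    if r: "1/2 \<le> r" "r < 1" for r
  proof -
    let ?c = "\<lambda>m. \<integral>x. indicator {-1/2..1/2} x * (exp (- (s * (x + real_of_int m)\<^sup>2)) * poisson_kernel r x) \<partial>lborel"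
    have b: "\<bar>?c m - exp (- (s * (of_int m)\<^sup>2))\<bar> \<le> (1 - r) * K m" for m
      unfolding K_def by (rule poisson_kernel_gauss_cell[OF s r])
    have id: "integrable (count_space UNIV) (\<lambda>m. ?c m - exp (- (s * (of_int m)\<^sup>2)))"
      by (rule Bochner_Integration.integrable_bound[of _ "\<lambda>m. (1 - r) * K m"])
        (use b iK in \<open>auto intro: order_trans[OF _ abs_ge_self]\<close>)
    have ic: "integrable (count_space UNIV) ?c"
      using Bochner_Integration.integrable_add[OF id ie] by simp
    have eq: "I r - theta_moment 0 (1/t) = (\<integral>m. ?c m - exp (- (s * (of_int m)\<^sup>2)) \<partial>count_space UNIV)"
      unfolding M I_def using poisson_kernel_gauss_cells[OF s, of r] r ic ie by simp
    have "norm (I r - theta_moment 0 (1/t)) \<le> (\<integral>m. (1 - r) * K m \<partial>count_space UNIV)"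
      unfolding eq by (rule norm_integral_le) (use iK b in auto)
    then show ?thesis by simp
  qed
  define a where "a = (\<lambda>n::nat. sqrt t * exp (- (pi * t * (real (Suc n))\<^sup>2)))"
  have asum: "a sums (sqrt t * ((theta_moment 0 t - 1) / 2))"
    using sums_mult[OF integral_int_even[OF integrable_theta_moment[OF t, of 0]], of "sqrt t"]
    by (simp add: a_def[abs_def] theta_moment_def)
  have I: "(\<lambda>n. r ^ Suc n * a n) sums ((I r - sqrt t) / 2)" if r: "0 \<le> r" "r < 1" for r
  proof -
    have "integrable lborel (\<lambda>x. exp (- (s * x\<^sup>2)))" using integrable_gauss_moment[of "1/t" 0] t by (simp add: s_def)
    from poisson_kernel_integral_test[OF this r]
    show ?thesis
      using gauss_fourier[of "1/t" "real (Suc _)"] gauss_fourier[of "1/t" 0] t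
      by (simp add: I_def s_def a_def real_sqrt_divide mult_ac del: of_nat_Suc power_Suc)
  qed
  \<comment> \<open>Abel summation along one sequence \<open>r \<rightarrow> 1\<close>; starting from \<open>1/2\<close>, as the cell estimate requires.\<close>
  define r where "r = (\<lambda>j::nat. 1 - 1 / real (j + 2))"
  have r: "1/2 \<le> r j" "r j < 1" for j by (auto simp: r_def field_simps)
  have rl: "r \<longlonglongrightarrow> 1"
  proof -
    have "(\<lambda>j. 1 / real (j + 2)) \<longlonglongrightarrow> 0" by (rule LIMSEQ_ignore_initial_segment[OF lim_1_over_n])
    then show ?thesis unfolding r_def by (auto intro: tendsto_eq_intros)
  qed
  have "(\<lambda>j. \<bar>I (r j) - theta_moment 0 (1/t)\<bar>) \<longlonglongrightarrow> 0"
  proof (rule tendsto_sandwich[OF _ _ tendsto_const])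
    show "\<forall>\<^sub>F j in sequentially. \<bar>I (r j) - theta_moment 0 (1/t)\<bar> \<le> (1 - r j) * integral\<^sup>L (count_space UNIV) K"
      using upper r by auto
    show "(\<lambda>j. (1 - r j) * integral\<^sup>L (count_space UNIV) K) \<longlonglongrightarrow> 0"
      using rl by (auto intro!: tendsto_eq_intros)
  qed auto
  then have L1: "(\<lambda>j. I (r j)) \<longlonglongrightarrow> theta_moment 0 (1/t)"
    by (simp add: tendsto_rabs_zero_iff LIM_zero_iff)
  have L2: "(\<lambda>j. \<integral>n. r j ^ Suc n * a n \<partial>count_space UNIV) \<longlonglongrightarrow> (\<integral>n. a n \<partial>count_space UNIV)"
  proof (rule integral_dominated_convergence)
    have a0: "a n \<ge> 0" for n using t by (simp add: a_def)
    show "integrable (count_space UNIV) a"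
      using asum a0 by (simp add: integrable_count_space_nat_iff sums_iff)
    show "AE n in count_space UNIV. (\<lambda>j. r j ^ Suc n * a n) \<longlonglongrightarrow> a n"
    proof (intro AE_I2)
      fix n
      have "(\<lambda>j. r j ^ Suc n * a n) \<longlonglongrightarrow> 1 ^ Suc n * a n" by (intro tendsto_intros rl)
      then show "(\<lambda>j. r j ^ Suc n * a n) \<longlonglongrightarrow> a n" by simp
    qed
    show "AE n in count_space UNIV. norm (r j ^ Suc n * a n) \<le> a n" for j
    proof (intro AE_I2)
      fix n
      have "0 \<le> r j" using r[of j] by auto
      then have "0 \<le> r j ^ Suc n" "r j ^ Suc n \<le> 1" using r[of j] by (auto intro!: power_le_one simp del: power_Suc)
      then show "norm (r j ^ Suc n * a n) \<le> a n" using a0[of n]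
        by (simp add: abs_mult mult_left_le_one_le del: power_Suc)
    qed
  qed auto
  have "(\<integral>n. r j ^ Suc n * a n \<partial>count_space UNIV) = (I (r j) - sqrt t) / 2" for j
  proof -
    have r0: "0 \<le> r j" using r[of j] by auto
    have "integrable (count_space UNIV) (\<lambda>n. r j ^ Suc n * a n)"
      using I[OF r0 r(2)] r0 t by (subst integrable_count_space_nat_iff) (auto simp: sums_iff abs_mult a_def simp del: of_nat_Suc power_Suc)
    from sums_unique2[OF sums_integral_count_space_nat[OF this] I[OF r0 r(2)]] show ?thesis .
  qed
  moreover have "(\<integral>n. a n \<partial>count_space UNIV) = sqrt t * ((theta_moment 0 t - 1) / 2)"
  proof -
    have "integrable (count_space UNIV) a"
      using asum t by (simp add: integrable_count_space_nat_iff sums_iff a_def del: of_nat_Suc)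
    from sums_unique2[OF sums_integral_count_space_nat[OF this] asum] show ?thesis .
  qed
  ultimately have A: "(\<lambda>j. (I (r j) - sqrt t) / 2) \<longlonglongrightarrow> sqrt t * ((theta_moment 0 t - 1) / 2)" using L2 by (simp only:)
  have B: "(\<lambda>j. (I (r j) - sqrt t) / 2) \<longlonglongrightarrow> (theta_moment 0 (1/t) - sqrt t) / 2"
    by (intro tendsto_intros L1) auto
  have "sqrt t * ((theta_moment 0 t - 1) / 2) = (theta_moment 0 (1/t) - sqrt t) / 2"
    by (rule LIMSEQ_unique[OF A B])
  then have "sqrt t * (theta_moment 0 t - 1) = theta_moment 0 (1/t) - sqrt t" by simp
  then show ?thesis by (simp add: right_diff_distrib)
qed

section \<open>Product integrands and moments of quadratic forms\<close>

lemma prod_Basis_vec: "(\<Prod>b\<in>Basis. F (b::real^'n)) = (\<Prod>i\<in>UNIV. F (axis i 1))"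
proof -
  have B: "(Basis :: (real^'n) set) = (\<lambda>i. axis i (1::real)) ` (UNIV :: 'n set)" by (auto simp: Basis_vec_def)
  have inj: "inj (\<lambda>i::'n. axis i (1::real))" by (auto simp: inj_def axis_eq_axis)
  show ?thesis unfolding B by (simp add: prod.reindex[OF inj])
qed

text \<open>
  Fubini for product integrands on \<open>\<real>\<^sup>n\<close>.
\<close>

lemma lborel_vec_prod:
  fixes f :: "'n::finite \<Rightarrow> real \<Rightarrow> 'c::{real_normed_field,banach,second_countable_topology}"
  assumes f: "\<And>i. integrable lborel (f i)"
  shows "integrable lborel (\<lambda>x::real^'n. \<Prod>i\<in>UNIV. f i (x $ i))"
    and "(\<integral>x. (\<Prod>i\<in>UNIV. f i (x $ i)) \<partial>lborel) = (\<Prod>i\<in>UNIV. integral\<^sup>L lborel (f i))"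
proof -
  interpret product_sigma_finite "\<lambda>_::real^'n. lborel :: real measure" by standard
  define g where "g = (\<lambda>b::real^'n. f (THE i. b = axis i 1))"
  have g: "g (axis i 1) = f i" for i by (simp add: g_def axis_eq_axis)
  have gi: "integrable lborel (g b)" for b unfolding g_def by (rule f)
  note [measurable] = borel_measurable_integrable[OF gi]
  have eq: "(\<Prod>i\<in>UNIV. f i (x $ i)) = (\<Prod>b\<in>Basis. g b (x \<bullet> b))" for x :: "real^'n"
    by (simp add: prod_Basis_vec g inner_axis)
  have [measurable]: "(\<lambda>f. \<Sum>b\<in>Basis. f b *\<^sub>R b) \<in> measurable (\<Pi>\<^sub>M b\<in>(Basis::(real^'n) set). lborel) borel"
    by measurable
  have c: "(\<Prod>b\<in>Basis. g b ((\<Sum>b'\<in>Basis. h b' *\<^sub>R b') \<bullet> b)) = (\<Prod>b\<in>Basis. g b (h b))" for h :: "real^'n \<Rightarrow> real"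
    by (intro prod.cong refl) simp
  have I: "integrable (\<Pi>\<^sub>M b\<in>(Basis::(real^'n) set). lborel) (\<lambda>h. \<Prod>b\<in>Basis. g b (h b))"
    by (rule product_integrable_prod) (auto intro: gi)
  show "integrable lborel (\<lambda>x::real^'n. \<Prod>i\<in>UNIV. f i (x $ i))"
    unfolding eq by (subst lborel_eq, subst integrable_distr_eq) (auto simp: I c)
  have "(\<integral>x. (\<Prod>i\<in>UNIV. f i (x $ i)) \<partial>(lborel :: (real^'n) measure)) = (\<integral>h. (\<Prod>b\<in>Basis. g b (h b)) \<partial>(\<Pi>\<^sub>M b\<in>(Basis::(real^'n) set). lborel))"
    unfolding eq by (subst lborel_eq, subst integral_distr) (auto simp: c)
  also have "\<dots> = (\<Prod>b\<in>Basis. integral\<^sup>L lborel (g b))"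
    by (rule product_integral_prod) (auto intro: gi)
  finally show "(\<integral>x. (\<Prod>i\<in>UNIV. f i (x $ i)) \<partial>lborel) = (\<Prod>i\<in>UNIV. integral\<^sup>L lborel (f i))"
    by (simp add: prod_Basis_vec g)
qed

lemma bij_vec_lambda: "bij (vec_lambda :: ('n::finite \<Rightarrow> 'a) \<Rightarrow> 'a^'n)"
  by (rule o_bij[of vec_nth]) (auto simp: fun_eq_iff vec_eq_iff)

text \<open>
  The discrete counterpart of the preceding lemma, for absolutely convergent sums over \<open>\<int>\<^sup>n\<close>.
\<close>

lemma lattice_vec_prod:
  fixes f :: "'n::finite \<Rightarrow> int \<Rightarrow> 'c::{real_normed_field,banach,second_countable_topology}"
  assumes f: "\<And>i. integrable (count_space UNIV) (f i)"
  shows "integrable (count_space UNIV) (\<lambda>k::int^'n. \<Prod>i\<in>UNIV. f i (k $ i))"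
    and "(\<integral>k. (\<Prod>i\<in>UNIV. f i (k $ i)) \<partial>count_space (UNIV :: (int^'n) set)) = (\<Prod>i\<in>UNIV. integral\<^sup>L (count_space UNIV) (f i))"
proof -
  have P: "PiE UNIV (\<lambda>_. UNIV) = (UNIV :: ('n \<Rightarrow> int) set)" by auto
  have s: "Infinite_Set_Sum.abs_summable_on (\<lambda>g. \<Prod>i\<in>UNIV. f i (g i)) (UNIV :: ('n \<Rightarrow> int) set)"
    using abs_summable_on_prod_PiE[of UNIV "\<lambda>_. UNIV" f] f unfolding P by (simp add: abs_summable_on_def)
  have "integrable (count_space UNIV) (\<lambda>k::int^'n. \<Prod>i\<in>UNIV. f i (k $ i))
     \<longleftrightarrow> integrable (count_space UNIV) (\<lambda>g. \<Prod>i\<in>UNIV. f i (g i))"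
    using abs_summable_on_reindex_bij_betw[OF bij_vec_lambda, of "\<lambda>k::int^'n. \<Prod>i\<in>UNIV. f i (k $ i)"]
    by (simp add: abs_summable_on_def)
  with s show "integrable (count_space UNIV) (\<lambda>k::int^'n. \<Prod>i\<in>UNIV. f i (k $ i))"
    by (simp add: abs_summable_on_def)
  have "(\<integral>k. (\<Prod>i\<in>UNIV. f i (k $ i)) \<partial>count_space (UNIV :: (int^'n) set)) = infsetsum (\<lambda>g. \<Prod>i\<in>UNIV. f i (g i)) UNIV"
    using infsetsum_reindex_bij_betw[OF bij_vec_lambda, of "\<lambda>k::int^'n. \<Prod>i\<in>UNIV. f i (k $ i)"]
    by (simp add: infsetsum_def)
  also have "\<dots> = (\<Prod>i\<in>UNIV. integral\<^sup>L (count_space UNIV) (f i))"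
    using infsetsum_prod_PiE[of UNIV "\<lambda>_. UNIV" f] f unfolding P by (simp add: abs_summable_on_def infsetsum_def)
  finally show "(\<integral>k. (\<Prod>i\<in>UNIV. f i (k $ i)) \<partial>count_space (UNIV :: (int^'n) set)) = (\<Prod>i\<in>UNIV. integral\<^sup>L (count_space UNIV) (f i))" .
qed

lemma norm3_sq: "(norm (x::real^3))\<^sup>2 = (x$1)\<^sup>2 + (x$2)\<^sup>2 + (x$3)\<^sup>2"
  unfolding power2_norm_eq_inner by (simp add: inner_vec_def sum_3 power2_eq_square)

lemma int_vec_nth [simp]: "int_vec k $ i = real_of_int (k $ i)"
  by (simp add: int_vec_def)

lemma prod_3: "prod f (UNIV :: 3 set) = f 1 * f 2 * f 3"
  unfolding UNIV_3 by (simp add: mult.assoc)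

definition coord_power :: "nat \<Rightarrow> nat \<Rightarrow> nat \<Rightarrow> real^3 \<Rightarrow> real" where
  "coord_power a b c x = (x $ 1) ^ a * (x $ 2) ^ b * (x $ 3) ^ c"

lemma coord_power_exp_prod:
  "coord_power a b c x * exp (- (pi * t * (norm x)\<^sup>2)) =
   (\<Prod>i\<in>UNIV. (\<lambda>y. y ^ (if i = 1 then a else if i = 2 then b else c) * exp (- (pi * t * y\<^sup>2))) (x $ i))"
proof -
  have "exp (- (pi * t * (norm x)\<^sup>2)) = exp (- (pi * t * (x$1)\<^sup>2)) * exp (- (pi * t * (x$2)\<^sup>2)) * exp (- (pi * t * (x$3)\<^sup>2))"
    by (simp add: norm3_sq exp_add[symmetric] algebra_simps)
  then show ?thesis by (simp add: prod_3 coord_power_def)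
qed

lemma gauss_coord_power:
  assumes "t > 0"
  shows "integrable lborel (\<lambda>x. coord_power a b c x * exp (- (pi * t * (norm x)\<^sup>2)))"
    and "(\<integral>x. coord_power a b c x * exp (- (pi * t * (norm x)\<^sup>2)) \<partial>lborel) = gauss_moment a t * gauss_moment b t * gauss_moment c t"
  unfolding coord_power_exp_prod
   apply (rule lborel_vec_prod(1), rule integrable_gauss_moment[OF assms])
  apply (subst lborel_vec_prod(2), rule integrable_gauss_moment[OF assms], simp add: prod_3 gauss_moment_def)
  done

lemma lattice_coord_power:
  assumes "t > 0"
  shows "integrable (count_space UNIV) (\<lambda>k. coord_power a b c (int_vec k) * exp (- (pi * t * (norm (int_vec k))\<^sup>2)))"
    and "(\<integral>k. coord_power a b c (int_vec k) * exp (- (pi * t * (norm (int_vec k))\<^sup>2)) \<partial>count_space UNIV) = theta_moment a t * theta_moment b t * theta_moment c t"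
proof -
  let ?f = "\<lambda>(i::3) k. (\<lambda>y. y ^ (if i = 1 then a else if i = 2 then b else c) * exp (- (pi * t * y\<^sup>2))) (real_of_int k)"
  have eq: "coord_power a b c (int_vec k) * exp (- (pi * t * (norm (int_vec k))\<^sup>2)) = (\<Prod>i\<in>UNIV. ?f i (k $ i))" for k
    unfolding coord_power_exp_prod by simp
  have i: "integrable (count_space UNIV) (?f i)" for i by (rule integrable_theta_moment[OF assms])
  show "integrable (count_space UNIV) (\<lambda>k. coord_power a b c (int_vec k) * exp (- (pi * t * (norm (int_vec k))\<^sup>2)))"
    unfolding eq by (rule lattice_vec_prod(1)[OF i])
  show "(\<integral>k. coord_power a b c (int_vec k) * exp (- (pi * t * (norm (int_vec k))\<^sup>2)) \<partial>count_space UNIV) = theta_moment a t * theta_moment b t * theta_moment c t"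
    unfolding eq lattice_vec_prod(2)[OF i] by (simp add: prod_3 theta_moment_def)
qed

definition diag_sq :: "real^3^3 \<Rightarrow> real" where "diag_sq S = (\<Sum>i\<in>UNIV. (S $ i $ i)\<^sup>2)"
definition offdiag_sq :: "real^3^3 \<Rightarrow> real" where "offdiag_sq S = (\<Sum>i\<in>UNIV. \<Sum>j\<in>UNIV - {i}. (S $ i $ j)\<^sup>2)"

lemma transpose_eq_nth:
  assumes "transpose S = (S :: 'a^'n^'n)"
  shows "S $ i $ j = S $ j $ i"
proof -
  have "transpose S $ i $ j = S $ i $ j" using assms by simp
  then show ?thesis by (simp add: transpose_def)
qed

abbreviation quad :: "real^3^3 \<Rightarrow> real^3 \<Rightarrow> real" where "quad S z \<equiv> S \<bullet> outer z z"

lemma quad_expand: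
  assumes "transpose S = S"
  shows "quad S z = S$1$1 * (z$1)\<^sup>2 + S$2$2 * (z$2)\<^sup>2 + S$3$3 * (z$3)\<^sup>2
    + 2 * S$1$2 * (z$1 * z$2) + 2 * S$1$3 * (z$1 * z$3) + 2 * S$2$3 * (z$2 * z$3)"
proof -
  have "S $ i $ j = S $ j $ i" for i j by (rule transpose_eq_nth[OF assms])
  then have "S$2$1 = S$1$2" "S$3$1 = S$1$3" "S$3$2 = S$2$3" by auto
  then show ?thesis by (simp add: inner_vec_def outer_def sum_3 power2_eq_square algebra_simps)
qed

lemma norm_mat_vec_expand:
  fixes S :: "real^3^3"
  shows "(norm (S *v z))\<^sup>2 = (S$1$1 * z$1 + S$1$2 * z$2 + S$1$3 * z$3)\<^sup>2
     + (S$2$1 * z$1 + S$2$2 * z$2 + S$2$3 * z$3)\<^sup>2 + (S$3$1 * z$1 + S$3$2 * z$2 + S$3$3 * z$3)\<^sup>2"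
  by (simp add: norm3_sq matrix_vector_mult_def sum_3)

lemma offdiag_sq_expand:
  assumes "transpose S = S"
  shows "offdiag_sq S = 2 * ((S$1$2)\<^sup>2 + (S$1$3)\<^sup>2 + (S$2$3)\<^sup>2)"
proof -
  have "S $ i $ j = S $ j $ i" for i j by (rule transpose_eq_nth[OF assms])
  then have *: "S$2$1 = S$1$2" "S$3$1 = S$1$3" "S$3$2 = S$2$3" by auto
  have "UNIV - {1} = {2, 3::3}" "UNIV - {2} = {1, 3::3}" "UNIV - {3} = {1, 2::3}"
    using exhaust_3 by auto
  then show ?thesis by (simp add: offdiag_sq_def sum_3 *)
qed

text \<open>
  Only even monomials survive against a weight with vanishing odd moments, and \<open>tr S = 0\<close> gives
  \<open>\<Sum>\<^bsub>i\<noteq>j\<^esub> S\<^sub>i\<^sub>i S\<^sub>j\<^sub>j = - \<Sum>\<^sub>i S\<^sub>i\<^sub>i\<^sup>2\<close>, so that just two invariants of \<open>S\<close> remain. Stated for an arbitrary product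
  weight because it is applied both to Lebesgue measure, with \<open>\<mu>\<close> the Gaussian moments, and to the
  counting measure of the lattice, with \<open>\<mu>\<close> the theta moments.
\<close>

lemma quadratic_form_moments:
  fixes u :: "'a \<Rightarrow> real^3" and w :: "'a \<Rightarrow> real" and \<mu> :: "nat \<Rightarrow> real"
  assumes S: "transpose S = S" "trace S = 0"
    and int: "\<And>a b c. integrable M (\<lambda>x. coord_power a b c (u x) * w x)"
    and val: "\<And>a b c. (\<integral>x. coord_power a b c (u x) * w x \<partial>M) = \<mu> a * \<mu> b * \<mu> c"
    and odd: "\<mu> (Suc 0) = 0" "\<mu> 3 = 0"
  shows "integrable M (\<lambda>x. (quad S (u x))\<^sup>2 * w x)"
    and "integrable M (\<lambda>x. (norm (S *v u x))\<^sup>2 * w x)"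
    and "(\<integral>x. (quad S (u x))\<^sup>2 * w x \<partial>M) =
       diag_sq S * (\<mu> 4 * (\<mu> 0)\<^sup>2 - (\<mu> 2)\<^sup>2 * \<mu> 0) + 2 * offdiag_sq S * ((\<mu> 2)\<^sup>2 * \<mu> 0)"
    and "(\<integral>x. (norm (S *v u x))\<^sup>2 * w x \<partial>M) = (diag_sq S + offdiag_sq S) * (\<mu> 2 * (\<mu> 0)\<^sup>2)"
proof -
  define m where "m = (\<lambda>a b c x. coord_power a b c (u x) * w x)"
  have im: "integrable M (m a b c)" for a b c unfolding m_def by (rule int)
  have vm: "integral\<^sup>L M (m a b c) = \<mu> a * \<mu> b * \<mu> c" for a b c unfolding m_def by (rule val)
  define s11 s22 s33 s12 s13 s23 where "s11 = S$1$1" and "s22 = S$2$2" and "s33 = S$3$3"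
    and "s12 = S$1$2" and "s13 = S$1$3" and "s23 = S$2$3"
  have sym: "S $ i $ j = S $ j $ i" for i j by (rule transpose_eq_nth[OF S(1)])
  have tr: "s33 = - s11 - s22" using S(2) by (simp add: trace_def sum_3 s11_def s22_def s33_def)
  have d: "diag_sq S = s11\<^sup>2 + s22\<^sup>2 + s33\<^sup>2" by (simp add: diag_sq_def sum_3 s11_def s22_def s33_def)
  have o: "offdiag_sq S = 2 * (s12\<^sup>2 + s13\<^sup>2 + s23\<^sup>2)" using offdiag_sq_expand[OF S(1)] by (simp add: s12_def s13_def s23_def)
  have q: "(quad S (u x))\<^sup>2 * w x = s11\<^sup>2 * m 4 0 0 x + s22\<^sup>2 * m 0 4 0 x + s33\<^sup>2 * m 0 0 4 x
     + (2 * s11 * s22 + 4 * s12\<^sup>2) * m 2 2 0 x + (2 * s11 * s33 + 4 * s13\<^sup>2) * m 2 0 2 x + (2 * s22 * s33 + 4 * s23\<^sup>2) * m 0 2 2 x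
     + 4 * s11 * s12 * m 3 1 0 x + 4 * s11 * s13 * m 3 0 1 x + (4 * s11 * s23 + 8 * s12 * s13) * m 2 1 1 x
     + 4 * s22 * s12 * m 1 3 0 x + 4 * s22 * s23 * m 0 3 1 x + (4 * s22 * s13 + 8 * s12 * s23) * m 1 2 1 x
     + 4 * s33 * s13 * m 1 0 3 x + 4 * s33 * s23 * m 0 1 3 x + (4 * s33 * s12 + 8 * s13 * s23) * m 1 1 2 x" for x
    unfolding quad_expand[OF S(1)] m_def coord_power_def s11_def[symmetric] s22_def[symmetric] s33_def[symmetric] s12_def[symmetric] s13_def[symmetric] s23_def[symmetric]
    by (simp add: power2_eq_square power3_eq_cube power4_eq_xxxx algebra_simps)
  have n: "(norm (S *v u x))\<^sup>2 * w x = (s11\<^sup>2 + s12\<^sup>2 + s13\<^sup>2) * m 2 0 0 x + (s12\<^sup>2 + s22\<^sup>2 + s23\<^sup>2) * m 0 2 0 x + (s13\<^sup>2 + s23\<^sup>2 + s33\<^sup>2) * m 0 0 2 x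
     + 2 * (s11 * s12 + s12 * s22 + s13 * s23) * m 1 1 0 x + 2 * (s11 * s13 + s12 * s23 + s13 * s33) * m 1 0 1 x + 2 * (s12 * s13 + s22 * s23 + s23 * s33) * m 0 1 1 x" for x
    unfolding norm_mat_vec_expand m_def coord_power_def sym[of 2 1] sym[of 3 1] sym[of 3 2] s11_def[symmetric] s22_def[symmetric] s33_def[symmetric] s12_def[symmetric] s13_def[symmetric] s23_def[symmetric]
    by (simp add: power2_eq_square algebra_simps)
  show "integrable M (\<lambda>x. (quad S (u x))\<^sup>2 * w x)" unfolding q
    by (intro Bochner_Integration.integrable_add integrable_mult_right im)
  show "integrable M (\<lambda>x. (norm (S *v u x))\<^sup>2 * w x)" unfolding n
    by (intro Bochner_Integration.integrable_add integrable_mult_right im)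
  have "(\<integral>x. (quad S (u x))\<^sup>2 * w x \<partial>M) = (s11\<^sup>2 + s22\<^sup>2 + s33\<^sup>2) * (\<mu> 4 * (\<mu> 0)\<^sup>2)
     + (2 * s11 * s22 + 2 * s11 * s33 + 2 * s22 * s33 + 4 * s12\<^sup>2 + 4 * s13\<^sup>2 + 4 * s23\<^sup>2) * ((\<mu> 2)\<^sup>2 * \<mu> 0)"
    unfolding q by (simp add: im vm odd power2_eq_square algebra_simps)
  also have "\<dots> = diag_sq S * (\<mu> 4 * (\<mu> 0)\<^sup>2 - (\<mu> 2)\<^sup>2 * \<mu> 0) + 2 * offdiag_sq S * ((\<mu> 2)\<^sup>2 * \<mu> 0)"
    unfolding d o tr by (simp add: power2_eq_square algebra_simps)
  finally show "(\<integral>x. (quad S (u x))\<^sup>2 * w x \<partial>M) =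
       diag_sq S * (\<mu> 4 * (\<mu> 0)\<^sup>2 - (\<mu> 2)\<^sup>2 * \<mu> 0) + 2 * offdiag_sq S * ((\<mu> 2)\<^sup>2 * \<mu> 0)" .
  show "(\<integral>x. (norm (S *v u x))\<^sup>2 * w x \<partial>M) = (diag_sq S + offdiag_sq S) * (\<mu> 2 * (\<mu> 0)\<^sup>2)"
    unfolding n d o by (simp add: im vm odd power2_eq_square algebra_simps)
qed

section \<open>Theta moments under inversion\<close>

lemma theta_moment_nonneg: "even p \<Longrightarrow> 0 \<le> theta_moment p t"
  unfolding theta_moment_def by (intro Bochner_Integration.integral_nonneg) auto

text \<open>
  For \<open>p > 0\<close> the term \<open>k = 0\<close> is absent and the others decay at least like \<open>exp(-\<pi>t)\<close>.
\<close>

lemma theta_moment_decay: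
  assumes t: "1 \<le> t" and p: "even p" "p > 0"
  shows "theta_moment p t \<le> exp pi * theta_moment p 1 * exp (- (pi * t))"
proof -
  have "theta_moment p t \<le> (\<integral>k. exp (- (pi * (t - 1))) * (real_of_int k ^ p * exp (- (pi * 1 * (real_of_int k)\<^sup>2))) \<partial>count_space UNIV)"
    unfolding theta_moment_def
  proof (rule integral_mono)
    fix k :: int
    show "real_of_int k ^ p * exp (- (pi * t * (real_of_int k)\<^sup>2)) \<le> exp (- (pi * (t - 1))) * (real_of_int k ^ p * exp (- (pi * 1 * (real_of_int k)\<^sup>2)))"
    proof (cases "k = 0")
      case False
      then have "1 \<le> \<bar>k\<bar>" by simp
      then have "1 \<le> \<bar>real_of_int k\<bar>" by (metis of_int_1_le_iff of_int_abs)
      then have "1 \<le> (real_of_int k)\<^sup>2" by (metis one_le_power power2_abs)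
      then have "(t - 1) * 1 \<le> (t - 1) * (real_of_int k)\<^sup>2" using t by (intro mult_left_mono) auto
      then have "pi * (t - 1) \<le> pi * ((t - 1) * (real_of_int k)\<^sup>2)" by (intro mult_left_mono) auto
      then have "exp (- (pi * t * (real_of_int k)\<^sup>2)) \<le> exp (- (pi * (t - 1))) * exp (- (pi * 1 * (real_of_int k)\<^sup>2))"
        by (simp add: exp_add[symmetric] algebra_simps)
      from mult_left_mono[OF this, of "real_of_int k ^ p"] show ?thesis using p by (simp add: mult_ac zero_le_even_power)
    qed (use p in \<open>simp add: power_0_left\<close>)
  qed (use t in \<open>auto intro!: integrable_mult_right integrable_theta_moment[of 1, simplified] integrable_theta_moment\<close>)
  also have "\<dots> = exp (- (pi * (t - 1))) * theta_moment p 1"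
    unfolding theta_moment_def by (rule integral_mult_right_zero)
  also have "exp (- (pi * (t - 1))) = exp pi * exp (- (pi * t))"
    by (simp add: exp_add[symmetric] algebra_simps)
  also have "exp pi * exp (- (pi * t)) * theta_moment p 1 = exp pi * theta_moment p 1 * exp (- (pi * t))"
    by simp
  finally show ?thesis .
qed

lemma theta_moment_0_antimono:
  assumes "0 < s" "s \<le> t"
  shows "theta_moment 0 t \<le> theta_moment 0 s"
  unfolding theta_moment_def
  by (rule integral_mono) (use assms integrable_theta_moment[of _ 0] in \<open>auto intro!: mult_right_mono\<close>)

lemma theta_moment_deriv_0_2:
  assumes "t > 0"
  shows "(theta_moment 0 has_real_derivative - (pi * theta_moment 2 t)) (at t)"
    and "(theta_moment 2 has_real_derivative - (pi * theta_moment 4 t)) (at t)"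
  using theta_moment_deriv[OF assms, of 0] theta_moment_deriv[OF assms, of 2]
  by (simp_all add: eval_nat_numeral)

lemma DERIV_compose_inverse:
  assumes "u > 0" "(f has_real_derivative D) (at (1/u))"
  shows "((\<lambda>u. f (1/u)) has_real_derivative - (D / u\<^sup>2)) (at u)"
proof -
  have "((\<lambda>u::real. 1/u) has_real_derivative - (1 / u\<^sup>2)) (at u)"
    using assms(1) by (auto intro!: derivative_eq_intros simp: power2_eq_square)
  from DERIV_chain2[OF assms(2) this] show ?thesis by simp
qed

text \<open>
  The derivative of Jacobi's identity.
\<close>

lemma theta_moment_2_functional:
  assumes t: "t > 0"
  shows "theta_moment 2 (1/t) = t * sqrt t * theta_moment 0 t / (2 * pi) - t\<^sup>2 * sqrt t * theta_moment 2 t"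
proof -
  have d1: "((\<lambda>t. theta_moment 0 (1/t)) has_real_derivative - (- (pi * theta_moment 2 (1/t)) / t\<^sup>2)) (at t)"
    by (rule DERIV_compose_inverse[OF t theta_moment_deriv_0_2(1)]) (use t in simp)
  have d2: "((\<lambda>t. sqrt t * theta_moment 0 t) has_real_derivative (theta_moment 0 t / (2 * sqrt t) - sqrt t * pi * theta_moment 2 t)) (at t)"
    by (rule DERIV_cong, (rule theta_moment_deriv_0_2[OF t] DERIV_real_sqrt[OF t] DERIV_diff DERIV_add DERIV_cdivide DERIV_mult DERIV_power DERIV_ident DERIV_const)+)
      (use t in \<open>simp add: field_simps\<close>)
  have "((\<lambda>t. theta_moment 0 (1/t)) has_real_derivative (theta_moment 0 t / (2 * sqrt t) - sqrt t * pi * theta_moment 2 t)) (at t)"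
    by (rule has_field_derivative_transform_within_open[OF d2, of "{0<..}"]) (use t theta_functional in auto)
  from DERIV_unique[OF d1 this] have "pi * theta_moment 2 (1/t) = t\<^sup>2 * (theta_moment 0 t / (2 * sqrt t) - sqrt t * pi * theta_moment 2 t)"
    using t by (simp add: field_simps)
  also have "\<dots> = pi * (t * sqrt t * theta_moment 0 t / (2 * pi) - t\<^sup>2 * sqrt t * theta_moment 2 t)"
  proof -
    obtain r where r: "r > 0" "t = r * r" using t by (metis real_sqrt_gt_zero real_sqrt_mult_self abs_of_pos)
    show ?thesis using r(1) by (simp add: r(2) power2_eq_square field_simps)
  qed
  finally show ?thesis by simp
qed

text \<open>
  The second derivative of Jacobi's identity.
\<close>

lemma theta_moment_4_functional:
  assumes t: "t > 0"
  shows "theta_moment 4 (1/t) = 3 * t\<^sup>2 * sqrt t * theta_moment 0 t / (4 * pi\<^sup>2)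
     - 3 * t^3 * sqrt t * theta_moment 2 t / pi + t^4 * sqrt t * theta_moment 4 t"
proof -
  let ?A = "theta_moment 0 t" and ?B = "theta_moment 2 t" and ?D = "theta_moment 4 t"
  have d1: "((\<lambda>t. theta_moment 2 (1/t)) has_real_derivative - (- (pi * theta_moment 4 (1/t)) / t\<^sup>2)) (at t)"
    by (rule DERIV_compose_inverse[OF t theta_moment_deriv_0_2(2)]) (use t in simp)
  obtain r where r: "r > 0" "t = r * r" using t by (metis real_sqrt_gt_zero real_sqrt_mult_self abs_of_pos)
  have d2: "((\<lambda>t. t * sqrt t * theta_moment 0 t / (2 * pi) - t\<^sup>2 * sqrt t * theta_moment 2 t) has_real_derivative
      (3 * sqrt t * ?A / (4 * pi) - 3 * t * sqrt t * ?B + pi * t\<^sup>2 * sqrt t * ?D)) (at t)"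
    by (rule DERIV_cong, (rule theta_moment_deriv_0_2[OF t] DERIV_real_sqrt[OF t] DERIV_diff DERIV_add DERIV_cdivide DERIV_mult DERIV_power DERIV_ident DERIV_const)+)
      (use r(1) in \<open>simp add: r(2) power2_eq_square field_simps\<close>)
  have "((\<lambda>t. theta_moment 2 (1/t)) has_real_derivative (3 * sqrt t * ?A / (4 * pi) - 3 * t * sqrt t * ?B + pi * t\<^sup>2 * sqrt t * ?D)) (at t)"
    by (rule has_field_derivative_transform_within_open[OF d2, of "{0<..}"]) (use t theta_moment_2_functional in auto)
  from DERIV_unique[OF d1 this] have "pi * theta_moment 4 (1/t) = t\<^sup>2 * (3 * sqrt t * ?A / (4 * pi) - 3 * t * sqrt t * ?B + pi * t\<^sup>2 * sqrt t * ?D)"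
    using t by (simp add: field_simps)
  also have "\<dots> = pi * (3 * t\<^sup>2 * sqrt t * ?A / (4 * pi\<^sup>2) - 3 * t^3 * sqrt t * ?B / pi + t^4 * sqrt t * ?D)"
    by (simp add: field_simps power2_eq_square power3_eq_cube power4_eq_xxxx)
  finally show ?thesis by simp
qed

text \<open>
  Half of the theta series of the harmonic polynomial \<open>x\<^sup>4 - 6x\<^sup>2y\<^sup>2 + y\<^sup>4\<close> on \<open>\<int>\<^sup>3\<close>, in terms of
  one-dimensional moments.
\<close>

definition theta_harm :: "real \<Rightarrow> real" where
  "theta_harm t = theta_moment 4 t * (theta_moment 0 t)\<^sup>2 - 3 * (theta_moment 2 t)\<^sup>2 * theta_moment 0 t"

text \<open>
  The lower order terms in the functional equations of the moments cancel: a theta series with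
  harmonic coefficients is again modular. This is the reason for isolating this combination.
\<close>

lemma theta_harm_functional:
  assumes t: "t > 0"
  shows "theta_harm (1/t) = t^5 * sqrt t * theta_harm t"
proof -
  have s: "sqrt t * sqrt t = t" using t by simp
  define r where "r = sqrt t"
  have t': "t = r * r" using s by (simp add: r_def)
  have r: "sqrt (r * r) = r" using t by (simp add: r_def)
  show ?thesis
    unfolding theta_harm_def theta_functional[OF t] theta_moment_2_functional[OF t] theta_moment_4_functional[OF t]
    unfolding t' r by (simp add: field_simps power2_eq_square power3_eq_cube power4_eq_xxxx eval_nat_numeral)
qed

text \<open>
  The radial companion of \<open>theta_harm\<close>: \<open>t\<^bsup>5/2\<^esup>\<close> times a third of the lattice sum of
  \<open>|k|\<^sup>2 exp(-\<pi>t|k|\<^sup>2)\<close>. The rotationally symmetric part of the lattice sum of the kernel is a multiple of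
  its derivative.
\<close>

definition radial_theta :: "real \<Rightarrow> real" where
  "radial_theta t = t\<^sup>2 * sqrt t * theta_moment 2 t * (theta_moment 0 t)\<^sup>2"

definition radial_theta' :: "real \<Rightarrow> real" where
  "radial_theta' t = 5/2 * t * sqrt t * theta_moment 2 t * (theta_moment 0 t)\<^sup>2
     - pi * t\<^sup>2 * sqrt t * (theta_moment 4 t * (theta_moment 0 t)\<^sup>2 + 2 * (theta_moment 2 t)\<^sup>2 * theta_moment 0 t)"

lemma radial_theta_deriv:
  assumes t: "t > 0"
  shows "(radial_theta has_real_derivative radial_theta' t) (at t)"
proof -
  obtain r where r: "r > 0" "t = r * r" using t by (metis real_sqrt_gt_zero real_sqrt_mult_self abs_of_pos)
  show ?thesis
    unfolding radial_theta_def[abs_def] radial_theta'_def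
    by (rule DERIV_cong, (rule theta_moment_deriv_0_2[OF t] DERIV_real_sqrt[OF t] DERIV_diff DERIV_add DERIV_cdivide DERIV_mult DERIV_power DERIV_ident DERIV_const)+)
      (use r(1) in \<open>simp add: r(2) power2_eq_square field_simps\<close>)
qed

text \<open>
  The radial function in the inverted variable (\<open>radial_theta_dual\<close>), where its behaviour near time
  \<open>0\<close> becomes visible.
\<close>

definition radial_dual :: "real \<Rightarrow> real" where
  "radial_dual u = (theta_moment 0 u)\<^sup>2 * (theta_moment 0 u / (2 * pi) - u * theta_moment 2 u)"

definition radial_dual' :: "real \<Rightarrow> real" where
  "radial_dual' u = - 2 * pi * theta_moment 0 u * theta_moment 2 u * (theta_moment 0 u / (2 * pi) - u * theta_moment 2 u)
     + (theta_moment 0 u)\<^sup>2 * (pi * u * theta_moment 4 u - 3/2 * theta_moment 2 u)"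

lemma radial_dual_deriv:
  assumes "u > 0"
  shows "(radial_dual has_real_derivative radial_dual' u) (at u)"
  unfolding radial_dual_def[abs_def] radial_dual'_def
  by (rule DERIV_cong, (rule theta_moment_deriv_0_2[OF assms] DERIV_diff DERIV_add DERIV_cdivide DERIV_mult DERIV_power DERIV_ident DERIV_const)+)
    (simp add: power2_eq_square field_simps)

lemma radial_theta_dual:
  assumes u: "u > 0"
  shows "radial_theta (1/u) = radial_dual u"
proof -
  define r where "r = sqrt u"
  have r0: "r > 0" using u by (simp add: r_def)
  have u': "u = r * r" using u by (simp add: r_def)
  have r: "sqrt (r * r) = r" "sqrt (1 / (r * r)) = 1 / r" using r0 by (auto simp: real_sqrt_divide)
  show ?thesis
    unfolding radial_theta_def radial_dual_def theta_functional[OF u] theta_moment_2_functional[OF u]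
    unfolding u' r using r0 by (simp add: field_simps power2_eq_square)
qed

lemma radial_theta'_dual:
  assumes u: "u > 0"
  shows "radial_theta' (1/u) = - (u\<^sup>2 * radial_dual' u)"
proof -
  have d1: "((\<lambda>u. radial_theta (1/u)) has_real_derivative - (radial_theta' (1/u) / u\<^sup>2)) (at u)"
    by (rule DERIV_compose_inverse[OF u radial_theta_deriv]) (use u in simp)
  have "((\<lambda>u. radial_theta (1/u)) has_real_derivative radial_dual' u) (at u)"
    by (rule has_field_derivative_transform_within_open[OF radial_dual_deriv[OF u], of "{0<..}"]) (use u radial_theta_dual in auto)
  from DERIV_unique[OF d1 this] show ?thesis using u by (simp add: field_simps)
qed

lemma power_exp_decay:
  assumes "1 \<le> (t::real)"
  shows "t ^ n * exp (- (pi * t)) \<le> fact n * exp (- (2 * t))"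
proof -
  have "t ^ n * exp (- (pi * t)) \<le> (fact n * exp (1 * t)) * exp (- (pi * t))"
    using power_le_fact_exp[of t 1 n] assms by (intro mult_right_mono) auto
  also have "\<dots> = fact n * exp (t - pi * t)" by (simp add: exp_add[symmetric])
  also have "\<dots> \<le> fact n * exp (- (2 * t))"
  proof -
    have "3 * t \<le> pi * t" using assms pi_gt3 by (intro mult_right_mono) auto
    then show ?thesis by simp
  qed
  finally show ?thesis .
qed

text \<open>
  Every product of moments that occurs contains a moment of positive order, hence a factor
  \<open>exp(-\<pi>t)\<close>.
\<close>

lemma theta_tail_bounds:
  obtains K where "0 \<le> K" "\<And>t. 1 \<le> t \<Longrightarrow> \<bar>theta_harm t\<bar> \<le> K * exp (- (pi * t))"
    "\<And>t. 1 \<le> t \<Longrightarrow> \<bar>radial_dual' t\<bar> \<le> K * t * exp (- (pi * t))"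
    "\<And>t. 1 \<le> t \<Longrightarrow> \<bar>radial_theta' t\<bar> \<le> K * t ^ 3 * exp (- (pi * t))"
proof -
  define a b d where "a = theta_moment 0 1" and "b = exp pi * theta_moment 2 1" and "d = exp pi * theta_moment 4 1"
  have nn: "0 \<le> a" "0 \<le> b" "0 \<le> d" by (auto simp: a_def b_def d_def theta_moment_nonneg)
  have A: "0 \<le> theta_moment 0 t" "theta_moment 0 t \<le> a" if "1 \<le> t" for t
    using that theta_moment_0_antimono[of 1 t] by (auto simp: theta_moment_nonneg a_def)
  have B: "0 \<le> theta_moment 2 t" "theta_moment 2 t \<le> b * exp (- (pi * t))" "theta_moment 2 t \<le> b" if "1 \<le> t" for t
  proof -
    show "theta_moment 2 t \<le> b * exp (- (pi * t))"
      using that theta_moment_decay[of t 2] by (auto simp: b_def)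
    also have "\<dots> \<le> b" using nn that by (intro mult_left_le) auto
    finally show "theta_moment 2 t \<le> b" .
  qed (auto simp: theta_moment_nonneg)
  have D: "0 \<le> theta_moment 4 t" "theta_moment 4 t \<le> d * exp (- (pi * t))" if "1 \<le> t" for t
    using that theta_moment_decay[of t 4] by (auto simp: theta_moment_nonneg d_def)
  define K1 where "K1 = d * a\<^sup>2 + 3 * (b * b) * a"
  define K2 where "K2 = 2 * pi * a * b * (a / (2 * pi) + b) + a\<^sup>2 * (pi * d + 3/2 * b)"
  define K3 where "K3 = 5/2 * b * a\<^sup>2 + pi * (d * a\<^sup>2 + 2 * (b * b) * a)"
  have K: "0 \<le> K1" "0 \<le> K2" "0 \<le> K3" using nn by (auto simp: K1_def K2_def K3_def)
  have 1: "\<bar>theta_harm t\<bar> \<le> (K1 + K2 + K3) * exp (- (pi * t))" if t: "1 \<le> t" for t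
  proof -
    let ?e = "exp (- (pi * t))"
    have "\<bar>theta_harm t\<bar> \<le> theta_moment 4 t * (theta_moment 0 t)\<^sup>2 + 3 * (theta_moment 2 t * theta_moment 2 t) * theta_moment 0 t"
      unfolding theta_harm_def using A[OF t] B[OF t] D[OF t]
      by (intro order_trans[OF abs_triangle_ineq4]) (auto simp: abs_mult power2_eq_square)
    also have "\<dots> \<le> (d * ?e) * a\<^sup>2 + 3 * ((b * ?e) * b) * a"
      using A[OF t] B[OF t] D[OF t] nn by (intro add_mono mult_mono power_mono mult_nonneg_nonneg) auto
    also have "\<dots> = K1 * ?e" by (simp add: K1_def algebra_simps)
    also have "\<dots> \<le> (K1 + K2 + K3) * ?e" using K by (intro mult_right_mono) auto
    finally show ?thesis .
  qed
  have 2: "\<bar>radial_dual' t\<bar> \<le> (K1 + K2 + K3) * t * exp (- (pi * t))" if t: "1 \<le> t" for t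
  proof -
    let ?e = "exp (- (pi * t))"
    let ?A = "theta_moment 0 t" and ?B = "theta_moment 2 t" and ?D = "theta_moment 4 t"
    have x: "\<bar>?A / (2 * pi) - t * ?B\<bar> \<le> ?A / (2 * pi) + t * ?B"
      using A[OF t] B[OF t] t by (intro order_trans[OF abs_triangle_ineq4]) auto
    have y: "\<bar>pi * t * ?D - 3/2 * ?B\<bar> \<le> pi * t * ?D + 3/2 * ?B"
      using B[OF t] D[OF t] t by (intro order_trans[OF abs_triangle_ineq4]) auto
    have "\<bar>radial_dual' t\<bar> \<le> \<bar>- 2 * pi * ?A * ?B * (?A / (2 * pi) - t * ?B)\<bar> + \<bar>?A\<^sup>2 * (pi * t * ?D - 3/2 * ?B)\<bar>"
      unfolding radial_dual'_def by (rule abs_triangle_ineq)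
    also have "\<dots> = 2 * pi * ?A * ?B * \<bar>?A / (2 * pi) - t * ?B\<bar> + ?A\<^sup>2 * \<bar>pi * t * ?D - 3/2 * ?B\<bar>"
      using A[OF t] B[OF t] by (simp add: abs_mult)
    also have "\<dots> \<le> 2 * pi * ?A * ?B * (?A / (2 * pi) + t * ?B) + ?A\<^sup>2 * (pi * t * ?D + 3/2 * ?B)"
      using x y A[OF t] B[OF t] by (intro add_mono mult_left_mono) auto
    also have "\<dots> \<le> 2 * pi * a * (b * ?e) * (a * t / (2 * pi) + t * b) + a\<^sup>2 * (pi * t * (d * ?e) + 3/2 * (t * (b * ?e)))"
    proof -
      have "?A \<le> a * t" using mult_mono[of ?A a 1 t] A[OF t] nn t by auto
      moreover have "?B \<le> t * (b * ?e)" using mult_mono[of 1 t ?B "b * ?e"] B[OF t] nn t by auto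
      ultimately show ?thesis
        using A[OF t] B[OF t] D[OF t] nn t
        by (intro add_mono mult_mono power_mono mult_nonneg_nonneg divide_right_mono add_nonneg_nonneg) auto
    qed
    also have "\<dots> = K2 * t * ?e" by (simp add: K2_def algebra_simps power2_eq_square)
    also have "\<dots> \<le> (K1 + K2 + K3) * t * ?e" using K t by (intro mult_right_mono) auto
    finally show ?thesis .
  qed
  have 3: "\<bar>radial_theta' t\<bar> \<le> (K1 + K2 + K3) * t ^ 3 * exp (- (pi * t))" if t: "1 \<le> t" for t
  proof -
    let ?e = "exp (- (pi * t))"
    let ?A = "theta_moment 0 t" and ?B = "theta_moment 2 t" and ?D = "theta_moment 4 t"
    have s: "sqrt t \<le> t" using t by (intro real_le_lsqrt) (auto simp: power2_eq_square)
    have t2: "t * sqrt t \<le> t ^ 3"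
    proof -
      have "t * sqrt t \<le> t * t" using s t by (intro mult_left_mono) auto
      also have "\<dots> \<le> t * t * t" using t mult_left_mono[of 1 t "t * t"] by simp
      finally show ?thesis by (simp add: power3_eq_cube)
    qed
    have t3: "t\<^sup>2 * sqrt t \<le> t ^ 3" using s t mult_left_mono[OF s, of "t\<^sup>2"] by (simp add: power3_eq_cube power2_eq_square)
    have "\<bar>radial_theta' t\<bar> \<le> \<bar>5/2 * t * sqrt t * ?B * ?A\<^sup>2\<bar> + \<bar>pi * t\<^sup>2 * sqrt t * (?D * ?A\<^sup>2 + 2 * ?B\<^sup>2 * ?A)\<bar>"
      unfolding radial_theta'_def by (rule abs_triangle_ineq4)
    also have "\<dots> = 5/2 * (t * sqrt t) * ?B * ?A\<^sup>2 + pi * (t\<^sup>2 * sqrt t) * (?D * ?A\<^sup>2 + 2 * (?B * ?B) * ?A)"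
      using A[OF t] B[OF t] D[OF t] t by (simp add: abs_mult power2_eq_square)
    also have "\<dots> \<le> 5/2 * t ^ 3 * (b * ?e) * a\<^sup>2 + pi * t ^ 3 * ((d * ?e) * a\<^sup>2 + 2 * ((b * ?e) * b) * a)"
      using A[OF t] B[OF t] D[OF t] nn t t2 t3
      by (intro add_mono mult_mono power_mono mult_nonneg_nonneg add_nonneg_nonneg) auto
    also have "\<dots> = K3 * t ^ 3 * ?e" by (simp add: K3_def algebra_simps)
    also have "\<dots> \<le> (K1 + K2 + K3) * t ^ 3 * ?e" using K t by (intro mult_right_mono) auto
    finally show ?thesis .
  qed
  show ?thesis by (rule that[OF _ 1 2 3]) (use K in auto)
qed

section \<open>Integrals of theta combinations over time\<close>

lemma set_integrable_exp_neg: "set_integrable lborel {0<..} (\<lambda>t::real. K * exp (- t))"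
proof -
  have "set_integrable lborel {0<..} (\<lambda>t::real. exp (- t))"
    using has_bochner_integral_I0i_power_exp_m[of 0] by (auto simp: has_bochner_integral_iff set_integrable_def mult.commute)
  then show ?thesis by (rule set_integrable_mult_right)
qed

lemma set_integrable_dominated:
  fixes f :: "real \<Rightarrow> real"
  assumes g: "set_integrable lborel A g" and A: "A \<in> sets borel"
    and f: "set_borel_measurable borel A f" and le: "\<And>t. t \<in> A \<Longrightarrow> \<bar>f t\<bar> \<le> g t"
  shows "set_integrable lborel A f"
  by (rule set_integrable_bound[OF g]) (use f le in \<open>auto simp: set_borel_measurable_def intro!: AE_I2 order_trans[OF le]\<close>)

lemma continuous_on_theta_moment: "continuous_on {0<..} (theta_moment p)"
  by (rule continuous_at_imp_continuous_on) (auto intro!: DERIV_isCont theta_moment_deriv)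

lemma continuous_on_theta_harm: "continuous_on {0<..} theta_harm"
  unfolding theta_harm_def[abs_def] by (intro continuous_intros continuous_on_theta_moment)

lemma continuous_on_radial_theta': "continuous_on {0<..} radial_theta'"
  unfolding radial_theta'_def[abs_def] by (intro continuous_intros continuous_on_theta_moment) auto

text \<open>
  For \<open>t \<ge> 1\<close> these are the tail bounds; for \<open>t < 1\<close> the functional equations reduce them to
  the tail bounds at \<open>1/t\<close>.
\<close>

lemma theta_exponential_bounds:
  obtains K where "0 \<le> K" "\<And>t. 0 < t \<Longrightarrow> \<bar>t * theta_harm t\<bar> \<le> K * exp (- t)"
    "\<And>t. 0 < t \<Longrightarrow> \<bar>t\<^sup>2 * sqrt t * theta_harm t\<bar> \<le> K * exp (- t)"
    "\<And>t. 0 < t \<Longrightarrow> \<bar>radial_theta' t\<bar> \<le> K * exp (- t)"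
proof -
  obtain K where K: "0 \<le> K" "\<And>t. 1 \<le> t \<Longrightarrow> \<bar>theta_harm t\<bar> \<le> K * exp (- (pi * t))"
    "\<And>t. 1 \<le> t \<Longrightarrow> \<bar>radial_dual' t\<bar> \<le> K * t * exp (- (pi * t))"
    "\<And>t. 1 \<le> t \<Longrightarrow> \<bar>radial_theta' t\<bar> \<le> K * t ^ 3 * exp (- (pi * t))"
    using theta_tail_bounds by metis
  have e: "t ^ n * exp (- (pi * t)) \<le> fact 6 * exp (- t)" if "1 \<le> t" "n \<le> 6" for t :: real and n
  proof -
    have "t ^ n * exp (- (pi * t)) \<le> t ^ 6 * exp (- (pi * t))"
      using that by (intro mult_right_mono power_increasing) auto
    also have "\<dots> \<le> fact 6 * exp (- (2 * t))" by (rule power_exp_decay[OF that(1)])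
    also have "\<dots> \<le> fact 6 * exp (- t)" using that by (intro mult_left_mono) auto
    finally show ?thesis .
  qed
  have e1: "u ^ n * exp (- (pi * u)) \<le> fact 6 * exp 1 * exp (- (1/u))" if "1 \<le> u" "n \<le> 6" for u :: real and n
  proof -
    have "u ^ n * exp (- (pi * u)) \<le> fact 6 * exp (- u)" by (rule e[OF that])
    also have "\<dots> \<le> fact 6 * (exp 1 * exp (- (1/u)))"
    proof (rule mult_left_mono)
      have "1 / u \<le> u" using that by (simp add: divide_le_eq mult_mono[of 1 u 1 u, simplified])
      then show "exp (- u) \<le> exp 1 * exp (- (1 / u))" using that by (simp add: exp_add[symmetric])
    qed auto
    finally show ?thesis by simp
  qed
  have s1: "sqrt t \<le> t" if "1 \<le> t" for t
    using that by (intro real_le_lsqrt) (auto simp: power2_eq_square)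
  define C where "C = K * (fact 6 * exp 1)"
  have C: "K * (fact 6 * exp (- t)) \<le> C * exp (- t)" for t
  proof -
    have "fact 6 * exp (- t) * 1 \<le> fact 6 * exp (- t) * exp 1" by (intro mult_left_mono) auto
    from mult_left_mono[OF this K(1)] show ?thesis by (simp add: C_def mult_ac)
  qed
  have th: "\<bar>t * theta_harm t\<bar> \<le> C * exp (- t) \<and> \<bar>t\<^sup>2 * sqrt t * theta_harm t\<bar> \<le> C * exp (- t) \<and> \<bar>radial_theta' t\<bar> \<le> C * exp (- t)"
    if t: "0 < t" for t
  proof (cases "1 \<le> t")
    case True
    have "\<bar>t * theta_harm t\<bar> \<le> t * (K * exp (- (pi * t)))"
      using K(2)[OF True] True by (simp add: abs_mult)
    also have "\<dots> = K * (t ^ 1 * exp (- (pi * t)))" by simp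
    also have "\<dots> \<le> K * (fact 6 * exp (- t))" by (intro mult_left_mono e K True) auto
    finally have 1: "\<bar>t * theta_harm t\<bar> \<le> K * (fact 6 * exp (- t))" .
    have "\<bar>t\<^sup>2 * sqrt t * theta_harm t\<bar> \<le> t\<^sup>2 * t * (K * exp (- (pi * t)))"
      using K(2)[OF True] True s1[OF True] by (auto simp: abs_mult intro!: mult_mono)
    also have "\<dots> = K * (t ^ 3 * exp (- (pi * t)))" by (simp add: power2_eq_square power3_eq_cube)
    also have "\<dots> \<le> K * (fact 6 * exp (- t))" by (intro mult_left_mono e K True) auto
    finally have 2: "\<bar>t\<^sup>2 * sqrt t * theta_harm t\<bar> \<le> K * (fact 6 * exp (- t))" .
    have "\<bar>radial_theta' t\<bar> \<le> K * (t ^ 3 * exp (- (pi * t)))" using K(4)[OF True] by (simp add: mult.assoc)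
    also have "\<dots> \<le> K * (fact 6 * exp (- t))" by (intro mult_left_mono e K True) auto
    finally have 3: "\<bar>radial_theta' t\<bar> \<le> K * (fact 6 * exp (- t))" .
    show ?thesis using 1 2 3 C[of t] by linarith
  next
    case False
    define u where "u = 1 / t"
    have u: "1 \<le> u" "0 < u" and tu: "t = 1 / u" using False t by (auto simp: u_def field_simps)
    have h: "\<bar>theta_harm t\<bar> \<le> C * exp (- t)"
    proof -
      have "\<bar>theta_harm t\<bar> = u ^ 5 * sqrt u * \<bar>theta_harm u\<bar>"
        unfolding tu theta_harm_functional[OF u(2)] using u by (simp add: abs_mult)
      also have "\<dots> \<le> u ^ 5 * u * (K * exp (- (pi * u)))"
        using K(2)[OF u(1)] s1[OF u(1)] u K(1) by (intro mult_mono) auto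
      also have "\<dots> = K * (u ^ 6 * exp (- (pi * u)))" by (simp add: eval_nat_numeral)
      also have "\<dots> \<le> K * (fact 6 * exp 1 * exp (- (1/u)))" by (intro mult_left_mono e1 K u) auto
      finally show ?thesis by (simp add: C_def tu)
    qed
    have s: "sqrt t \<le> 1" using False t by simp
    have 1: "\<bar>t * theta_harm t\<bar> \<le> 1 * (C * exp (- t))"
      unfolding abs_mult using h False t by (intro mult_mono) auto
    have "t\<^sup>2 * sqrt t \<le> 1 * 1" using s False t by (intro mult_mono power_le_one) auto
    then have 2: "\<bar>t\<^sup>2 * sqrt t * theta_harm t\<bar> \<le> 1 * (C * exp (- t))"
      unfolding abs_mult[of "t\<^sup>2 * sqrt t"] using h t by (intro mult_mono) auto
    have "\<bar>radial_theta' t\<bar> = u\<^sup>2 * \<bar>radial_dual' u\<bar>"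
      unfolding tu radial_theta'_dual[OF u(2)] by (simp add: abs_mult)
    also have "\<dots> \<le> u\<^sup>2 * (K * u * exp (- (pi * u)))" by (intro mult_left_mono K u) auto
    also have "\<dots> = K * (u ^ 3 * exp (- (pi * u)))" by (simp add: eval_nat_numeral)
    also have "\<dots> \<le> K * (fact 6 * exp 1 * exp (- (1/u)))" by (intro mult_left_mono e1 K u) auto
    finally have 3: "\<bar>radial_theta' t\<bar> \<le> C * exp (- t)" by (simp add: C_def tu)
    show ?thesis using 1 2 3 by simp
  qed
  show ?thesis by (rule that[of C]) (use th K in \<open>auto simp: C_def\<close>)
qed

lemma set_borel_measurable_cont: "continuous_on {0<..} f \<Longrightarrow> set_borel_measurable borel {0<..} (f::real\<Rightarrow>real)"
  unfolding set_borel_measurable_def by (rule borel_measurable_continuous_on_indicator) auto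

lemma theta_harm_integrable:
  "set_integrable lborel {0<..} (\<lambda>t. t * theta_harm t)"
  "set_integrable lborel {0<..} (\<lambda>t. t\<^sup>2 * sqrt t * theta_harm t)"
  "set_integrable lborel {0<..} radial_theta'"
proof -
  obtain K where K: "0 \<le> K" "\<And>t. 0 < t \<Longrightarrow> \<bar>t * theta_harm t\<bar> \<le> K * exp (- t)"
    "\<And>t. 0 < t \<Longrightarrow> \<bar>t\<^sup>2 * sqrt t * theta_harm t\<bar> \<le> K * exp (- t)"
    "\<And>t. 0 < t \<Longrightarrow> \<bar>radial_theta' t\<bar> \<le> K * exp (- t)"
    using theta_exponential_bounds by metis
  show "set_integrable lborel {0<..} (\<lambda>t. t * theta_harm t)"
    by (rule set_integrable_dominated[OF set_integrable_exp_neg[of K]])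
      (use K in \<open>auto intro!: set_borel_measurable_cont continuous_intros continuous_on_theta_harm\<close>)
  show "set_integrable lborel {0<..} (\<lambda>t. t\<^sup>2 * sqrt t * theta_harm t)"
    by (rule set_integrable_dominated[OF set_integrable_exp_neg[of K]])
      (use K in \<open>auto intro!: set_borel_measurable_cont continuous_intros continuous_on_theta_harm\<close>)
  show "set_integrable lborel {0<..} radial_theta'"
    by (rule set_integrable_dominated[OF set_integrable_exp_neg[of K]])
      (use K in \<open>auto intro!: set_borel_measurable_cont continuous_on_radial_theta'\<close>)
qed

text \<open>
  Substituting \<open>t \<mapsto> 1/t\<close> and using the functional equation of \<open>theta_harm\<close>.
\<close>

lemma theta_harm_integral_duality:
  "(LINT t:{0<..}|lborel. t\<^sup>2 * sqrt t * theta_harm t) = (LINT t:{0<..}|lborel. t * theta_harm t)"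
proof -
  have ai: "f absolutely_integrable_on {0<..}" "(LINT t:{0<..}|lborel. f t) = integral {0<..} f"
    if "set_integrable lborel {0<..} f" for f :: "real \<Rightarrow> real"
  proof -
    show "f absolutely_integrable_on {0<..}"
      using that integrable_completion[OF borel_measurable_integrable[OF that[unfolded set_integrable_def]]]
      unfolding set_integrable_def by blast
    show "(LINT t:{0<..}|lborel. f t) = integral {0<..} f"
      by (rule set_borel_integral_eq_integral(2)[OF that])
  qed
  have im: "(\<lambda>x::real. 1/x) ` {0<..} = {0<..}"
  proof (intro set_eqI iffI)
    fix y :: real assume "y \<in> {0<..}"
    then show "y \<in> (\<lambda>x::real. 1/x) ` {0<..}" by (intro image_eqI[of _ _ "1/y"]) auto
  qed auto
  have "(\<lambda>x. \<bar>- (1/x\<^sup>2)\<bar> * ((1/x)\<^sup>2 * sqrt (1/x) * theta_harm (1/x))) absolutely_integrable_on {0<..} \<and>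
      integral {0<..} (\<lambda>x. \<bar>- (1/x\<^sup>2)\<bar> * ((1/x)\<^sup>2 * sqrt (1/x) * theta_harm (1/x))) = integral {0<..} (\<lambda>t. t\<^sup>2 * sqrt t * theta_harm t)
    \<longleftrightarrow> (\<lambda>t. t\<^sup>2 * sqrt t * theta_harm t) absolutely_integrable_on (\<lambda>x. 1/x) ` {0<..} \<and>
      integral ((\<lambda>x. 1/x) ` {0<..}) (\<lambda>t. t\<^sup>2 * sqrt t * theta_harm t) = integral {0<..} (\<lambda>t. t\<^sup>2 * sqrt t * theta_harm t)"
  proof (rule has_absolute_integral_change_of_variables_1')
    show "((\<lambda>x. 1/x) has_field_derivative - (1/x\<^sup>2)) (at x within {0<..})" if "x \<in> {0<..}" for x :: real
      using that by (auto intro!: derivative_eq_intros simp: power2_eq_square)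
  qed (auto simp: inj_on_def)
  then have "integral {0<..} (\<lambda>x. \<bar>- (1/x\<^sup>2)\<bar> * ((1/x)\<^sup>2 * sqrt (1/x) * theta_harm (1/x))) = integral {0<..} (\<lambda>t. t\<^sup>2 * sqrt t * theta_harm t)"
    unfolding im using ai(1)[OF theta_harm_integrable(2)] by blast
  also have "integral {0<..} (\<lambda>x. \<bar>- (1/x\<^sup>2)\<bar> * ((1/x)\<^sup>2 * sqrt (1/x) * theta_harm (1/x))) = integral {0<..} (\<lambda>t. t * theta_harm t)"
  proof (rule integral_cong)
    fix x :: real assume "x \<in> {0<..}"
    then have x: "x > 0" by simp
    then obtain r where r: "r > 0" "x = r * r" by (metis real_sqrt_gt_zero real_sqrt_mult_self abs_of_pos)
    show "\<bar>- (1/x\<^sup>2)\<bar> * ((1/x)\<^sup>2 * sqrt (1/x) * theta_harm (1/x)) = x * theta_harm x"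
      unfolding theta_harm_functional[OF x] using r(1) by (simp add: r(2) real_sqrt_divide eval_nat_numeral)
  qed
  finally show ?thesis using ai(2)[OF theta_harm_integrable(1)] ai(2)[OF theta_harm_integrable(2)] by simp
qed

lemma theta_moment_0_tendsto: "(theta_moment 0 \<longlongrightarrow> 1) at_top"
proof -
  have "((\<lambda>t. theta_moment 0 t - 1) \<longlongrightarrow> 0) at_top"
  proof (rule Lim_null_comparison)
    show "\<forall>\<^sub>F t in at_top. norm (theta_moment 0 t - 1) \<le> exp pi * theta_moment 2 1 * exp (- (pi * t))"
      using eventually_ge_at_top[of 1]
    proof eventually_elim
      case (elim t)
      have t: "t > 0" using elim by simp
      have 1: "(\<integral>k. indicator {0::int} k \<partial>count_space UNIV) = (1::real)" by simp
      have i1: "integrable (count_space UNIV) (indicator {0::int} :: int \<Rightarrow> real)" by simp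
      have i: "integrable (count_space UNIV) (\<lambda>k::int. exp (- (pi * t * (real_of_int k)\<^sup>2)))"
        using integrable_theta_moment[OF t, of 0] by simp
      have eq: "theta_moment 0 t - 1 = (\<integral>k. exp (- (pi * t * (real_of_int k)\<^sup>2)) - indicator {0::int} k \<partial>count_space UNIV)"
        using i i1 1 by (simp add: theta_moment_def)
      have "norm (theta_moment 0 t - 1) \<le> theta_moment 2 t"
        unfolding eq theta_moment_def[of 2]
      proof (rule norm_integral_le[OF integrable_theta_moment[OF t]])
        fix k :: int
        show "norm (exp (- (pi * t * (real_of_int k)\<^sup>2)) - indicator {0} k) \<le> (real_of_int k)\<^sup>2 * exp (- (pi * t * (real_of_int k)\<^sup>2))"
        proof (cases "k = 0")
          case False
          then have "1 \<le> \<bar>k\<bar>" by simp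
          then have "1 \<le> \<bar>real_of_int k\<bar>" by (metis of_int_1_le_iff of_int_abs)
          then have "1 \<le> (real_of_int k)\<^sup>2" by (metis one_le_power power2_abs)
          then show ?thesis using False by simp
        qed simp
      qed
      also have "\<dots> \<le> exp pi * theta_moment 2 1 * exp (- (pi * t))" by (rule theta_moment_decay[OF elim]) auto
      finally show ?case .
    qed
    show "((\<lambda>t. exp pi * theta_moment 2 1 * exp (- (pi * t))) \<longlongrightarrow> 0) at_top" by real_asymp
  qed
  then show ?thesis by (simp add: LIM_zero_iff)
qed

lemma theta_moment_2_tendsto: "((\<lambda>t. t ^ n * theta_moment 2 t) \<longlongrightarrow> 0) at_top"
proof (rule Lim_null_comparison)
  show "\<forall>\<^sub>F t in at_top. norm (t ^ n * theta_moment 2 t) \<le> exp pi * theta_moment 2 1 * fact n * exp (- (2 * t))"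
    using eventually_ge_at_top[of 1]
  proof eventually_elim
    case (elim t)
    have "norm (t ^ n * theta_moment 2 t) \<le> t ^ n * (exp pi * theta_moment 2 1 * exp (- (pi * t)))"
      using elim theta_moment_decay[OF elim, of 2] theta_moment_nonneg[of 2 t] by (simp add: abs_mult mult_left_mono)
    also have "\<dots> = exp pi * theta_moment 2 1 * (t ^ n * exp (- (pi * t)))" by simp
    also have "\<dots> \<le> exp pi * theta_moment 2 1 * (fact n * exp (- (2 * t)))"
      by (intro mult_left_mono power_exp_decay elim mult_nonneg_nonneg theta_moment_nonneg) auto
    finally show ?case by (simp add: mult.assoc)
  qed
  show "((\<lambda>t. exp pi * theta_moment 2 1 * fact n * exp (- (2 * t))) \<longlongrightarrow> 0) at_top" by real_asymp
qed

text \<open>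
  A total derivative. The function vanishes at infinity, and its limit at \<open>0\<close> is read off from the
  inverted variable, where the theta function tends to \<open>1\<close>.
\<close>

lemma radial_theta_integral:
  "(LINT t:{0<..}|lborel. radial_theta' t) = - (1 / (2 * pi))"
proof -
  have "(LBINT t=0..\<infinity>. radial_theta' t) = 0 - 1 / (2 * pi)"
  proof (rule interval_integral_FTC_integrable)
    show "(radial_theta has_vector_derivative radial_theta' x) (at x)" if "0 < ereal x" for x
      using radial_theta_deriv[of x] that by (simp add: has_real_derivative_iff_has_vector_derivative[symmetric])
    show "isCont radial_theta' x" if "0 < ereal x" for x
      using continuous_on_radial_theta' that by (simp add: continuous_on_eq_continuous_at)
    have e: "einterval 0 \<infinity> = {0<..}" by (auto simp: einterval_def)
    show "set_integrable lborel (einterval 0 \<infinity>) radial_theta'" unfolding e by (rule theta_harm_integrable(3))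
    have "(radial_dual \<longlongrightarrow> 1\<^sup>2 * (1 / (2 * pi) - 0)) at_top"
      unfolding radial_dual_def[abs_def]
      by (intro tendsto_intros theta_moment_0_tendsto theta_moment_2_tendsto[of 1, simplified]) auto
    then have "(radial_dual \<longlongrightarrow> 1 / (2 * pi)) at_top" by simp
    then have "((\<lambda>t. radial_dual (inverse t)) \<longlongrightarrow> 1 / (2 * pi)) (at_right 0)"
      by (rule filterlim_compose[OF _ filterlim_inverse_at_top_right])
    moreover have "\<forall>\<^sub>F t in at_right 0. radial_dual (inverse t) = radial_theta t"
      unfolding eventually_at_right_field
      by (rule exI[of _ 1]) (use radial_theta_dual[of "inverse _"] in \<open>auto simp: inverse_eq_divide\<close>)
    ultimately have "(radial_theta \<longlongrightarrow> 1 / (2 * pi)) (at_right 0)"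
      by (rule Lim_transform_eventually)
    then show "((radial_theta \<circ> real_of_ereal) \<longlongrightarrow> 1 / (2 * pi)) (at_right 0)"
      using ereal_tendsto_simps1(2)[of radial_theta _ 0] by (simp add: zero_ereal_def)
    have "(radial_theta \<longlongrightarrow> 0) at_top"
    proof (rule Lim_null_comparison)
      show "\<forall>\<^sub>F t in at_top. norm (radial_theta t) \<le> t ^ 3 * theta_moment 2 t * (theta_moment 0 t)\<^sup>2"
        using eventually_ge_at_top[of 1]
      proof eventually_elim
        case (elim t)
        have "sqrt t \<le> t" using elim by (intro real_le_lsqrt) (auto simp: power2_eq_square)
        then have "t\<^sup>2 * sqrt t \<le> t ^ 3" using elim mult_left_mono[of "sqrt t" t "t\<^sup>2"] by (simp add: power3_eq_cube power2_eq_square)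
        then show ?case using theta_moment_nonneg[of 2 t] elim by (auto simp: radial_theta_def abs_mult intro!: mult_right_mono)
      qed
      have "((\<lambda>t. t ^ 3 * theta_moment 2 t * (theta_moment 0 t)\<^sup>2) \<longlongrightarrow> 0 * 1\<^sup>2) at_top"
        by (intro tendsto_intros theta_moment_0_tendsto theta_moment_2_tendsto)
      then show "((\<lambda>t. t ^ 3 * theta_moment 2 t * (theta_moment 0 t)\<^sup>2) \<longlongrightarrow> 0) at_top" by simp
    qed
    then show "((radial_theta \<circ> real_of_ereal) \<longlongrightarrow> 0) (at_left \<infinity>)"
      by (simp add: ereal_tendsto_simps1)
  qed auto
  then show ?thesis
    by (simp add: interval_lebesgue_integral_def einterval_def greaterThan_def)
qed

section \<open>Gaussian pieces of the kernel and their lattice sums\<close>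

text \<open>
  The coefficient of \<open>dt\<close> in the representation of the kernel as a superposition of Gaussians.
\<close>

definition stresslet_gauss :: "real^3^3 \<Rightarrow> real \<Rightarrow> real^3 \<Rightarrow> real" where
  "stresslet_gauss S t z = 4 * pi\<^sup>2 / 3 * (t * sqrt t)
     * (2 * pi * t * (quad S z)\<^sup>2 - 2 * (norm (S *v z))\<^sup>2) * exp (- (pi * t * (norm z)\<^sup>2))"

definition lattice_stresslet :: "real^3^3 \<Rightarrow> real \<Rightarrow> real" where
  "lattice_stresslet S t = (\<integral>k. stresslet_gauss S t (int_vec k) \<partial>count_space UNIV)"

lemma stresslet_gauss_split:
  "stresslet_gauss S t z = 4 * pi\<^sup>2 / 3 * (t * sqrt t) *
     (2 * pi * t * ((quad S z)\<^sup>2 * exp (- (pi * t * (norm z)\<^sup>2)))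
       - 2 * ((norm (S *v z))\<^sup>2 * exp (- (pi * t * (norm z)\<^sup>2))))"
  by (simp add: stresslet_gauss_def algebra_simps)

context
  fixes S :: "real^3^3"
  assumes S: "transpose S = S" "trace S = 0"
begin

lemma integrable_stresslet_gauss:
  assumes t: "t > 0"
  shows "integrable lborel (stresslet_gauss S t)"
  unfolding stresslet_gauss_split[abs_def]
  using quadratic_form_moments(1,2)[OF S gauss_coord_power[OF t]]
  by (intro integrable_mult_right Bochner_Integration.integrable_diff) (auto simp: gauss_moment_odd)

text \<open>
  The prefactors of the two quadratic expressions in \<open>S\<close> are balanced for exactly this cancellation.
\<close>

lemma integral_stresslet_gauss:
  assumes t: "t > 0"
  shows "(\<integral>z. stresslet_gauss S t z \<partial>lborel) = 0"
proof -
  note q = quadratic_form_moments[OF S gauss_coord_power[OF t]]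
  have m: "gauss_moment 0 t = 1 / sqrt t" "gauss_moment 2 t = 1 / (2 * pi * t * sqrt t)" "gauss_moment 4 t = 3 / ((2 * pi * t)\<^sup>2 * sqrt t)"
    using gauss_moment_even[OF t, of 0] gauss_moment_even[OF t, of 1] gauss_moment_even[OF t, of 2]
    by (simp_all add: eval_nat_numeral)
  have o: "gauss_moment (Suc 0) t = 0" "gauss_moment 3 t = 0" by (auto simp: gauss_moment_odd)
  have s: "sqrt t * sqrt t = t" using t by simp
  have "(\<integral>z. stresslet_gauss S t z \<partial>lborel) = 4 * pi\<^sup>2 / 3 * (t * sqrt t) * (2 * pi * t *
     (diag_sq S * (gauss_moment 4 t * (gauss_moment 0 t)\<^sup>2 - (gauss_moment 2 t)\<^sup>2 * gauss_moment 0 t) + 2 * offdiag_sq S * ((gauss_moment 2 t)\<^sup>2 * gauss_moment 0 t))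
     - 2 * ((diag_sq S + offdiag_sq S) * (gauss_moment 2 t * (gauss_moment 0 t)\<^sup>2)))"
    unfolding stresslet_gauss_split[abs_def] using q[OF o] by simp
  also have "2 * pi * t *
     (diag_sq S * (gauss_moment 4 t * (gauss_moment 0 t)\<^sup>2 - (gauss_moment 2 t)\<^sup>2 * gauss_moment 0 t) + 2 * offdiag_sq S * ((gauss_moment 2 t)\<^sup>2 * gauss_moment 0 t))
     - 2 * ((diag_sq S + offdiag_sq S) * (gauss_moment 2 t * (gauss_moment 0 t)\<^sup>2)) = 0"
  proof -
    obtain r where r: "r > 0" "t = r * r" using t by (metis real_sqrt_gt_zero real_sqrt_mult_self abs_of_pos)
    show ?thesis unfolding m using r(1) by (simp add: r(2) field_simps power2_eq_square)
  qed
  finally show ?thesis by simp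
qed

lemma integrable_lattice_stresslet:
  assumes t: "t > 0"
  shows "integrable (count_space UNIV) (\<lambda>k. stresslet_gauss S t (int_vec k))"
  unfolding stresslet_gauss_split[abs_def]
  using quadratic_form_moments(1,2)[OF S lattice_coord_power[OF t]]
  by (intro integrable_mult_right Bochner_Integration.integrable_diff) (auto simp: theta_moment_odd)

text \<open>
  Averaged over the symmetries of the lattice, \<open>(S:zz)\<^sup>2\<close> is a combination of a harmonic polynomial of
  degree four and of \<open>|z|\<^sup>4\<close>, and \<open>|Sz|\<^sup>2\<close> is a multiple of \<open>|z|\<^sup>2\<close>. The harmonic part gives \<open>theta_harm\<close>; the
  two radial terms combine to the derivative of \<open>radial_theta\<close>.
\<close>

lemma lattice_stresslet_eq:
  assumes t: "t > 0"
  shows "lattice_stresslet S t = 4 * pi\<^sup>2 / 3 * (2 * pi / 5 * (3 * diag_sq S - 2 * offdiag_sq S) * (t\<^sup>2 * sqrt t * theta_harm t)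
      - 4/5 * (diag_sq S + offdiag_sq S) * radial_theta' t)"
proof -
  note q = quadratic_form_moments[OF S lattice_coord_power[OF t]]
  have o: "theta_moment (Suc 0) t = 0" "theta_moment 3 t = 0" by (auto simp: theta_moment_odd)
  have "lattice_stresslet S t = 4 * pi\<^sup>2 / 3 * (t * sqrt t) * (2 * pi * t *
     (diag_sq S * (theta_moment 4 t * (theta_moment 0 t)\<^sup>2 - (theta_moment 2 t)\<^sup>2 * theta_moment 0 t) + 2 * offdiag_sq S * ((theta_moment 2 t)\<^sup>2 * theta_moment 0 t))
     - 2 * ((diag_sq S + offdiag_sq S) * (theta_moment 2 t * (theta_moment 0 t)\<^sup>2)))"
    unfolding stresslet_gauss_split[abs_def] lattice_stresslet_def using q[OF o] by simp
  also have "\<dots> = 4 * pi\<^sup>2 / 3 * (2 * pi / 5 * (3 * diag_sq S - 2 * offdiag_sq S) * (t\<^sup>2 * sqrt t * theta_harm t)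
      - 4/5 * (diag_sq S + offdiag_sq S) * radial_theta' t)"
    unfolding theta_harm_def radial_theta'_def by (simp add: field_simps power2_eq_square)
  finally show ?thesis .
qed

lemma lattice_stresslet_bound:
  obtains K where "0 \<le> K" "\<And>t. 0 < t \<Longrightarrow> \<bar>lattice_stresslet S t\<bar> \<le> K * exp (- t)"
proof -
  obtain K where K: "0 \<le> K"
    "\<And>t. 0 < t \<Longrightarrow> \<bar>t\<^sup>2 * sqrt t * theta_harm t\<bar> \<le> K * exp (- t)"
    "\<And>t. 0 < t \<Longrightarrow> \<bar>radial_theta' t\<bar> \<le> K * exp (- t)"
    using theta_exponential_bounds by metis
  define c d where "c = 2 * pi / 5 * (3 * diag_sq S - 2 * offdiag_sq S)" and "d = 4/5 * (diag_sq S + offdiag_sq S)"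
  show ?thesis
  proof (rule that)
    fix t :: real assume t: "0 < t"
    have "\<bar>lattice_stresslet S t\<bar> = 4 * pi\<^sup>2 / 3 * \<bar>c * (t\<^sup>2 * sqrt t * theta_harm t) - d * radial_theta' t\<bar>"
      unfolding lattice_stresslet_eq[OF t] c_def[symmetric] d_def[symmetric] by (simp add: abs_mult)
    also have "\<dots> \<le> 4 * pi\<^sup>2 / 3 * (\<bar>c\<bar> * \<bar>t\<^sup>2 * sqrt t * theta_harm t\<bar> + \<bar>d\<bar> * \<bar>radial_theta' t\<bar>)"
      by (intro mult_left_mono order_trans[OF abs_triangle_ineq4]) (auto simp: abs_mult)
    also have "\<dots> \<le> 4 * pi\<^sup>2 / 3 * (\<bar>c\<bar> * (K * exp (- t)) + \<bar>d\<bar> * (K * exp (- t)))"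
      using K t by (intro mult_left_mono add_mono) auto
    also have "\<dots> = (4 * pi\<^sup>2 / 3 * (\<bar>c\<bar> + \<bar>d\<bar>) * K) * exp (- t)" by (simp add: algebra_simps)
    finally show "\<bar>lattice_stresslet S t\<bar> \<le> (4 * pi\<^sup>2 / 3 * (\<bar>c\<bar> + \<bar>d\<bar>) * K) * exp (- t)" .
  qed (use K in auto)
qed

text \<open>
  The harmonic part is rewritten by duality, the radial part is a boundary term.
\<close>

lemma lattice_stresslet_integral:
  shows "set_integrable lborel {0<..} (lattice_stresslet S)"
    and "(LINT t:{0<..}|lborel. lattice_stresslet S t) = 4 * pi\<^sup>2 / 3 *
      (2 * pi / 5 * (3 * diag_sq S - 2 * offdiag_sq S) * (LINT t:{0<..}|lborel. t * theta_harm t)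
        + 2 / (5 * pi) * (diag_sq S + offdiag_sq S))"
proof -
  let ?f = "\<lambda>t. 4 * pi\<^sup>2 / 3 * (2 * pi / 5 * (3 * diag_sq S - 2 * offdiag_sq S) * (t\<^sup>2 * sqrt t * theta_harm t)
      - 4/5 * (diag_sq S + offdiag_sq S) * radial_theta' t)"
  have "set_integrable lborel {0<..} ?f"
    by (intro set_integrable_mult_right set_integral_diff theta_harm_integrable)
  moreover have "set_integrable lborel {0<..} (lattice_stresslet S) \<longleftrightarrow> set_integrable lborel {0<..} ?f"
    by (intro set_integrable_cong) (auto simp: lattice_stresslet_eq)
  ultimately show "set_integrable lborel {0<..} (lattice_stresslet S)" by simp
  have "(LINT t:{0<..}|lborel. lattice_stresslet S t) = (LINT t:{0<..}|lborel. ?f t)"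
    by (intro set_lebesgue_integral_cong) (auto simp: lattice_stresslet_eq)
  also have "\<dots> = 4 * pi\<^sup>2 / 3 * (2 * pi / 5 * (3 * diag_sq S - 2 * offdiag_sq S) * (LINT t:{0<..}|lborel. t\<^sup>2 * sqrt t * theta_harm t)
      - 4/5 * (diag_sq S + offdiag_sq S) * (LINT t:{0<..}|lborel. radial_theta' t))"
    by (simp only: set_integral_mult_right set_integral_diff(2)[OF set_integrable_mult_right set_integrable_mult_right, OF theta_harm_integrable(2) theta_harm_integrable(3)])
  finally show "(LINT t:{0<..}|lborel. lattice_stresslet S t) = 4 * pi\<^sup>2 / 3 *
      (2 * pi / 5 * (3 * diag_sq S - 2 * offdiag_sq S) * (LINT t:{0<..}|lborel. t * theta_harm t)
        + 2 / (5 * pi) * (diag_sq S + offdiag_sq S))"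
    unfolding theta_harm_integral_duality radial_theta_integral by (simp add: field_simps)
qed

end

section \<open>A Gaussian weight and its Fourier transform\<close>

lemma gauss_fourier_second_moment:
  "(\<integral>x. x\<^sup>2 * exp (- (pi * x\<^sup>2)) * cos (2 * pi * \<xi> * x) \<partial>lborel) = (1 / (2 * pi) - \<xi>\<^sup>2) * exp (- (pi * \<xi>\<^sup>2))"
proof -
  let ?e = "\<lambda>x::real. exp (- (pi * x\<^sup>2))" let ?c = "\<lambda>x. cos (2 * pi * \<xi> * x)" let ?s = "\<lambda>x. sin (2 * pi * \<xi> * x)"
  let ?G = "\<lambda>x. (\<xi> * (?e x * ?s x) - x * (?e x * ?c x)) / (2 * pi)"
  let ?g = "\<lambda>x. x\<^sup>2 * ?e x * ?c x - (1 / (2 * pi) - \<xi>\<^sup>2) * (?e x * ?c x)"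
  have i0: "integrable lborel ?e" and i2: "integrable lborel (\<lambda>x. x\<^sup>2 * ?e x)"
    using integrable_gauss_moment[of 1 0] integrable_gauss_moment[of 1 2] by auto
  have i0c: "integrable lborel (\<lambda>x. ?e x * ?c x)"
    by (rule Bochner_Integration.integrable_bound[OF i0]) (auto simp: abs_mult intro!: mult_left_le)
  have i2c: "integrable lborel (\<lambda>x. x\<^sup>2 * ?e x * ?c x)"
    by (rule Bochner_Integration.integrable_bound[OF i2]) (auto simp: abs_mult intro!: mult_left_le mult_nonneg_nonneg)
  have e0: "((\<lambda>x. (\<bar>\<xi>\<bar> + \<bar>x\<bar>) * ?e x / (2 * pi)) \<longlongrightarrow> 0) at_top" "((\<lambda>x. (\<bar>\<xi>\<bar> + \<bar>x\<bar>) * ?e x / (2 * pi)) \<longlongrightarrow> 0) at_bot"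
    by real_asymp+
  have Gb: "norm (?G x) \<le> (\<bar>\<xi>\<bar> + \<bar>x\<bar>) * ?e x / (2 * pi)" for x
  proof -
    have "\<bar>\<xi> * (?e x * ?s x)\<bar> \<le> \<bar>\<xi>\<bar> * (?e x * 1)" "\<bar>x * (?e x * ?c x)\<bar> \<le> \<bar>x\<bar> * (?e x * 1)"
      unfolding abs_mult by (intro mult_left_mono; simp)+
    then have "\<bar>\<xi> * (?e x * ?s x) - x * (?e x * ?c x)\<bar> \<le> (\<bar>\<xi>\<bar> + \<bar>x\<bar>) * ?e x"
      by (simp add: algebra_simps)
    then show ?thesis by (simp add: divide_right_mono)
  qed
  have "(LBINT x=-\<infinity>..\<infinity>. ?g x) = 0 - 0"
  proof (rule interval_integral_FTC_integrable)
    show "(?G has_vector_derivative ?g x) (at x)" for x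
      unfolding has_real_derivative_iff_has_vector_derivative[symmetric]
      by (auto intro!: derivative_eq_intros simp: field_simps power2_eq_square)
    show "isCont ?g x" for x by (intro continuous_intros) auto
    show "set_integrable lborel (einterval (-\<infinity>) \<infinity>) ?g"
      using i0c i2c by (simp add: set_integrable_def)
    have "(?G \<longlongrightarrow> 0) at_bot" by (rule Lim_null_comparison[OF always_eventually e0(2)]) (use Gb in auto)
    then show "((?G \<circ> real_of_ereal) \<longlongrightarrow> 0) (at_right (-\<infinity>))" by (simp add: ereal_tendsto_simps1)
    have "(?G \<longlongrightarrow> 0) at_top" by (rule Lim_null_comparison[OF always_eventually e0(1)]) (use Gb in auto)
    then show "((?G \<circ> real_of_ereal) \<longlongrightarrow> 0) (at_left \<infinity>)" by (simp add: ereal_tendsto_simps1)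
  qed auto
  then have "(\<integral>x. ?g x \<partial>lborel) = 0"
    by (simp add: interval_lebesgue_integral_def set_lebesgue_integral_def)
  then have "(\<integral>x. x\<^sup>2 * ?e x * ?c x \<partial>lborel) = (1 / (2 * pi) - \<xi>\<^sup>2) * (\<integral>x. ?e x * ?c x \<partial>lborel)"
    using i0c i2c by simp
  then show ?thesis using gauss_fourier[of 1 \<xi>] by simp
qed

lemma gauss_fourier_complex:
  assumes p: "even p"
  shows "integrable lborel (\<lambda>x. complex_of_real (x ^ p * exp (- (pi * x\<^sup>2))) * exp (2 * \<i> * complex_of_real (pi * \<xi> * x)))"
    and "(\<integral>x. complex_of_real (x ^ p * exp (- (pi * x\<^sup>2))) * exp (2 * \<i> * complex_of_real (pi * \<xi> * x)) \<partial>lborel)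
      = complex_of_real (\<integral>x. x ^ p * exp (- (pi * x\<^sup>2)) * cos (2 * pi * \<xi> * x) \<partial>lborel)"
proof -
  let ?w = "\<lambda>x::real. x ^ p * exp (- (pi * x\<^sup>2))"
  have i: "integrable lborel ?w" using integrable_gauss_moment[of 1 p] by simp
  have e: "exp (2 * \<i> * complex_of_real (pi * \<xi> * x)) = cis (2 * pi * \<xi> * x)" for x
    by (simp add: cis_conv_exp mult_ac)
  show I: "integrable lborel (\<lambda>x. complex_of_real (?w x) * exp (2 * \<i> * complex_of_real (pi * \<xi> * x)))"
    unfolding e
  proof (rule Bochner_Integration.integrable_bound[OF i])
    have "(\<lambda>x. complex_of_real (?w x) * cis (2 * pi * \<xi> * x)) \<in> borel_measurable borel"
      by (intro borel_measurable_continuous_onI continuous_intros)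
    then show "(\<lambda>x. complex_of_real (?w x) * cis (2 * pi * \<xi> * x)) \<in> borel_measurable lborel"
      by (simp only: measurable_def sets_lborel space_lborel)
    show "AE x in lborel. norm (complex_of_real (?w x) * cis (2 * pi * \<xi> * x)) \<le> norm (?w x)"
      by (simp only: norm_mult norm_of_real norm_cis mult_1_right real_norm_def order_refl) simp
  qed
  have "(\<integral>x. ?w x * sin (2 * pi * \<xi> * x) \<partial>lborel) = (\<integral>x. ?w (0 + (-1) * x) * sin (2 * pi * \<xi> * (0 + (-1) * x)) \<partial>lborel)"
    by (subst lborel_integral_real_affine[of "-1" _ 0]) auto
  also have "\<dots> = - (\<integral>x. ?w x * sin (2 * pi * \<xi> * x) \<partial>lborel)" using p by simp
  finally have s: "(\<integral>x. ?w x * sin (2 * pi * \<xi> * x) \<partial>lborel) = 0" by simp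
  show "(\<integral>x. complex_of_real (?w x) * exp (2 * \<i> * complex_of_real (pi * \<xi> * x)) \<partial>lborel)
      = complex_of_real (\<integral>x. ?w x * cos (2 * pi * \<xi> * x) \<partial>lborel)"
  proof (rule complex_eqI)
    show "Re (\<integral>x. complex_of_real (?w x) * exp (2 * \<i> * complex_of_real (pi * \<xi> * x)) \<partial>lborel)
      = Re (complex_of_real (\<integral>x. ?w x * cos (2 * pi * \<xi> * x) \<partial>lborel))"
      unfolding integral_Re[OF I, symmetric] unfolding e by simp
    show "Im (\<integral>x. complex_of_real (?w x) * exp (2 * \<i> * complex_of_real (pi * \<xi> * x)) \<partial>lborel)
      = Im (complex_of_real (\<integral>x. ?w x * cos (2 * pi * \<xi> * x) \<partial>lborel))"
      unfolding integral_Im[OF I, symmetric] unfolding e using s by simp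
  qed
qed

text \<open>
  A weight for testing the expansion near the origin. The factor \<open>x\<^sub>1\<^sup>2 x\<^sub>2\<^sup>2\<close> makes it see the planar
  harmonic polynomial below, which a radial weight would annihilate.
\<close>

definition probe :: "real^3 \<Rightarrow> real" where
  "probe x = coord_power 2 2 0 x * exp (- (pi * (norm x)\<^sup>2))"

lemma integrable_coord_power_probe: "integrable lborel (\<lambda>x. coord_power a b c x * probe x)"
proof -
  have "coord_power a b c x * probe x = coord_power (a+2) (b+2) c x * exp (- (pi * 1 * (norm x)\<^sup>2))" for x
    by (simp add: probe_def coord_power_def power_add power2_eq_square)
  then show ?thesis using gauss_coord_power(1)[of 1 "a+2" "b+2" c] by simp
qed

lemma integral_coord_power_probe: "(\<integral>x. coord_power a b c x * probe x \<partial>lborel) = gauss_moment (a+2) 1 * gauss_moment (b+2) 1 * gauss_moment c 1"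
proof -
  have "coord_power a b c x * probe x = coord_power (a+2) (b+2) c x * exp (- (pi * 1 * (norm x)\<^sup>2))" for x
    by (simp add: probe_def coord_power_def power_add power2_eq_square)
  then show ?thesis using gauss_coord_power(2)[of 1 "a+2" "b+2" c] by simp
qed

lemma probe_fourier:
  "(\<integral>x. complex_of_real (probe x) * exp (2 * \<i> * complex_of_real (pi * (\<xi> \<bullet> x))) \<partial>lborel)
    = complex_of_real ((1 / (2 * pi) - (\<xi>$1)\<^sup>2) * (1 / (2 * pi) - (\<xi>$2)\<^sup>2) * exp (- (pi * (norm \<xi>)\<^sup>2)))"
proof -
  let ?p = "\<lambda>i::3. if i = 3 then 0 else 2 :: nat"
  let ?f = "\<lambda>i y. complex_of_real (y ^ ?p i * exp (- (pi * y\<^sup>2))) * exp (2 * \<i> * complex_of_real (pi * \<xi> $ i * y))"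
  have eq: "complex_of_real (probe x) * exp (2 * \<i> * complex_of_real (pi * (\<xi> \<bullet> x))) = (\<Prod>i\<in>UNIV. ?f i (x $ i))" for x
  proof -
    have "exp (2 * \<i> * complex_of_real (pi * (\<xi> \<bullet> x))) = exp (2 * \<i> * complex_of_real (pi * \<xi> $ 1 * x $ 1)) * exp (2 * \<i> * complex_of_real (pi * \<xi> $ 2 * x $ 2)) * exp (2 * \<i> * complex_of_real (pi * \<xi> $ 3 * x $ 3))"
      by (simp add: inner_vec_def sum_3 exp_add[symmetric] algebra_simps)
    moreover have "probe x = ((x$1)^2 * exp (- (pi * (x$1)\<^sup>2))) * ((x$2)^2 * exp (- (pi * (x$2)\<^sup>2))) * exp (- (pi * (x$3)\<^sup>2))"
      by (simp add: probe_def coord_power_def norm3_sq exp_add[symmetric] algebra_simps)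
    ultimately show ?thesis by (simp add: prod_3)
  qed
  have i: "integrable lborel (?f i)" for i by (rule gauss_fourier_complex(1)) simp
  have v: "integral\<^sup>L lborel (?f i) = complex_of_real ((if i = 3 then 1 else 1 / (2 * pi) - (\<xi>$i)\<^sup>2) * exp (- (pi * (\<xi>$i)\<^sup>2)))" for i
  proof -
    have "integral\<^sup>L lborel (?f i) = complex_of_real (\<integral>x. x ^ ?p i * exp (- (pi * x\<^sup>2)) * cos (2 * pi * \<xi> $ i * x) \<partial>lborel)"
      by (rule gauss_fourier_complex(2)) simp
    then show ?thesis using gauss_fourier[of 1 "\<xi> $ i"] gauss_fourier_second_moment[of "\<xi> $ i"] by (cases "i = 3") simp_all
  qed
  have "(\<integral>x. complex_of_real (probe x) * exp (2 * \<i> * complex_of_real (pi * (\<xi> \<bullet> x))) \<partial>lborel) = (\<Prod>i\<in>UNIV. integral\<^sup>L lborel (?f i))"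
    unfolding eq by (rule lborel_vec_prod(2)[OF i])
  also have "\<dots> = complex_of_real (\<Prod>i\<in>UNIV. ((if i = 3 then 1 else 1 / (2 * pi) - (\<xi>$i)\<^sup>2) * exp (- (pi * (\<xi>$i)\<^sup>2))))"
    unfolding v by simp
  also have "(\<Prod>i\<in>UNIV. ((if i = 3 then 1 else 1 / (2 * pi) - (\<xi>$i)\<^sup>2) * exp (- (pi * (\<xi>$i)\<^sup>2))))
     = (1 / (2 * pi) - (\<xi>$1)\<^sup>2) * (1 / (2 * pi) - (\<xi>$2)\<^sup>2) * (exp (- (pi * (\<xi>$1)\<^sup>2)) * exp (- (pi * (\<xi>$2)\<^sup>2)) * exp (- (pi * (\<xi>$3)\<^sup>2)))"
    by (simp add: prod_3)
  also have "exp (- (pi * (\<xi>$1)\<^sup>2)) * exp (- (pi * (\<xi>$2)\<^sup>2)) * exp (- (pi * (\<xi>$3)\<^sup>2)) = exp (- (pi * (norm \<xi>)\<^sup>2))"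
    by (simp add: norm3_sq exp_add[symmetric] algebra_simps)
  finally show ?thesis .
qed

section \<open>The biharmonic lattice series near the origin\<close>

text \<open>
  \<open>|x|\<^bsup>-4\<^esup>\<close> is split evenly among the coordinates, with exponent \<open>4/3 > 1\<close> in each, so that the
  sum over \<open>\<int>\<^sup>3\<close> is dominated by a product of three convergent one-dimensional sums.
\<close>

lemma inverse_quartic_bound:
  fixes x :: "real^3"
  assumes "1 \<le> norm x"
  shows "1 / norm x ^ 4 \<le> 4 * (\<Prod>i\<in>UNIV. (1 + (x $ i)\<^sup>2) powr (-2/3))"
proof -
  let ?n = "(norm x)\<^sup>2"
  have n: "1 \<le> ?n" using assms by (simp add: one_le_power)
  have le: "(1 + (x $ i)\<^sup>2) \<le> 1 + ?n" for i
    using component_le_norm_cart[of x i] by (simp add: abs_le_square_iff[symmetric])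
  have "(1 + ?n) powr (-2) = ((1 + ?n) powr (-2/3)) ^ 3"
    using n by (simp add: powr_power)
  also have "\<dots> = (1 + ?n) powr (-2/3) * (1 + ?n) powr (-2/3) * (1 + ?n) powr (-2/3)"
    by (simp add: power3_eq_cube)
  also have "\<dots> \<le> (1 + (x $ 1)\<^sup>2) powr (-2/3) * (1 + (x $ 2)\<^sup>2) powr (-2/3) * (1 + (x $ 3)\<^sup>2) powr (-2/3)"
    by (intro mult_mono powr_mono2' le) (auto intro: add_pos_nonneg)
  finally have 1: "(1 + ?n) powr (-2) \<le> (\<Prod>i\<in>UNIV. (1 + (x $ i)\<^sup>2) powr (-2/3))" by (simp add: prod_3)
  have "(1 + ?n)\<^sup>2 \<le> (2 * ?n)\<^sup>2" using n by (intro power_mono) auto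
  also have "\<dots> = 4 * norm x ^ 4" by (simp add: power_mult_distrib power_mult[symmetric])
  finally have 2: "(1 + ?n)\<^sup>2 \<le> 4 * norm x ^ 4" .
  have "1 / norm x ^ 4 = 4 / (4 * norm x ^ 4)" by simp
  also have "\<dots> \<le> 4 / (1 + ?n)\<^sup>2"
    using 2 n by (intro divide_left_mono) (auto intro!: mult_pos_pos zero_less_power add_pos_nonneg)
  also have "\<dots> = 4 * (1 + ?n) powr (-2)"
    using n by (subst powr_minus) (simp add: powr_numeral divide_inverse)
  finally show ?thesis using 1 by simp
qed

lemma one_le_norm_int_vec:
  assumes "k \<noteq> 0"
  shows "1 \<le> norm (int_vec k)"
proof -
  obtain i where "k $ i \<noteq> 0" using assms by (auto simp: vec_eq_iff)
  then have "1 \<le> \<bar>k $ i\<bar>" by simp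
  then have "1 \<le> \<bar>real_of_int (k $ i)\<bar>" by (metis of_int_1_le_iff of_int_abs)
  also have "\<dots> \<le> norm (int_vec k)" using component_le_norm_cart[of "int_vec k" i] by simp
  finally show ?thesis .
qed

lemma int_vec_0 [simp]: "int_vec 0 = 0" by (simp add: vec_eq_iff)

lemma integrable_inverse_quartic: "integrable (count_space UNIV) (\<lambda>k. 1 / norm (int_vec k) ^ 4)"
proof (rule Bochner_Integration.integrable_bound)
  let ?g = "\<lambda>n. (1 + (real n)\<^sup>2) powr (-2/3)"
  have "summable ?g"
  proof (rule summable_comparison_test'[where N=1])
    show "summable (\<lambda>n. real n powr (-4/3))" by (subst summable_real_powr_iff) simp
    fix n :: nat assume "1 \<le> n"
    then have "?g n \<le> ((real n)\<^sup>2) powr (-2/3)" by (intro powr_mono2') auto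
    also have "\<dots> = real n powr (-4/3)" using \<open>1 \<le> n\<close> by (simp add: powr_powr flip: powr_numeral)
    finally show "norm (?g n) \<le> real n powr (-4/3)" by simp
  qed
  then have "integrable (count_space UNIV) (\<lambda>k::int. ?g (nat \<bar>k\<bar>))" by (intro integrable_int_of_nat) simp
  then have "integrable (count_space UNIV) (\<lambda>k::int. (1 + (real_of_int k)\<^sup>2) powr (-2/3))" by simp
  then show "integrable (count_space UNIV) (\<lambda>k::int^3. 4 * (\<Prod>i\<in>UNIV. (1 + (int_vec k $ i)\<^sup>2) powr (-2/3)))"
    unfolding int_vec_nth by (intro integrable_mult_right lattice_vec_prod(1))
  show "AE k in count_space UNIV. norm (1 / norm (int_vec k) ^ 4) \<le> norm (4 * (\<Prod>i\<in>UNIV. (1 + (int_vec k $ i)\<^sup>2) powr (-2/3)))"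
  proof (intro AE_I2)
    fix k :: "int^3"
    show "norm (1 / norm (int_vec k) ^ 4) \<le> norm (4 * (\<Prod>i\<in>UNIV. (1 + (int_vec k $ i)\<^sup>2) powr (-2/3)))"
    proof (cases "k = 0")
      case False
      show ?thesis using inverse_quartic_bound[OF one_le_norm_int_vec[OF False]] by simp
    qed simp
  qed
qed auto

definition biharmonic_coeff :: "int^3 \<Rightarrow> real" where
  "biharmonic_coeff k = 1 / (16 * pi ^ 4 * norm (int_vec k) ^ 4)"

lemma integrable_biharmonic_coeff: "integrable (count_space UNIV) biharmonic_coeff"
  using integrable_mult_right[OF integrable_inverse_quartic, of "1 / (16 * pi ^ 4)"]
  by (simp add: biharmonic_coeff_def[abs_def])

lemma biharmonic_coeff_nonneg: "0 \<le> biharmonic_coeff k" by (simp add: biharmonic_coeff_def)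

text \<open>
  The term \<open>k = 0\<close> may be included because its coefficient is \<open>1/0 = 0\<close>.
\<close>

lemma biharmonic_series_eq:
  "biharmonic_series y = (\<integral>k. complex_of_real (biharmonic_coeff k) * exp (2 * \<i> * complex_of_real (pi * (int_vec k \<bullet> y))) \<partial>count_space UNIV)"
proof -
  let ?f = "\<lambda>k. complex_of_real (biharmonic_coeff k) * exp (2 * \<i> * complex_of_real (pi * (int_vec k \<bullet> y)))"
  have "integrable (count_space UNIV) ?f"
    by (rule Bochner_Integration.integrable_bound[OF integrable_biharmonic_coeff]) (auto simp: norm_mult)
  then have s: "Infinite_Set_Sum.abs_summable_on ?f UNIV" by (simp add: abs_summable_on_def)
  then have s': "Infinite_Set_Sum.abs_summable_on ?f (UNIV - {0})" by (rule abs_summable_on_subset) auto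
  have "biharmonic_series y = infsum ?f (UNIV - {0})"
    by (simp add: biharmonic_series_def biharmonic_coeff_def)
  also have "\<dots> = infsetsum ?f (UNIV - {0})" using infsetsum_infsum[OF s'] by simp
  also have "\<dots> = infsetsum ?f UNIV"
    by (rule infsetsum_cong_neutral) (auto simp: biharmonic_coeff_def)
  finally show ?thesis by (simp add: infsetsum_def)
qed

text \<open>
  A symmetric orthogonal involution: the reflection of the \<open>12\<close>-plane that exchanges the first axis
  with the diagonal. It preserves all radial functions but is not a symmetry of the cubic lattice.
\<close>

definition plane_swap :: "real^3 \<Rightarrow> real^3" where
  "plane_swap y = (\<chi> i. if i = 1 then (y$1 + y$2) / sqrt 2 else if i = 2 then (y$1 - y$2) / sqrt 2 else y$3)"

lemma plane_swap_nth [simp]: "plane_swap y $ 1 = (y$1 + y$2) / sqrt 2" "plane_swap y $ 2 = (y$1 - y$2) / sqrt 2" "plane_swap y $ 3 = y$3"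
  by (auto simp: plane_swap_def)

lemma norm_plane_swap [simp]: "norm (plane_swap y) = norm y"
proof -
  have "(norm (plane_swap y))\<^sup>2 = (norm y)\<^sup>2"
    unfolding norm3_sq by (simp add: power_divide power2_eq_square field_simps)
  then show ?thesis by simp
qed

lemma plane_swap_scaleR: "plane_swap (r *\<^sub>R y) = r *\<^sub>R plane_swap y"
  by (simp add: plane_swap_def vec_eq_iff algebra_simps)

lemma inner_plane_swap: "x \<bullet> plane_swap y = plane_swap x \<bullet> y"
  by (simp add: inner_vec_def sum_3 field_simps)

definition planar_harmonic :: "real^3 \<Rightarrow> real" where
  "planar_harmonic y = (y$1) ^ 4 - 6 * (y$1)\<^sup>2 * (y$2)\<^sup>2 + (y$2) ^ 4"

lemma planar_harmonic_scaleR: "planar_harmonic (r *\<^sub>R y) = r ^ 4 * planar_harmonic y"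
  by (simp add: planar_harmonic_def power_mult_distrib algebra_simps)

lemma planar_harmonic_bound: "\<bar>planar_harmonic y\<bar> \<le> 8 * norm y ^ 4"
proof -
  have c: "(y$i)\<^sup>2 \<le> (norm y)\<^sup>2" for i using component_le_norm_cart[of y i] by (simp add: abs_le_square_iff[symmetric])
  have p: "(y$i)\<^sup>2 * (y$j)\<^sup>2 \<le> (norm y)\<^sup>2 * (norm y)\<^sup>2" for i j by (intro mult_mono c) auto
  have "planar_harmonic y = (y$1)\<^sup>2 * (y$1)\<^sup>2 - 6 * ((y$1)\<^sup>2 * (y$2)\<^sup>2) + (y$2)\<^sup>2 * (y$2)\<^sup>2"
    by (simp add: planar_harmonic_def power_numeral_reduce)
  moreover have "norm y ^ 4 = (norm y)\<^sup>2 * (norm y)\<^sup>2" by (simp add: power_numeral_reduce)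
  moreover have "0 \<le> (y$1)\<^sup>2 * (y$1)\<^sup>2" "0 \<le> (y$2)\<^sup>2 * (y$2)\<^sup>2" "0 \<le> (y$1)\<^sup>2 * (y$2)\<^sup>2" by auto
  ultimately show ?thesis using p[of 1 1] p[of 1 2] p[of 2 2] by linarith
qed

text \<open>
  Antisymmetrisation leaves a harmonic polynomial in two of the three variables.
\<close>

lemma cubic_harmonic_plane_swap:
  "cubic_harmonic y - cubic_harmonic (plane_swap y) = 5 * pi / 3 * planar_harmonic y"
proof -
  have 4: "(z / sqrt 2) ^ 4 = z ^ 4 / 4" for z :: real
  proof -
    have "(sqrt 2) ^ 4 = ((sqrt 2)\<^sup>2)\<^sup>2" by (simp only: power_mult[symmetric]) simp
    then show ?thesis by (simp add: power_divide)
  qed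
  show ?thesis
    unfolding cubic_harmonic_def planar_harmonic_def plane_swap_nth norm_plane_swap 4
    by (simp add: power_divide field_simps) (simp add: power2_eq_square power4_eq_xxxx algebra_simps)
qed

text \<open>
  Subtracting the reflected copy removes every radial term of the expansion, and with them the
  unknown constants \<open>c\<^sub>1\<close> and \<open>c\<^sub>2\<close>. The estimate becomes global because the series is bounded.
\<close>

lemma hasimoto_difference:
  assumes "is_hasimoto_constant a"
  obtains C where "0 \<le> C" "\<And>y. norm (biharmonic_series y - biharmonic_series (plane_swap y) + complex_of_real (5 * a / 12 * planar_harmonic y)) \<le> C * norm y ^ 6"
proof -
  define R where "R = (\<lambda>c1 c2 y. - 1 / (4 * pi) * (norm y / 2 - c2 - c1 / 6 * (norm y)\<^sup>2
              + pi / 30 * norm y ^ 4 + a * cubic_harmonic y))"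
  obtain c1 c2 where O: "(\<lambda>y. biharmonic_series y - complex_of_real (R c1 c2 y)) \<in> O[at 0](\<lambda>y. complex_of_real (norm y ^ 6))"
    using assms unfolding is_hasimoto_constant_def R_def by blast
  then obtain C where C: "C > 0" "\<forall>\<^sub>F y in at 0. norm (biharmonic_series y - complex_of_real (R c1 c2 y)) \<le> C * norm (complex_of_real (norm y ^ 6))"
    by (rule landau_o.bigE)
  then obtain d where d: "d > 0" "\<And>y. y \<noteq> 0 \<Longrightarrow> norm y < d \<Longrightarrow> norm (biharmonic_series y - complex_of_real (R c1 c2 y)) \<le> C * norm y ^ 6"
    unfolding eventually_at by (auto simp: norm_power simp del: of_real_power)
  \<comment> \<open>Only the cubic harmonic is not invariant under the reflection.\<close>
  have RR: "R c1 c2 y - R c1 c2 (plane_swap y) = - (5 * a / 12 * planar_harmonic y)" for y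
  proof -
    have "R c1 c2 y - R c1 c2 (plane_swap y) = - 1 / (4 * pi) * a * (cubic_harmonic y - cubic_harmonic (plane_swap y))"
      unfolding R_def norm_plane_swap by (simp add: algebra_simps diff_divide_distrib add_divide_distrib)
    then show ?thesis unfolding cubic_harmonic_plane_swap by simp
  qed
  define M where "M = (\<integral>k. biharmonic_coeff k \<partial>count_space UNIV)"
  have M: "norm (biharmonic_series y) \<le> M" for y
    unfolding biharmonic_series_eq M_def
    by (rule norm_integral_le[OF integrable_biharmonic_coeff]) (auto simp: norm_mult biharmonic_coeff_nonneg)
  have M0: "0 \<le> M" using order_trans[OF norm_ge_zero M[of 0]] .
  let ?E = "\<lambda>y. biharmonic_series y - biharmonic_series (plane_swap y) + complex_of_real (5 * a / 12 * planar_harmonic y)"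
  let ?K = "2 * C + 2 * M / d ^ 6 + 10 * \<bar>a\<bar> / d\<^sup>2"
  show ?thesis
  proof (rule that)
    show "0 \<le> ?K" using C M0 d by simp
    fix y :: "real^3"
    consider "y = 0" | "y \<noteq> 0" "norm y < d" | "norm y \<ge> d" by linarith
    then show "norm (?E y) \<le> ?K * norm y ^ 6"
    proof cases
      case 1
      have "plane_swap 0 = 0" using plane_swap_scaleR[of 0 0] by simp
      then show ?thesis using 1 by (simp add: planar_harmonic_def)
    next
      case 2
      have eq: "?E y = (biharmonic_series y - complex_of_real (R c1 c2 y)) - (biharmonic_series (plane_swap y) - complex_of_real (R c1 c2 (plane_swap y)))"
        using arg_cong[OF RR[of y], of complex_of_real] by (simp add: algebra_simps)
      have "plane_swap y \<noteq> 0" using 2 norm_plane_swap[of y] by (metis norm_eq_zero)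
      then have "norm (?E y) \<le> C * norm y ^ 6 + C * norm y ^ 6"
        unfolding eq using d(2)[of y] d(2)[of "plane_swap y"] 2
        by (intro order_trans[OF norm_triangle_ineq4 add_mono]) (simp_all only: norm_plane_swap simp_thms)
      also have "\<dots> = 2 * C * norm y ^ 6" by simp
      also have "\<dots> \<le> ?K * norm y ^ 6" using C M0 d by (intro mult_right_mono) auto
      finally show ?thesis .
    next
      case 3
      have y6: "1 \<le> norm y ^ 6 / d ^ 6" using 3 d by (simp add: power_mono)
      have y2: "1 \<le> (norm y)\<^sup>2 / d\<^sup>2" using 3 d by (simp add: power_mono)
      have "norm (?E y) \<le> (M + M) + \<bar>5 * a / 12\<bar> * (8 * norm y ^ 4)"
        by (intro norm_triangle_le add_mono norm_triangle_le_diff M)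
          (auto simp only: norm_of_real abs_mult intro!: mult_left_mono planar_harmonic_bound abs_ge_zero)
      also have "\<dots> \<le> (M + M) * (norm y ^ 6 / d ^ 6) + 10 * \<bar>a\<bar> * norm y ^ 4 * ((norm y)\<^sup>2 / d\<^sup>2)"
      proof (rule add_mono)
        show "M + M \<le> (M + M) * (norm y ^ 6 / d ^ 6)" using mult_left_mono[OF y6, of "M + M"] M0 by simp
        have "\<bar>5 * a / 12\<bar> * (8 * norm y ^ 4) \<le> 10 * \<bar>a\<bar> * norm y ^ 4 * 1"
          by (simp add: abs_mult)
        also have "\<dots> \<le> 10 * \<bar>a\<bar> * norm y ^ 4 * ((norm y)\<^sup>2 / d\<^sup>2)" by (intro mult_left_mono y2) auto
        finally show "\<bar>5 * a / 12\<bar> * (8 * norm y ^ 4) \<le> 10 * \<bar>a\<bar> * norm y ^ 4 * ((norm y)\<^sup>2 / d\<^sup>2)" .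
      qed
      also have "\<dots> = (2 * M / d ^ 6 + 10 * \<bar>a\<bar> / d\<^sup>2) * norm y ^ 6"
        by (simp add: algebra_simps power_add[symmetric])
      also have "\<dots> \<le> ?K * norm y ^ 6" using C by (intro mult_right_mono) auto
      finally show ?thesis .
    qed
  qed
qed

section \<open>Testing the expansion against the Gaussian weight\<close>

lemma probe_nonneg: "0 \<le> probe x"
  by (simp add: probe_def coord_power_def)

lemma integrable_probe: "integrable lborel probe"
  using integrable_coord_power_probe[of 0 0 0] by (simp add: coord_power_def)

text \<open>
  Pairing the series with the weight replaces every exponential by the Fourier transform of the
  weight at its frequency. The frequencies \<open>u k\<close> are arbitrary so that the lemma covers both the
  lattice, rescaled, and its reflected copy.
\<close>

lemma biharmonic_probe:
  fixes u :: "int^3 \<Rightarrow> real^3"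
  shows "integrable lborel (\<lambda>x. (\<integral>k. complex_of_real (biharmonic_coeff k) * exp (2 * \<i> * complex_of_real (pi * (u k \<bullet> x))) \<partial>count_space UNIV) * complex_of_real (probe x))" (is ?A)
  and "(\<integral>x. (\<integral>k. complex_of_real (biharmonic_coeff k) * exp (2 * \<i> * complex_of_real (pi * (u k \<bullet> x))) \<partial>count_space UNIV) * complex_of_real (probe x) \<partial>lborel)
    = complex_of_real (\<integral>k. biharmonic_coeff k * ((1 / (2 * pi) - (u k $ 1)\<^sup>2) * (1 / (2 * pi) - (u k $ 2)\<^sup>2) * exp (- (pi * (norm (u k))\<^sup>2))) \<partial>count_space UNIV)" (is ?B)
proof -
  interpret pair_sigma_finite "count_space (UNIV::(int^3) set)" "lborel :: (real^3) measure"
    unfolding pair_sigma_finite_def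
    using lborel.sigma_finite_measure_axioms by (auto intro: sigma_finite_measure_count_space_countable)
  let ?f = "\<lambda>k x. complex_of_real (biharmonic_coeff k) * exp (2 * \<i> * complex_of_real (pi * (u k \<bullet> x))) * complex_of_real (probe x)"
  note [measurable] = borel_measurable_integrable[OF integrable_probe]
  have m: "?f k \<in> borel_measurable borel" for k
  proof -
    have [measurable]: "(\<lambda>x. exp (2 * \<i> * complex_of_real (pi * (u k \<bullet> x)))) \<in> borel_measurable borel"
      by (intro borel_measurable_continuous_onI continuous_intros)
    show ?thesis by measurable
  qed
  have nf: "norm (?f k x) = biharmonic_coeff k * probe x" for k x
    by (simp add: norm_mult biharmonic_coeff_nonneg probe_nonneg)
  have ik: "integrable lborel (?f k)" for k
  proof (rule Bochner_Integration.integrable_bound[OF integrable_mult_right[OF integrable_probe, of "biharmonic_coeff k"]])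
    show "AE x in lborel. norm (?f k x) \<le> norm (biharmonic_coeff k * probe x)"
      by (intro AE_I2) (simp only: nf real_norm_def abs_ge_self)
  qed (use m in simp)
  have I: "integrable (count_space UNIV \<Otimes>\<^sub>M lborel) (case_prod ?f)"
  proof (rule integrable_prod_bounded)
    show "case_prod ?f \<in> borel_measurable (count_space UNIV \<Otimes>\<^sub>M lborel)"
      by (rule measurable_pair_measure_countable1) (use m in auto)
    show "AE k in count_space UNIV. (\<integral>x. norm (?f k x) \<partial>lborel) \<le> biharmonic_coeff k * integral\<^sup>L lborel probe"
      unfolding nf by simp
    show "integrable (count_space UNIV) (\<lambda>k. biharmonic_coeff k * integral\<^sup>L lborel probe)"
      by (intro integrable_mult_left integrable_biharmonic_coeff)
  qed (use ik in auto)
  show ?A using integrable_snd[OF I] by simp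
  have "(\<integral>x. (\<integral>k. complex_of_real (biharmonic_coeff k) * exp (2 * \<i> * complex_of_real (pi * (u k \<bullet> x))) \<partial>count_space UNIV) * complex_of_real (probe x) \<partial>lborel)
      = (\<integral>x. (\<integral>k. ?f k x \<partial>count_space UNIV) \<partial>lborel)" by simp
  also have "\<dots> = (\<integral>k. (\<integral>x. ?f k x \<partial>lborel) \<partial>count_space UNIV)" by (rule Fubini_integral[OF I])
  also have "\<dots> = (\<integral>k. complex_of_real (biharmonic_coeff k * ((1 / (2 * pi) - (u k $ 1)\<^sup>2) * (1 / (2 * pi) - (u k $ 2)\<^sup>2) * exp (- (pi * (norm (u k))\<^sup>2)))) \<partial>count_space UNIV)"
  proof (rule Bochner_Integration.integral_cong[OF refl])
    fix k
    have "(\<integral>x. ?f k x \<partial>lborel) = (\<integral>x. complex_of_real (biharmonic_coeff k) * (complex_of_real (probe x) * exp (2 * \<i> * complex_of_real (pi * (u k \<bullet> x)))) \<partial>lborel)"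
      by (simp add: mult_ac)
    also have "\<dots> = complex_of_real (biharmonic_coeff k) * complex_of_real ((1 / (2 * pi) - (u k $ 1)\<^sup>2) * (1 / (2 * pi) - (u k $ 2)\<^sup>2) * exp (- (pi * (norm (u k))\<^sup>2)))"
      unfolding integral_mult_right_zero probe_fourier ..
    finally show "(\<integral>x. ?f k x \<partial>lborel) = complex_of_real (biharmonic_coeff k * ((1 / (2 * pi) - (u k $ 1)\<^sup>2) * (1 / (2 * pi) - (u k $ 2)\<^sup>2) * exp (- (pi * (norm (u k))\<^sup>2))))"
      by simp
  qed
  finally show ?B by (simp only: integral_complex_of_real)
qed

lemma biharmonic_weight_integrable:
  fixes u :: "int^3 \<Rightarrow> real^3"
  shows "integrable (count_space UNIV) (\<lambda>k. biharmonic_coeff k * ((1 / (2 * pi) - (u k $ 1)\<^sup>2) * (1 / (2 * pi) - (u k $ 2)\<^sup>2) * exp (- (pi * (norm (u k))\<^sup>2))))"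
proof (rule Bochner_Integration.integrable_bound[OF integrable_mult_left[OF integrable_biharmonic_coeff, of 4]])
  show "AE k in count_space UNIV. norm (biharmonic_coeff k * ((1 / (2 * pi) - (u k $ 1)\<^sup>2) * (1 / (2 * pi) - (u k $ 2)\<^sup>2) * exp (- (pi * (norm (u k))\<^sup>2)))) \<le> norm (biharmonic_coeff k * 4)"
  proof (intro AE_I2)
    fix k
    let ?n = "(norm (u k))\<^sup>2"
    have b: "\<bar>1 / (2 * pi) - (u k $ i)\<^sup>2\<bar> \<le> 1 + ?n" for i
    proof -
      have "(u k $ i)\<^sup>2 \<le> ?n" using component_le_norm_cart[of "u k" i] by (simp add: abs_le_square_iff[symmetric])
      moreover have "0 \<le> 1 / (2 * pi)" "1 / (2 * pi) \<le> 1" using pi_gt3 by (auto simp: divide_le_eq)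
      moreover have "0 \<le> (u k $ i)\<^sup>2" by simp
      ultimately show ?thesis unfolding abs_le_iff by linarith
    qed
    have "\<bar>(1 / (2 * pi) - (u k $ 1)\<^sup>2) * (1 / (2 * pi) - (u k $ 2)\<^sup>2)\<bar> \<le> (1 + ?n) * (1 + ?n)"
      unfolding abs_mult by (intro mult_mono b) auto
    also have "\<dots> \<le> exp ?n * exp ?n" by (intro mult_mono) auto
    also have "\<dots> = exp (2 * ?n)" by (simp add: exp_add[symmetric])
    finally have "\<bar>(1 / (2 * pi) - (u k $ 1)\<^sup>2) * (1 / (2 * pi) - (u k $ 2)\<^sup>2)\<bar> * exp (- (pi * ?n)) \<le> exp (2 * ?n) * exp (- (pi * ?n))"
      by (intro mult_right_mono) auto
    also have "\<dots> \<le> 1"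
      using pi_gt3 mult_right_mono[of 2 pi ?n] by (simp add: exp_add[symmetric])
    finally have "\<bar>(1 / (2 * pi) - (u k $ 1)\<^sup>2) * (1 / (2 * pi) - (u k $ 2)\<^sup>2) * exp (- (pi * ?n))\<bar> \<le> 4"
      by (simp add: abs_mult)
    then show "norm (biharmonic_coeff k * ((1 / (2 * pi) - (u k $ 1)\<^sup>2) * (1 / (2 * pi) - (u k $ 2)\<^sup>2) * exp (- (pi * ?n)))) \<le> norm (biharmonic_coeff k * 4)"
      by (simp only: norm_mult) (intro mult_left_mono, auto)
  qed
qed auto

text \<open>
  The sum of the planar harmonic polynomial over \<open>16\<pi>\<^sup>4|k|\<^sup>4\<close>, with a Gaussian cutoff to make it
  absolutely convergent.
\<close>

definition planar_sum :: "real \<Rightarrow> real" where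
  "planar_sum \<tau> = (\<integral>k. biharmonic_coeff k * planar_harmonic (int_vec k) * exp (- (pi * \<tau> * (norm (int_vec k))\<^sup>2)) \<partial>count_space UNIV)"

lemma norm6_expand: "norm x ^ 6 = coord_power 6 0 0 x + coord_power 0 6 0 x + coord_power 0 0 6 x
   + 3 * (coord_power 4 2 0 x + coord_power 4 0 2 x + coord_power 2 4 0 x + coord_power 0 4 2 x + coord_power 2 0 4 x + coord_power 0 2 4 x)
   + 6 * coord_power 2 2 2 x"
proof -
  have "norm x ^ 6 = ((norm x)\<^sup>2) ^ 3" by (simp add: power_mult[symmetric])
  then show ?thesis unfolding norm3_sq coord_power_def by (simp add: power_numeral_reduce algebra_simps)
qed

text \<open>
  The expansion is evaluated at \<open>\<surd>\<tau> x\<close> and integrated against the weight. The reflected difference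
  of Fourier transforms is exactly \<open>-\<tau>\<^sup>2/4\<close> times the planar polynomial with the Gaussian cutoff, the
  main term of the expansion is of the same order \<open>\<tau>\<^sup>2\<close>, and the remainder is \<open>O(\<tau>\<^sup>3)\<close>.
\<close>

lemma planar_sum_limit:
  assumes "is_hasimoto_constant a"
  shows "(planar_sum \<longlongrightarrow> - (5 * a / (2 * pi ^ 4))) (at_right 0)"
proof -
  obtain C where C: "0 \<le> C" "\<And>y. norm (biharmonic_series y - biharmonic_series (plane_swap y) + complex_of_real (5 * a / 12 * planar_harmonic y)) \<le> C * norm y ^ 6"
    using hasimoto_difference[OF assms] by blast
  have i6: "integrable lborel (\<lambda>x. norm x ^ 6 * probe x)"
    unfolding norm6_expand distrib_right mult.assoc distrib_left
    by (intro Bochner_Integration.integrable_add integrable_mult_right integrable_coord_power_probe)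
  have ph: "planar_harmonic x * probe x = coord_power 4 0 0 x * probe x - 6 * (coord_power 2 2 0 x * probe x) + coord_power 0 4 0 x * probe x" for x
    by (simp add: planar_harmonic_def coord_power_def algebra_simps)
  have ip: "integrable lborel (\<lambda>x. planar_harmonic x * probe x)"
    unfolding ph by (intro Bochner_Integration.integrable_add Bochner_Integration.integrable_diff integrable_mult_right integrable_coord_power_probe)
  have vp: "(\<integral>x. planar_harmonic x * probe x \<partial>lborel) = - 3 / (2 * pi ^ 4)"
  proof -
    have m: "gauss_moment 0 1 = 1" "gauss_moment 2 1 = 1 / (2 * pi)" "gauss_moment 4 1 = 3 / (2 * pi)\<^sup>2" "gauss_moment 6 1 = 15 / (2 * pi) ^ 3"
    proof -
      have e: "gauss_moment (2 * k) 1 = fact (2 * k) / (2 ^ k * fact k * (2 * pi) ^ k)" for k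
        using gauss_moment_even[of 1 k] by simp
      have "gauss_moment 2 1 = gauss_moment (2 * 1) 1" "gauss_moment 4 1 = gauss_moment (2 * 2) 1" "gauss_moment 6 1 = gauss_moment (2 * 3) 1"
        by simp_all
      then show "gauss_moment 2 1 = 1 / (2 * pi)" "gauss_moment 4 1 = 3 / (2 * pi)\<^sup>2" "gauss_moment 6 1 = 15 / (2 * pi) ^ 3"
        unfolding e by (simp_all add: fact_numeral)
    qed (use gauss_moment_even[of 1 0] in simp)
    have "(\<integral>x. planar_harmonic x * probe x \<partial>lborel) = gauss_moment (4+2) 1 * gauss_moment (0+2) 1 * gauss_moment 0 1
       - 6 * (gauss_moment (2+2) 1 * gauss_moment (2+2) 1 * gauss_moment 0 1) + gauss_moment (0+2) 1 * gauss_moment (4+2) 1 * gauss_moment 0 1"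
      unfolding ph by (simp only: Bochner_Integration.integral_add Bochner_Integration.integral_diff integral_mult_right_zero Bochner_Integration.integrable_diff integrable_mult_right integrable_coord_power_probe integral_coord_power_probe)
    also have "\<dots> = - 3 / (2 * pi ^ 4)"
      by (simp add: m m(2)[unfolded numeral_2_eq_2] field_simps power2_eq_square power3_eq_cube power4_eq_xxxx)
    finally show ?thesis .
  qed
  let ?L = "- (5 * a / (2 * pi ^ 4))"
  let ?K = "4 * C * (\<integral>x. norm x ^ 6 * probe x \<partial>lborel)"
  have main: "\<bar>planar_sum \<tau> - ?L\<bar> \<le> ?K * \<tau>" if \<tau>: "\<tau> > 0" for \<tau>
  proof -
    define \<sigma> where "\<sigma> = sqrt \<tau>"
    have \<sigma>: "\<sigma> > 0" "\<sigma>\<^sup>2 = \<tau>" using \<tau> by (auto simp: \<sigma>_def)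
    have \<sigma>4: "\<sigma> ^ 4 = \<tau>\<^sup>2" using \<sigma>(2) by (metis power_mult mult_2 numeral_Bit0)
    have \<sigma>6: "\<sigma> ^ 6 = \<tau> ^ 3" using \<sigma>(2) power_mult[of \<sigma> 2 3] by simp
    let ?E = "\<lambda>y. biharmonic_series y - biharmonic_series (plane_swap y) + complex_of_real (5 * a / 12 * planar_harmonic y)"
    let ?u = "\<lambda>k. \<sigma> *\<^sub>R int_vec k" let ?v = "\<lambda>k. \<sigma> *\<^sub>R plane_swap (int_vec k)"
    have B1: "biharmonic_series (\<sigma> *\<^sub>R x) = (\<integral>k. complex_of_real (biharmonic_coeff k) * exp (2 * \<i> * complex_of_real (pi * (?u k \<bullet> x))) \<partial>count_space UNIV)" for x
      unfolding biharmonic_series_eq by simp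
    have B2: "biharmonic_series (plane_swap (\<sigma> *\<^sub>R x)) = (\<integral>k. complex_of_real (biharmonic_coeff k) * exp (2 * \<i> * complex_of_real (pi * (?v k \<bullet> x))) \<partial>count_space UNIV)" for x
      unfolding biharmonic_series_eq by (simp add: inner_plane_swap plane_swap_scaleR)
    let ?W = "\<lambda>\<xi>::real^3. (1 / (2 * pi) - (\<xi> $ 1)\<^sup>2) * (1 / (2 * pi) - (\<xi> $ 2)\<^sup>2) * exp (- (pi * (norm \<xi>)\<^sup>2))"
    \<comment> \<open>The two Fourier transforms differ by a quartic in \<open>k\<close> with the common Gaussian factor; the constant and the quadratic terms are invariant.\<close>
    have W: "?W (?u k) - ?W (?v k) = - (\<tau>\<^sup>2 / 4) * (planar_harmonic (int_vec k) * exp (- (pi * \<tau> * (norm (int_vec k))\<^sup>2)))" for k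
    proof -
      have n: "(norm (?u k))\<^sup>2 = \<tau> * (norm (int_vec k))\<^sup>2" "(norm (?v k))\<^sup>2 = \<tau> * (norm (int_vec k))\<^sup>2"
        using \<sigma> by (auto simp: power_mult_distrib)
      define x y where "x = int_vec k $ 1" and "y = int_vec k $ 2"
      have "(1 / (2 * pi) - \<tau> * x\<^sup>2) * (1 / (2 * pi) - \<tau> * y\<^sup>2) - (1 / (2 * pi) - \<tau> * ((x + y)\<^sup>2 / 2)) * (1 / (2 * pi) - \<tau> * ((x - y)\<^sup>2 / 2))
         = - (\<tau>\<^sup>2 / 4) * (x ^ 4 - 6 * x\<^sup>2 * y\<^sup>2 + y ^ 4)"
        by (simp add: field_simps power2_eq_square power4_eq_xxxx)
      note poly = this
      have c: "(?u k $ 1)\<^sup>2 = \<tau> * x\<^sup>2" "(?u k $ 2)\<^sup>2 = \<tau> * y\<^sup>2"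
        "(?v k $ 1)\<^sup>2 = \<tau> * ((x + y)\<^sup>2 / 2)" "(?v k $ 2)\<^sup>2 = \<tau> * ((x - y)\<^sup>2 / 2)"
        by (simp_all add: x_def y_def \<sigma>(2)[symmetric] power_mult_distrib power_divide)
      have h: "planar_harmonic (int_vec k) = x ^ 4 - 6 * x\<^sup>2 * y\<^sup>2 + y ^ 4"
        by (simp add: planar_harmonic_def x_def y_def)
      show ?thesis
        unfolding n c h left_diff_distrib[symmetric] poly by (simp only: mult.assoc)
    qed
    have E_int: "integrable lborel (\<lambda>x. biharmonic_series (\<sigma> *\<^sub>R x) * complex_of_real (probe x))"
        "integrable lborel (\<lambda>x. biharmonic_series (plane_swap (\<sigma> *\<^sub>R x)) * complex_of_real (probe x))"
      unfolding B1 B2 by (rule biharmonic_probe(1))+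
    have P_int: "integrable lborel (\<lambda>x. complex_of_real (5 * a / 12 * planar_harmonic (\<sigma> *\<^sub>R x)) * complex_of_real (probe x))"
    proof -
      have "complex_of_real (5 * a / 12 * planar_harmonic (\<sigma> *\<^sub>R x)) * complex_of_real (probe x) = complex_of_real (5 * a / 12 * \<sigma> ^ 4 * (planar_harmonic x * probe x))" for x
        by (simp add: planar_harmonic_scaleR)
      then show ?thesis by (simp only:) (intro integrable_of_real integrable_mult_right ip)
    qed
    have v1: "(\<integral>x. complex_of_real (5 * a / 12 * planar_harmonic (\<sigma> *\<^sub>R x)) * complex_of_real (probe x) \<partial>lborel) = complex_of_real (5 * a / 12 * \<tau>\<^sup>2 * (- 3 / (2 * pi ^ 4)))"
    proof -
      have "complex_of_real (5 * a / 12 * planar_harmonic (\<sigma> *\<^sub>R x)) * complex_of_real (probe x) = complex_of_real (5 * a / 12 * \<tau>\<^sup>2 * (planar_harmonic x * probe x))" for x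
        by (simp add: planar_harmonic_scaleR \<sigma>4)
      then show ?thesis unfolding vp[symmetric] by (simp only: integral_complex_of_real integral_mult_right_zero)
    qed
    have v2: "(\<integral>x. biharmonic_series (\<sigma> *\<^sub>R x) * complex_of_real (probe x) \<partial>lborel) - (\<integral>x. biharmonic_series (plane_swap (\<sigma> *\<^sub>R x)) * complex_of_real (probe x) \<partial>lborel)
       = complex_of_real (- (\<tau>\<^sup>2 / 4) * planar_sum \<tau>)"
    proof -
      have "(\<integral>k. biharmonic_coeff k * ?W (?u k) \<partial>count_space UNIV) - (\<integral>k. biharmonic_coeff k * ?W (?v k) \<partial>count_space UNIV)
         = (\<integral>k. biharmonic_coeff k * ?W (?u k) - biharmonic_coeff k * ?W (?v k) \<partial>count_space UNIV)"
        by (rule Bochner_Integration.integral_diff[symmetric]) (rule biharmonic_weight_integrable)+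
      also have "\<dots> = (\<integral>k. - (\<tau>\<^sup>2 / 4) * (biharmonic_coeff k * planar_harmonic (int_vec k) * exp (- (pi * \<tau> * (norm (int_vec k))\<^sup>2))) \<partial>count_space UNIV)"
        unfolding right_diff_distrib[symmetric] W by (simp add: mult_ac)
      also have "\<dots> = - (\<tau>\<^sup>2 / 4) * planar_sum \<tau>" unfolding planar_sum_def by (rule integral_mult_right_zero)
      finally show ?thesis unfolding B1 B2 biharmonic_probe(2) of_real_diff[symmetric] by simp
    qed
    have "norm (\<integral>x. ?E (\<sigma> *\<^sub>R x) * complex_of_real (probe x) \<partial>lborel) \<le> (\<integral>x. C * \<sigma> ^ 6 * (norm x ^ 6 * probe x) \<partial>lborel)"
    proof (rule norm_integral_le)
      show "integrable lborel (\<lambda>x. C * \<sigma> ^ 6 * (norm x ^ 6 * probe x))" by (intro integrable_mult_right i6)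
      fix x :: "real^3"
      have "norm (?E (\<sigma> *\<^sub>R x) * complex_of_real (probe x)) \<le> C * norm (\<sigma> *\<^sub>R x) ^ 6 * probe x"
        unfolding norm_mult using C(2)[of "\<sigma> *\<^sub>R x"] probe_nonneg[of x] C(1) by (intro mult_mono mult_nonneg_nonneg) auto
      then show "norm (?E (\<sigma> *\<^sub>R x) * complex_of_real (probe x)) \<le> C * \<sigma> ^ 6 * (norm x ^ 6 * probe x)"
        using \<sigma> by (simp add: power_mult_distrib mult_ac)
    qed
    also have "(\<integral>x. C * \<sigma> ^ 6 * (norm x ^ 6 * probe x) \<partial>lborel) = C * \<tau> ^ 3 * (\<integral>x. norm x ^ 6 * probe x \<partial>lborel)"
      unfolding \<sigma>6 by (rule integral_mult_right_zero)
    also have "(\<integral>x. ?E (\<sigma> *\<^sub>R x) * complex_of_real (probe x) \<partial>lborel) = complex_of_real (- (\<tau>\<^sup>2 / 4) * planar_sum \<tau>) + complex_of_real (5 * a / 12 * \<tau>\<^sup>2 * (- 3 / (2 * pi ^ 4)))"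
      unfolding v1[symmetric] v2[symmetric] distrib_right left_diff_distrib
      by (subst Bochner_Integration.integral_add Bochner_Integration.integral_diff, intro E_int P_int Bochner_Integration.integrable_diff E_int P_int, intro E_int P_int)+ simp
    also have "\<dots> = complex_of_real (- (\<tau>\<^sup>2 / 4) * (planar_sum \<tau> - ?L))"
      by (simp only: of_real_add[symmetric]) (simp add: field_simps)
    finally have "\<tau>\<^sup>2 / 4 * \<bar>planar_sum \<tau> - ?L\<bar> \<le> C * \<tau> ^ 3 * (\<integral>x. norm x ^ 6 * probe x \<partial>lborel)"
      by (simp only: norm_of_real abs_mult) simp
    also have "\<dots> = \<tau>\<^sup>2 / 4 * (?K * \<tau>)" by (simp add: power3_eq_cube power2_eq_square)
    finally show ?thesis using \<tau> by (simp add: mult_le_cancel_left_pos)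
  qed
  have "((\<lambda>\<tau>. planar_sum \<tau> - ?L) \<longlongrightarrow> 0) (at_right 0)"
  proof (rule Lim_null_comparison)
    show "\<forall>\<^sub>F \<tau> in at_right 0. norm (planar_sum \<tau> - ?L) \<le> ?K * \<tau>"
      using main by (auto simp: eventually_at_right_field intro: exI[of _ 1])
    have "((\<lambda>\<tau>. ?K * \<tau>) \<longlongrightarrow> ?K * 0) (at_right 0)" by (intro tendsto_intros)
    then show "((\<lambda>\<tau>. ?K * \<tau>) \<longlongrightarrow> 0) (at_right 0)" by simp
  qed
  then show ?thesis by (simp only: LIM_zero_iff)
qed

section \<open>Hasimoto's constant as a theta integral\<close>

lemma integral_ramp_exp:
  fixes b \<tau> :: real
  assumes b: "b > 0"
  shows "integrable lborel (\<lambda>t. indicator {\<tau><..} t * ((t - \<tau>) * exp (- (b * t))))"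
    and "(\<integral>t. indicator {\<tau><..} t * ((t - \<tau>) * exp (- (b * t))) \<partial>lborel) = exp (- (b * \<tau>)) / b\<^sup>2"
proof -
  let ?g = "\<lambda>x::real. x ^ 1 * exp (- x) * indicator {0<..} x"
  let ?f = "\<lambda>t. indicator {\<tau><..} t * ((t - \<tau>) * exp (- (b * t)))"
  have h: "integrable lborel ?g" "integral\<^sup>L lborel ?g = 1"
    using has_bochner_integral_I0i_power_exp_m[of 1] by (auto simp: has_bochner_integral_iff)
  have eq: "?f (\<tau> + (1/b) * x) = exp (- (b * \<tau>)) / b * ?g x" for x
  proof (cases "x > 0")
    case True
    then have "exp (- (b * (\<tau> + (1/b) * x))) = exp (- (b * \<tau>)) * exp (- x)"
      using b by (simp add: exp_add[symmetric] algebra_simps)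
    then show ?thesis using True b by simp
  next
    case False
    then show ?thesis using b by (cases "x = 0") (auto simp: indicator_def zero_less_divide_iff)
  qed
  have "integrable lborel (\<lambda>x. ?f (\<tau> + (1/b) * x))" unfolding eq by (intro integrable_mult_right h)
  then show "integrable lborel ?f"
    by (subst (asm) lborel_integrable_real_affine_iff) (use b in auto)
  have "integral\<^sup>L lborel ?f = (1/b) * (\<integral>x. ?f (\<tau> + (1/b) * x) \<partial>lborel)"
    by (subst lborel_integral_real_affine[of "1/b" _ \<tau>]) (use b in auto)
  also have "\<dots> = (1/b) * (exp (- (b * \<tau>)) / b)" unfolding eq integral_mult_right_zero h by simp
  finally show "integral\<^sup>L lborel ?f = exp (- (b * \<tau>)) / b\<^sup>2" by (simp add: power2_eq_square)
qed

lemma planar_lattice_sum: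
  assumes t: "t > 0"
  shows "(\<integral>k. planar_harmonic (int_vec k) * exp (- (pi * t * (norm (int_vec k))\<^sup>2)) \<partial>count_space UNIV) = 2 * theta_harm t"
proof -
  let ?e = "\<lambda>k. exp (- (pi * t * (norm (int_vec k))\<^sup>2))"
  have ph: "planar_harmonic (int_vec k) * ?e k = coord_power 4 0 0 (int_vec k) * ?e k - 6 * (coord_power 2 2 0 (int_vec k) * ?e k) + coord_power 0 4 0 (int_vec k) * ?e k" for k
    by (simp add: planar_harmonic_def coord_power_def algebra_simps)
  show ?thesis
    unfolding ph by (simp add: lattice_coord_power[OF t]) (simp add: theta_harm_def power2_eq_square)
qed

text \<open>
  Writes \<open>exp(-\<pi>\<tau>|k|\<^sup>2) / (\<pi>|k|\<^sup>2)\<^sup>2\<close> as an integral of \<open>(t - \<tau>) exp(-\<pi>t|k|\<^sup>2)\<close> over \<open>t > \<tau>\<close> and exchanges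
  sum and integral; the cutoff makes the exchange absolutely convergent.
\<close>

lemma planar_sum_eq:
  assumes \<tau>: "\<tau> > 0"
  shows "planar_sum \<tau> = 1 / (8 * pi\<^sup>2) * (\<integral>t. indicator {\<tau><..} t * ((t - \<tau>) * theta_harm t) \<partial>lborel)"
proof -
  interpret pair_sigma_finite "count_space (UNIV::(int^3) set)" "lborel :: real measure"
    unfolding pair_sigma_finite_def
    using lborel.sigma_finite_measure_axioms by (auto intro: sigma_finite_measure_count_space_countable)
  let ?n = "\<lambda>k. (norm (int_vec k))\<^sup>2"
  let ?r = "\<lambda>k t. indicator {\<tau><..} t * ((t - \<tau>) * exp (- (pi * ?n k * t)))"
  let ?f = "\<lambda>k t. planar_harmonic (int_vec k) * ?r k t"
  have b: "pi * ?n k > 0" if "k \<noteq> 0" for k using one_le_norm_int_vec[OF that] by (intro mult_pos_pos) auto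
  have h0: "planar_harmonic (int_vec 0) = 0" by (simp add: planar_harmonic_def)
  have ir: "integrable lborel (?f k)" for k
    by (cases "k = 0") (use h0 integral_ramp_exp(1)[OF b] in \<open>auto intro: integrable_mult_right\<close>)
  have vr: "integral\<^sup>L lborel (?f k) = planar_harmonic (int_vec k) * (exp (- (pi * \<tau> * ?n k)) / (pi * ?n k)\<^sup>2)" for k
  proof (cases "k = 0")
    case False
    show ?thesis unfolding integral_mult_right_zero integral_ramp_exp(2)[OF b[OF False]] by (simp add: mult_ac)
  qed (use h0 in simp)
  have nr: "(\<integral>t. norm (?f k t) \<partial>lborel) \<le> 8 / pi\<^sup>2 * exp (- (pi * \<tau> * ?n k))" for k
  proof (cases "k = 0")
    case False
    have "norm (?f k t) = \<bar>planar_harmonic (int_vec k)\<bar> * ?r k t" for t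
      by (auto simp: abs_mult indicator_def)
    then have "(\<integral>t. norm (?f k t) \<partial>lborel) = \<bar>planar_harmonic (int_vec k)\<bar> * (exp (- (pi * ?n k * \<tau>)) / (pi * ?n k)\<^sup>2)"
      using integral_ramp_exp(2)[OF b[OF False], of \<tau>] by simp
    also have "\<dots> \<le> 8 * norm (int_vec k) ^ 4 * (exp (- (pi * ?n k * \<tau>)) / (pi * ?n k)\<^sup>2)"
      by (intro mult_right_mono planar_harmonic_bound) auto
    also have "\<dots> = 8 / pi\<^sup>2 * exp (- (pi * \<tau> * ?n k))"
      using one_le_norm_int_vec[OF False] by (auto simp: power_mult_distrib power_mult[symmetric] field_simps)
    finally show ?thesis .
  qed (use h0 in simp)
  have m: "?f k \<in> borel_measurable borel" for k by measurable
  have I: "integrable (count_space UNIV \<Otimes>\<^sub>M lborel) (case_prod ?f)"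
  proof (rule integrable_prod_bounded)
    show "case_prod ?f \<in> borel_measurable (count_space UNIV \<Otimes>\<^sub>M lborel)"
      by (rule measurable_pair_measure_countable1) (use m in auto)
    show "AE k in count_space UNIV. (\<integral>t. norm (?f k t) \<partial>lborel) \<le> 8 / pi\<^sup>2 * exp (- (pi * \<tau> * ?n k))"
      by (intro AE_I2 nr)
    have "integrable (count_space UNIV) (\<lambda>k. exp (- (pi * \<tau> * ?n k)))"
      using lattice_coord_power(1)[OF \<tau>, of 0 0 0] by (simp add: coord_power_def)
    then show "integrable (count_space UNIV) (\<lambda>k. 8 / pi\<^sup>2 * exp (- (pi * \<tau> * ?n k)))"
      by (rule integrable_mult_right)
    show "AE k in count_space UNIV. integrable lborel (?f k)" by (intro AE_I2 ir)
  qed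
  have inner: "(\<integral>k. ?f k t \<partial>count_space UNIV) = 2 * (indicator {\<tau><..} t * ((t - \<tau>) * theta_harm t))" for t
  proof (cases "t > \<tau>")
    case True
    have "(\<integral>k. ?f k t \<partial>count_space UNIV) = (\<integral>k. (t - \<tau>) * (planar_harmonic (int_vec k) * exp (- (pi * t * ?n k))) \<partial>count_space UNIV)"
      using True by (simp add: mult_ac)
    also have "\<dots> = (t - \<tau>) * (2 * theta_harm t)"
      unfolding integral_mult_right_zero using planar_lattice_sum[of t] True \<tau> by simp
    finally show ?thesis using True by simp
  qed simp
  have "planar_sum \<tau> = (\<integral>k. 1 / (16 * pi\<^sup>2) * integral\<^sup>L lborel (?f k) \<partial>count_space UNIV)"
    unfolding planar_sum_def vr
    by (intro Bochner_Integration.integral_cong) (auto simp: biharmonic_coeff_def power_mult_distrib power_mult[symmetric] field_simps)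
  also have "\<dots> = 1 / (16 * pi\<^sup>2) * (\<integral>k. integral\<^sup>L lborel (?f k) \<partial>count_space UNIV)"
    by (rule integral_mult_right_zero)
  also have "(\<integral>k. integral\<^sup>L lborel (?f k) \<partial>count_space UNIV) = (\<integral>t. (\<integral>k. ?f k t \<partial>count_space UNIV) \<partial>lborel)"
    by (rule Fubini_integral[OF I, symmetric])
  also have "\<dots> = 2 * (\<integral>t. indicator {\<tau><..} t * ((t - \<tau>) * theta_harm t) \<partial>lborel)"
    unfolding inner by (rule integral_mult_right_zero)
  finally show ?thesis by simp
qed

text \<open>
  The cutoff is removed on both sides: the limit of the sum is known in terms of \<open>a\<close>, the limit of
  the integral is given by dominated convergence.
\<close>

theorem hasimoto_constant_theta:
  assumes "is_hasimoto_constant a"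
  shows "(LINT t:{0<..}|lborel. t * theta_harm t) = - 20 * a / pi\<^sup>2"
proof -
  define \<tau> where "\<tau> = (\<lambda>n. 1 / real (Suc n))"
  have \<tau>0: "\<tau> n > 0" for n by (simp add: \<tau>_def)
  have \<tau>l: "\<tau> \<longlonglongrightarrow> 0" unfolding \<tau>_def using LIMSEQ_Suc[OF lim_1_over_n] by simp
  obtain K where K: "\<And>t. 0 < t \<Longrightarrow> \<bar>t * theta_harm t\<bar> \<le> K * exp (- t)" using theta_exponential_bounds by metis
  have mt: "(\<lambda>t. indicator {0<..} t * theta_harm t) \<in> borel_measurable borel"
    using set_borel_measurable_cont[OF continuous_on_theta_harm] by (simp add: set_borel_measurable_def)
  have "(\<lambda>n. \<integral>t. indicator {\<tau> n<..} t * ((t - \<tau> n) * theta_harm t) \<partial>lborel) \<longlonglongrightarrow> (\<integral>t. indicator {0<..} t * (t * theta_harm t) \<partial>lborel)"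
  proof (rule integral_dominated_convergence)
    show "integrable lborel (\<lambda>t. indicator {0<..} t * (K * exp (- t)))"
      using set_integrable_exp_neg[of K] by (simp add: set_integrable_def)
    have "(\<lambda>t. t * (indicator {0<..} t * theta_harm t)) \<in> borel_measurable borel" using mt by measurable
    then show "(\<lambda>t. indicator {0<..} t * (t * theta_harm t)) \<in> borel_measurable lborel" by (simp add: mult.left_commute)
    fix n
    have "(\<lambda>t. indicator {\<tau> n<..} t * (t - \<tau> n) * (indicator {0<..} t * theta_harm t)) \<in> borel_measurable borel" using mt by measurable
    moreover have "indicator {\<tau> n<..} t * (t - \<tau> n) * (indicator {0<..} t * theta_harm t) = indicator {\<tau> n<..} t * ((t - \<tau> n) * theta_harm t)" for t
      using \<tau>0[of n] by (auto simp: indicator_def)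
    ultimately show "(\<lambda>t. indicator {\<tau> n<..} t * ((t - \<tau> n) * theta_harm t)) \<in> borel_measurable lborel" by simp
    show "AE t in lborel. norm (indicator {\<tau> n<..} t * ((t - \<tau> n) * theta_harm t)) \<le> indicator {0<..} t * (K * exp (- t))"
    proof (intro AE_I2)
      fix t
      show "norm (indicator {\<tau> n<..} t * ((t - \<tau> n) * theta_harm t)) \<le> indicator {0<..} t * (K * exp (- t))"
      proof (cases "t > \<tau> n")
        case True
        then have t: "t > 0" using \<tau>0[of n] by simp
        have "\<bar>(t - \<tau> n) * theta_harm t\<bar> \<le> \<bar>t * theta_harm t\<bar>"
          unfolding abs_mult using True \<tau>0[of n] by (intro mult_right_mono) auto
        also note K[OF t]
        finally show ?thesis using True t by simp
      next
        case False
        then show ?thesis using K[of t] by (auto simp: indicator_def intro: order_trans[OF abs_ge_zero])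
      qed
    qed
  next
    show "AE t in lborel. (\<lambda>n. indicator {\<tau> n<..} t * ((t - \<tau> n) * theta_harm t)) \<longlonglongrightarrow> indicator {0<..} t * (t * theta_harm t)"
    proof (intro AE_I2)
      fix t :: real
      show "(\<lambda>n. indicator {\<tau> n<..} t * ((t - \<tau> n) * theta_harm t)) \<longlonglongrightarrow> indicator {0<..} t * (t * theta_harm t)"
      proof (cases "t > 0")
        case True
        have "\<forall>\<^sub>F n in sequentially. \<tau> n < t" using order_tendstoD(2)[OF \<tau>l True] .
        then have "\<forall>\<^sub>F n in sequentially. (t - \<tau> n) * theta_harm t = indicator {\<tau> n<..} t * ((t - \<tau> n) * theta_harm t)"
          by eventually_elim simp
        moreover have "(\<lambda>n. (t - \<tau> n) * theta_harm t) \<longlonglongrightarrow> (t - 0) * theta_harm t" by (intro tendsto_intros \<tau>l)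
        ultimately show ?thesis using True by (auto intro: Lim_transform_eventually)
      next
        case False
        then have "indicator {\<tau> n<..} t = (0::real)" for n using \<tau>0[of n] by (auto simp: indicator_def)
        then show ?thesis using False by simp
      qed
    qed
  qed
  then have "(\<lambda>n. planar_sum (\<tau> n)) \<longlonglongrightarrow> 1 / (8 * pi\<^sup>2) * (\<integral>t. indicator {0<..} t * (t * theta_harm t) \<partial>lborel)"
    unfolding planar_sum_eq[OF \<tau>0] by (rule tendsto_mult_left)
  moreover have "(\<lambda>n. planar_sum (\<tau> n)) \<longlonglongrightarrow> - (5 * a / (2 * pi ^ 4))"
  proof (rule filterlim_compose[OF planar_sum_limit[OF assms]])
    show "filterlim \<tau> (at_right 0) sequentially"
      using \<tau>l \<tau>0 \<tau>0[THEN less_imp_neq, THEN not_sym] by (auto simp: filterlim_at intro!: always_eventually)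
  qed
  ultimately have "1 / (8 * pi\<^sup>2) * (\<integral>t. indicator {0<..} t * (t * theta_harm t) \<partial>lborel) = - (5 * a / (2 * pi ^ 4))"
    by (rule LIMSEQ_unique)
  then show ?thesis
    by (simp add: set_lebesgue_integral_def field_simps power4_eq_xxxx power2_eq_square)
qed

section \<open>Volume of a tube along a smooth boundary\<close>

text \<open>
  About \<open>1/h\<close> translates of \<open>E\<close> by multiples of \<open>h v\<close> stay within distance \<open>1\<close>, and they are disjoint.
\<close>

lemma disjoint_translates_measure:
  fixes E :: "'a::euclidean_space set"
  assumes E: "E \<in> lmeasurable" "E \<subseteq> ball x R" and v: "norm v = 1" and h: "0 < h"
    and dis: "\<And>y j::nat. y \<in> E \<Longrightarrow> y + (real j * h) *\<^sub>R v \<in> E \<Longrightarrow> j = 0"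
  shows "measure lebesgue E \<le> measure lebesgue (ball x (R + 1)) * h"
proof -
  \<comment> \<open>The translates \<open>j = 0, \<dots>, J\<close> move by at most \<open>1\<close>.\<close>
  define J where "J = nat \<lfloor>1 / h\<rfloor>"
  have J: "real J \<le> 1 / h" "1 / h \<le> real J + 1" using h by (auto simp: J_def)
  let ?F = "\<lambda>j::nat. (+) ((real j * h) *\<^sub>R v) ` E"
  have d: "disjnt (?F i) (?F j)" if "i < j" for i j
  proof -
    have False if yz: "y \<in> E" "z \<in> E" "(real i * h) *\<^sub>R v + y = (real j * h) *\<^sub>R v + z" for y z
    proof -
      have "z + (real (j - i) * h) *\<^sub>R v = y"
        using yz(3) \<open>i < j\<close> by (simp add: of_nat_diff algebra_simps)
      then have "j - i = 0" using dis[OF yz(2), of "j - i"] yz(1) by simp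
      then show False using \<open>i < j\<close> by simp
    qed
    then show ?thesis by (auto simp: disjnt_def)
  qed
  have pw: "pairwise (\<lambda>i j. disjnt (?F i) (?F j)) {..J}"
    unfolding pairwise_def using d by (metis disjnt_sym linorder_neqE_nat)
  have "(\<Sum>j\<le>J. measure lebesgue (?F j)) = measure lebesgue (\<Union>j\<le>J. ?F j)"
    by (rule measure_UNION'[symmetric]) (use pw E in \<open>auto intro: measurable_translation\<close>)
  also have "\<dots> \<le> measure lebesgue (ball x (R + 1))"
  proof (rule measure_mono_fmeasurable)
    show "(\<Union>j\<le>J. ?F j) \<subseteq> ball x (R + 1)"
    proof safe
      fix j y assume j: "j \<le> J" and y: "y \<in> E"
      have "real j * h \<le> real J * h" using j h by (intro mult_right_mono) auto
      also have "\<dots> \<le> 1" using J(1) h by (simp add: field_simps)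
      finally have jh: "real j * h \<le> 1" .
      have "dist x ((real j * h) *\<^sub>R v + y) \<le> dist x y + norm ((real j * h) *\<^sub>R v)"
        using dist_triangle[of x "(real j * h) *\<^sub>R v + y" y] by (simp add: dist_norm)
      also have "\<dots> < R + 1" using y E(2) jh h v by (auto simp: subset_eq)
      finally show "(real j * h) *\<^sub>R v + y \<in> ball x (R + 1)" by simp
    qed
    show "(\<Union>j\<le>J. ?F j) \<in> sets lebesgue"
      using E by (auto intro!: sets.finite_UN fmeasurableD measurable_translation)
  qed auto
  finally have "real (Suc J) * measure lebesgue E \<le> measure lebesgue (ball x (R + 1))"
    by (simp only: measure_translation sum_constant card_atMost)
  then have "(real J + 1) * measure lebesgue E \<le> measure lebesgue (ball x (R + 1))"
    by (simp add: add.commute)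
  moreover have "(1 / h) * measure lebesgue E \<le> (real J + 1) * measure lebesgue E"
    using J by (intro mult_right_mono) auto
  ultimately have "(1 / h) * measure lebesgue E \<le> measure lebesgue (ball x (R + 1))" by linarith
  then show ?thesis using h by (simp add: field_simps)
qed

text \<open>
  Near a boundary point one partial derivative of the defining function \<open>\<rho>\<close> is bounded away from \<open>0\<close>.
  Points of the domain within distance \<open>s\<close> of its complement satisfy \<open>-Ms \<le> \<rho> < 0\<close>, and this slab is disjoint
  from its translates by multiples of \<open>2Ms/c\<close> along that axis because \<open>\<rho>\<close> grows at rate \<open>c\<close> there.
\<close>

lemma smooth_open_local_tube:
  assumes O: "smooth_open \<O>" and x: "x \<in> frontier \<O>"
  shows "\<exists>r>0. \<exists>C\<ge>0. \<forall>s. 0 < s \<and> s < r \<longrightarrow> (\<exists>E\<in>lmeasurable. measure lebesgue E \<le> C * s \<and>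
           (\<forall>y p. y \<in> \<O> \<and> y \<in> ball x (2 * r) \<and> p \<notin> \<O> \<and> dist y p \<le> s \<longrightarrow> y \<in> E))"
proof -
  obtain U \<rho> where U: "open U" "x \<in> U" "smooth_on U \<rho>" "\<And>y. y \<in> U \<Longrightarrow> grad \<rho> y \<noteq> 0" "\<O> \<inter> U = {y \<in> U. \<rho> y < 0}"
    using O x unfolding smooth_open_def by blast
  have "Ck_on (Suc 0) U \<rho>" using U(3) unfolding smooth_on_def by blast
  then obtain g :: "3 \<Rightarrow> real^3 \<Rightarrow> real" where g: "\<And>y. y \<in> U \<Longrightarrow> (\<rho> has_derivative (\<lambda>h. \<Sum>i\<in>UNIV. g i y * h $ i)) (at y)" "\<And>i. continuous_on U (g i)"
    by auto
  have "grad \<rho> x = (\<chi> i. g i x)"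
    using frechet_derivative_at[OF g(1)[OF U(2)], symmetric]
    by (simp add: grad_def vec_eq_iff axis_def if_distrib[of "\<lambda>z. _ * z"] cong: if_cong)
  then obtain i0 where i0: "g i0 x \<noteq> 0" using U(4)[OF U(2)] by (auto simp: vec_eq_iff)
  define \<sigma> where "\<sigma> = sgn (g i0 x)"
  define c where "c = \<bar>g i0 x\<bar> / 2"
  define M where "M = (\<Sum>i\<in>UNIV. \<bar>g i x\<bar> + 1)"
  have \<sigma>: "\<bar>\<sigma>\<bar> = 1" "\<sigma> * g i0 x = \<bar>g i0 x\<bar>" using i0 by (auto simp: \<sigma>_def sgn_if)
  have c: "c > 0" using i0 by (simp add: c_def)
  have M: "M > 0" unfolding M_def by (intro sum_pos) auto
  have "\<forall>\<^sub>F y in at x. \<bar>g i y - g i x\<bar> < min 1 c" for i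
  proof -
    have "isCont (g i) x" using g(2)[of i] U by (simp add: continuous_on_eq_continuous_at)
    then have "((\<lambda>y. g i y) \<longlongrightarrow> g i x) (at x)" by (simp add: isCont_def)
    from tendstoD[OF this, of "min 1 c"] show ?thesis using c by (simp add: dist_real_def)
  qed
  then have "\<forall>\<^sub>F y in at x. (\<forall>i. \<bar>g i y - g i x\<bar> < min 1 c) \<and> y \<in> U"
    using U by (intro eventually_conj eventually_all_finite eventually_at_in_open') auto
  then obtain d where d: "d > 0" "\<And>y. y \<noteq> x \<Longrightarrow> dist y x < d \<Longrightarrow> (\<forall>i. \<bar>g i y - g i x\<bar> < min 1 c) \<and> y \<in> U"
    unfolding eventually_at by auto
  have dx: "\<bar>g i y - g i x\<bar> < min 1 c" "y \<in> U" if "dist x y < d" for i y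
    using d(2)[of y] that c U(2) by (cases "y = x"; simp add: dist_commute)+
  define r where "r = d / 3"
  have r: "r > 0" "3 * r = d" using d by (auto simp: r_def)
  have gM: "\<bar>\<Sum>i\<in>UNIV. g i y * h $ i\<bar> \<le> norm h * M" if "y \<in> ball x d" for y h
  proof -
    have "\<bar>\<Sum>i\<in>UNIV. g i y * h $ i\<bar> \<le> (\<Sum>i\<in>UNIV. \<bar>g i y * h $ i\<bar>)" by (rule sum_abs)
    also have "\<dots> \<le> (\<Sum>i\<in>UNIV. (\<bar>g i x\<bar> + 1) * norm h)"
    proof (rule sum_mono)
      fix i
      have "\<bar>g i y\<bar> \<le> \<bar>g i x\<bar> + 1" using dx(1)[of y i] that by (auto simp: abs_le_iff)
      then show "\<bar>g i y * h $ i\<bar> \<le> (\<bar>g i x\<bar> + 1) * norm h"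
        unfolding abs_mult using component_le_norm_cart by (intro mult_mono) auto
    qed
    also have "\<dots> = norm h * M" by (simp add: M_def sum_distrib_left mult.commute)
    finally show ?thesis .
  qed
  have lip: "\<bar>\<rho> y - \<rho> p\<bar> \<le> M * dist y p" if "y \<in> ball x d" "p \<in> ball x d" for y p
  proof -
    have "norm (\<rho> y - \<rho> p) \<le> M * norm (y - p)"
    proof (rule differentiable_bound[of "ball x d" \<rho> "\<lambda>y h. \<Sum>i\<in>UNIV. g i y * h $ i"])
      show "(\<rho> has_derivative (\<lambda>h. \<Sum>i\<in>UNIV. g i z * h $ i)) (at z within ball x d)" if "z \<in> ball x d" for z
        using g(1)[of z] dx(2)[of z] that by (auto intro: has_derivative_at_withinI)
      show "onorm (\<lambda>h. \<Sum>i\<in>UNIV. g i z * h $ i) \<le> M" if "z \<in> ball x d" for z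
        by (rule onorm_le) (use gM[OF that] in \<open>auto simp: mult.commute\<close>)
    qed (use that in auto)
    then show ?thesis by (simp add: dist_norm)
  qed
  \<comment> \<open>The direction of the chosen axis in which \<open>\<rho>\<close> increases.\<close>
  define v :: "real^3" where "v = \<sigma> *\<^sub>R axis i0 1"
  have v: "norm v = 1" using \<sigma> by (simp add: v_def norm_axis_1)
  have incr: "\<rho> y + c * \<tau> \<le> \<rho> (y + \<tau> *\<^sub>R v)" if "y \<in> ball x d" "y + \<tau> *\<^sub>R v \<in> ball x d" "0 \<le> \<tau>" for y \<tau>
  proof -
    let ?q = "\<lambda>t. \<rho> (y + t *\<^sub>R v) - c * t"
    have seg: "y + t *\<^sub>R v \<in> ball x d" if "0 \<le> t" "t \<le> \<tau>" for t
    proof (cases "\<tau> = 0")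
      case False
      have "(1 - t/\<tau>) *\<^sub>R y + (t/\<tau>) *\<^sub>R (y + \<tau> *\<^sub>R v) \<in> ball x d"
        by (rule convexD[OF convex_ball]) (use that \<open>y \<in> ball x d\<close> \<open>y + \<tau> *\<^sub>R v \<in> ball x d\<close> False in \<open>auto simp: field_simps\<close>)
      then show ?thesis using False by (simp add: algebra_simps)
    qed (use that \<open>y \<in> ball x d\<close> in auto)
    have "?q 0 \<le> ?q \<tau>"
    proof (rule DERIV_nonneg_imp_nondecreasing[OF that(3)])
      fix t assume t: "0 \<le> t" "t \<le> \<tau>"
      let ?y = "y + t *\<^sub>R v"
      have b: "?y \<in> ball x d" by (rule seg[OF t])
      have U': "?y \<in> U" using dx(2)[of ?y] b by simp
      have "((\<lambda>t. \<rho> (y + t *\<^sub>R v)) has_derivative (\<lambda>h. \<Sum>i\<in>UNIV. g i ?y * (h *\<^sub>R v) $ i)) (at t)"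
        by (rule has_derivative_compose[where g=\<rho> and f="\<lambda>t. y + t *\<^sub>R v", OF _ g(1)[OF U']]) (auto intro!: derivative_eq_intros)
      moreover have "(\<Sum>i\<in>UNIV. g i ?y * (h *\<^sub>R v) $ i) = \<sigma> * g i0 ?y * h" for h
      proof -
        have "(\<Sum>i\<in>UNIV. g i ?y * (h *\<^sub>R v) $ i) = (\<Sum>i\<in>UNIV. if i = i0 then \<sigma> * g i0 ?y * h else 0)"
          by (intro sum.cong) (auto simp: v_def axis_def)
        then show ?thesis by simp
      qed
      ultimately have "((\<lambda>t. \<rho> (y + t *\<^sub>R v)) has_real_derivative \<sigma> * g i0 ?y) (at t)"
        by (simp add: has_field_derivative_def)
      then have D: "(?q has_real_derivative \<sigma> * g i0 ?y - c) (at t)"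
        by (auto intro!: derivative_eq_intros)
      have "\<bar>\<sigma> * g i0 ?y - \<sigma> * g i0 x\<bar> < c"
        using dx(1)[of ?y i0] b \<sigma>(1) by (simp add: right_diff_distrib[symmetric] abs_mult)
      then have "0 \<le> \<sigma> * g i0 ?y - c" using \<sigma>(2) unfolding c_def by linarith
      with D show "\<exists>D. (?q has_real_derivative D) (at t) \<and> 0 \<le> D" by blast
    qed
    then show ?thesis by simp
  qed
  let ?V = "measure lebesgue (ball x (2 * r + 1))"
  show ?thesis
  proof (intro exI conjI allI impI)
    show "r > 0" by fact
    show "0 \<le> ?V * (2 * M / c)" using M c by simp
    fix s assume s: "0 < s \<and> s < r"
    let ?E = "{y \<in> ball x (2 * r). - (M * s) \<le> \<rho> y \<and> \<rho> y < 0}"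
    have bb: "ball x (2 * r) \<subseteq> ball x d" using r by auto
    have cont: "continuous_on (ball x (2 * r)) \<rho>"
      by (rule continuous_at_imp_continuous_on) (use g(1) dx(2) bb in \<open>force intro: has_derivative_continuous\<close>)
    have "?E = (ball x (2 * r) \<inter> \<rho> -` {..<0}) - (ball x (2 * r) \<inter> \<rho> -` {..< - (M * s)})" by auto
    moreover have "(ball x (2 * r) \<inter> \<rho> -` {..<0}) \<in> lmeasurable" "(ball x (2 * r) \<inter> \<rho> -` {..< - (M * s)}) \<in> lmeasurable"
      by (intro bounded_set_imp_lmeasurable; use continuous_open_preimage[OF cont] in \<open>auto intro: bounded_subset[OF bounded_ball] borel_open simp: lmeasurable_ball\<close>)+
    ultimately have Em: "?E \<in> lmeasurable" by (simp add: fmeasurable.Diff)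
    have "measure lebesgue ?E \<le> ?V * (2 * M * s / c)"
    proof (rule disjoint_translates_measure[OF Em _ v])
      show "0 < 2 * M * s / c" using M c s by simp
      fix y and j :: nat assume y: "y \<in> ?E" and y': "y + (real j * (2 * M * s / c)) *\<^sub>R v \<in> ?E"
      have "\<rho> y + c * (real j * (2 * M * s / c)) \<le> \<rho> (y + (real j * (2 * M * s / c)) *\<^sub>R v)"
        using y y' bb M c s by (intro incr) auto
      then have "c * (real j * (2 * M * s / c)) < M * s" using y y' by auto
      then have "real j * 2 * (M * s) < 1 * (M * s)" using c by (simp add: field_simps)
      then have "real j * 2 < 1" using M s by (simp add: mult_less_cancel_right)
      then show "j = 0" by (cases j) auto
    qed auto
    then have ms: "measure lebesgue ?E \<le> ?V * (2 * M / c) * s" by simp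
    have "y \<in> ?E" if "y \<in> \<O> \<and> y \<in> ball x (2 * r) \<and> p \<notin> \<O> \<and> dist y p \<le> s" for y p
    proof -
      have yU: "y \<in> U" using dx(2)[of y] that bb by auto
      have "dist x p \<le> dist x y + dist y p" by (rule dist_triangle)
      also have "\<dots> < d" using that s r by auto
      finally have p: "p \<in> ball x d" by simp
      have "\<rho> y < 0" using that yU U(5) by blast
      moreover have "\<rho> p \<ge> 0" using dx(2)[of p] p that U(5) by force
      moreover have "\<bar>\<rho> y - \<rho> p\<bar> \<le> M * s"
      proof -
        have "\<bar>\<rho> y - \<rho> p\<bar> \<le> M * dist y p" using lip[of y p] that bb p by blast
        also have "\<dots> \<le> M * s" using that M by (intro mult_left_mono) auto
        finally show ?thesis .
      qed
      ultimately show ?thesis using that by auto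
    qed
    then show "\<exists>E\<in>lmeasurable. measure lebesgue E \<le> ?V * (2 * M / c) * s \<and>
           (\<forall>y p. y \<in> \<O> \<and> y \<in> ball x (2 * r) \<and> p \<notin> \<O> \<and> dist y p \<le> s \<longrightarrow> y \<in> E)"
      by (intro bexI[OF _ Em] conjI ms) blast
  qed
qed

definition inner_tube :: "(real^3) set \<Rightarrow> real \<Rightarrow> (real^3) set" where
  "inner_tube \<O> s = {y \<in> \<O>. \<exists>p. p \<notin> \<O> \<and> dist y p \<le> s}"

lemma inner_tube_borel:
  assumes "open \<O>"
  shows "inner_tube \<O> s \<in> sets borel"
proof -
  have "inner_tube \<O> s = \<O> \<inter> (\<Union>x\<in>- \<O>. \<Union>y\<in>cball 0 s. {x + y})"
  proof (intro set_eqI iffI)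
    fix y assume "y \<in> inner_tube \<O> s"
    then obtain p where p: "y \<in> \<O>" "p \<in> - \<O>" "dist y p \<le> s" by (auto simp: inner_tube_def)
    then have "y - p \<in> cball 0 s" "y \<in> {p + (y - p)}" by (auto simp: dist_norm norm_minus_commute)
    with p show "y \<in> \<O> \<inter> (\<Union>x\<in>- \<O>. \<Union>y\<in>cball 0 s. {x + y})" by blast
  qed (auto simp: inner_tube_def dist_norm norm_minus_commute)
  moreover have "closed (\<Union>x\<in>- \<O>. \<Union>y\<in>cball 0 s. {x + y})"
    by (rule closed_compact_sums) (use assms in auto)
  ultimately show ?thesis using assms by auto
qed

text \<open>
  Finitely many of the local estimates cover the compact boundary; for large \<open>s\<close> the volume
  of the whole domain is a sufficient bound.
\<close>

theorem inner_tube_measure: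
  assumes O: "smooth_open \<O>" and b: "bounded \<O>"
  obtains C where "0 \<le> C" "\<And>s. 0 < s \<Longrightarrow> measure lborel (inner_tube \<O> s) \<le> C * s"
proof -
  have op: "open \<O>" using O by (simp add: smooth_open_def)
  have Om: "\<O> \<in> lmeasurable" using b op by (intro bounded_set_imp_lmeasurable) auto
  have eqm: "measure lborel (inner_tube \<O> s) = measure lebesgue (inner_tube \<O> s)" for s
    using inner_tube_borel[OF op] by (simp add: measure_completion)
  obtain r C where rC: "\<And>x. x \<in> frontier \<O> \<Longrightarrow> r x > 0" "\<And>x. x \<in> frontier \<O> \<Longrightarrow> C x \<ge> 0"
    "\<And>x s. x \<in> frontier \<O> \<Longrightarrow> 0 < s \<Longrightarrow> s < r x \<Longrightarrow> (\<exists>E\<in>lmeasurable. measure lebesgue E \<le> C x * s \<and>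
           (\<forall>y p. y \<in> \<O> \<and> y \<in> ball x (2 * r x) \<and> p \<notin> \<O> \<and> dist y p \<le> s \<longrightarrow> y \<in> E))"
  proof -
    have "\<forall>x\<in>frontier \<O>. \<exists>r C. 0 < r \<and> 0 \<le> C \<and> (\<forall>s. 0 < s \<and> s < r \<longrightarrow> (\<exists>E\<in>lmeasurable. measure lebesgue E \<le> C * s \<and>
           (\<forall>y p. y \<in> \<O> \<and> y \<in> ball x (2 * r) \<and> p \<notin> \<O> \<and> dist y p \<le> s \<longrightarrow> y \<in> E)))"
      using smooth_open_local_tube[OF O] by blast
    then obtain r where "\<forall>x\<in>frontier \<O>. \<exists>C. 0 < r x \<and> 0 \<le> C \<and> (\<forall>s. 0 < s \<and> s < r x \<longrightarrow> (\<exists>E\<in>lmeasurable. measure lebesgue E \<le> C * s \<and>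
           (\<forall>y p. y \<in> \<O> \<and> y \<in> ball x (2 * r x) \<and> p \<notin> \<O> \<and> dist y p \<le> s \<longrightarrow> y \<in> E)))"
      by (rule bchoice[THEN exE])
    then obtain C where "\<forall>x\<in>frontier \<O>. 0 < r x \<and> 0 \<le> C x \<and> (\<forall>s. 0 < s \<and> s < r x \<longrightarrow> (\<exists>E\<in>lmeasurable. measure lebesgue E \<le> C x * s \<and>
           (\<forall>y p. y \<in> \<O> \<and> y \<in> ball x (2 * r x) \<and> p \<notin> \<O> \<and> dist y p \<le> s \<longrightarrow> y \<in> E)))"
      by (rule bchoice[THEN exE])
    then show ?thesis by (intro that[of r C]) auto
  qed
  have "frontier \<O> \<subseteq> (\<Union>x\<in>frontier \<O>. ball x (r x))" using rC(1) by force
  then obtain D where D: "D \<subseteq> frontier \<O>" "finite D" "frontier \<O> \<subseteq> (\<Union>x\<in>D. ball x (r x))"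
    by (rule compactE_image[OF compact_frontier_bounded[OF b], rotated 1]) auto
  define s0 where "s0 = Min (insert 1 (r ` D))"
  have s0: "s0 > 0" "\<And>x. x \<in> D \<Longrightarrow> s0 \<le> r x"
    using D rC(1) by (auto simp: s0_def)
  define C0 where "C0 = (\<Sum>x\<in>D. C x)"
  have C0: "C0 \<ge> 0" unfolding C0_def using D rC(2) by (intro sum_nonneg) auto
  have small: "measure lebesgue (inner_tube \<O> s) \<le> C0 * s" if s: "0 < s" "s < s0" for s
  proof -
    have "\<exists>E. E \<in> lmeasurable \<and> measure lebesgue E \<le> C x * s \<and>
           (\<forall>y p. y \<in> \<O> \<and> y \<in> ball x (2 * r x) \<and> p \<notin> \<O> \<and> dist y p \<le> s \<longrightarrow> y \<in> E)" if "x \<in> D" for x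
    proof -
      have "x \<in> frontier \<O>" "s < r x" using D(1) s s0(2)[OF that] that by auto
      from rC(3)[OF this(1) s(1) this(2)] show ?thesis by blast
    qed
    then have "\<forall>x\<in>D. \<exists>E. E \<in> lmeasurable \<and> measure lebesgue E \<le> C x * s \<and>
           (\<forall>y p. y \<in> \<O> \<and> y \<in> ball x (2 * r x) \<and> p \<notin> \<O> \<and> dist y p \<le> s \<longrightarrow> y \<in> E)" by blast
    from bchoice[OF this] obtain E where E': "\<forall>x\<in>D. E x \<in> lmeasurable \<and> measure lebesgue (E x) \<le> C x * s \<and>
           (\<forall>y p. y \<in> \<O> \<and> y \<in> ball x (2 * r x) \<and> p \<notin> \<O> \<and> dist y p \<le> s \<longrightarrow> y \<in> E x)" ..
    then have E: "\<And>x. x \<in> D \<Longrightarrow> E x \<in> lmeasurable" "\<And>x. x \<in> D \<Longrightarrow> measure lebesgue (E x) \<le> C x * s"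
       "\<And>x y p. x \<in> D \<Longrightarrow> y \<in> \<O> \<Longrightarrow> y \<in> ball x (2 * r x) \<Longrightarrow> p \<notin> \<O> \<Longrightarrow> dist y p \<le> s \<Longrightarrow> y \<in> E x"
      by blast+
    have "inner_tube \<O> s \<subseteq> (\<Union>x\<in>D. E x)"
    proof
      fix y assume "y \<in> inner_tube \<O> s"
      then obtain p where y: "y \<in> \<O>" "p \<notin> \<O>" "dist y p \<le> s" by (auto simp: inner_tube_def)
      \<comment> \<open>The segment to the complement meets the boundary, at a point covered by one of the chosen balls.\<close>
      have "closed_segment y p \<inter> frontier \<O> \<noteq> {}"
        by (rule connected_Int_frontier) (use y in auto)
      then obtain q where q: "q \<in> closed_segment y p" "q \<in> frontier \<O>" by auto
      then obtain x where x: "x \<in> D" "q \<in> ball x (r x)" using D(3) by auto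
      have "dist y q \<le> dist y p" using q(1) by (metis dist_in_closed_segment dist_commute)
      then have "dist y q < r x" using y s s0(2)[OF x(1)] by simp
      moreover have "dist x y \<le> dist x q + dist y q" using dist_triangle[of x y q] by (simp add: dist_commute)
      ultimately have "y \<in> ball x (2 * r x)" using x(2) by simp
      then show "y \<in> (\<Union>x\<in>D. E x)" using E(3)[OF x(1)] y x(1) by blast
    qed
    moreover have Em: "(\<Union>x\<in>D. E x) \<in> lmeasurable" using D(2) E(1) by (intro fmeasurable.finite_UN) auto
    ultimately have "measure lebesgue (inner_tube \<O> s) \<le> measure lebesgue (\<Union>x\<in>D. E x)"
      using inner_tube_borel[OF op] by (intro measure_mono_fmeasurable) auto
    also have "\<dots> \<le> (\<Sum>x\<in>D. measure lebesgue (E x))"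
      using D(2) E(1) by (intro measure_UNION_le) auto
    also have "\<dots> \<le> (\<Sum>x\<in>D. C x * s)" by (intro sum_mono E(2))
    finally show ?thesis by (simp add: C0_def sum_distrib_right)
  qed
  show ?thesis
  proof (rule that)
    show "0 \<le> C0 + measure lebesgue \<O> / s0" using C0 s0 by simp
    fix s :: real assume s: "0 < s"
    show "measure lborel (inner_tube \<O> s) \<le> (C0 + measure lebesgue \<O> / s0) * s"
    proof (cases "s < s0")
      case True
      have "C0 * s \<le> (C0 + measure lebesgue \<O> / s0) * s" using s0 s by (intro mult_right_mono) auto
      then show ?thesis using small[OF s True] eqm by simp
    next
      case False
      have "measure lebesgue (inner_tube \<O> s) \<le> measure lebesgue \<O>"
        using inner_tube_borel[OF op] Om by (intro measure_mono_fmeasurable) (auto simp: inner_tube_def)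
      also have "\<dots> \<le> measure lebesgue \<O> / s0 * s"
        using False s0 mult_left_mono[of s0 s "measure lebesgue \<O>"] by (simp add: field_simps)
      also have "\<dots> \<le> (C0 + measure lebesgue \<O> / s0) * s" using C0 s by (intro mult_right_mono) auto
      finally show ?thesis using eqm by simp
    qed
  qed
qed

section \<open>The kernel as a superposition of Gaussians\<close>

lemma quad_inner: "quad S z = z \<bullet> (S *v z)"
  by (simp add: inner_vec_def outer_def matrix_vector_mult_def sum_distrib_left mult_ac)

lemma sym_matrix_inner:
  assumes "transpose S = (S :: real^'n^'n)"
  shows "x \<bullet> (S *v y) = (S *v x) \<bullet> y"
  using dot_lmul_matrix[of x S y] vector_transpose_matrix[of x S] assms by (simp add: transpose_matrix_vector[symmetric])

lemma quad_has_derivative: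
  assumes S: "transpose S = S"
  shows "(quad S has_derivative (\<lambda>h. 2 * ((S *v x) \<bullet> h))) (at x)"
proof -
  have "((\<lambda>z. z \<bullet> (S *v z)) has_derivative (\<lambda>h. x \<bullet> (S *v h) + h \<bullet> (S *v x))) (at x)"
    by (auto intro!: derivative_eq_intros bounded_linear.has_derivative[OF matrix_vector_mul_bounded_linear])
  moreover have "x \<bullet> (S *v h) + h \<bullet> (S *v x) = 2 * ((S *v x) \<bullet> h)" for h
    using sym_matrix_inner[OF S, of x h] by (simp add: inner_commute)
  ultimately show ?thesis by (simp add: quad_inner[abs_def])
qed

text \<open>
  The term \<open>|x|\<^bsup>-5\<^esup> (S:xx) tr S\<close> of the contraction vanishes.
\<close>

lemma g_S_formula:
  assumes S: "transpose S = S" "trace S = 0" and x: "x \<noteq> 0"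
  shows "g_S S x = 5 * (quad S x)\<^sup>2 / norm x ^ 7 - 2 * (norm (S *v x))\<^sup>2 / norm x ^ 5"
proof -
  let ?n = "norm x"
  define \<alpha> where "\<alpha> = (\<lambda>h. 2 * ((S *v x) \<bullet> h) / ?n ^ 5 - 5 * quad S x * (x \<bullet> h) / ?n ^ 7)"
  define \<beta> where "\<beta> = quad S x / ?n ^ 5"
  have n: "?n > 0" using x by simp
  have d5: "((\<lambda>z. norm z ^ 5) has_derivative (\<lambda>h. 5 * ?n ^ 3 * (x \<bullet> h))) (at x)"
    by (rule has_derivative_eq_rhs, rule has_derivative_power, rule has_derivative_norm[OF x])
      (use x in \<open>auto simp: fun_eq_iff sgn_div_norm inner_commute power_numeral_reduce\<close>)
  have dq: "((\<lambda>z. quad S z / norm z ^ 5) has_derivative \<alpha>) (at x)"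
    by (rule has_derivative_eq_rhs, rule has_derivative_divide[OF quad_has_derivative[OF S(1)] d5])
      (use n in \<open>auto simp: fun_eq_iff \<alpha>_def divide_simps power_numeral_reduce\<close>)
  have D: "(v_S S has_derivative (\<lambda>h. \<beta> *\<^sub>R h + \<alpha> h *\<^sub>R x)) (at x)"
    unfolding v_S_def[abs_def]
    by (rule has_derivative_eq_rhs, rule has_derivative_scaleR[OF dq has_derivative_ident]) (simp add: \<beta>_def)
  define J where "J = matrix (frechet_derivative (v_S S) (at x))"
  have J: "J $ i $ j = \<beta> * (if i = j then 1 else 0) + \<alpha> (axis j 1) * x $ i" for i j
    unfolding J_def frechet_derivative_at[OF D, symmetric] by (simp add: matrix_def axis_def)
  have S': "S $ i $ j = S $ j $ i" for i j by (rule transpose_eq_nth[OF S(1)])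
  have "sym_grad (v_S S) x \<bullet> S = J \<bullet> S"
  proof -
    have "transpose J \<bullet> S = J \<bullet> S"
      using S' by (simp add: inner_vec_def transpose_def sum_3)
    then show ?thesis by (simp add: sym_grad_def J_def[symmetric] Let_def inner_add_left inner_diff_left algebra_simps)
  qed
  also have "\<dots> = (\<Sum>i\<in>UNIV. \<Sum>j\<in>UNIV. \<beta> * (if i = j then 1 else 0) * S $ i $ j + \<alpha> (axis j 1) * x $ i * S $ i $ j)"
    by (simp add: inner_vec_def J algebra_simps)
  also have "\<dots> = \<beta> * trace S + (\<Sum>j\<in>UNIV. \<alpha> (axis j 1) * (S *v x) $ j)"
    using S' by (simp add: trace_def matrix_vector_mult_def sum_3 algebra_simps)
  also have "(\<Sum>j\<in>UNIV. \<alpha> (axis j 1) * (S *v x) $ j) = \<alpha> (S *v x)"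
  proof -
    define c1 c2 where "c1 = 2 / ?n ^ 5" and "c2 = 5 * quad S x / ?n ^ 7"
    have "\<alpha> h = c1 * ((S *v x) \<bullet> h) - c2 * (x \<bullet> h)" for h by (simp add: \<alpha>_def c1_def c2_def)
    then show ?thesis by (simp add: inner_axis) (simp add: inner_vec_def sum_3 algebra_simps)
  qed
  also have "\<alpha> (S *v x) = 2 * (norm (S *v x))\<^sup>2 / ?n ^ 5 - 5 * (quad S x)\<^sup>2 / ?n ^ 7"
    by (simp add: \<alpha>_def quad_inner power2_norm_eq_inner) (simp add: power2_eq_square)
  finally show ?thesis using S(2) by (simp add: g_S_def)
qed

lemma gamma_scaled_integral:
  fixes x b :: real
  assumes x: "x > 0" and b: "b > 0"
  shows "set_integrable lborel {0<..} (\<lambda>t. t powr (x - 1) * exp (- (b * t)))"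
    and "(LINT t:{0<..}|lborel. t powr (x - 1) * exp (- (b * t))) = Gamma x / b powr x"
proof -
  let ?g = "\<lambda>t. indicator {0<..} t * (t powr (x - 1) * exp (- t))"
  let ?f = "\<lambda>t. indicator {0<..} t * (t powr (x - 1) * exp (- (b * t)))"
  have nn: "(\<integral>\<^sup>+t. ennreal (?g t) \<partial>lborel) = ennreal (Gamma x)"
    unfolding Gamma_conv_nn_integral_real[OF x]
    by (intro nn_integral_cong) (auto simp: indicator_def exp_minus divide_inverse)
  have g: "integrable lborel ?g" "integral\<^sup>L lborel ?g = Gamma x"
  proof -
    show "integrable lborel ?g"
      by (rule integrableI_nn_integral_finite[OF _ _ nn]) (auto simp: indicator_def)
    show "integral\<^sup>L lborel ?g = Gamma x"
      by (rule integral_eq_nn_integral[THEN trans]) (use nn x in \<open>auto simp: indicator_def Gamma_real_nonneg\<close>)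
  qed
  have eq: "?f (0 + (1/b) * s) = 1 / b powr (x - 1) * ?g s" for s
    using b by (auto simp: indicator_def powr_divide zero_less_divide_iff)
  have "integrable lborel (\<lambda>s. ?f (0 + (1/b) * s))" unfolding eq by (intro integrable_mult_right g)
  then have "integrable lborel ?f"
    by (subst (asm) lborel_integrable_real_affine_iff) (use b in auto)
  then show "set_integrable lborel {0<..} (\<lambda>t. t powr (x - 1) * exp (- (b * t)))"
    by (simp add: set_integrable_def)
  have "integral\<^sup>L lborel ?f = (1/b) * (\<integral>s. ?f (0 + (1/b) * s) \<partial>lborel)"
    by (subst lborel_integral_real_affine[of "1/b" _ 0]) (use b in auto)
  also have "\<dots> = (1/b) * (1 / b powr (x - 1) * Gamma x)" unfolding eq integral_mult_right_zero g by simp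
  also have "\<dots> = Gamma x / b powr x" using b by (simp add: powr_diff)
  finally show "(LINT t:{0<..}|lborel. t powr (x - 1) * exp (- (b * t))) = Gamma x / b powr x"
    by (simp add: set_lebesgue_integral_def)
qed

lemma not_nonpos_Ints_pos: "(x::real) > 0 \<Longrightarrow> x \<notin> \<int>\<^sub>\<le>\<^sub>0"
  by (auto dest: nonpos_Ints_nonpos)

lemma Gamma_five_halves: "Gamma (5/2 :: real) = 3 * sqrt pi / 4"
  using Gamma_plus1[of "1/2::real"] Gamma_plus1[of "3/2::real"] Gamma_one_half_real by (simp add: not_nonpos_Ints_pos)

lemma Gamma_seven_halves: "Gamma (7/2 :: real) = 15 * sqrt pi / 8"
  using Gamma_plus1[of "5/2::real"] Gamma_five_halves by (simp add: not_nonpos_Ints_pos)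

lemma power_gauss_time_integral:
  fixes r :: real
  assumes r: "r > 0"
  shows "set_integrable lborel {0<..} (\<lambda>t. t * sqrt t * exp (- (pi * t * r\<^sup>2)))"
    and "(LINT t:{0<..}|lborel. t * sqrt t * exp (- (pi * t * r\<^sup>2))) = 3 / (4 * pi\<^sup>2 * r ^ 5)"
    and "set_integrable lborel {0<..} (\<lambda>t. t\<^sup>2 * sqrt t * exp (- (pi * t * r\<^sup>2)))"
    and "(LINT t:{0<..}|lborel. t\<^sup>2 * sqrt t * exp (- (pi * t * r\<^sup>2))) = 15 / (8 * pi ^ 3 * r ^ 7)"
proof -
  have b: "pi * r\<^sup>2 > 0" using r by simp
  have e1: "t powr (5/2 - 1) * exp (- (pi * r\<^sup>2 * t)) = t * sqrt t * exp (- (pi * t * r\<^sup>2))" if "t \<in> {0<..}" for t :: real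
  proof -
    have "t powr (5/2 - 1) = t powr (1 + 1/2)" by simp
    also have "\<dots> = t * sqrt t" using that by (subst powr_add) (auto simp: powr_half_sqrt)
    finally show ?thesis by (simp add: mult_ac)
  qed
  have e2: "t powr (7/2 - 1) * exp (- (pi * r\<^sup>2 * t)) = t\<^sup>2 * sqrt t * exp (- (pi * t * r\<^sup>2))" if "t \<in> {0<..}" for t :: real
  proof -
    have "t powr (7/2 - 1) = t powr (2 + 1/2)" by simp
    also have "\<dots> = t\<^sup>2 * sqrt t" using that by (subst powr_add) (auto simp: powr_half_sqrt powr_numeral)
    finally show ?thesis by (simp add: mult_ac)
  qed
  have p1: "(pi * r\<^sup>2) powr (5/2) = pi\<^sup>2 * sqrt pi * r ^ 5"
  proof -
    have "(pi * r\<^sup>2) powr (5/2) = (pi * r\<^sup>2) powr (2 + 1/2)" by simp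
    also have "\<dots> = (pi * r\<^sup>2)\<^sup>2 * sqrt (pi * r\<^sup>2)" using b by (subst powr_add) (auto simp: powr_half_sqrt powr_numeral)
    also have "\<dots> = pi\<^sup>2 * sqrt pi * r ^ 5" using r by (simp add: real_sqrt_mult power_mult_distrib power_numeral_reduce)
    finally show ?thesis .
  qed
  have p2: "(pi * r\<^sup>2) powr (7/2) = pi ^ 3 * sqrt pi * r ^ 7"
  proof -
    have "(pi * r\<^sup>2) powr (7/2) = (pi * r\<^sup>2) powr (3 + 1/2)" by simp
    also have "\<dots> = (pi * r\<^sup>2) ^ 3 * sqrt (pi * r\<^sup>2)" using b by (subst powr_add) (auto simp: powr_half_sqrt powr_numeral)
    also have "\<dots> = pi ^ 3 * sqrt pi * r ^ 7" using r by (simp add: real_sqrt_mult power_mult_distrib power_numeral_reduce)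
    finally show ?thesis .
  qed
  have h: "(0::real) < 5/2" "(0::real) < 7/2" by auto
  show "set_integrable lborel {0<..} (\<lambda>t. t * sqrt t * exp (- (pi * t * r\<^sup>2)))"
    by (rule set_integrable_cong[THEN iffD1, OF refl refl e1 gamma_scaled_integral(1)[OF h(1) b]])
  show "set_integrable lborel {0<..} (\<lambda>t. t\<^sup>2 * sqrt t * exp (- (pi * t * r\<^sup>2)))"
    by (rule set_integrable_cong[THEN iffD1, OF refl refl e2 gamma_scaled_integral(1)[OF h(2) b]])
  have "(LINT t:{0<..}|lborel. t * sqrt t * exp (- (pi * t * r\<^sup>2))) = (LINT t:{0<..}|lborel. t powr (5/2 - 1) * exp (- (pi * r\<^sup>2 * t)))"
    by (rule set_lebesgue_integral_cong, simp, intro allI impI, rule e1[symmetric])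
  also have "\<dots> = 3 / (4 * pi\<^sup>2 * r ^ 5)" unfolding gamma_scaled_integral(2)[OF h(1) b] Gamma_five_halves p1 by simp
  finally show "(LINT t:{0<..}|lborel. t * sqrt t * exp (- (pi * t * r\<^sup>2))) = 3 / (4 * pi\<^sup>2 * r ^ 5)" .
  have "(LINT t:{0<..}|lborel. t\<^sup>2 * sqrt t * exp (- (pi * t * r\<^sup>2))) = (LINT t:{0<..}|lborel. t powr (7/2 - 1) * exp (- (pi * r\<^sup>2 * t)))"
    by (rule set_lebesgue_integral_cong, simp, intro allI impI, rule e2[symmetric])
  also have "\<dots> = 15 / (8 * pi ^ 3 * r ^ 7)" unfolding gamma_scaled_integral(2)[OF h(2) b] Gamma_seven_halves p2 by simp
  finally show "(LINT t:{0<..}|lborel. t\<^sup>2 * sqrt t * exp (- (pi * t * r\<^sup>2))) = 15 / (8 * pi ^ 3 * r ^ 7)" .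
qed

text \<open>
  Both terms of the classical formula are Gamma integrals of Gaussians in \<open>|z|\<close>, with arguments
  \<open>5/2\<close> and \<open>7/2\<close>.
\<close>

lemma g_S_time_integral:
  assumes S: "transpose S = S" "trace S = 0" and z: "z \<noteq> 0"
  shows "set_integrable lborel {0<..} (\<lambda>t. stresslet_gauss S t z)"
    and "(LINT t:{0<..}|lborel. stresslet_gauss S t z) = g_S S z"
proof -
  have n: "norm z > 0" using z by simp
  note G = power_gauss_time_integral[OF n]
  have eq: "stresslet_gauss S t z = 8 * pi ^ 3 / 3 * (quad S z)\<^sup>2 * (t\<^sup>2 * sqrt t * exp (- (pi * t * (norm z)\<^sup>2)))
     - 8 * pi\<^sup>2 / 3 * (norm (S *v z))\<^sup>2 * (t * sqrt t * exp (- (pi * t * (norm z)\<^sup>2)))" for t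
    by (simp add: stresslet_gauss_def field_simps power2_eq_square power3_eq_cube)
  show "set_integrable lborel {0<..} (\<lambda>t. stresslet_gauss S t z)"
    unfolding eq by (intro set_integral_diff set_integrable_mult_right G)
  have "(LINT t:{0<..}|lborel. stresslet_gauss S t z) = 8 * pi ^ 3 / 3 * (quad S z)\<^sup>2 * (15 / (8 * pi ^ 3 * norm z ^ 7))
     - 8 * pi\<^sup>2 / 3 * (norm (S *v z))\<^sup>2 * (3 / (4 * pi\<^sup>2 * norm z ^ 5))"
    unfolding eq by (subst set_integral_diff(2)) (auto intro: set_integrable_mult_right G(1,3) simp: G(2,4) simp del: times_divide_eq_left times_divide_eq_right)
  also have "\<dots> = g_S S z" unfolding g_S_formula[OF S z] by (simp add: field_simps)
  finally show "(LINT t:{0<..}|lborel. stresslet_gauss S t z) = g_S S z" .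
qed

lemma matrix_bound:
  obtains B where "0 \<le> B" "\<And>z. norm (S *v z) \<le> B * norm (z :: real^3)" "\<And>z. \<bar>quad S z\<bar> \<le> B * (norm z)\<^sup>2"
proof -
  obtain B where B: "0 < B" "\<And>z. norm (S *v z) \<le> norm z * B"
    using bounded_linear.pos_bounded[OF matrix_vector_mul_bounded_linear[of S]] by blast
  show ?thesis
  proof (rule that[of B])
    fix z
    have "\<bar>quad S z\<bar> \<le> norm z * norm (S *v z)" unfolding quad_inner by (rule Cauchy_Schwarz_ineq2)
    also have "\<dots> \<le> norm z * (norm z * B)" by (intro mult_left_mono B) auto
    finally show "\<bar>quad S z\<bar> \<le> B * (norm z)\<^sup>2" by (simp add: power2_eq_square mult_ac)
  qed (use B in \<open>auto simp: mult.commute\<close>)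
qed

text \<open>
  Powers of \<open>t|z|\<^sup>2\<close> are absorbed by the exponential, for which \<open>\<pi> > 3\<close> leaves room. A factor \<open>|z|\<close> is
  worth \<open>t\<^bsup>-1/2\<^esup>\<close>; it will be supplied by the regularity of the boundary.
\<close>

lemma stresslet_gauss_bound:
  obtains C where "0 \<le> C" "\<And>t z. 0 < t \<Longrightarrow> \<bar>stresslet_gauss S t z\<bar> \<le> C * sqrt t * exp (- (2 * t * (norm z)\<^sup>2))"
    "\<And>t z. 0 < t \<Longrightarrow> norm z * \<bar>stresslet_gauss S t z\<bar> \<le> C * exp (- (t * (norm z)\<^sup>2))"
proof -
  obtain B where B: "0 \<le> B" "\<And>z. norm (S *v z) \<le> B * norm (z :: real^3)" "\<And>z. \<bar>quad S z\<bar> \<le> B * (norm z)\<^sup>2"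
    using matrix_bound by blast
  define C where "C = 4 * pi\<^sup>2 / 3 * B\<^sup>2 * (4 * pi + 2)"
  have C: "0 \<le> C" by (simp add: C_def)
  have 1: "\<bar>stresslet_gauss S t z\<bar> \<le> C * sqrt t * exp (- (2 * t * (norm z)\<^sup>2))" if t: "0 < t" for t z
  proof -
    define y where "y = t * (norm z)\<^sup>2"
    have y: "0 \<le> y" using t by (simp add: y_def)
    have y2: "y\<^sup>2 \<le> 2 * exp y" using power_le_fact_exp[OF y, of 1 2] by simp
    have y1: "y \<le> exp y" using exp_ge_add_one_self[of y] by linarith
    have q: "(quad S z)\<^sup>2 \<le> (B * (norm z)\<^sup>2)\<^sup>2" using power_mono[OF B(3)[of z], of 2] by simp
    have n: "(norm (S *v z))\<^sup>2 \<le> (B * norm z)\<^sup>2" using power_mono[OF B(2)[of z], of 2] by simp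
    have "\<bar>2 * pi * t * (quad S z)\<^sup>2 - 2 * (norm (S *v z))\<^sup>2\<bar> \<le> 2 * pi * t * (quad S z)\<^sup>2 + 2 * (norm (S *v z))\<^sup>2"
      using t by (intro order_trans[OF abs_triangle_ineq4]) auto
    also have "\<dots> \<le> 2 * pi * t * (B * (norm z)\<^sup>2)\<^sup>2 + 2 * (B * norm z)\<^sup>2"
      using q n t by (intro add_mono mult_left_mono) auto
    finally have "t * \<bar>2 * pi * t * (quad S z)\<^sup>2 - 2 * (norm (S *v z))\<^sup>2\<bar> \<le> t * (2 * pi * t * (B * (norm z)\<^sup>2)\<^sup>2 + 2 * (B * norm z)\<^sup>2)"
      using t by (intro mult_left_mono) auto
    also have "\<dots> = B\<^sup>2 * (2 * pi * y\<^sup>2 + 2 * y)"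
      by (simp add: y_def power_mult_distrib power2_eq_square algebra_simps)
    also have "\<dots> \<le> B\<^sup>2 * (2 * pi * (2 * exp y) + 2 * exp y)"
      using y1 y2 by (intro mult_left_mono add_mono) auto
    also have "\<dots> = B\<^sup>2 * (4 * pi + 2) * exp y" by (simp add: algebra_simps)
    finally have m: "t * \<bar>2 * pi * t * (quad S z)\<^sup>2 - 2 * (norm (S *v z))\<^sup>2\<bar> \<le> B\<^sup>2 * (4 * pi + 2) * exp y" .
    have "\<bar>stresslet_gauss S t z\<bar> = 4 * pi\<^sup>2 / 3 * sqrt t * (t * \<bar>2 * pi * t * (quad S z)\<^sup>2 - 2 * (norm (S *v z))\<^sup>2\<bar>) * exp (- (pi * y))"
      using t by (simp add: stresslet_gauss_def abs_mult y_def mult.assoc)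
    also have "\<dots> \<le> 4 * pi\<^sup>2 / 3 * sqrt t * (B\<^sup>2 * (4 * pi + 2) * exp y) * exp (- (pi * y))"
      using t by (intro mult_right_mono mult_left_mono m) auto
    also have "\<dots> = C * sqrt t * exp (y - pi * y)" by (simp add: C_def exp_add[symmetric])
    also have "\<dots> \<le> C * sqrt t * exp (- (2 * y))"
    proof (intro mult_left_mono)
      have "3 * y \<le> pi * y" using y pi_gt3 by (intro mult_right_mono) auto
      then show "exp (y - pi * y) \<le> exp (- (2 * y))" by simp
    qed (use C t in auto)
    finally show ?thesis by (simp add: y_def mult.assoc)
  qed
  have 2: "norm z * \<bar>stresslet_gauss S t z\<bar> \<le> C * exp (- (t * (norm z)\<^sup>2))" if t: "0 < t" for t z
  proof -
    define y where "y = t * (norm z)\<^sup>2"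
    have y: "0 \<le> y" using t by (simp add: y_def)
    have "norm z * \<bar>stresslet_gauss S t z\<bar> \<le> norm z * (C * sqrt t * exp (- (2 * y)))"
      using 1[OF t, of z] by (intro mult_left_mono) (auto simp: y_def mult.assoc)
    also have "\<dots> = C * (sqrt y * exp (- (2 * y)))" using t by (simp add: y_def real_sqrt_mult)
    also have "\<dots> \<le> C * (exp y * exp (- (2 * y)))"
    proof (intro mult_left_mono mult_right_mono)
      have "sqrt y \<le> sqrt ((1 + y)\<^sup>2)" using y by (intro real_sqrt_le_mono) (simp add: power2_sum)
      also have "\<dots> = 1 + y" using y by simp
      also have "\<dots> \<le> exp y" by (rule exp_ge_add_one_self)
      finally show "sqrt y \<le> exp y" .
    qed (use C in auto)
    also have "\<dots> = C * exp (- y)" by (simp add: exp_add[symmetric])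
    finally show ?thesis by (simp add: y_def)
  qed
  show ?thesis by (rule that[OF C 1 2])
qed

section \<open>Time majorants and compactly supported functions\<close>

lemma lborel_integral_reflect:
  fixes f :: "'a::euclidean_space \<Rightarrow> 'b::{banach, second_countable_topology}"
  assumes [measurable]: "f \<in> borel_measurable borel"
  shows "(\<integral>y. f (x - y) \<partial>lborel) = (\<integral>z. f z \<partial>lborel)"
proof -
  have "(lborel :: 'a measure) = distr lborel borel (\<lambda>y. x - y)"
    using lborel_affine[of "-1" x] by (simp add: density_1 one_ennreal_def[symmetric])
  then have "(\<integral>z. f z \<partial>lborel) = (\<integral>z. f z \<partial>distr lborel borel (\<lambda>y. x - y))" by simp
  then show ?thesis by (simp add: integral_distr)
qed

lemma lborel_integral_translate:
  fixes f :: "'a::euclidean_space \<Rightarrow> 'b::{banach, second_countable_topology}"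
  assumes [measurable]: "f \<in> borel_measurable borel"
  shows "(\<integral>y. f (x + y) \<partial>lborel) = (\<integral>z. f z \<partial>lborel)"
  using integral_distr[of "(+) x" lborel borel f] by (simp add: lborel_distr_plus)

lemma lborel_integrable_translate:
  fixes f :: "'a::euclidean_space \<Rightarrow> 'b::{banach, second_countable_topology}"
  assumes "f \<in> borel_measurable borel" "integrable lborel f"
  shows "integrable lborel (\<lambda>y. f (x + y))"
  using integrable_distr_eq[of "(+) x" lborel borel f] assms by (simp add: lborel_distr_plus)

text \<open>
  A common integrable majorant on \<open>(0,\<infinity>)\<close> for all quantities that depend on time. The
  exponent \<open>-5/4\<close> comes from the \<open>L\<^sup>2\<close> norm of the Gaussian potentials: it is the geometric mean of their
  supremum bound \<open>t\<^bsup>-1\<^esup>\<close> and their \<open>L\<^sup>1\<close> bound \<open>t\<^bsup>-3/2\<^esup>\<close>.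
\<close>

definition time_bound :: "real \<Rightarrow> real" where
  "time_bound t = (if t \<le> 1 then t powr (-1/2) else t powr (-5/4))"

lemma time_bound_pos: "t > 0 \<Longrightarrow> time_bound t > 0"
  by (simp add: time_bound_def)

lemma measurable_time_bound [measurable]: "time_bound \<in> borel_measurable borel"
  unfolding time_bound_def by measurable

lemma set_integrable_time_bound: "set_integrable lborel {0<..} time_bound"
proof -
  have a: "set_integrable lborel {0..1} (\<lambda>t::real. t powr (-1/2))"
  proof -
    have "(\<lambda>t::real. t powr (-1/2)) absolutely_integrable_on {0..1}"
      using integrable_on_powr_from_0[of "-1/2" 1] by (intro nonnegative_absolutely_integrable_1) auto
    then show ?thesis unfolding set_integrable_def by (subst (asm) integrable_completion) auto
  qed
  have b: "set_integrable lborel {1..} (\<lambda>t::real. t powr (-5/4))"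
  proof -
    have "(\<lambda>t::real. t powr (-5/4)) absolutely_integrable_on {1..}"
      using has_integral_powr_to_inf[of "-5/4" 1] by (intro nonnegative_absolutely_integrable_1) (auto simp: has_integral_integrable)
    then show ?thesis unfolding set_integrable_def by (subst (asm) integrable_completion) auto
  qed
  have "integrable lborel (\<lambda>t. indicator {0..1} t * t powr (-1/2) + indicator {1..} t * t powr (-5/4) :: real)"
    using a b by (auto simp: set_integrable_def)
  then have "integrable lborel (\<lambda>t. indicator {0<..} t * time_bound t)"
    by (rule Bochner_Integration.integrable_bound) (auto simp: time_bound_def indicator_def)
  then show ?thesis by (simp add: set_integrable_def)
qed

lemma integrable_time_bound: "integrable lborel (\<lambda>t. indicator {0<..} t * (C * time_bound t))"
  using set_integrable_mult_right[OF set_integrable_time_bound, of C] by (simp add: set_integrable_def)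

lemma sqrt_le_time_bound: "0 < t \<Longrightarrow> t \<le> 1 \<Longrightarrow> sqrt t \<le> time_bound t" "0 < t \<Longrightarrow> t \<le> 1 \<Longrightarrow> 1 \<le> time_bound t"
proof -
  assume t: "0 < t" "t \<le> 1"
  have "1 powr (-1/2) \<le> t powr (-1/2)" using t by (intro powr_mono2') auto
  then show 1: "1 \<le> time_bound t" using t by (simp add: time_bound_def)
  have "sqrt t \<le> 1" using t by simp
  then show "sqrt t \<le> time_bound t" using 1 by (rule order_trans)
qed

lemma inverse_le_time_bound:
  assumes "1 < t"
  shows "1 / (t * sqrt t) \<le> time_bound t"
proof -
  have "1 / (t * sqrt t) = t powr (- 3/2)"
  proof -
    have "t powr (- 3/2) = 1 / t powr (1 + 1/2)" by (simp add: powr_minus_divide[symmetric])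
    also have "t powr (1 + 1/2) = t * sqrt t" using assms by (subst powr_add) (auto simp: powr_half_sqrt)
    finally show ?thesis by simp
  qed
  also have "\<dots> \<le> t powr (-5/4)" using assms by (intro powr_mono) auto
  finally show ?thesis using assms by (simp add: time_bound_def)
qed

lemma time_bound_square:
  assumes "t > 0"
  shows "t \<le> 1 \<Longrightarrow> sqrt t * (1 / t) \<le> (time_bound t)\<^sup>2" "1 < t \<Longrightarrow> 1 / t * (1 / (t * sqrt t)) \<le> (time_bound t)\<^sup>2"
proof -
  assume t: "t \<le> 1"
  have "(time_bound t)\<^sup>2 = t powr (-1)" using t assms by (simp add: time_bound_def powr_power)
  also have "\<dots> = 1 / t" using assms by (simp add: powr_minus_divide)
  finally show "sqrt t * (1 / t) \<le> (time_bound t)\<^sup>2" using t assms by (simp add: divide_right_mono)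
next
  assume t: "1 < t"
  have "(time_bound t)\<^sup>2 = 1 / t powr (2 + 1/2)" using t by (simp add: time_bound_def powr_power powr_minus_divide[symmetric])
  also have "t powr (2 + 1/2) = t\<^sup>2 * sqrt t" using assms by (subst powr_add) (auto simp: powr_half_sqrt powr_numeral)
  finally show "1 / t * (1 / (t * sqrt t)) \<le> (time_bound t)\<^sup>2" using t by (simp add: power2_eq_square)
qed

lemma gauss3_integral:
  assumes a: "a > 0"
  shows "integrable lborel (\<lambda>z::real^3. exp (- (a * (norm z)\<^sup>2)))"
    and "(\<integral>z. exp (- (a * (norm z)\<^sup>2)) \<partial>(lborel :: (real^3) measure)) = pi * sqrt pi / (a * sqrt a)"
proof -
  have t: "a / pi > 0" using a by simp
  have e: "coord_power 0 0 0 z * exp (- (pi * (a / pi) * (norm z)\<^sup>2)) = exp (- (a * (norm z)\<^sup>2))" for z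
    by (simp add: coord_power_def)
  show "integrable lborel (\<lambda>z::real^3. exp (- (a * (norm z)\<^sup>2)))"
    using gauss_coord_power(1)[OF t, of 0 0 0] unfolding e .
  have "gauss_moment 0 (a/pi) = sqrt pi / sqrt a" using gauss_moment_even[OF t, of 0] by (simp add: real_sqrt_divide)
  then show "(\<integral>z. exp (- (a * (norm z)\<^sup>2)) \<partial>(lborel :: (real^3) measure)) = pi * sqrt pi / (a * sqrt a)"
    using gauss_coord_power(2)[OF t, of 0 0 0] a unfolding e by simp
qed

lemma gauss3_scaled_le:
  assumes a: "1 \<le> a" and t: "t > 0"
  shows "(\<integral>z. exp (- (a * t * (norm z)\<^sup>2)) \<partial>(lborel :: (real^3) measure)) \<le> pi * sqrt pi / (t * sqrt t)"
proof -
  have "t * sqrt t \<le> (a * t) * sqrt (a * t)"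
    using a t by (intro mult_mono real_sqrt_le_mono) (auto simp: mult_le_cancel_right1)
  moreover have "a * t > 0" using a t by simp
  ultimately show ?thesis using gauss3_integral(2)[of "a * t"] t by (simp add: divide_left_mono)
qed

lemma continuous_on_quad [continuous_intros]: "continuous_on A f \<Longrightarrow> continuous_on A (\<lambda>z. quad S (f z))"
  unfolding quad_inner
  by (intro continuous_intros bounded_linear.continuous_on[OF matrix_vector_mul_bounded_linear]) auto

lemma measurable_quad [measurable]: "quad S \<in> borel_measurable borel"
  by (intro borel_measurable_continuous_onI continuous_intros)

lemma measurable_mat_vec [measurable]: "(*v) (S::real^'n^'m) \<in> borel_measurable borel"
  by (intro borel_measurable_continuous_onI continuous_intros)

lemma measurable_stresslet_gauss [measurable]:
  assumes "f \<in> borel_measurable M" "g \<in> borel_measurable M"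
  shows "(\<lambda>x. stresslet_gauss S (f x) (g x)) \<in> borel_measurable M"
  unfolding stresslet_gauss_def
  using measurable_compose[OF assms(2) measurable_quad[of S]] measurable_compose[OF assms(2) measurable_mat_vec[of S]] assms by measurable

lemma compact_support_deriv_zero:
  fixes F :: "real^3 \<Rightarrow> real"
  assumes D: "(F has_derivative (\<lambda>h. \<Sum>i\<in>UNIV. d i * h $ i)) (at z)"
    and supp: "\<And>z. norm z > R \<Longrightarrow> F z = 0" and z: "norm z > R"
  shows "d i = 0"
proof -
  have o: "open {z::real^3. norm z > R}" by (intro open_Collect_less continuous_intros)
  have "((\<lambda>z. 0) has_derivative (\<lambda>h. 0)) (at z)" by simp
  then have "(F has_derivative (\<lambda>h. 0)) (at z)"
    by (rule has_derivative_transform_within_open[OF _ o]) (use supp z in auto)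
  from has_derivative_unique[OF D this] have "(\<Sum>j\<in>UNIV. d j * axis i 1 $ j) = 0" by (rule fun_cong)
  moreover have "(\<Sum>j\<in>UNIV. d j * axis i 1 $ j) = (\<Sum>j\<in>UNIV. if j = i then d i else 0)"
    by (intro sum.cong) (auto simp: axis_def)
  ultimately show ?thesis by simp
qed

lemma compact_support_bounded:
  fixes f :: "real^3 \<Rightarrow> real"
  assumes "continuous_on UNIV f" "\<And>z. norm z > R \<Longrightarrow> f z = 0"
  obtains M where "0 \<le> M" "\<And>z. \<bar>f z\<bar> \<le> M"
proof -
  have "compact (f ` cball 0 R)" by (intro compact_continuous_image continuous_on_subset[OF assms(1)]) auto
  then have "bounded (f ` cball 0 R)" by (rule compact_imp_bounded)
  then obtain M where M: "\<forall>x\<in>f ` cball 0 R. norm x \<le> M" unfolding bounded_iff by (elim exE)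
  show ?thesis
  proof (rule that[of "\<bar>M\<bar>"])
    fix z show "\<bar>f z\<bar> \<le> \<bar>M\<bar>"
    proof (cases "norm z \<le> R")
      case True
      then have "norm (f z) \<le> M" by (intro M[rule_format] imageI) simp
      then show ?thesis by simp
    qed (use assms(2)[of z] in simp)
  qed auto
qed

lemma integrable_compact_support:
  fixes f :: "real^3 \<Rightarrow> real"
  assumes "continuous_on UNIV f" "\<And>z. norm z > R \<Longrightarrow> f z = 0"
  shows "integrable lborel f"
proof -
  have "integrable lborel (\<lambda>z. indicator (cball 0 R) z *\<^sub>R f z)"
    by (rule borel_integrable_compact[unfolded set_integrable_def]) (use assms in \<open>auto intro: continuous_on_subset\<close>)
  moreover have "(\<lambda>z. indicator (cball 0 R) z *\<^sub>R f z) = f" using assms(2) by (force simp: indicator_def)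
  ultimately show ?thesis by (simp only:)
qed

lemma sum_component_bound:
  fixes h :: "real^3"
  assumes "\<And>i. \<bar>d i\<bar> \<le> M"
  shows "\<bar>\<Sum>i\<in>UNIV. d i * h $ i\<bar> \<le> 3 * M * norm h"
proof -
  have M: "0 \<le> M" using order_trans[OF abs_ge_zero assms] .
  have "\<bar>\<Sum>i\<in>UNIV. d i * h $ i\<bar> \<le> (\<Sum>i\<in>UNIV. \<bar>d i * h $ i\<bar>)" by (rule sum_abs)
  also have "\<dots> \<le> (\<Sum>i\<in>(UNIV::3 set). M * norm h)"
    unfolding abs_mult using assms component_le_norm_cart M by (intro sum_mono mult_mono) auto
  finally show ?thesis by simp
qed

lemma gradient_bound_lipschitz:
  fixes F :: "real^3 \<Rightarrow> real"
  assumes D: "\<And>z. (F has_derivative (\<lambda>h. \<Sum>i\<in>UNIV. d i z * h $ i)) (at z)"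
    and M: "\<And>i z. \<bar>d i z\<bar> \<le> M"
  shows "\<bar>F y - F z\<bar> \<le> 3 * M * norm (y - z)"
proof -
  have "norm (F y - F z) \<le> 3 * M * norm (y - z)"
  proof (rule differentiable_bound[of UNIV F "\<lambda>z h. \<Sum>i\<in>UNIV. d i z * h $ i"])
    show "onorm (\<lambda>h. \<Sum>i\<in>UNIV. d i x * h $ i) \<le> 3 * M" for x
      by (rule onorm_le) (use sum_component_bound[of "\<lambda>i. d i x" M, OF M] in auto)
  qed (use D in auto)
  then show ?thesis by simp
qed

text \<open>
  Difference quotients have integral \<open>0\<close> by translation invariance, and for functions of compact
  support they converge dominatedly.
\<close>

lemma integral_partial_derivative_zero:
  fixes F :: "real^3 \<Rightarrow> real"
  assumes D: "\<And>z. (F has_derivative (\<lambda>h. \<Sum>i\<in>UNIV. d i z * h $ i)) (at z)"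
    and supp: "\<And>z. norm z > R \<Longrightarrow> F z = 0" and cont: "\<And>i. continuous_on UNIV (d i)"
  shows "(\<integral>z. d i z \<partial>lborel) = 0"
proof -
  have dz: "d i z = 0" if "norm z > R" for i z
    by (rule compact_support_deriv_zero[OF D supp that])
  have "\<exists>M. \<forall>z. \<bar>d i z\<bar> \<le> M" for i using compact_support_bounded[OF cont[of i] dz[of _ i]] by metis
  then obtain M' where M': "\<And>i z. \<bar>d i z\<bar> \<le> M' i" by metis
  define M where "M = (\<Sum>i\<in>UNIV. \<bar>M' i\<bar>)"
  have M: "\<bar>d i z\<bar> \<le> M" for i z
  proof -
    have "\<bar>d i z\<bar> \<le> \<bar>M' i\<bar>" using M'[of i z] by simp
    also have "\<dots> \<le> M" unfolding M_def by (rule member_le_sum) auto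
    finally show ?thesis .
  qed
  have Fc: "continuous_on UNIV F" using D by (intro continuous_at_imp_continuous_on) (auto intro: has_derivative_continuous)
  have [measurable]: "F \<in> borel_measurable borel" using Fc by (rule borel_measurable_continuous_onI)
  have Fi: "integrable lborel F" by (rule integrable_compact_support[OF Fc supp])
  let ?e = "\<lambda>n. (1 / real (Suc n)) *\<^sub>R axis i (1::real) :: real^3"
  let ?q = "\<lambda>n z. real (Suc n) * (F (?e n + z) - F z)"
  have ne: "norm (?e n) = 1 / real (Suc n)" for n by (simp add: norm_axis_1)
  have q0: "(\<integral>z. ?q n z \<partial>lborel) = 0" for n
    using lborel_integral_translate[of F "?e n"] lborel_integrable_translate[OF _ Fi, of "?e n"] Fi by simp
  have "(\<lambda>n. \<integral>z. ?q n z \<partial>lborel) \<longlonglongrightarrow> (\<integral>z. d i z \<partial>lborel)"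
  proof (rule integral_dominated_convergence)
    show "d i \<in> borel_measurable lborel" using borel_measurable_continuous_onI[OF cont[of i]] by simp
    show "integrable lborel (\<lambda>z::real^3. 3 * M * indicator (cball 0 (R + 1)) z)"
      by (intro integrable_mult_right integrable_real_indicator) (auto simp: emeasure_lborel_cball_finite[simplified])
    fix n
    show "?q n \<in> borel_measurable lborel" by measurable
    show "AE z in lborel. norm (?q n z) \<le> 3 * M * indicator (cball 0 (R + 1)) z"
    proof (intro AE_I2)
      fix z :: "real^3"
      show "norm (?q n z) \<le> 3 * M * indicator (cball 0 (R + 1)) z"
      proof (cases "norm z \<le> R + 1")
        case True
        have "\<bar>F (?e n + z) - F z\<bar> \<le> 3 * M * norm (?e n)"
          using gradient_bound_lipschitz[OF D M, of "?e n + z" z] by simp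
        then have "real (Suc n) * \<bar>F (?e n + z) - F z\<bar> \<le> real (Suc n) * (3 * M * (1 / real (Suc n)))"
          unfolding ne by (intro mult_left_mono) auto
        then show ?thesis using True by (simp add: abs_mult del: of_nat_Suc)
      next
        case False
        have "norm z \<le> norm (?e n + z) + norm (?e n)" using norm_triangle_ineq4[of "?e n + z" "?e n"] by simp
        moreover have "norm (?e n) \<le> 1" unfolding ne by simp
        ultimately have "norm (?e n + z) > R" "norm z > R" using False by linarith+
        from supp[OF this(1)] supp[OF this(2)] show ?thesis using False by simp
      qed
    qed
  next
    show "AE z in lborel. (\<lambda>n. ?q n z) \<longlonglongrightarrow> d i z"
    proof (intro AE_I2)
      fix z
      have "((\<lambda>t. F (z + t *\<^sub>R axis i 1)) has_derivative (\<lambda>h. \<Sum>j\<in>UNIV. d j z * (h *\<^sub>R axis i 1) $ j)) (at 0)"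
        by (rule has_derivative_compose[where g=F and f="\<lambda>t. z + t *\<^sub>R axis i 1", OF _ ]) (use D[of z] in \<open>auto intro!: derivative_eq_intros\<close>)
      moreover have "(\<Sum>j\<in>UNIV. d j z * (h *\<^sub>R axis i 1) $ j) = d i z * h" for h :: real
      proof -
        have "(\<Sum>j\<in>UNIV. d j z * (h *\<^sub>R axis i 1) $ j) = (\<Sum>j\<in>UNIV. if j = i then d i z * h else 0)"
          by (intro sum.cong) (auto simp: axis_def)
        then show ?thesis by simp
      qed
      ultimately have "((\<lambda>t. F (z + t *\<^sub>R axis i 1)) has_real_derivative d i z) (at 0)"
        by (simp add: has_field_derivative_def)
      then have L: "((\<lambda>h. (F (z + h *\<^sub>R axis i 1) - F z) / h) \<longlongrightarrow> d i z) (at 0)"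
        by (simp add: DERIV_def)
      have "filterlim (\<lambda>n. 1 / real (Suc n)) (at 0) sequentially"
        using LIMSEQ_Suc[OF lim_1_over_n] by (auto simp: filterlim_at intro!: always_eventually)
      from filterlim_compose[OF L this] show "(\<lambda>n. ?q n z) \<longlonglongrightarrow> d i z"
        by (simp add: mult.commute add.commute del: of_nat_Suc)
    qed
  qed
  from LIMSEQ_unique[OF this[unfolded q0] tendsto_const] show ?thesis by simp
qed

section \<open>Gaussian potentials of the domain\<close>

locale stresslet_domain =
  fixes S :: "real^3^3" and \<O> :: "(real^3) set"
  assumes S: "transpose S = S" "trace S = 0"
    and smooth: "smooth_open \<O>" and bounded: "bounded \<O>" and nonempty: "\<O> \<noteq> {}"
begin

definition dom :: "real^3 \<Rightarrow> real" where "dom = indicator \<O>"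

definition vol :: real where "vol = measure lborel \<O>"

lemma open_dom: "open \<O>" using smooth by (simp add: smooth_open_def)

lemma measurable_O [measurable]: "\<O> \<in> sets borel" using open_dom by auto

lemma measurable_dom [measurable]: "dom \<in> borel_measurable borel" unfolding dom_def by measurable

lemma dom_range: "0 \<le> dom x" "dom x \<le> 1" "\<bar>dom x\<bar> \<le> 1" by (auto simp: dom_def indicator_def)

lemma emeasure_O: "emeasure lborel \<O> < \<infinity>" by (rule emeasure_bounded_finite[OF bounded])

lemma integrable_dom: "integrable lborel dom"
  unfolding dom_def using emeasure_O by (intro integrable_real_indicator) auto

lemma integral_dom: "(\<integral>x. dom x \<partial>lborel) = vol"
  by (simp add: dom_def vol_def)

lemma vol_pos: "0 < vol"
proof -
  obtain a where "a \<in> \<O>" using nonempty by auto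
  then obtain e where e: "e > 0" "ball a e \<subseteq> \<O>" using open_dom by (auto simp: open_contains_ball)
  have "0 < measure lborel (ball a e)" using content_ball_pos[OF e(1)] by simp
  also have "\<dots> \<le> vol" unfolding vol_def
    by (rule measure_mono_fmeasurable) (use e emeasure_O in \<open>auto simp: fmeasurable_def\<close>)
  finally show ?thesis .
qed

definition tube_const :: real where
  "tube_const = (SOME C. 0 \<le> C \<and> (\<forall>s>0. measure lborel (inner_tube \<O> s) \<le> C * s))"

lemma tube_const: "0 \<le> tube_const" "0 < s \<Longrightarrow> measure lborel (inner_tube \<O> s) \<le> tube_const * s"
proof -
  have "\<exists>C. 0 \<le> C \<and> (\<forall>s>0. measure lborel (inner_tube \<O> s) \<le> C * s)"
    using inner_tube_measure[OF smooth bounded] by metis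
  from someI_ex[OF this] show "0 \<le> tube_const" "0 < s \<Longrightarrow> measure lborel (inner_tube \<O> s) \<le> tube_const * s"
    by (auto simp: tube_const_def)
qed

lemma inner_tube_finite: "inner_tube \<O> s \<in> fmeasurable lborel"
proof -
  have "emeasure lborel (inner_tube \<O> s) \<le> emeasure lborel \<O>"
    by (rule emeasure_mono) (auto simp: inner_tube_def)
  then have "emeasure lborel (inner_tube \<O> s) < \<infinity>" using emeasure_O by (rule le_less_trans)
  then show ?thesis using inner_tube_borel[OF open_dom] by (auto simp: fmeasurable_def)
qed

lemma integrable_dom_shift: "integrable lborel (\<lambda>x. dom (x - z))"
  using lborel_integrable_translate[OF measurable_dom integrable_dom, of "- z"] by simp

text \<open>
  A point that lies in only one of the domain and its translate is within \<open>|z|\<close> of the boundary.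
\<close>

lemma dom_shift_difference:
  shows "integrable lborel (\<lambda>x. \<bar>dom (x - z) - dom x\<bar>)"
    and "(\<integral>x. \<bar>dom (x - z) - dom x\<bar> \<partial>lborel) \<le> 2 * tube_const * norm z"
proof -
  let ?t = "indicator (inner_tube \<O> (norm z)) :: real^3 \<Rightarrow> real"
  note m = inner_tube_borel[OF open_dom, of "norm z", measurable]
  have ti: "integrable lborel ?t" using inner_tube_finite by (intro integrable_real_indicator) (auto simp: fmeasurable_def)
  have tz: "integrable lborel (\<lambda>x. ?t (- z + x))" by (rule lborel_integrable_translate[OF _ ti]) measurable
  have le: "\<bar>dom (x - z) - dom x\<bar> \<le> ?t x + ?t (- z + x)" for x
  proof -
    have "x \<in> inner_tube \<O> (norm z)" if "x \<in> \<O>" "x - z \<notin> \<O>"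
      using that unfolding inner_tube_def by (auto intro!: exI[of _ "x - z"] simp: dist_norm)
    moreover have "- z + x \<in> inner_tube \<O> (norm z)" if "x \<notin> \<O>" "x - z \<in> \<O>"
      using that unfolding inner_tube_def by (auto intro!: exI[of _ x] simp: dist_norm)
    ultimately show ?thesis by (auto simp: dom_def indicator_def)
  qed
  show "integrable lborel (\<lambda>x. \<bar>dom (x - z) - dom x\<bar>)"
    by (rule Bochner_Integration.integrable_bound[OF Bochner_Integration.integrable_add[OF ti tz]])
      (use le in \<open>auto intro!: AE_I2 order_trans[OF le]\<close>)
  have "(\<integral>x. \<bar>dom (x - z) - dom x\<bar> \<partial>lborel) \<le> (\<integral>x. ?t x + ?t (- z + x) \<partial>lborel)"
    by (rule integral_mono) (use le ti tz \<open>integrable lborel (\<lambda>x. \<bar>dom (x - z) - dom x\<bar>)\<close> in auto)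
  also have "\<dots> = (\<integral>x. ?t x \<partial>lborel) + (\<integral>x. ?t x \<partial>lborel)"
    using ti tz lborel_integral_translate[of ?t "- z"] by simp
  also have "\<dots> = 2 * measure lborel (inner_tube \<O> (norm z))" using m by simp
  finally have 1: "(\<integral>x. \<bar>dom (x - z) - dom x\<bar> \<partial>lborel) \<le> 2 * measure lborel (inner_tube \<O> (norm z))" .
  show "(\<integral>x. \<bar>dom (x - z) - dom x\<bar> \<partial>lborel) \<le> 2 * tube_const * norm z"
  proof (cases "z = 0")
    case False
    then show ?thesis using 1 tube_const(2)[of "norm z"] by simp
  qed simp
qed

definition gauss_pot :: "real \<Rightarrow> real^3 \<Rightarrow> real" where
  "gauss_pot t x = (\<integral>y. stresslet_gauss S t (x - y) * dom y \<partial>lborel)"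

lemma measurable_gauss_pot [measurable]:
  "case_prod gauss_pot \<in> borel_measurable (lborel \<Otimes>\<^sub>M lborel)"
proof -
  have "(\<lambda>p. \<integral>y. stresslet_gauss S (fst p) (snd p - y) * dom y \<partial>lborel) \<in> borel_measurable (lborel \<Otimes>\<^sub>M lborel)"
    by (rule lborel.borel_measurable_lebesgue_integral) measurable
  then show ?thesis by (simp add: gauss_pot_def[abs_def] split_beta')
qed

lemma gauss_pot_eq:
  "gauss_pot t x = (\<integral>z. stresslet_gauss S t z * dom (x - z) \<partial>lborel)"
  unfolding gauss_pot_def
  using lborel_integral_reflect[of "\<lambda>z. stresslet_gauss S t z * dom (x - z)" x] by simp

text \<open>
  Since the kernel has integral \<open>0\<close>, the value at \<open>x\<close> may be subtracted.
\<close>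

lemma gauss_pot_diff:
  assumes t: "t > 0"
  shows "gauss_pot t x = (\<integral>z. stresslet_gauss S t z * (dom (x - z) - dom x) \<partial>lborel)"
proof -
  note i = integrable_stresslet_gauss[OF S t]
  have i1: "integrable lborel (\<lambda>z. stresslet_gauss S t z * dom (x - z))"
    by (rule Bochner_Integration.integrable_bound[OF i]) (use dom_range in \<open>auto simp: abs_mult mult_left_le\<close>)
  have "(\<integral>z. stresslet_gauss S t z * (dom (x - z) - dom x) \<partial>lborel)
     = (\<integral>z. stresslet_gauss S t z * dom (x - z) \<partial>lborel) - (\<integral>z. stresslet_gauss S t z * dom x \<partial>lborel)"
    unfolding right_diff_distrib using i i1 by (intro Bochner_Integration.integral_diff) auto
  then show ?thesis using integral_stresslet_gauss[OF S t] by (simp add: gauss_pot_eq)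
qed

lemma stresslet_gauss_L1:
  obtains C where "0 \<le> C" "\<And>t. 0 < t \<Longrightarrow> (\<integral>z. \<bar>stresslet_gauss S t z\<bar> \<partial>lborel) \<le> C / t"
proof -
  obtain C where C: "0 \<le> C" "\<And>t z. 0 < t \<Longrightarrow> \<bar>stresslet_gauss S t z\<bar> \<le> C * sqrt t * exp (- (2 * t * (norm z)\<^sup>2))"
    using stresslet_gauss_bound by metis
  show ?thesis
  proof (rule that)
    fix t :: real assume t: "0 < t"
    have "(\<integral>z. \<bar>stresslet_gauss S t z\<bar> \<partial>lborel) \<le> (\<integral>z. C * sqrt t * exp (- (2 * t * (norm z)\<^sup>2)) \<partial>(lborel :: (real^3) measure))"
      by (rule integral_mono) (use C(2) t integrable_stresslet_gauss[OF S t] gauss3_integral(1)[of "2 * t"] in auto)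
    also have "\<dots> = C * sqrt t * (\<integral>z. exp (- (2 * t * (norm z)\<^sup>2)) \<partial>(lborel :: (real^3) measure))"
      by (rule integral_mult_right_zero)
    also have "\<dots> \<le> C * sqrt t * (pi * sqrt pi / (t * sqrt t))"
      using C t gauss3_scaled_le[of 2 t] by (intro mult_left_mono) auto
    also have "\<dots> = C * (pi * sqrt pi) / t" using t by simp
    finally show "(\<integral>z. \<bar>stresslet_gauss S t z\<bar> \<partial>lborel) \<le> C * (pi * sqrt pi) / t" .
  qed (use C in simp)
qed

text \<open>
  The supremum is bounded by the supremum or by the \<open>L\<^sup>1\<close> norm of the kernel. The stronger \<open>L\<^sup>1\<close> bound
  \<open>t\<^bsup>-3/2\<^esup>\<close> for large times uses the cancellation: the shifted domain differs from the domain by \<open>O(|z|)\<close>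
  in measure, and \<open>|z||\<gamma>\<^sub>t(z)|\<close> is bounded by a Gaussian.
\<close>

lemma gauss_pot_bounds:
  obtains C where "0 \<le> C"
    "\<And>t x. 0 < t \<Longrightarrow> \<bar>gauss_pot t x\<bar> \<le> C * sqrt t"
    "\<And>t x. 0 < t \<Longrightarrow> \<bar>gauss_pot t x\<bar> \<le> C / t"
    "\<And>t. 0 < t \<Longrightarrow> integrable lborel (gauss_pot t)"
    "\<And>t. 0 < t \<Longrightarrow> (\<integral>x. \<bar>gauss_pot t x\<bar> \<partial>lborel) \<le> C / t"
    "\<And>t. 0 < t \<Longrightarrow> (\<integral>x. \<bar>gauss_pot t x\<bar> \<partial>lborel) \<le> C / (t * sqrt t)"
proof -
  obtain C1 where C1: "0 \<le> C1" "\<And>t z. 0 < t \<Longrightarrow> \<bar>stresslet_gauss S t z\<bar> \<le> C1 * sqrt t * exp (- (2 * t * (norm z)\<^sup>2))"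
    "\<And>t z. 0 < t \<Longrightarrow> norm z * \<bar>stresslet_gauss S t z\<bar> \<le> C1 * exp (- (t * (norm z)\<^sup>2))"
    using stresslet_gauss_bound by metis
  obtain C2 where C2: "0 \<le> C2" "\<And>t. 0 < t \<Longrightarrow> (\<integral>z. \<bar>stresslet_gauss S t z\<bar> \<partial>lborel) \<le> C2 / t"
    using stresslet_gauss_L1 by metis
  define K where "K = 2 * tube_const * C1 * (pi * sqrt pi)"
  define C where "C = C1 * vol + C2 + C2 * (2 * vol) + K"
  have K: "0 \<le> K" using C1 tube_const by (simp add: K_def)
  have nn: "0 \<le> C1 * vol" "0 \<le> C2 * (2 * vol)" using C1 C2 vol_pos by auto
  have C: "0 \<le> C" "C1 * vol \<le> C" "C2 \<le> C" "C2 * (2 * vol) \<le> C" "K \<le> C"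
    using nn K C2 by (auto simp: C_def)
  have main: "integrable lborel (gauss_pot t)" "(\<integral>x. \<bar>gauss_pot t x\<bar> \<partial>lborel) \<le> (\<integral>z. g z \<partial>lborel)"
    if t: "0 < t" and g: "integrable lborel g" "\<And>z. \<bar>stresslet_gauss S t z\<bar> * (\<integral>x. \<bar>dom (x - z) - dom x\<bar> \<partial>lborel) \<le> g z" for t g
  proof -
    let ?f = "\<lambda>z x. stresslet_gauss S t z * (dom (x - z) - dom x)"
    have n: "(\<integral>x. norm (?f z x) \<partial>lborel) \<le> g z" for z
      using g(2)[of z] by (simp add: abs_mult)
    have I: "integrable (lborel \<Otimes>\<^sub>M lborel) (case_prod ?f)"
    proof (rule lborel_pair.integrable_prod_bounded[OF _ _ _ g(1)])
      show "AE z in lborel. integrable lborel (?f z)"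
        by (intro AE_I2 integrable_mult_right Bochner_Integration.integrable_diff integrable_dom_shift integrable_dom)
      show "AE z in lborel. (\<integral>x. norm (?f z x) \<partial>lborel) \<le> g z" by (intro AE_I2 n)
    qed measurable
    have "integrable lborel (\<lambda>x. \<integral>z. ?f z x \<partial>lborel)" by (rule lborel_pair.integrable_snd[OF I])
    moreover have "gauss_pot t = (\<lambda>x. \<integral>z. ?f z x \<partial>lborel)" by (rule ext) (rule gauss_pot_diff[OF t])
    ultimately show "integrable lborel (gauss_pot t)" by (simp only:)
    have In: "integrable (lborel \<Otimes>\<^sub>M lborel) (case_prod (\<lambda>z x. norm (?f z x)))"
      using integrable_norm[OF I] by (simp add: split_beta')
    have "(\<integral>x. \<bar>gauss_pot t x\<bar> \<partial>lborel) \<le> (\<integral>x. (\<integral>z. norm (?f z x) \<partial>lborel) \<partial>lborel)"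
    proof (rule integral_mono)
      show "integrable lborel (\<lambda>x. \<integral>z. norm (?f z x) \<partial>lborel)" by (rule lborel_pair.integrable_snd[OF In])
      show "\<bar>gauss_pot t x\<bar> \<le> (\<integral>z. norm (?f z x) \<partial>lborel)" for x
        unfolding gauss_pot_diff[OF t] real_norm_def[symmetric] by (rule integral_norm_bound)
    qed (use \<open>integrable lborel (gauss_pot t)\<close> in auto)
    also have "\<dots> = (\<integral>z. (\<integral>x. norm (?f z x) \<partial>lborel) \<partial>lborel)" by (rule lborel_pair.Fubini_integral[OF In])
    also have "\<dots> \<le> (\<integral>z. g z \<partial>lborel)"
      by (rule integral_mono[OF lborel_pair.integrable_fst[OF In] g(1)]) (rule n)
    finally show "(\<integral>x. \<bar>gauss_pot t x\<bar> \<partial>lborel) \<le> (\<integral>z. g z \<partial>lborel)" .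
  qed
  have D2: "(\<integral>x. \<bar>dom (x - z) - dom x\<bar> \<partial>lborel) \<le> 2 * vol" for z
  proof -
    have i: "integrable lborel (\<lambda>x. dom (- z + x))" by (rule lborel_integrable_translate[OF _ integrable_dom]) measurable
    have "(\<integral>x. \<bar>dom (x - z) - dom x\<bar> \<partial>lborel) \<le> (\<integral>x. dom (- z + x) + dom x \<partial>lborel)"
    proof (rule integral_mono)
      show "\<bar>dom (x - z) - dom x\<bar> \<le> dom (- z + x) + dom x" for x
        using dom_range(1)[of "x - z"] dom_range(1)[of x] by simp
    qed (use i integrable_dom dom_shift_difference(1) in auto)
    also have "\<dots> = 2 * vol" using i integrable_dom lborel_integral_translate[of dom "- z"] by (simp add: integral_dom)
    finally show ?thesis .
  qed
  have g1: "integrable lborel (\<lambda>z. \<bar>stresslet_gauss S t z\<bar> * (2 * vol))"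
       "\<And>z. \<bar>stresslet_gauss S t z\<bar> * (\<integral>x. \<bar>dom (x - z) - dom x\<bar> \<partial>lborel) \<le> \<bar>stresslet_gauss S t z\<bar> * (2 * vol)" if t: "0 < t" for t
    using integrable_stresslet_gauss[OF S t] D2 by (auto intro!: mult_left_mono)
  have g2: "integrable lborel (\<lambda>z::real^3. 2 * tube_const * C1 * exp (- (1 * t * (norm z)\<^sup>2)))"
       "\<And>z. \<bar>stresslet_gauss S t z\<bar> * (\<integral>x. \<bar>dom (x - z) - dom x\<bar> \<partial>lborel) \<le> 2 * tube_const * C1 * exp (- (1 * t * (norm z)\<^sup>2))" if t: "0 < t" for t
  proof -
    show "integrable lborel (\<lambda>z::real^3. 2 * tube_const * C1 * exp (- (1 * t * (norm z)\<^sup>2)))"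
      using gauss3_integral(1)[OF t] by (intro integrable_mult_right) simp
    fix z
    have "\<bar>stresslet_gauss S t z\<bar> * (\<integral>x. \<bar>dom (x - z) - dom x\<bar> \<partial>lborel) \<le> \<bar>stresslet_gauss S t z\<bar> * (2 * tube_const * norm z)"
      by (intro mult_left_mono dom_shift_difference(2)) auto
    also have "\<dots> = 2 * tube_const * (norm z * \<bar>stresslet_gauss S t z\<bar>)" by simp
    also have "\<dots> \<le> 2 * tube_const * (C1 * exp (- (t * (norm z)\<^sup>2)))"
      using tube_const by (intro mult_left_mono C1 t) auto
    finally show "\<bar>stresslet_gauss S t z\<bar> * (\<integral>x. \<bar>dom (x - z) - dom x\<bar> \<partial>lborel) \<le> 2 * tube_const * C1 * exp (- (1 * t * (norm z)\<^sup>2))" by simp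
  qed
  show ?thesis
  proof (rule that[OF C(1)])
    fix t :: real and x assume t: "0 < t"
    have b: "\<bar>stresslet_gauss S t z\<bar> \<le> C1 * sqrt t" for z
      using C1(1) t by (auto intro!: order_trans[OF C1(2)[OF t, of z]] mult_left_le)
    have "norm (gauss_pot t x) \<le> (\<integral>y. C1 * sqrt t * dom y \<partial>lborel)"
      unfolding gauss_pot_def
      by (rule norm_integral_le) (use integrable_dom b dom_range in \<open>auto simp: abs_mult intro!: mult_right_mono\<close>)
    also have "\<dots> = C1 * vol * sqrt t" by (simp add: integral_dom)
    also have "\<dots> \<le> C * sqrt t" using C t by (intro mult_right_mono) auto
    finally show "\<bar>gauss_pot t x\<bar> \<le> C * sqrt t" by simp
    have "norm (gauss_pot t x) \<le> (\<integral>z. \<bar>stresslet_gauss S t z\<bar> \<partial>lborel)"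
      unfolding gauss_pot_eq
      by (rule norm_integral_le) (use integrable_stresslet_gauss[OF S t] dom_range in \<open>auto simp: abs_mult mult_left_le\<close>)
    also have "\<dots> \<le> C2 / t" by (rule C2(2)[OF t])
    also have "\<dots> \<le> C / t" using C t by (intro divide_right_mono) auto
    finally show "\<bar>gauss_pot t x\<bar> \<le> C / t" by simp
  next
    fix t :: real assume t: "0 < t"
    show "integrable lborel (gauss_pot t)" by (rule main(1)[OF t g1(1)[OF t] g1(2)[OF t]])
    have "(\<integral>x. \<bar>gauss_pot t x\<bar> \<partial>lborel) \<le> (\<integral>z. \<bar>stresslet_gauss S t z\<bar> * (2 * vol) \<partial>lborel)"
      by (rule main(2)[OF t g1(1)[OF t] g1(2)[OF t]])
    also have "\<dots> \<le> C2 / t * (2 * vol)" using mult_right_mono[OF C2(2)[OF t], of "2 * vol"] vol_pos by simp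
    also have "\<dots> \<le> C / t" using C(4) t by (simp add: divide_right_mono)
    finally show "(\<integral>x. \<bar>gauss_pot t x\<bar> \<partial>lborel) \<le> C / t" .
    have "(\<integral>x. \<bar>gauss_pot t x\<bar> \<partial>lborel) \<le> (\<integral>z. 2 * tube_const * C1 * exp (- (1 * t * (norm z)\<^sup>2)) \<partial>(lborel :: (real^3) measure))"
      by (rule main(2)[OF t g2(1)[OF t] g2(2)[OF t]])
    also have "\<dots> = 2 * tube_const * C1 * (\<integral>z. exp (- (1 * t * (norm z)\<^sup>2)) \<partial>(lborel :: (real^3) measure))"
      by (rule integral_mult_right_zero)
    also have "\<dots> \<le> 2 * tube_const * C1 * (pi * sqrt pi / (t * sqrt t))"
      using tube_const C1 t by (intro mult_left_mono gauss3_scaled_le) auto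
    also have "\<dots> = K / (t * sqrt t)" by (simp add: K_def)
    also have "\<dots> \<le> C / (t * sqrt t)" using C t by (intro divide_right_mono) auto
    finally show "(\<integral>x. \<bar>gauss_pot t x\<bar> \<partial>lborel) \<le> C / (t * sqrt t)" .
  qed
qed

end

section \<open>The square integrable potential\<close>

context stresslet_domain
begin

text \<open>
  The candidate for the convolution of the kernel with the indicator function of the domain.
  The integral over \<open>t\<close> need not converge absolutely at every \<open>x\<close>; where it does not, the value is \<open>0\<close>.
\<close>

definition stresslet_pot :: "real^3 \<Rightarrow> real" where
  "stresslet_pot x = (LINT t:{0<..}|lborel. gauss_pot t x)"

definition gauss_energy :: "real \<Rightarrow> real" where
  "gauss_energy t = (\<integral>x. gauss_pot t x * dom x \<partial>lborel)"

lemma measurable_stresslet_pot [measurable]: "stresslet_pot \<in> borel_measurable borel"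
proof -
  have "(\<lambda>x. \<integral>t. indicator {0<..} t * gauss_pot t x \<partial>lborel) \<in> borel_measurable lborel"
  proof (rule lborel.borel_measurable_lebesgue_integral)
    have "(\<lambda>p. gauss_pot (snd p) (fst p)) \<in> borel_measurable (lborel \<Otimes>\<^sub>M lborel)"
      using measurable_compose[OF measurable_pair_swap' measurable_gauss_pot] by (simp add: split_beta')
    then show "(\<lambda>(x, t). indicator {0<..} t * gauss_pot t x) \<in> borel_measurable (lborel \<Otimes>\<^sub>M lborel)"
      unfolding split_beta' by measurable
  qed
  then show ?thesis by (simp add: stresslet_pot_def[abs_def] set_lebesgue_integral_def)
qed

text \<open>
  The \<open>L\<^sup>2\<close> norm is interpolated between the supremum and the \<open>L\<^sup>1\<close> norm.
\<close>

lemma gauss_pot_time_bound: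
  obtains C where "0 \<le> C"
    "\<And>t. 0 < t \<Longrightarrow> (\<integral>\<^sup>+x. ennreal ((gauss_pot t x)\<^sup>2) \<partial>lborel) \<le> ennreal ((C * time_bound t)\<^sup>2)"
    "\<And>u M t. integrable lborel u \<Longrightarrow> (\<And>x. \<bar>u x\<bar> \<le> M) \<Longrightarrow> 0 < t \<Longrightarrow>
        (\<integral>x. \<bar>gauss_pot t x * u x\<bar> \<partial>lborel) \<le> C * (M + (\<integral>x. \<bar>u x\<bar> \<partial>lborel)) * time_bound t"
proof -
  obtain C where C: "0 \<le> C"
    "\<And>t x. 0 < t \<Longrightarrow> \<bar>gauss_pot t x\<bar> \<le> C * sqrt t"
    "\<And>t x. 0 < t \<Longrightarrow> \<bar>gauss_pot t x\<bar> \<le> C / t"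
    "\<And>t. 0 < t \<Longrightarrow> integrable lborel (gauss_pot t)"
    "\<And>t. 0 < t \<Longrightarrow> (\<integral>x. \<bar>gauss_pot t x\<bar> \<partial>lborel) \<le> C / t"
    "\<And>t. 0 < t \<Longrightarrow> (\<integral>x. \<bar>gauss_pot t x\<bar> \<partial>lborel) \<le> C / (t * sqrt t)"
    using gauss_pot_bounds by metis
  have sq: "(\<integral>\<^sup>+x. ennreal ((gauss_pot t x)\<^sup>2) \<partial>lborel) \<le> ennreal (a * b)"
    if t: "0 < t" and a: "\<And>x. \<bar>gauss_pot t x\<bar> \<le> a" and b: "(\<integral>x. \<bar>gauss_pot t x\<bar> \<partial>lborel) \<le> b" for t a b
  proof -
    have a0: "0 \<le> a" using order_trans[OF abs_ge_zero a] .
    have "(\<integral>\<^sup>+x. ennreal ((gauss_pot t x)\<^sup>2) \<partial>lborel) \<le> (\<integral>\<^sup>+x. ennreal (a * \<bar>gauss_pot t x\<bar>) \<partial>lborel)"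
    proof (intro nn_integral_mono ennreal_leI)
      fix x
      have "(gauss_pot t x)\<^sup>2 = \<bar>gauss_pot t x\<bar> * \<bar>gauss_pot t x\<bar>" by (simp add: power2_eq_square)
      also have "\<dots> \<le> a * \<bar>gauss_pot t x\<bar>" by (intro mult_right_mono a) auto
      finally show "(gauss_pot t x)\<^sup>2 \<le> a * \<bar>gauss_pot t x\<bar>" .
    qed
    also have "\<dots> = ennreal (\<integral>x. a * \<bar>gauss_pot t x\<bar> \<partial>lborel)"
      by (rule nn_integral_eq_integral) (use a0 C(4)[OF t] in auto)
    also have "\<dots> \<le> ennreal (a * b)" using b a0 by (intro ennreal_leI) (simp add: mult_left_mono)
    finally show ?thesis .
  qed
  show ?thesis
  proof (rule that[OF C(1)])
    fix t :: real assume t: "0 < t"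
    show "(\<integral>\<^sup>+x. ennreal ((gauss_pot t x)\<^sup>2) \<partial>lborel) \<le> ennreal ((C * time_bound t)\<^sup>2)"
    proof (cases "t \<le> 1")
      case True
      have "(\<integral>\<^sup>+x. ennreal ((gauss_pot t x)\<^sup>2) \<partial>lborel) \<le> ennreal (C * sqrt t * (C / t))"
        by (rule sq[OF t C(2)[OF t] C(5)[OF t]])
      also have "C * sqrt t * (C / t) = C\<^sup>2 * (sqrt t * (1 / t))" by (simp add: power2_eq_square)
      also have "\<dots> \<le> C\<^sup>2 * (time_bound t)\<^sup>2" using time_bound_square(1)[OF t True] by (intro mult_left_mono) auto
      finally show ?thesis by (simp add: power_mult_distrib ennreal_leI)
    next
      case False
      have "(\<integral>\<^sup>+x. ennreal ((gauss_pot t x)\<^sup>2) \<partial>lborel) \<le> ennreal (C / t * (C / (t * sqrt t)))"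
        by (rule sq[OF t C(3)[OF t] C(6)[OF t]])
      also have "C / t * (C / (t * sqrt t)) = C\<^sup>2 * (1 / t * (1 / (t * sqrt t)))" by (simp add: power2_eq_square)
      also have "\<dots> \<le> C\<^sup>2 * (time_bound t)\<^sup>2" using time_bound_square(2)[OF t] False by (intro mult_left_mono) auto
      finally show ?thesis by (simp add: power_mult_distrib ennreal_leI)
    qed
  next
    fix u :: "real^3 \<Rightarrow> real" and M t :: real
    assume u: "integrable lborel u" "\<And>x. \<bar>u x\<bar> \<le> M" and t: "0 < t"
    let ?U = "\<integral>x. \<bar>u x\<bar> \<partial>lborel"
    have M: "0 \<le> M" using order_trans[OF abs_ge_zero u(2)] .
    have U: "0 \<le> ?U" by simp
    note [measurable] = borel_measurable_integrable[OF u(1)]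
    have ig: "integrable lborel (\<lambda>x. \<bar>gauss_pot t x * u x\<bar>)"
      by (rule Bochner_Integration.integrable_bound[OF integrable_mult_right[OF C(4)[OF t], of M]])
        (use u(2) M in \<open>auto simp: abs_mult mult.commute intro!: mult_right_mono\<close>)
    show "(\<integral>x. \<bar>gauss_pot t x * u x\<bar> \<partial>lborel) \<le> C * (M + ?U) * time_bound t"
    proof (cases "t \<le> 1")
      case True
      have "(\<integral>x. \<bar>gauss_pot t x * u x\<bar> \<partial>lborel) \<le> (\<integral>x. C * sqrt t * \<bar>u x\<bar> \<partial>lborel)"
        by (rule integral_mono[OF ig]) (use u(1) C(2)[OF t] in \<open>auto simp: abs_mult intro!: mult_right_mono\<close>)
      also have "\<dots> = C * ?U * sqrt t" by simp
      also have "\<dots> \<le> C * (M + ?U) * time_bound t"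
        using C(1) U M t sqrt_le_time_bound(1)[OF t True] by (intro mult_mono mult_nonneg_nonneg) auto
      finally show ?thesis .
    next
      case False
      have "(\<integral>x. \<bar>gauss_pot t x * u x\<bar> \<partial>lborel) \<le> (\<integral>x. M * \<bar>gauss_pot t x\<bar> \<partial>lborel)"
        by (rule integral_mono[OF ig]) (use u(2) C(4)[OF t] in \<open>auto simp: abs_mult mult.commute[of M] intro!: mult_left_mono\<close>)
      also have "\<dots> \<le> M * (C / (t * sqrt t))" using mult_left_mono[OF C(6)[OF t] M] by simp
      also have "\<dots> = C * M * (1 / (t * sqrt t))" by simp
      also have "\<dots> \<le> C * (M + ?U) * time_bound t"
        using C(1) U M t inverse_le_time_bound[of t] False by (intro mult_mono mult_nonneg_nonneg) auto
      finally show ?thesis .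
    qed
  qed
qed

lemma gauss_pot_pairing_bound:
  assumes u: "integrable lborel u" "\<And>x. \<bar>u x\<bar> \<le> M"
  obtains K where "\<And>t. 0 < t \<Longrightarrow> (\<integral>x. \<bar>gauss_pot t x * u x\<bar> \<partial>lborel) \<le> K * time_bound t"
proof (rule gauss_pot_time_bound)
  fix C
  assume C: "\<And>u M t. integrable lborel u \<Longrightarrow> (\<And>x. \<bar>u x\<bar> \<le> M) \<Longrightarrow> 0 < t \<Longrightarrow>
        (\<integral>x. \<bar>gauss_pot t x * u x\<bar> \<partial>lborel) \<le> C * (M + (\<integral>x. \<bar>u x\<bar> \<partial>lborel)) * time_bound t"
  show thesis by (rule that) (rule C[OF u])
qed

text \<open>
  Cauchy-Schwarz in time with the integrable weight \<open>w = time_bound\<close>: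
  \<open>|\<integral> H\<^sub>t dt|\<^sup>2 \<le> \<integral> w \<cdot> \<integral> H\<^sub>t\<^sup>2/w dt\<close>, and \<open>\<integral> H\<^sub>t(x)\<^sup>2 dx = O(w\<^sup>2)\<close>.
\<close>

lemma stresslet_pot_square_integrable: "integrable lborel (\<lambda>x. (stresslet_pot x)\<^sup>2)"
proof -
  obtain C where C: "0 \<le> C"
    "\<And>t. 0 < t \<Longrightarrow> (\<integral>\<^sup>+x. ennreal ((gauss_pot t x)\<^sup>2) \<partial>lborel) \<le> ennreal ((C * time_bound t)\<^sup>2)"
    using gauss_pot_time_bound by metis
  let ?w = "\<lambda>t. ennreal (indicator {0<..} t * time_bound t)"
  let ?A = "\<integral>\<^sup>+t. ?w t \<partial>lborel"
  let ?r = "\<lambda>t. if 0 < t then sqrt (time_bound t) else 0"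
  let ?h = "\<lambda>t x. if 0 < t then \<bar>gauss_pot t x\<bar> / sqrt (time_bound t) else 0"
  have A: "?A < \<infinity>"
    using integrable_time_bound[of 1] time_bound_pos
    by (subst nn_integral_eq_integral) (auto simp: indicator_def less_imp_le)
  have gm: "(\<lambda>p. gauss_pot (snd p) (fst p)) \<in> borel_measurable (lborel \<Otimes>\<^sub>M lborel)"
      using measurable_compose[OF measurable_pair_swap' measurable_gauss_pot] by (simp add: split_beta')
  have hm: "(\<lambda>p. ?h (snd p) (fst p)) \<in> borel_measurable (lborel \<Otimes>\<^sub>M lborel)"
    using gm by measurable
  \<comment> \<open>The weight is distributed over the two factors as \<open>\<surd>w\<close> and \<open>|H\<^sub>t|/\<surd>w\<close>.\<close>
  have pt: "ennreal ((stresslet_pot x)\<^sup>2) \<le> ?A * (\<integral>\<^sup>+t. ennreal ((?h t x)\<^sup>2) \<partial>lborel)" for x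
  proof -
    have "ennreal \<bar>stresslet_pot x\<bar> \<le> (\<integral>\<^sup>+t. ennreal (norm (indicator {0<..} t * gauss_pot t x)) \<partial>lborel)"
    proof (cases "integrable lborel (\<lambda>t. indicator {0<..} t * gauss_pot t x)")
      case True
      then show ?thesis
        using integral_norm_bound_ennreal[OF True] by (simp add: stresslet_pot_def set_lebesgue_integral_def)
    qed (simp add: stresslet_pot_def set_lebesgue_integral_def not_integrable_integral_eq)
    also have "\<dots> = (\<integral>\<^sup>+t. ennreal (?r t) * ennreal (?h t x) \<partial>lborel)"
    proof (rule nn_integral_cong)
      fix t
      show "ennreal (norm (indicator {0<..} t * gauss_pot t x)) = ennreal (?r t) * ennreal (?h t x)"
        using time_bound_pos[of t] by (auto simp: ennreal_mult[symmetric] abs_mult)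
    qed
    finally have 1: "ennreal \<bar>stresslet_pot x\<bar> \<le> (\<integral>\<^sup>+t. ennreal (?r t) * ennreal (?h t x) \<partial>lborel)" .
    have "ennreal ((stresslet_pot x)\<^sup>2) = (ennreal \<bar>stresslet_pot x\<bar>)\<^sup>2"
      by (simp add: ennreal_power)
    also have "\<dots> \<le> (\<integral>\<^sup>+t. ennreal (?r t) * ennreal (?h t x) \<partial>lborel)\<^sup>2"
      using 1 by (rule power_mono) simp
    also have "\<dots> \<le> (\<integral>\<^sup>+t. (ennreal (?r t))\<^sup>2 \<partial>lborel) * (\<integral>\<^sup>+t. (ennreal (?h t x))\<^sup>2 \<partial>lborel)"
      by (rule Cauchy_Schwarz_nn_integral) measurable
    also have "(\<integral>\<^sup>+t. (ennreal (?r t))\<^sup>2 \<partial>lborel) = ?A"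
      using time_bound_pos by (intro nn_integral_cong) (auto simp: ennreal_power less_imp_le)
    also have "(\<integral>\<^sup>+t. (ennreal (?h t x))\<^sup>2 \<partial>lborel) = (\<integral>\<^sup>+t. ennreal ((?h t x)\<^sup>2) \<partial>lborel)"
      using time_bound_pos by (intro nn_integral_cong) (auto simp: ennreal_power less_imp_le)
    finally show ?thesis .
  qed
  have "(\<integral>\<^sup>+x. ennreal ((stresslet_pot x)\<^sup>2) \<partial>lborel) \<le> (\<integral>\<^sup>+x. ?A * (\<integral>\<^sup>+t. ennreal ((?h t x)\<^sup>2) \<partial>lborel) \<partial>lborel)"
    by (intro nn_integral_mono pt)
  also have "\<dots> = ?A * (\<integral>\<^sup>+x. (\<integral>\<^sup>+t. ennreal ((?h t x)\<^sup>2) \<partial>lborel) \<partial>lborel)"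
  proof (rule nn_integral_cmult)
    show "(\<lambda>x. \<integral>\<^sup>+t. ennreal ((?h t x)\<^sup>2) \<partial>lborel) \<in> borel_measurable lborel"
      by (rule lborel.borel_measurable_nn_integral) (use hm in \<open>simp add: split_beta'\<close>)
  qed
  also have "(\<integral>\<^sup>+x. (\<integral>\<^sup>+t. ennreal ((?h t x)\<^sup>2) \<partial>lborel) \<partial>lborel) = (\<integral>\<^sup>+t. (\<integral>\<^sup>+x. ennreal ((?h t x)\<^sup>2) \<partial>lborel) \<partial>lborel)"
    by (rule lborel_pair.Fubini'[symmetric]) (use hm in \<open>simp add: split_beta'\<close>)
  also have "\<dots> \<le> (\<integral>\<^sup>+t. ennreal (C\<^sup>2) * ?w t \<partial>lborel)"
  proof (rule nn_integral_mono)
    fix t :: real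
    show "(\<integral>\<^sup>+x. ennreal ((?h t x)\<^sup>2) \<partial>lborel) \<le> ennreal (C\<^sup>2) * ?w t"
    proof (cases "0 < t")
      case True
      note p = time_bound_pos[OF True]
      have "(\<integral>\<^sup>+x. ennreal ((?h t x)\<^sup>2) \<partial>lborel) = (\<integral>\<^sup>+x. ennreal (1 / time_bound t) * ennreal ((gauss_pot t x)\<^sup>2) \<partial>lborel)"
        using True p by (intro nn_integral_cong) (simp add: power_divide ennreal_mult[symmetric])
      also have "\<dots> = ennreal (1 / time_bound t) * (\<integral>\<^sup>+x. ennreal ((gauss_pot t x)\<^sup>2) \<partial>lborel)"
        by (rule nn_integral_cmult) measurable
      also have "\<dots> \<le> ennreal (1 / time_bound t) * ennreal ((C * time_bound t)\<^sup>2)"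
        by (intro mult_left_mono C(2) True) auto
      also have "\<dots> = ennreal (1 / time_bound t * (C * time_bound t)\<^sup>2)"
        using p by (intro ennreal_mult[symmetric]) auto
      also have "1 / time_bound t * (C * time_bound t)\<^sup>2 = C\<^sup>2 * time_bound t"
        using p by (simp add: power_mult_distrib power2_eq_square)
      also have "ennreal (C\<^sup>2 * time_bound t) = ennreal (C\<^sup>2) * ?w t"
        using True p by (simp add: ennreal_mult)
      finally show ?thesis .
    qed simp
  qed
  also have "\<dots> = ennreal (C\<^sup>2) * ?A" by (rule nn_integral_cmult) measurable
  finally have "(\<integral>\<^sup>+x. ennreal ((stresslet_pot x)\<^sup>2) \<partial>lborel) \<le> ?A * (ennreal (C\<^sup>2) * ?A)"
    by (simp add: mult_left_mono)
  also have "\<dots> < \<infinity>" using A by (simp add: ennreal_mult_less_top)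
  finally show ?thesis by (intro integrableI_bounded) auto
qed

lemma stresslet_pot_pairing:
  fixes u :: "real^3 \<Rightarrow> real"
  assumes u: "integrable lborel u" "\<And>x. \<bar>u x\<bar> \<le> M"
  shows "(\<integral>x. stresslet_pot x * u x \<partial>lborel) = (LINT t:{0<..}|lborel. (\<integral>x. gauss_pot t x * u x \<partial>lborel))"
    and "set_integrable lborel {0<..} (\<lambda>t. (\<integral>x. gauss_pot t x * u x \<partial>lborel))"
proof -
  obtain K where K: "\<And>t. 0 < t \<Longrightarrow> (\<integral>x. \<bar>gauss_pot t x * u x\<bar> \<partial>lborel) \<le> K * time_bound t"
    using gauss_pot_pairing_bound[OF u] by blast
  have C': "integrable lborel (gauss_pot t)" if "0 < t" for t
    by (rule gauss_pot_bounds) (use that in blast)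
  note [measurable] = borel_measurable_integrable[OF u(1)]
  let ?f = "\<lambda>t x. indicator {0<..} t * (gauss_pot t x * u x)"
  have M: "0 \<le> M" using order_trans[OF abs_ge_zero u(2)] .
  have gi: "integrable lborel (\<lambda>x. gauss_pot t x * u x)" if "0 < t" for t
    by (rule Bochner_Integration.integrable_bound[OF integrable_mult_right[OF C'[OF that], of M]])
      (use u(2) M in \<open>auto simp: abs_mult mult.commute intro!: mult_right_mono\<close>)
  have I: "integrable (lborel \<Otimes>\<^sub>M lborel) (case_prod ?f)"
  proof (rule lborel_pair.integrable_prod_bounded[OF _ _ _ integrable_time_bound[of K]])
    have "(\<lambda>p. gauss_pot (fst p) (snd p)) \<in> borel_measurable (lborel \<Otimes>\<^sub>M lborel)"
      using measurable_gauss_pot by (simp add: split_beta')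
    then show "case_prod ?f \<in> borel_measurable (lborel \<Otimes>\<^sub>M lborel)" unfolding split_beta' by measurable
    show "AE t in lborel. integrable lborel (?f t)"
    proof (intro AE_I2)
      fix t show "integrable lborel (?f t)" using gi[of t] by (cases "0 < t") auto
    qed
    show "AE t in lborel. (\<integral>x. norm (?f t x) \<partial>lborel) \<le> indicator {0<..} t * (K * time_bound t)"
    proof (intro AE_I2)
      fix t show "(\<integral>x. norm (?f t x) \<partial>lborel) \<le> indicator {0<..} t * (K * time_bound t)"
        using K[of t] by (cases "0 < t") auto
    qed
  qed
  have i1: "(\<integral>x. ?f t x \<partial>lborel) = indicator {0<..} t * (\<integral>x. gauss_pot t x * u x \<partial>lborel)" for t by simp
  have i2: "(\<integral>t. ?f t x \<partial>lborel) = stresslet_pot x * u x" for x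
    unfolding stresslet_pot_def set_lebesgue_integral_def by (simp add: mult.assoc[symmetric])
  show "(\<integral>x. stresslet_pot x * u x \<partial>lborel) = (LINT t:{0<..}|lborel. (\<integral>x. gauss_pot t x * u x \<partial>lborel))"
    using lborel_pair.Fubini_integral[OF I] unfolding i1 i2 by (simp add: set_lebesgue_integral_def)
  show "set_integrable lborel {0<..} (\<lambda>t. (\<integral>x. gauss_pot t x * u x \<partial>lborel))"
    using lborel_pair.integrable_fst[OF I] unfolding i1 by (simp add: set_integrable_def)
qed

end

section \<open>Divergence form of the Gaussian pieces\<close>

text \<open>
  Smoothness and compact support enter the identification of the convolution in this form. The
  Lipschitz bound on the gradient makes the Taylor remainder quadratic.
\<close>

lemma test_function_lipschitz_gradient:
  assumes "test_function \<phi>"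
  obtains p R L where "\<And>z. (\<phi> has_derivative (\<lambda>h. \<Sum>i\<in>UNIV. p i z * h $ i)) (at z)"
    "\<And>i. continuous_on UNIV (p i)" "\<And>z. norm z > R \<Longrightarrow> \<phi> z = 0" "\<And>i z. norm z > R \<Longrightarrow> p i z = 0"
    "0 \<le> L" "\<And>i y z. \<bar>p i y - p i z\<bar> \<le> L * norm (y - z)"
proof -
  have "Ck_on (Suc (Suc 0)) UNIV \<phi>" and b: "bounded {x. \<phi> x \<noteq> 0}"
    using assms unfolding test_function_def smooth_on_def by blast+
  then obtain p :: "3 \<Rightarrow> real^3 \<Rightarrow> real" where p: "\<And>z. (\<phi> has_derivative (\<lambda>h. \<Sum>i\<in>UNIV. p i z * h $ i)) (at z)" "\<And>i. Ck_on (Suc 0) UNIV (p i)"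
    by auto
  have "\<forall>i. \<exists>g :: 3 \<Rightarrow> real^3 \<Rightarrow> real. (\<forall>z. (p i has_derivative (\<lambda>h. \<Sum>j\<in>UNIV. g j z * h $ j)) (at z)) \<and> (\<forall>j. continuous_on UNIV (g j))"
    using p(2) by simp
  from choice[OF this] obtain g where g': "\<forall>i. (\<forall>z. (p i has_derivative (\<lambda>h. \<Sum>j\<in>UNIV. (g i :: 3 \<Rightarrow> real^3 \<Rightarrow> real) j z * h $ j)) (at z)) \<and> (\<forall>j. continuous_on UNIV (g i j))" ..
  have g: "(p i has_derivative (\<lambda>h. \<Sum>j\<in>UNIV. g i j z * h $ j)) (at z)" "continuous_on UNIV (g i j)" for i j z
    using g' by auto
  obtain R where R: "\<And>z. \<phi> z \<noteq> 0 \<Longrightarrow> norm z \<le> R" using b unfolding bounded_iff by auto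
  then have R0: "\<phi> z = 0" if "norm z > R" for z using that by fastforce
  have pz: "p i z = 0" if "norm z > R" for i z
    by (rule compact_support_deriv_zero[OF p(1) R0 that])
  have gz: "g i j z = 0" if "norm z > R" for i j z
    by (rule compact_support_deriv_zero[OF g(1) pz that])
  define M' where "M' = (\<lambda>i j. SOME M. \<forall>z. \<bar>g i j z\<bar> \<le> M)"
  have M': "\<bar>g i j z\<bar> \<le> M' i j" for i j z
  proof -
    have "\<exists>M. \<forall>z. \<bar>g i j z\<bar> \<le> M"
      by (rule compact_support_bounded[OF g(2)[of i j] gz]) blast+
    from someI_ex[OF this] show ?thesis by (simp add: M'_def)
  qed
  define M where "M = (\<Sum>i\<in>UNIV. \<Sum>j\<in>UNIV. \<bar>M' i j\<bar>)"
  have M: "\<bar>g i j z\<bar> \<le> M" for i j z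
  proof -
    have "\<bar>g i j z\<bar> \<le> \<bar>M' i j\<bar>" using M'[where i=i and j=j and z=z] by simp
    also have "\<dots> \<le> (\<Sum>j\<in>UNIV. \<bar>M' i j\<bar>)" by (rule member_le_sum) auto
    also have "\<dots> \<le> M" unfolding M_def by (rule member_le_sum) (auto intro: sum_nonneg)
    finally show ?thesis .
  qed
  have M0: "0 \<le> M" unfolding M_def by (intro sum_nonneg) auto
  have lip: "\<bar>p i y - p i z\<bar> \<le> 3 * M * norm (y - z)" for i y z
    by (rule gradient_bound_lipschitz[OF g(1) M])
  have pc: "continuous_on UNIV (p i)" for i
    using g(1) by (intro continuous_at_imp_continuous_on) (auto intro: has_derivative_continuous)
  show ?thesis by (rule that[OF p(1) pc R0 pz _ lip]) (use M0 in auto)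
qed

lemma gradient_taylor:
  fixes \<phi> :: "real^3 \<Rightarrow> real"
  assumes D: "\<And>z. (\<phi> has_derivative (\<lambda>h. \<Sum>i\<in>UNIV. p i z * h $ i)) (at z)"
    and L: "0 \<le> L" "\<And>i y z. \<bar>p i y - p i z\<bar> \<le> L * norm (y - z)"
  shows "\<bar>\<phi> (w + h) - \<phi> w - (\<Sum>i\<in>UNIV. p i w * h $ i)\<bar> \<le> 3 * L * (norm h)\<^sup>2"
proof -
  let ?F = "\<lambda>v. \<phi> v - (\<Sum>i\<in>UNIV. p i w * v $ i)"
  have "norm (?F (w + h) - ?F w) \<le> 3 * (L * norm h) * norm (w + h - w)"
  proof (rule differentiable_bound[of "cball w (norm h)" ?F "\<lambda>v k. \<Sum>i\<in>UNIV. (p i v - p i w) * k $ i"])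
    fix v assume v: "v \<in> cball w (norm h)"
    have "(?F has_derivative (\<lambda>k. (\<Sum>i\<in>UNIV. p i v * k $ i) - (\<Sum>i\<in>UNIV. p i w * k $ i))) (at v)"
      by (rule has_derivative_diff[OF D])
        (auto intro!: derivative_eq_intros bounded_linear.has_derivative[OF bounded_linear_vec_nth])
    then show "(?F has_derivative (\<lambda>k. \<Sum>i\<in>UNIV. (p i v - p i w) * k $ i)) (at v within cball w (norm h))"
      by (auto simp: left_diff_distrib sum_subtractf intro: has_derivative_at_withinI)
    have "\<bar>p i v - p i w\<bar> \<le> L * norm h" for i
    proof -
      have "\<bar>p i v - p i w\<bar> \<le> L * norm (v - w)" by (rule L(2))
      also have "\<dots> \<le> L * norm h" using v L(1) by (intro mult_left_mono) (auto simp: dist_norm norm_minus_commute)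
      finally show ?thesis .
    qed
    then show "onorm (\<lambda>k. \<Sum>i\<in>UNIV. (p i v - p i w) * k $ i) \<le> 3 * (L * norm h)"
      by (intro onorm_le) (use sum_component_bound[of "\<lambda>i. p i v - p i w" "L * norm h"] in auto)
  qed (auto simp: dist_norm)
  then show ?thesis by (simp add: power2_eq_square algebra_simps sum.distrib)
qed

lemma has_derivative_quadratic:
  fixes F :: "real^3 \<Rightarrow> real"
  assumes "\<And>h. \<bar>F (z + h) - F z - (\<Sum>i\<in>UNIV. q i * h $ i)\<bar> \<le> C * (norm h)\<^sup>2"
  shows "(F has_derivative (\<lambda>h. \<Sum>i\<in>UNIV. q i * h $ i)) (at z)"
  unfolding has_derivative_at
proof
  show "bounded_linear (\<lambda>h. \<Sum>i\<in>UNIV. q i * h $ i)"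
    by (intro bounded_linear_sum bounded_linear_const_mult bounded_linear_vec_nth)
  show "(\<lambda>h. norm (F (z + h) - F z - (\<Sum>i\<in>UNIV. q i * h $ i)) / norm h) \<midarrow>0\<rightarrow> 0"
  proof (rule Lim_null_comparison)
    show "\<forall>\<^sub>F h in at 0. norm (norm (F (z + h) - F z - (\<Sum>i\<in>UNIV. q i * h $ i)) / norm h) \<le> C * norm h"
    proof (rule eventually_mono[OF eventually_neq_at_within[of 0]])
      fix h :: "real^3" assume "h \<noteq> 0"
      then show "norm (norm (F (z + h) - F z - (\<Sum>i\<in>UNIV. q i * h $ i)) / norm h) \<le> C * norm h"
        using assms[of h] by (simp add: divide_le_eq power2_eq_square mult.assoc)
    qed
    have "((\<lambda>h::real^3. C * norm h) \<longlongrightarrow> C * norm (0::real^3)) (at 0)" by (rule tendsto_mult[OF tendsto_const tendsto_norm[OF tendsto_ident_at]])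
    then show "((\<lambda>h::real^3. C * norm h) \<longlongrightarrow> 0) (at 0)" by simp
  qed
qed

text \<open>
  The Gaussian pieces \<open>W\<^sub>t\<close> of the vector field \<open>S v_S\<close>.
\<close>

definition stresslet_field :: "real^3^3 \<Rightarrow> real \<Rightarrow> real^3 \<Rightarrow> real^3" where
  "stresslet_field S t z = (4 * pi\<^sup>2 / 3 * (t * sqrt t) * quad S z * exp (- (pi * t * (norm z)\<^sup>2))) *\<^sub>R (S *v z)"

lemma stresslet_field_bound:
  obtains C where "0 \<le> C" "\<And>t z. 0 < t \<Longrightarrow> norm (stresslet_field S t z) \<le> C * exp (- (t * (norm z)\<^sup>2))"
proof -
  obtain B where B: "0 \<le> B" "\<And>z. norm (S *v z) \<le> B * norm (z :: real^3)" "\<And>z. \<bar>quad S z\<bar> \<le> B * (norm z)\<^sup>2"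
    using matrix_bound by blast
  show ?thesis
  proof (rule that)
    fix t :: real and z :: "real^3" assume t: "0 < t"
    define y where "y = t * (norm z)\<^sup>2"
    have y: "0 \<le> y" using t by (simp add: y_def)
    have sy: "sqrt y \<le> 1 + y"
    proof -
      have "sqrt y \<le> sqrt ((1 + y)\<^sup>2)" using y by (intro real_sqrt_le_mono) (simp add: power2_sum)
      then show ?thesis using y by simp
    qed
    have y2: "y\<^sup>2 \<le> 2 * exp y" using power_le_fact_exp[OF y, of 1 2] by simp
    have y1: "y \<le> exp y" using exp_ge_add_one_self[of y] by linarith
    have tz: "t * sqrt t * (norm z)\<^sup>2 * norm z = y * sqrt y" using t by (simp add: y_def real_sqrt_mult)
    have "y * sqrt y \<le> y * (1 + y)" using sy y by (intro mult_left_mono) auto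
    also have "\<dots> \<le> 3 * exp y" using y1 y2 by (simp add: algebra_simps power2_eq_square)
    finally have y3: "y * sqrt y \<le> 3 * exp y" .
    have "norm (stresslet_field S t z) = 4 * pi\<^sup>2 / 3 * (t * sqrt t) * exp (- (pi * y)) * (\<bar>quad S z\<bar> * norm (S *v z))"
      using t by (simp add: stresslet_field_def abs_mult y_def mult_ac)
    also have "\<dots> \<le> 4 * pi\<^sup>2 / 3 * (t * sqrt t) * exp (- (pi * y)) * ((B * (norm z)\<^sup>2) * (B * norm z))"
      using t B by (intro mult_left_mono mult_mono) auto
    also have "\<dots> = 4 * pi\<^sup>2 / 3 * B\<^sup>2 * exp (- (pi * y)) * (t * sqrt t * (norm z)\<^sup>2 * norm z)"
      by (simp add: power2_eq_square)
    also have "\<dots> \<le> 4 * pi\<^sup>2 / 3 * B\<^sup>2 * exp (- (pi * y)) * (3 * exp y)"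
      unfolding tz by (intro mult_left_mono y3) auto
    also have "\<dots> = 4 * pi\<^sup>2 * B\<^sup>2 * exp (y - pi * y)" by (simp add: exp_add[symmetric])
    also have "\<dots> \<le> 4 * pi\<^sup>2 * B\<^sup>2 * exp (- y)"
    proof (intro mult_left_mono)
      have "2 * y \<le> pi * y" using y pi_gt3 by (intro mult_right_mono) auto
      then show "exp (y - pi * y) \<le> exp (- y)" by simp
    qed auto
    finally show "norm (stresslet_field S t z) \<le> 4 * pi\<^sup>2 * B\<^sup>2 * exp (- (t * (norm z)\<^sup>2))" by (simp add: y_def)
  qed auto
qed

lemma stresslet_field_time_integral:
  assumes z: "z \<noteq> 0"
  shows "(LINT t:{0<..}|lborel. stresslet_field S t z \<bullet> Q) = (S *v v_S S z) \<bullet> Q"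
proof -
  have n: "norm z > 0" using z by simp
  have eq: "stresslet_field S t z \<bullet> Q = 4 * pi\<^sup>2 / 3 * quad S z * ((S *v z) \<bullet> Q) * (t * sqrt t * exp (- (pi * t * (norm z)\<^sup>2)))" for t
    by (simp add: stresslet_field_def)
  have v: "S *v v_S S z = (quad S z / norm z ^ 5) *\<^sub>R (S *v z)"
    by (simp add: v_S_def matrix_vector_mult_scaleR)
  show ?thesis unfolding eq v by (simp add: power_gauss_time_integral(2)[OF n])
qed

text \<open>
  The weak form of \<open>\<gamma>\<^sub>t = - div W\<^sub>t\<close>: the divergence of \<open>\<psi> W\<^sub>t\<close> integrates to \<open>0\<close>. The term of the product
  rule that involves \<open>tr S\<close> vanishes.
\<close>

lemma stresslet_field_divergence:
  fixes \<psi> :: "real^3 \<Rightarrow> real"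
  assumes S: "transpose S = S" "trace S = 0"
    and D: "\<And>z. (\<psi> has_derivative (\<lambda>h. \<Sum>i\<in>UNIV. q i z * h $ i)) (at z)"
    and q: "\<And>i. continuous_on UNIV (q i)" and supp: "\<And>z. norm z > R \<Longrightarrow> \<psi> z = 0"
  shows "(\<integral>z. stresslet_field S t z \<bullet> (\<chi> i. q i z) \<partial>lborel) = (\<integral>z. stresslet_gauss S t z * \<psi> z \<partial>lborel)"
proof -
  let ?k = "4 * pi\<^sup>2 / 3 * (t * sqrt t)"
  let ?E = "\<lambda>z::real^3. exp (- (pi * t * (z \<bullet> z)))"
  let ?d = "\<lambda>i j z. ?k * (2 * (S *v z) $ j * (S *v z) $ i + quad S z * S $ i $ j - 2 * pi * t * quad S z * (S *v z) $ i * z $ j) * ?E z * \<psi> z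
      + ?k * quad S z * (S *v z) $ i * ?E z * q j z"
  have \<psi>c: "continuous_on UNIV \<psi>" using D by (intro continuous_at_imp_continuous_on) (auto intro: has_derivative_continuous)
  have dc: "continuous_on UNIV (?d i j)" for i j
  proof -
    have c1: "continuous_on UNIV (\<lambda>z. (S *v z) $ j)" for j
      by (intro linear_continuous_on bounded_linear_compose[OF bounded_linear_vec_nth matrix_vector_mul_bounded_linear])
    have c2: "continuous_on UNIV (quad S)" by (intro continuous_intros)
    have c3: "continuous_on UNIV ?E" by (intro continuous_intros)
    have c4: "continuous_on UNIV (\<lambda>z::real^3. z $ j)" for j
      by (intro linear_continuous_on bounded_linear_vec_nth)
    show ?thesis
      by (intro continuous_on_mult continuous_on_add continuous_on_diff continuous_on_const c1 c2 c3 c4 \<psi>c q)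
  qed
  have qz: "q i z = 0" if "norm z > R" for i z by (rule compact_support_deriv_zero[OF D supp that])
  have dz: "?d i j z = 0" if "norm z > R" for i j z using supp[OF that] qz[OF that] by simp
  have di: "integrable lborel (?d i j)" for i j by (rule integrable_compact_support[OF dc dz])
  have F: "((\<lambda>z. ?k * quad S z * (S *v z) $ i * ?E z * \<psi> z) has_derivative (\<lambda>h. \<Sum>j\<in>UNIV. ?d i j z * h $ j)) (at z)" for i z
  proof -
    have e: "(?E has_derivative (\<lambda>h. ?E z * (- (2 * pi * t * (z \<bullet> h))))) (at z)"
      by (auto intro!: derivative_eq_intros simp: inner_commute)
    have s: "((\<lambda>z. (S *v z) $ i) has_derivative (\<lambda>h. (S *v h) $ i)) (at z)"
      by (rule bounded_linear.has_derivative[OF bounded_linear_compose[OF bounded_linear_vec_nth matrix_vector_mul_bounded_linear] has_derivative_ident])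
    have qd: "((\<lambda>z. ?k * quad S z) has_derivative (\<lambda>h. ?k * (2 * ((S *v z) \<bullet> h)))) (at z)"
      by (rule has_derivative_mult_right[OF quad_has_derivative[OF S(1)]])
    show ?thesis
      apply (rule has_derivative_eq_rhs)
       apply (rule has_derivative_mult[OF has_derivative_mult[OF has_derivative_mult[OF qd s] e] D])
      apply (rule ext)
      subgoal for h
      proof -
        have a: "(S *v h) $ i = (\<Sum>j\<in>UNIV. S $ i $ j * h $ j)" by (simp add: matrix_vector_mult_def)
        have b: "(S *v z) \<bullet> h = (\<Sum>j\<in>UNIV. (S *v z) $ j * h $ j)" by (simp add: inner_vec_def)
        have c: "z \<bullet> h = (\<Sum>j\<in>UNIV. z $ j * h $ j)" by (simp add: inner_vec_def)
        define w where "w = S *v z"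
        define Q where "Q = quad S z"
        define EE where "EE = ?E z"
        define K where "K = ?k"
        show ?thesis unfolding a b c unfolding K_def[symmetric] w_def[symmetric] Q_def[symmetric] EE_def[symmetric] by (simp add: sum_3 algebra_simps)
      qed
      done
  qed
  have 0: "(\<integral>z. ?d i i z \<partial>lborel) = 0" for i
    by (rule integral_partial_derivative_zero[OF F, of R i]) (use supp dc in auto)
  have sum: "(\<Sum>i\<in>UNIV. ?d i i z) = stresslet_field S t z \<bullet> (\<chi> i. q i z) - stresslet_gauss S t z * \<psi> z" for z
  proof -
    have E: "exp (- (pi * t * (norm z)\<^sup>2)) = ?E z" by (simp add: power2_norm_eq_inner)
    define w where "w = S *v z"
    define Q where "Q = quad S z"
    define EE where "EE = ?E z"
    define K where "K = ?k"
    have Qs: "w $ 1 * z $ 1 + w $ 2 * z $ 2 + w $ 3 * z $ 3 = Q"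
    proof -
      have "Q = z \<bullet> w" unfolding Q_def quad_inner w_def ..
      then show ?thesis by (simp add: inner_vec_def sum_3 mult.commute)
    qed
    have ww: "w $ 1 * w $ 1 + w $ 2 * w $ 2 + w $ 3 * w $ 3 = (norm w)\<^sup>2"
      unfolding norm3_sq by (simp add: power2_eq_square)
    have wq: "w $ 1 * q 1 z + w $ 2 * q 2 z + w $ 3 * q 3 z = w \<bullet> (\<chi> i. q i z)"
      by (simp add: inner_vec_def sum_3)
    have tr: "S $ 1 $ 1 + S $ 2 $ 2 + S $ 3 $ 3 = 0" using S(2) by (simp add: trace_def sum_3)
    have "(\<Sum>i\<in>UNIV. ?d i i z) = K * EE * \<psi> z * (2 * (w $ 1 * w $ 1 + w $ 2 * w $ 2 + w $ 3 * w $ 3)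
        + Q * (S $ 1 $ 1 + S $ 2 $ 2 + S $ 3 $ 3) - 2 * pi * t * Q * (w $ 1 * z $ 1 + w $ 2 * z $ 2 + w $ 3 * z $ 3))
        + K * Q * EE * (w $ 1 * q 1 z + w $ 2 * q 2 z + w $ 3 * q 3 z)"
      unfolding K_def[symmetric] EE_def[symmetric] w_def[symmetric] Q_def[symmetric] by (simp add: sum_3 algebra_simps)
    also have "\<dots> = stresslet_field S t z \<bullet> (\<chi> i. q i z) - stresslet_gauss S t z * \<psi> z"
      unfolding Qs ww wq tr stresslet_field_def stresslet_gauss_def E K_def[symmetric] EE_def[symmetric] w_def[symmetric] Q_def[symmetric]
      by (simp add: algebra_simps power2_eq_square)
    finally show ?thesis .
  qed
  have i1: "integrable lborel (\<lambda>z. stresslet_gauss S t z * \<psi> z)"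
  proof (rule integrable_compact_support)
    show "continuous_on UNIV (\<lambda>z. stresslet_gauss S t z * \<psi> z)"
      unfolding stresslet_gauss_def by (intro continuous_intros \<psi>c)
  qed (use supp in auto)
  have i2: "integrable lborel (\<lambda>z. stresslet_field S t z \<bullet> (\<chi> i. q i z))"
  proof -
    have "integrable lborel (\<lambda>z. (\<Sum>i\<in>UNIV. ?d i i z) + stresslet_gauss S t z * \<psi> z)"
      by (intro Bochner_Integration.integrable_add Bochner_Integration.integrable_sum di i1)
    then show ?thesis unfolding sum by simp
  qed
  have "0 = (\<integral>z. (\<Sum>i\<in>UNIV. ?d i i z) \<partial>lborel)"
    by (subst Bochner_Integration.integral_sum[OF di]) (simp only: 0 sum.neutral_const)
  also have "\<dots> = (\<integral>z. stresslet_field S t z \<bullet> (\<chi> i. q i z) \<partial>lborel) - (\<integral>z. stresslet_gauss S t z * \<psi> z \<partial>lborel)"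
    unfolding sum by (rule Bochner_Integration.integral_diff[OF i2 i1])
  finally show ?thesis by simp
qed

section \<open>The potential represents the convolution\<close>

context stresslet_domain
begin

definition density :: "real^3 \<Rightarrow> real" where "density x = dom x / vol"

lemma measurable_density [measurable]: "density \<in> borel_measurable borel" unfolding density_def by measurable

lemma integrable_density: "integrable lborel density" unfolding density_def using integrable_dom by simp

lemma integral_density: "(\<integral>x. density x \<partial>lborel) = 1"
  unfolding density_def using integral_dom vol_pos by simp

lemma density_nonneg: "0 \<le> density x" using dom_range vol_pos by (simp add: density_def)

lemma integrable_density_mult:
  assumes "f \<in> borel_measurable borel" "\<And>y. \<bar>f y\<bar> \<le> M"
  shows "integrable lborel (\<lambda>y. density y * f y)"
proof (rule Bochner_Integration.integrable_bound[OF integrable_mult_right[OF integrable_density, of M]])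
  show "AE y in lborel. norm (density y * f y) \<le> norm (M * density y)"
  proof (intro AE_I2)
    fix y
    have M: "0 \<le> M" using order_trans[OF abs_ge_zero assms(2)] .
    have "density y * \<bar>f y\<bar> \<le> density y * M" by (intro mult_left_mono assms density_nonneg)
    then show "norm (density y * f y) \<le> norm (M * density y)" using density_nonneg[of y] M by (simp add: abs_mult mult.commute)
  qed
qed (use assms(1) in measurable)

text \<open>
  Averaging against a probability density preserves the quadratic Taylor estimate, so that
  differentiation under the integral sign follows without further limits.
\<close>

lemma density_average_C1:
  assumes p: "\<And>z. (\<phi> has_derivative (\<lambda>h. \<Sum>i\<in>UNIV. p i z * h $ i)) (at z)"
    and pc: "\<And>i. continuous_on UNIV (p i)" and supp: "\<And>z. norm z > R \<Longrightarrow> \<phi> z = 0" "\<And>i z. norm z > R \<Longrightarrow> p i z = 0"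
    and L: "0 \<le> L" "\<And>i y z. \<bar>p i y - p i z\<bar> \<le> L * norm (y - z)"
  defines "\<psi> \<equiv> \<lambda>z. \<integral>y. density y * \<phi> (z + y) \<partial>lborel" and "q \<equiv> \<lambda>i z. \<integral>y. density y * p i (z + y) \<partial>lborel"
  obtains R' where "\<And>z. (\<psi> has_derivative (\<lambda>h. \<Sum>i\<in>UNIV. q i z * h $ i)) (at z)" "\<And>i. continuous_on UNIV (q i)"
    "\<And>z. norm z > R' \<Longrightarrow> \<psi> z = 0"
proof -
  have \<phi>c: "continuous_on UNIV \<phi>" using p by (intro continuous_at_imp_continuous_on) (auto intro: has_derivative_continuous)
  obtain M where M: "\<And>z. \<bar>\<phi> z\<bar> \<le> M" using compact_support_bounded[OF \<phi>c supp(1)] by blast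
  have [measurable]: "\<phi> \<in> borel_measurable borel" "p i \<in> borel_measurable borel" for i
    using \<phi>c pc by (auto intro: borel_measurable_continuous_onI)
  have pM: "\<exists>M. \<forall>z. \<bar>p i z\<bar> \<le> M" for i by (rule compact_support_bounded[OF pc[of i] supp(2)]) blast+
  have i\<phi>: "integrable lborel (\<lambda>y. density y * \<phi> (z + y))" for z
    by (rule integrable_density_mult[OF _ M]) measurable
  have ip: "integrable lborel (\<lambda>y. density y * p i (z + y))" for i z
  proof -
    obtain Mi where Mi: "\<And>z. \<bar>p i z\<bar> \<le> Mi" using pM[of i] by blast
    show ?thesis by (rule integrable_density_mult[OF _ Mi]) measurable
  qed
  have d: "(\<psi> has_derivative (\<lambda>h. \<Sum>i\<in>UNIV. q i z * h $ i)) (at z)" for z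
  proof (rule has_derivative_quadratic)
    fix h :: "real^3"
    have "\<psi> (z + h) - \<psi> z - (\<Sum>i\<in>UNIV. q i z * h $ i) =
       (\<integral>y. density y * \<phi> (z + h + y) - density y * \<phi> (z + y) - (\<Sum>i\<in>UNIV. density y * p i (z + y) * h $ i) \<partial>lborel)"
      unfolding \<psi>_def q_def
      by (subst Bochner_Integration.integral_diff Bochner_Integration.integral_sum, (intro Bochner_Integration.integrable_diff Bochner_Integration.integrable_sum i\<phi> ip integrable_mult_left; fail)+)+ simp
    also have "\<dots> = (\<integral>y. density y * (\<phi> (z + y + h) - \<phi> (z + y) - (\<Sum>i\<in>UNIV. p i (z + y) * h $ i)) \<partial>lborel)"
      by (intro Bochner_Integration.integral_cong refl) (simp add: algebra_simps sum_distrib_left)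
    finally have eq: "\<psi> (z + h) - \<psi> z - (\<Sum>i\<in>UNIV. q i z * h $ i) = \<dots>" .
    have "norm (\<psi> (z + h) - \<psi> z - (\<Sum>i\<in>UNIV. q i z * h $ i)) \<le> (\<integral>y. density y * (3 * L * (norm h)\<^sup>2) \<partial>lborel)"
      unfolding eq
    proof (rule norm_integral_le)
      fix y
      show "norm (density y * (\<phi> (z + y + h) - \<phi> (z + y) - (\<Sum>i\<in>UNIV. p i (z + y) * h $ i))) \<le> density y * (3 * L * (norm h)\<^sup>2)"
        unfolding norm_mult using gradient_taylor[OF p L, of "z + y" h] density_nonneg[of y] by (simp add: mult_left_mono)
    qed (use integrable_density in simp)
    also have "\<dots> = 3 * L * (norm h)\<^sup>2" by (simp add: integral_density)
    finally show "\<bar>\<psi> (z + h) - \<psi> z - (\<Sum>i\<in>UNIV. q i z * h $ i)\<bar> \<le> 3 * L * (norm h)\<^sup>2" by simp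
  qed
  have qc: "continuous_on UNIV (q i)" for i
  proof (rule lipschitz_on_continuous_on)
    show "L-lipschitz_on UNIV (q i)"
    proof (rule lipschitz_onI)
      fix x y :: "real^3"
      have eq: "q i x - q i y = (\<integral>w. density w * (p i (x + w) - p i (y + w)) \<partial>lborel)"
        unfolding q_def right_diff_distrib using ip by simp
      have "norm (q i x - q i y) \<le> (\<integral>w. density w * (L * norm (x - y)) \<partial>lborel)"
        unfolding eq
      proof (rule norm_integral_le)
        fix w
        show "norm (density w * (p i (x + w) - p i (y + w))) \<le> density w * (L * norm (x - y))"
          unfolding norm_mult using L(2)[of i "x + w" "y + w"] density_nonneg[of w] by (simp add: mult_left_mono)
      qed (use integrable_density in simp)
      then show "dist (q i x) (q i y) \<le> L * dist x y" by (simp add: dist_norm integral_density)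
    qed (rule L)
  qed
  obtain Ro where Ro: "\<And>y. y \<in> \<O> \<Longrightarrow> norm y \<le> Ro" using bounded unfolding bounded_iff by auto
  have s: "\<psi> z = 0" if z: "norm z > R + Ro" for z
  proof -
    have "density y * \<phi> (z + y) = 0" for y
    proof (cases "y \<in> \<O>")
      case True
      have "norm z \<le> norm (z + y) + norm y" using norm_triangle_ineq4[of "z + y" y] by simp
      then have "norm (z + y) > R" using z Ro[OF True] by simp
      then show ?thesis using supp(1) by simp
    qed (simp add: density_def dom_def)
    then show ?thesis unfolding \<psi>_def by (simp only: Bochner_Integration.integral_zero)
  qed
  show ?thesis by (rule that[OF d qc s])
qed

text \<open>
  Convolution moved from the test function to the kernel, by Fubini and translation.
\<close>

lemma gauss_pot_average:
  assumes t: "t > 0" and \<phi>c: "continuous_on UNIV \<phi>" and supp: "\<And>z. norm z > R \<Longrightarrow> \<phi> z = 0"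
  shows "(\<integral>z. stresslet_gauss S t z * (\<integral>y. density y * \<phi> (z + y) \<partial>lborel) \<partial>lborel) = (\<integral>x. gauss_pot t x * \<phi> x \<partial>lborel) / vol"
proof -
  obtain M where M: "0 \<le> M" "\<And>z. \<bar>\<phi> z\<bar> \<le> M" by (rule compact_support_bounded[OF \<phi>c supp]) blast+
  have [measurable]: "\<phi> \<in> borel_measurable borel" using \<phi>c by (rule borel_measurable_continuous_onI)
  have \<phi>i: "integrable lborel \<phi>" by (rule integrable_compact_support[OF \<phi>c supp])
  note gi = integrable_stresslet_gauss[OF S t]
  let ?g = "stresslet_gauss S t"
  let ?f = "\<lambda>z y. ?g z * (density y * \<phi> (z + y))"
  have dm: "integrable lborel (\<lambda>y. density y * \<phi> (z + y))" for z by (rule integrable_density_mult[OF _ M(2)]) measurable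
  have I1: "integrable (lborel \<Otimes>\<^sub>M lborel) (case_prod ?f)"
  proof (rule lborel_pair.integrable_prod_bounded[where g="\<lambda>z. \<bar>?g z\<bar> * M"])
    show "AE z in lborel. (\<integral>y. norm (?f z y) \<partial>lborel) \<le> \<bar>?g z\<bar> * M"
    proof (intro AE_I2)
      fix z
      have "(\<integral>y. norm (?f z y) \<partial>lborel) = \<bar>?g z\<bar> * (\<integral>y. density y * \<bar>\<phi> (z + y)\<bar> \<partial>lborel)"
        using density_nonneg by (simp add: abs_mult)
      also have "\<dots> \<le> \<bar>?g z\<bar> * (\<integral>y. density y * M \<partial>lborel)"
      proof (intro mult_left_mono integral_mono)
        show "integrable lborel (\<lambda>y. density y * \<bar>\<phi> (z + y)\<bar>)"
          by (rule integrable_density_mult[where M=M]) (use M in auto)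
      qed (use integrable_density M density_nonneg in \<open>auto intro: mult_left_mono\<close>)
      also have "\<dots> = \<bar>?g z\<bar> * M" by (simp add: integral_density)
      finally show "(\<integral>y. norm (?f z y) \<partial>lborel) \<le> \<bar>?g z\<bar> * M" .
    qed
    show "integrable lborel (\<lambda>z. \<bar>?g z\<bar> * M)" using gi by (intro integrable_mult_left integrable_abs)
    show "AE z in lborel. integrable lborel (?f z)" by (intro AE_I2 integrable_mult_right dm)
  qed measurable
  let ?h = "\<lambda>y x. density y * (?g (x - y) * \<phi> x)"
  obtain C where C: "0 \<le> C" "\<And>t z. 0 < t \<Longrightarrow> \<bar>stresslet_gauss S t z\<bar> \<le> C * sqrt t * exp (- (2 * t * (norm z)\<^sup>2))"
    using stresslet_gauss_bound by metis
  have b: "\<bar>?g z\<bar> \<le> C * sqrt t" for z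
    using C(1) t by (auto intro!: order_trans[OF C(2)[OF t, of z]] mult_left_le)
  have hb: "norm (?g (x - y) * \<phi> x) \<le> C * sqrt t * \<bar>\<phi> x\<bar>" for x y
    unfolding norm_mult using b[of "x - y"] by (simp add: mult_right_mono)
  have hi: "integrable lborel (\<lambda>x. ?g (x - y) * \<phi> x)" for y
    by (rule Bochner_Integration.integrable_bound[OF integrable_mult_right[OF integrable_abs[OF \<phi>i], of "C * sqrt t"]])
      (use hb in \<open>auto intro: order_trans[OF _ abs_ge_self]\<close>)
  have I2: "integrable (lborel \<Otimes>\<^sub>M lborel) (case_prod ?h)"
  proof (rule lborel_pair.integrable_prod_bounded[where g="\<lambda>y. density y * (C * sqrt t * (\<integral>x. \<bar>\<phi> x\<bar> \<partial>lborel))"])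
    show "AE y in lborel. (\<integral>x. norm (?h y x) \<partial>lborel) \<le> density y * (C * sqrt t * (\<integral>x. \<bar>\<phi> x\<bar> \<partial>lborel))"
    proof (intro AE_I2)
      fix y
      have "(\<integral>x. norm (?h y x) \<partial>lborel) = density y * (\<integral>x. norm (?g (x - y) * \<phi> x) \<partial>lborel)"
        using density_nonneg by (simp add: abs_mult)
      also have "\<dots> \<le> density y * (\<integral>x. C * sqrt t * \<bar>\<phi> x\<bar> \<partial>lborel)"
        by (intro mult_left_mono integral_mono integrable_norm hi density_nonneg hb integrable_mult_right integrable_abs \<phi>i)
      also have "\<dots> = density y * (C * sqrt t * (\<integral>x. \<bar>\<phi> x\<bar> \<partial>lborel))" by simp
      finally show "(\<integral>x. norm (?h y x) \<partial>lborel) \<le> density y * (C * sqrt t * (\<integral>x. \<bar>\<phi> x\<bar> \<partial>lborel))" .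
    qed
    show "integrable lborel (\<lambda>y. density y * (C * sqrt t * (\<integral>x. \<bar>\<phi> x\<bar> \<partial>lborel)))" by (intro integrable_mult_left integrable_density)
    show "AE y in lborel. integrable lborel (?h y)" by (intro AE_I2 integrable_mult_right hi)
  qed measurable
  have "(\<integral>z. ?g z * (\<integral>y. density y * \<phi> (z + y) \<partial>lborel) \<partial>lborel) = (\<integral>z. (\<integral>y. ?f z y \<partial>lborel) \<partial>lborel)" by simp
  also have "\<dots> = (\<integral>y. (\<integral>z. ?f z y \<partial>lborel) \<partial>lborel)" by (rule lborel_pair.Fubini_integral[OF I1, symmetric])
  also have "\<dots> = (\<integral>y. (\<integral>x. ?h y x \<partial>lborel) \<partial>lborel)"
  proof (rule Bochner_Integration.integral_cong[OF refl])
    fix y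
    have "(\<integral>z. ?f z y \<partial>lborel) = (\<integral>z. density y * (?g ((y + z) - y) * \<phi> (y + z)) \<partial>lborel)"
      by (intro Bochner_Integration.integral_cong refl) (simp add: add.commute mult_ac)
    also have "\<dots> = (\<integral>x. ?h y x \<partial>lborel)" by (rule lborel_integral_translate) measurable
    finally show "(\<integral>z. ?f z y \<partial>lborel) = (\<integral>x. ?h y x \<partial>lborel)" .
  qed
  also have "\<dots> = (\<integral>x. (\<integral>y. ?h y x \<partial>lborel) \<partial>lborel)" by (rule lborel_pair.Fubini_integral[OF I2, symmetric])
  also have "\<dots> = (\<integral>x. gauss_pot t x * \<phi> x / vol \<partial>lborel)"
  proof (rule Bochner_Integration.integral_cong[OF refl])
    fix x
    have "(\<integral>y. ?h y x \<partial>lborel) = (\<integral>y. (\<phi> x / vol) * (?g (x - y) * dom y) \<partial>lborel)"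
      by (intro Bochner_Integration.integral_cong refl) (simp add: density_def mult_ac)
    also have "\<dots> = (\<phi> x / vol) * gauss_pot t x" unfolding gauss_pot_def by (rule integral_mult_right_zero)
    finally show "(\<integral>y. ?h y x \<partial>lborel) = gauss_pot t x * \<phi> x / vol" by simp
  qed
  also have "\<dots> = (\<integral>x. gauss_pot t x * \<phi> x \<partial>lborel) / vol" by simp
  finally show ?thesis .
qed

text \<open>
  The distribution pairs \<open>S v_S\<close> with the gradient of \<open>\<psi>\<close>, without any term at the origin. Writing
  \<open>S v_S\<close> as the time integral of the smooth fields \<open>W\<^sub>t\<close> and integrating each of them by parts gives
  the time integral of the pairings with \<open>\<gamma>\<^sub>t\<close>, in this order of integration: the Dirac mass of the
  distribution is hidden in the exchange.
\<close>

lemma stresslet_distribution: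
  assumes D: "\<And>z. (\<psi> has_derivative (\<lambda>h. \<Sum>i\<in>UNIV. q i z * h $ i)) (at z)"
    and q: "\<And>i. continuous_on UNIV (q i)" and supp: "\<And>z. norm z > R \<Longrightarrow> \<psi> z = 0"
  shows "g_S_distr S \<psi> = (LINT t:{0<..}|lborel. (\<integral>z. stresslet_gauss S t z * \<psi> z \<partial>lborel))"
proof -
  let ?Q = "\<lambda>z. \<chi> i. q i z"
  have qz: "q i z = 0" if "norm z > R" for i z by (rule compact_support_deriv_zero[OF D supp that])
  have Qc: "continuous_on UNIV ?Q" by (rule continuous_on_vec_lambda) (use q in auto)
  have nc: "continuous_on UNIV (\<lambda>z. norm (?Q z))" by (intro continuous_intros Qc)
  have nz: "norm (?Q z) = 0" if "norm z > R" for z using qz[OF that] by (simp add: vec_eq_iff)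
  obtain M where M: "0 \<le> M" "\<And>z. \<bar>norm (?Q z)\<bar> \<le> M" by (rule compact_support_bounded[OF nc nz]) blast+
  have Ni: "integrable lborel (\<lambda>z. norm (?Q z))" by (rule integrable_compact_support[OF nc nz])
  have [measurable]: "?Q \<in> borel_measurable borel" by (rule borel_measurable_continuous_onI[OF Qc])
  have gr: "grad \<psi> z = ?Q z" for z
    unfolding grad_def frechet_derivative_at[OF D, symmetric]
    by (simp add: vec_eq_iff axis_def if_distrib[of "\<lambda>z. _ * z"] cong: if_cong)
  have pt: "((1/2) *\<^sub>R (outer (v_S S z) (grad \<psi> z) + outer (grad \<psi> z) (v_S S z))) \<bullet> S = (S *v v_S S z) \<bullet> ?Q z" for z
  proof -
    have o: "outer a b \<bullet> S = (S *v b) \<bullet> a" for a b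
      by (simp add: inner_vec_def outer_def matrix_vector_mult_def sum_distrib_left sum_distrib_right mult_ac)
    have "(S *v ?Q z) \<bullet> v_S S z = (S *v v_S S z) \<bullet> ?Q z"
      using sym_matrix_inner[OF S(1), of "v_S S z" "?Q z"] by (simp add: inner_commute)
    then show ?thesis unfolding gr inner_scaleR_left inner_add_left o by simp
  qed
  obtain C where C: "0 \<le> C" "\<And>t z. 0 < t \<Longrightarrow> norm (stresslet_field S t z) \<le> C * exp (- (t * (norm z)\<^sup>2))"
    using stresslet_field_bound by metis
  let ?f = "\<lambda>t z. indicator {0<..} t * (stresslet_field S t z \<bullet> ?Q z)"
  have fb: "\<bar>stresslet_field S t z \<bullet> ?Q z\<bar> \<le> C * exp (- (t * (norm z)\<^sup>2)) * norm (?Q z)" if "0 < t" for t z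
    by (rule order_trans[OF Cauchy_Schwarz_ineq2]) (intro mult_right_mono C(2) that norm_ge_zero)
  \<comment> \<open>Two bounds, for small and for large times: the field is bounded uniformly in time, and its integral over space decays like \<open>t\<^bsup>-3/2\<^esup>\<close>.\<close>
  have fb1: "\<bar>stresslet_field S t z \<bullet> ?Q z\<bar> \<le> C * norm (?Q z)" if "0 < t" for t z
    using C(1) that by (auto intro!: order_trans[OF fb[OF that]] mult_right_mono mult_left_le)
  have fb2: "\<bar>stresslet_field S t z \<bullet> ?Q z\<bar> \<le> C * M * exp (- (1 * t * (norm z)\<^sup>2))" if "0 < t" for t z
    using C(1) M(2)[of z] by (auto intro!: order_trans[OF fb[OF that]] simp: mult.assoc mult.commute[of M] intro!: mult_left_mono)
  have Wm: "(\<lambda>p. stresslet_field S (fst p) (snd p)) \<in> borel_measurable (lborel \<Otimes>\<^sub>M lborel)"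
    unfolding stresslet_field_def by measurable
  have fm: "(\<lambda>z. stresslet_field S t z \<bullet> ?Q z) \<in> borel_measurable borel" for t
    unfolding stresslet_field_def by measurable
  have fi: "integrable lborel (\<lambda>z. stresslet_field S t z \<bullet> ?Q z)" if "0 < t" for t
    by (rule Bochner_Integration.integrable_bound[OF integrable_mult_right[OF Ni, of C]])
      (use fb1[OF that] fm C in \<open>auto\<close>)
  define K where "K = C * (\<integral>z. norm (?Q z) \<partial>lborel) + C * M * (pi * sqrt pi)"
  have K1: "C * (\<integral>z. norm (?Q z) \<partial>lborel) \<le> K" "C * M * (pi * sqrt pi) \<le> K" "0 \<le> K"
    using C M by (auto simp: K_def)
  have I: "integrable (lborel \<Otimes>\<^sub>M lborel) (case_prod ?f)"
  proof (rule lborel_pair.integrable_prod_bounded[OF _ _ _ integrable_time_bound[of K]])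
    show "case_prod ?f \<in> borel_measurable (lborel \<Otimes>\<^sub>M lborel)" using Wm unfolding split_beta' by measurable
    show "AE t in lborel. integrable lborel (?f t)"
    proof (intro AE_I2)
      fix t show "integrable lborel (?f t)" using fi[of t] by (cases "0 < t") auto
    qed
    show "AE t in lborel. (\<integral>z. norm (?f t z) \<partial>lborel) \<le> indicator {0<..} t * (K * time_bound t)"
    proof (intro AE_I2)
      fix t :: real
      show "(\<integral>z. norm (?f t z) \<partial>lborel) \<le> indicator {0<..} t * (K * time_bound t)"
      proof (cases "0 < t")
        case t: True
        have "(\<integral>z. norm (?f t z) \<partial>lborel) \<le> K * time_bound t"
        proof (cases "t \<le> 1")
          case True
          have "(\<integral>z. norm (?f t z) \<partial>lborel) \<le> (\<integral>z. C * norm (?Q z) \<partial>lborel)"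
            by (rule integral_mono) (use t fi fb1 Ni in auto)
          also have "\<dots> = C * (\<integral>z. norm (?Q z) \<partial>lborel) * 1" by simp
          also have "\<dots> \<le> K * time_bound t" using K1 sqrt_le_time_bound(2)[OF t True] by (intro mult_mono) auto
          finally show ?thesis .
        next
          case False
          have "(\<integral>z. norm (?f t z) \<partial>lborel) \<le> (\<integral>z. C * M * exp (- (1 * t * (norm z)\<^sup>2)) \<partial>(lborel :: (real^3) measure))"
            by (rule integral_mono) (use t fi fb2 gauss3_integral(1)[OF t] in auto)
          also have "\<dots> = C * M * (\<integral>z. exp (- (1 * t * (norm z)\<^sup>2)) \<partial>(lborel :: (real^3) measure))"
            by (rule integral_mult_right_zero)
          also have "\<dots> \<le> C * M * (pi * sqrt pi / (t * sqrt t))" using C M t by (intro mult_left_mono gauss3_scaled_le) auto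
          also have "\<dots> = C * M * (pi * sqrt pi) * (1 / (t * sqrt t))" by simp
          also have "\<dots> \<le> K * time_bound t"
            using K1 t inverse_le_time_bound[of t] False by (intro mult_mono) auto
          finally show ?thesis .
        qed
        then show ?thesis using t by simp
      qed simp
    qed
  qed
  have "g_S_distr S \<psi> = (\<integral>z. (S *v v_S S z) \<bullet> ?Q z \<partial>lborel)" unfolding g_S_distr_def pt ..
  also have "\<dots> = (\<integral>z. (\<integral>t. ?f t z \<partial>lborel) \<partial>lborel)"
  proof (rule integral_cong_AE)
    show "AE z in lborel. (S *v v_S S z) \<bullet> ?Q z = (\<integral>t. ?f t z \<partial>lborel)"
      using AE_lborel_singleton[of "0::real^3"]
    proof eventually_elim
      case (elim z)
      show ?case using stresslet_field_time_integral[OF elim, of S "?Q z"] by (simp add: set_lebesgue_integral_def)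
    qed
    show "(\<lambda>z. \<integral>t. ?f t z \<partial>lborel) \<in> borel_measurable lborel"
      using borel_measurable_integrable[OF lborel_pair.integrable_snd[OF I]] .
    show "(\<lambda>z. (S *v v_S S z) \<bullet> ?Q z) \<in> borel_measurable lborel" unfolding v_S_def by measurable
  qed
  also have "\<dots> = (\<integral>t. (\<integral>z. ?f t z \<partial>lborel) \<partial>lborel)" by (rule lborel_pair.Fubini_integral[OF I])
  also have "\<dots> = (LINT t:{0<..}|lborel. (\<integral>z. stresslet_gauss S t z * \<psi> z \<partial>lborel))"
    using stresslet_field_divergence[OF S D q supp] by (simp add: set_lebesgue_integral_def)
  finally show ?thesis .
qed

theorem stresslet_pot_is_conv: "is_g_S_conv S density (\<lambda>x. stresslet_pot x / vol)"
  unfolding is_g_S_conv_def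
proof (intro conjI allI impI)
  show "(\<lambda>x. stresslet_pot x / vol) \<in> borel_measurable lborel" by measurable
  show "integrable lborel (\<lambda>x. (stresslet_pot x / vol)\<^sup>2)"
    using stresslet_pot_square_integrable by (simp add: power_divide)
  fix \<phi> assume "test_function \<phi>"
  then obtain p R L where p: "\<And>z. (\<phi> has_derivative (\<lambda>h. \<Sum>i\<in>UNIV. p i z * h $ i)) (at z)"
    "\<And>i. continuous_on UNIV (p i)" "\<And>z. norm z > R \<Longrightarrow> \<phi> z = 0" "\<And>i z. norm z > R \<Longrightarrow> p i z = 0"
    "0 \<le> L" "\<And>i y z. \<bar>p i y - p i z\<bar> \<le> L * norm (y - z)"
    using test_function_lipschitz_gradient by blast
  have \<phi>c: "continuous_on UNIV \<phi>" using p(1) by (intro continuous_at_imp_continuous_on) (auto intro: has_derivative_continuous)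
  obtain M where M: "\<And>z. \<bar>\<phi> z\<bar> \<le> M" by (rule compact_support_bounded[OF \<phi>c p(3)]) blast+
  let ?\<psi> = "\<lambda>z. \<integral>y. density y * \<phi> (z + y) \<partial>lborel"
  obtain R' where R': "\<And>z. (?\<psi> has_derivative (\<lambda>h. \<Sum>i\<in>UNIV. (\<integral>y. density y * p i (z + y) \<partial>lborel) * h $ i)) (at z)"
    "\<And>i. continuous_on UNIV (\<lambda>z. \<integral>y. density y * p i (z + y) \<partial>lborel)" "\<And>z. norm z > R' \<Longrightarrow> ?\<psi> z = 0"
    using density_average_C1[OF p] by blast
  have "g_S_distr S ?\<psi> = (LINT t:{0<..}|lborel. (\<integral>z. stresslet_gauss S t z * ?\<psi> z \<partial>lborel))"
    by (rule stresslet_distribution[OF R'])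
  also have "\<dots> = (LINT t:{0<..}|lborel. (\<integral>x. gauss_pot t x * \<phi> x \<partial>lborel) / vol)"
    by (rule set_lebesgue_integral_cong) (use gauss_pot_average[OF _ \<phi>c p(3)] in auto)
  also have "\<dots> = (LINT t:{0<..}|lborel. (\<integral>x. gauss_pot t x * \<phi> x \<partial>lborel)) / vol"
    by (rule set_integral_divide_zero)
  also have "(LINT t:{0<..}|lborel. (\<integral>x. gauss_pot t x * \<phi> x \<partial>lborel)) = (\<integral>x. stresslet_pot x * \<phi> x \<partial>lborel)"
    by (rule stresslet_pot_pairing(1)[OF integrable_compact_support[OF \<phi>c p(3)] M, symmetric])
  finally show "(\<integral>x. stresslet_pot x / vol * \<phi> x \<partial>lborel) = g_S_distr S ?\<psi>" by simp
qed

end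

section \<open>Test functions exhausting an open set, and the energy\<close>

text \<open>
  The functions \<open>t\<^bsup>-m\<^esup> exp(-1/t)\<close> on \<open>t > 0\<close>, extended by \<open>0\<close>. Up to linear combinations the family is closed
  under differentiation, which makes smoothness provable by induction on the order.
\<close>

definition exp_inv_deriv :: "nat \<Rightarrow> real \<Rightarrow> real" where
  "exp_inv_deriv m t = (if t > 0 then exp (- (1/t)) / t ^ m else 0)"

lemma exp_inv_le:
  fixes t :: real
  assumes "t > 0"
  shows "exp (- (1/t)) \<le> fact n * t ^ n"
proof -
  have "(1/t) ^ n \<le> fact n / 1 ^ n * exp (1 * (1/t))" by (rule power_le_fact_exp) (use assms in auto)
  then have "1 \<le> fact n * exp (1/t) * t ^ n" using assms by (simp add: power_divide divide_le_eq)
  then show ?thesis using assms by (simp add: exp_minus field_simps)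
qed

lemma exp_inv_deriv_derivative:
  "(exp_inv_deriv m has_real_derivative exp_inv_deriv (m + 2) t - real m * exp_inv_deriv (m + 1) t) (at t)"
proof -
  consider "t > 0" | "t < 0" | "t = 0" by linarith
  then show ?thesis
  proof cases
    case 1
    have "((\<lambda>t. exp (- (1/t)) / t ^ m) has_real_derivative exp_inv_deriv (m + 2) t - real m * exp_inv_deriv (m + 1) t) (at t)"
      using 1 by (auto intro!: derivative_eq_intros simp: exp_inv_deriv_def power2_eq_square divide_simps)
        (cases m; simp add: algebra_simps)
    then show ?thesis
      by (rule has_field_derivative_transform_within_open[of _ _ _ "{0<..}"]) (use 1 in \<open>auto simp: exp_inv_deriv_def\<close>)
  next
    case 2
    have "((\<lambda>t. 0) has_real_derivative exp_inv_deriv (m + 2) t - real m * exp_inv_deriv (m + 1) t) (at t)"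
      using 2 by (simp add: exp_inv_deriv_def)
    then show ?thesis
      by (rule has_field_derivative_transform_within_open[of _ _ _ "{..<0}"]) (use 2 in \<open>auto simp: exp_inv_deriv_def\<close>)
  next
    case 3
    have "(exp_inv_deriv m has_real_derivative 0) (at 0)"
    proof (rule DERIV_quadratic_remainder[of 1 _ _ _ "fact (m + 2)"])
      fix h :: real assume "\<bar>h\<bar> \<le> 1"
      show "\<bar>exp_inv_deriv m (0 + h) - exp_inv_deriv m 0 - h * 0\<bar> \<le> fact (m + 2) * h\<^sup>2"
      proof (cases "h > 0")
        case True
        have "exp (- (1/h)) / h ^ m \<le> fact (m + 2) * h ^ (m + 2) / h ^ m"
          using exp_inv_le[OF True, of "m + 2"] True by (intro divide_right_mono) auto
        also have "\<dots> = fact (m + 2) * h\<^sup>2" using True by (simp add: power_add power2_eq_square)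
        finally show ?thesis using True by (simp add: exp_inv_deriv_def)
      qed (simp add: exp_inv_deriv_def)
    qed auto
    then show ?thesis using 3 by (simp add: exp_inv_deriv_def)
  qed
qed

lemma Ck_on_const: "Ck_on n UNIV (\<lambda>z. c)"
proof (induction n arbitrary: c)
  case (Suc n)
  show ?case unfolding Ck_on.simps
    by (rule exI[of _ "\<lambda>i z. 0"]) (use Suc[of 0] in auto)
qed simp

lemma Ck_on_imp_continuous: "Ck_on n UNIV f \<Longrightarrow> continuous_on UNIV f"
proof (induction n)
  case (Suc n)
  then obtain g :: "3 \<Rightarrow> real^3 \<Rightarrow> real" where "\<And>x. (f has_derivative (\<lambda>h. \<Sum>i\<in>UNIV. g i x * h $ i)) (at x)" by auto
  then show ?case by (intro continuous_at_imp_continuous_on) (auto intro: has_derivative_continuous)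
qed simp

lemma Ck_on_add: "Ck_on n UNIV f \<Longrightarrow> Ck_on n UNIV g \<Longrightarrow> Ck_on n UNIV (\<lambda>z. f z + g z)"
proof (induction n arbitrary: f g)
  case (Suc n)
  then obtain f' g' :: "3 \<Rightarrow> real^3 \<Rightarrow> real" where
    f': "\<And>x. (f has_derivative (\<lambda>h. \<Sum>i\<in>UNIV. f' i x * h $ i)) (at x)" "\<And>i. Ck_on n UNIV (f' i)" and
    g': "\<And>x. (g has_derivative (\<lambda>h. \<Sum>i\<in>UNIV. g' i x * h $ i)) (at x)" "\<And>i. Ck_on n UNIV (g' i)" by auto
  show ?case unfolding Ck_on.simps
  proof (intro exI[of _ "\<lambda>i z. f' i z + g' i z"] conjI ballI allI)
    show "((\<lambda>z. f z + g z) has_derivative (\<lambda>h. \<Sum>i\<in>UNIV. (f' i x + g' i x) * h $ i)) (at x)" for x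
      using has_derivative_add[OF f'(1) g'(1)] by (simp add: distrib_right sum.distrib)
  qed (intro Suc.IH f' g')
qed (auto intro: continuous_intros)

lemma Ck_on_Suc_imp: "Ck_on (Suc n) UNIV f \<Longrightarrow> Ck_on n UNIV f"
proof (induction n arbitrary: f)
  case 0
  then show ?case using Ck_on_imp_continuous[of "Suc 0" f] by simp
next
  case (Suc n)
  from Suc.prems obtain g :: "3 \<Rightarrow> real^3 \<Rightarrow> real" where g: "\<And>x. (f has_derivative (\<lambda>h. \<Sum>i\<in>UNIV. g i x * h $ i)) (at x)" "\<And>i. Ck_on (Suc n) UNIV (g i)"
    using Ck_on.simps(2)[of "Suc n" UNIV f] by auto
  show ?case unfolding Ck_on.simps
    by (intro exI[of _ g] conjI ballI allI g(1) Suc.IH g(2))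
qed

lemma Ck_on_mult: "Ck_on n UNIV f \<Longrightarrow> Ck_on n UNIV g \<Longrightarrow> Ck_on n UNIV (\<lambda>z. f z * g z)"
proof (induction n arbitrary: f g)
  case (Suc n)
  then obtain f' g' :: "3 \<Rightarrow> real^3 \<Rightarrow> real" where
    f': "\<And>x. (f has_derivative (\<lambda>h. \<Sum>i\<in>UNIV. f' i x * h $ i)) (at x)" "\<And>i. Ck_on n UNIV (f' i)" and
    g': "\<And>x. (g has_derivative (\<lambda>h. \<Sum>i\<in>UNIV. g' i x * h $ i)) (at x)" "\<And>i. Ck_on n UNIV (g' i)" by auto
  have fg: "Ck_on n UNIV f" "Ck_on n UNIV g" by (rule Ck_on_Suc_imp[OF Suc.prems(1)], rule Ck_on_Suc_imp[OF Suc.prems(2)])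
  show ?case unfolding Ck_on.simps
  proof (intro exI[of _ "\<lambda>i z. f z * g' i z + f' i z * g z"] conjI ballI allI)
    show "((\<lambda>z. f z * g z) has_derivative (\<lambda>h. \<Sum>i\<in>UNIV. (f x * g' i x + f' i x * g x) * h $ i)) (at x)" for x
      by (rule has_derivative_eq_rhs[OF has_derivative_mult[OF f'(1) g'(1)]]) (simp add: fun_eq_iff sum_3 algebra_simps)
  qed (intro Ck_on_add Suc.IH f' g' fg)
qed (auto intro: continuous_intros)

lemma smooth_on_mult: "smooth_on UNIV f \<Longrightarrow> smooth_on UNIV g \<Longrightarrow> smooth_on UNIV (\<lambda>z. f z * g z)"
  by (simp add: smooth_on_def Ck_on_mult)

lemma smooth_on_const: "smooth_on UNIV (\<lambda>z. c)" by (simp add: smooth_on_def Ck_on_const)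

lemma smooth_on_one_minus: "smooth_on UNIV f \<Longrightarrow> smooth_on UNIV (\<lambda>z. 1 - f z)"
  using Ck_on_add[OF Ck_on_const[of _ 1] Ck_on_mult[OF Ck_on_const[of _ "-1"]]] by (simp add: smooth_on_def)

lemma smooth_on_prod: "(\<And>i. i \<in> I \<Longrightarrow> smooth_on UNIV (f i)) \<Longrightarrow> smooth_on UNIV (\<lambda>z. \<Prod>i\<in>I. f i z)"
  by (induction I rule: infinite_finite_induct) (auto intro: smooth_on_const smooth_on_mult)

lemma smooth_on_exp_inv_coord:
  "smooth_on UNIV (\<lambda>z. exp_inv_deriv m (\<alpha> * z $ i + \<beta>))"
proof -
  have "Ck_on n UNIV (\<lambda>z. exp_inv_deriv m (\<alpha> * z $ i + \<beta>))" for n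
  proof (induction n arbitrary: m)
    case 0
    have "continuous_on UNIV (exp_inv_deriv m)"
      by (intro continuous_at_imp_continuous_on ballI DERIV_isCont[OF exp_inv_deriv_derivative])
    moreover have "continuous_on UNIV (\<lambda>z::real^3. \<alpha> * z $ i + \<beta>)"
      by (intro continuous_on_add continuous_on_mult continuous_on_const linear_continuous_on bounded_linear_vec_nth)
    ultimately show ?case using continuous_on_compose2[of UNIV "exp_inv_deriv m" UNIV "\<lambda>z. \<alpha> * z $ i + \<beta>"] by simp
  next
    case (Suc n)
    let ?D = "\<lambda>z. \<alpha> * (exp_inv_deriv (m + 2) (\<alpha> * z $ i + \<beta>) + (- real m) * exp_inv_deriv (m + 1) (\<alpha> * z $ i + \<beta>))"
    show ?case unfolding Ck_on.simps
    proof (intro exI[of _ "\<lambda>j z. if j = i then ?D z else 0"] conjI ballI allI)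
      fix x :: "real^3"
      have a: "((\<lambda>z::real^3. \<alpha> * z $ i + \<beta>) has_derivative (\<lambda>h. \<alpha> * h $ i)) (at x)"
        by (auto intro!: derivative_eq_intros bounded_linear.has_derivative[OF bounded_linear_vec_nth])
      have "(exp_inv_deriv m has_derivative (*) (exp_inv_deriv (m + 2) (\<alpha> * x $ i + \<beta>) - real m * exp_inv_deriv (m + 1) (\<alpha> * x $ i + \<beta>))) (at (\<alpha> * x $ i + \<beta>))"
        using exp_inv_deriv_derivative[of m "\<alpha> * x $ i + \<beta>"] by (simp add: has_field_derivative_def)
      from has_derivative_compose[OF a this]
      have "((\<lambda>z. exp_inv_deriv m (\<alpha> * z $ i + \<beta>)) has_derivative (\<lambda>h. ?D x * h $ i)) (at x)"
        by (simp add: algebra_simps)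
      moreover have "(\<Sum>j\<in>UNIV. (if j = i then ?D x else 0) * h $ j) = ?D x * h $ i" for h :: "real^3"
        by (simp add: if_distrib[of "\<lambda>z. z * _"] cong: if_cong)
      ultimately show "((\<lambda>z. exp_inv_deriv m (\<alpha> * z $ i + \<beta>)) has_derivative (\<lambda>h. \<Sum>j\<in>UNIV. (if j = i then ?D x else 0) * h $ j)) (at x)"
        by simp
    next
      fix j
      show "Ck_on n UNIV (\<lambda>z. if j = i then ?D z else 0)"
      proof (cases "j = i")
        case True
        show ?thesis unfolding True simp_thms if_True by (intro Ck_on_mult Ck_on_add Ck_on_const Suc.IH)
      qed (simp only: if_False Ck_on_const)
    qed
  qed
  then show ?thesis by (simp add: smooth_on_def)
qed

text \<open>
  The factors are \<open>exp(-1/((n+1)(z\<^sub>i - a\<^sub>i)))\<close> and its mirror image, so the function is supported in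
  the box and increases to \<open>1\<close> inside as \<open>n\<close> grows.
\<close>

definition box_bump :: "nat \<Rightarrow> real^3 \<Rightarrow> real^3 \<Rightarrow> real^3 \<Rightarrow> real" where
  "box_bump n a b z = (\<Prod>i\<in>UNIV. exp_inv_deriv 0 (real (Suc n) * z $ i + - (real (Suc n) * a $ i))
      * exp_inv_deriv 0 (- real (Suc n) * z $ i + real (Suc n) * b $ i))"

lemma smooth_box_bump: "smooth_on UNIV (box_bump n a b)"
  unfolding box_bump_def[abs_def] by (intro smooth_on_prod smooth_on_mult smooth_on_exp_inv_coord)

lemma exp_inv_0_range: "0 \<le> exp_inv_deriv 0 t" "exp_inv_deriv 0 t \<le> 1"
  by (auto simp: exp_inv_deriv_def)

lemma box_bump_range: "0 \<le> box_bump n a b z" "box_bump n a b z \<le> 1"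
  unfolding box_bump_def
  by (auto intro!: prod_nonneg prod_le_1 mult_nonneg_nonneg mult_le_one exp_inv_0_range)

lemma box_bump_outside:
  assumes "z \<notin> box a b" shows "box_bump n a b z = 0"
proof -
  obtain i where i: "z $ i \<le> a $ i \<or> b $ i \<le> z $ i" using assms by (auto simp: mem_box_cart not_less)
  have "exp_inv_deriv 0 (real (Suc n) * z $ i + - (real (Suc n) * a $ i)) = 0 \<or> exp_inv_deriv 0 (- real (Suc n) * z $ i + real (Suc n) * b $ i) = 0"
  proof (cases "z $ i \<le> a $ i")
    case True
    then have "real (Suc n) * z $ i \<le> real (Suc n) * a $ i" by (intro mult_left_mono) auto
    then show ?thesis by (auto simp: exp_inv_deriv_def)
  next
    case False
    then have "- real (Suc n) * z $ i + real (Suc n) * b $ i \<le> 0" using i by (simp add: mult_left_mono del: of_nat_Suc)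
    then show ?thesis unfolding exp_inv_deriv_def by (simp del: of_nat_Suc)
  qed
  then show ?thesis unfolding box_bump_def by (intro prod_zero) auto
qed

lemma exp_inv_tendsto:
  assumes "c > 0" shows "(\<lambda>n. exp_inv_deriv 0 (real (Suc n) * c)) \<longlonglongrightarrow> 1"
proof -
  have "(\<lambda>n. 1 / real (Suc n) * (1 / c)) \<longlonglongrightarrow> 0 * (1 / c)"
    by (rule tendsto_mult[OF LIMSEQ_Suc[OF lim_1_over_n[where 'a=real]] tendsto_const])
  then have "(\<lambda>n. exp (- (1 / real (Suc n) * (1 / c)))) \<longlonglongrightarrow> exp (- (0 * (1/c)))" by (rule tendsto_exp[OF tendsto_minus])
  moreover have "exp_inv_deriv 0 (real (Suc n) * c) = exp (- (1 / real (Suc n) * (1 / c)))" for n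
    using assms by (simp add: exp_inv_deriv_def zero_less_mult_iff)
  ultimately show ?thesis by simp
qed

lemma box_bump_tendsto:
  assumes "z \<in> box a b" shows "(\<lambda>n. box_bump n a b z) \<longlonglongrightarrow> 1"
proof -
  have ab: "0 < z $ i - a $ i" "0 < b $ i - z $ i" for i using assms by (auto simp: mem_box_cart)
  have "(\<lambda>n. \<Prod>i\<in>UNIV. exp_inv_deriv 0 (real (Suc n) * (z $ i - a $ i)) * exp_inv_deriv 0 (real (Suc n) * (b $ i - z $ i))) \<longlonglongrightarrow> (\<Prod>i\<in>(UNIV::3 set). 1 * 1)"
    by (intro tendsto_prod tendsto_mult exp_inv_tendsto ab)
  then show ?thesis by (simp add: box_bump_def algebra_simps del: of_nat_Suc)
qed

text \<open>
  The open set is a countable union of boxes; \<open>\<phi>\<^sub>n\<close> is \<open>1 - \<Prod>\<^sub>j (1 - \<beta>\<^sub>n\<^sub>,\<^sub>j)\<close> over the first \<open>n\<close> of them.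
\<close>

lemma open_test_function_approx:
  fixes U :: "(real^3) set"
  assumes U: "open U" "bounded U"
  obtains \<phi> where "\<And>n. test_function (\<phi> n)" "\<And>n z. 0 \<le> \<phi> n z \<and> \<phi> n z \<le> indicator U z"
    "\<And>z. (\<lambda>n. \<phi> n z) \<longlonglongrightarrow> indicator U z"
proof -
  obtain D where D0: "countable D" "D \<subseteq> Pow U" "\<And>X. X \<in> D \<Longrightarrow> \<exists>a b. X = box a b" "\<Union>D = U"
    using open_countable_Union_open_box[OF U(1)] by metis
  have D: "countable D" "\<And>X. X \<in> D \<Longrightarrow> X \<subseteq> U" "\<And>X. X \<in> D \<Longrightarrow> \<exists>a b. X = box a b" "\<Union>D = U"
    using D0 by auto
  define E where "E = from_nat_into (insert {} D)"
  have Er: "range E = insert {} D" unfolding E_def by (rule range_from_nat_into) (use D in auto)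
  have Ebox: "\<exists>a b. E j = box a b" for j
  proof -
    have "E j \<in> insert {} D" using Er by auto
    moreover have "{} = box (0::real^3) 0" by simp
    ultimately show ?thesis using D(3) by blast
  qed
  then have "\<forall>j. \<exists>p. E j = box (fst p) (snd p)" by auto
  from choice[OF this] obtain p where p: "\<And>j. E j = box (fst (p j)) (snd (p j))" by blast
  have EU: "E j \<subseteq> U" for j using Er D(2) by blast
  have UE: "\<exists>j. z \<in> E j" if "z \<in> U" for z
  proof -
    obtain X where "X \<in> D" "z \<in> X" using D(4) \<open>z \<in> U\<close> by blast
    moreover have "X \<in> range E" using Er \<open>X \<in> D\<close> by auto
    ultimately show ?thesis by auto
  qed
  define \<beta> where "\<beta> = (\<lambda>n j. box_bump n (fst (p j)) (snd (p j)))"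
  define \<phi> where "\<phi> = (\<lambda>n z. 1 - (\<Prod>j<n. 1 - \<beta> n j z))"
  have \<beta>r: "0 \<le> \<beta> n j z" "\<beta> n j z \<le> 1" for n j z by (auto simp: \<beta>_def box_bump_range)
  have \<beta>z: "\<beta> n j z = 0" if "z \<notin> U" for n j z
    using box_bump_outside[of z "fst (p j)" "snd (p j)"] EU[of j] p[of j] that by (auto simp: \<beta>_def)
  have pr: "0 \<le> (\<Prod>j<n. 1 - \<beta> n j z)" "(\<Prod>j<n. 1 - \<beta> n j z) \<le> 1" for n z
    using \<beta>r by (auto intro!: prod_nonneg prod_le_1)
  have \<phi>z: "\<phi> n z = 0" if "z \<notin> U" for n z using \<beta>z[OF that] by (simp add: \<phi>_def)
  have \<phi>r: "0 \<le> \<phi> n z \<and> \<phi> n z \<le> indicator U z" for n z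
    using pr[where n=n and z=z] \<phi>z[of z n] by (cases "z \<in> U") (auto simp: \<phi>_def)
  show ?thesis
  proof (rule that)
    fix n
    have "smooth_on UNIV (\<phi> n)"
      unfolding \<phi>_def \<beta>_def by (intro smooth_on_one_minus smooth_on_prod smooth_box_bump)
    moreover have "bounded {x. \<phi> n x \<noteq> 0}" using \<phi>z by (intro bounded_subset[OF U(2)]) auto
    ultimately show "test_function (\<phi> n)" by (simp add: test_function_def)
    show "0 \<le> \<phi> n z \<and> \<phi> n z \<le> indicator U z" for z by (rule \<phi>r)
  next
    fix z
    show "(\<lambda>n. \<phi> n z) \<longlonglongrightarrow> indicator U z"
    proof (cases "z \<in> U")
      case True
      then obtain j where j: "z \<in> E j" using UE by blast
      have "(\<lambda>n. \<beta> n j z) \<longlonglongrightarrow> 1" unfolding \<beta>_def by (rule box_bump_tendsto) (use j p in simp)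
      moreover have "\<forall>\<^sub>F n in sequentially. \<beta> n j z \<le> \<phi> n z"
      proof (rule eventually_sequentiallyI[of "Suc j"])
        fix n assume "Suc j \<le> n"
        then have "j \<in> {..<n}" by auto
        then have "(\<Prod>i<n. 1 - \<beta> n i z) = (1 - \<beta> n j z) * (\<Prod>i\<in>{..<n} - {j}. 1 - \<beta> n i z)"
          by (intro prod.remove) auto
        also have "\<dots> \<le> (1 - \<beta> n j z) * 1"
          using \<beta>r by (intro mult_left_mono prod_le_1) auto
        finally show "\<beta> n j z \<le> \<phi> n z" by (simp add: \<phi>_def)
      qed
      moreover have "\<forall>\<^sub>F n in sequentially. \<phi> n z \<le> 1" using \<phi>r[of _ z] True by auto
      ultimately have "(\<lambda>n. \<phi> n z) \<longlonglongrightarrow> 1" using tendsto_sandwich[of "\<lambda>n. \<beta> n j z" "\<lambda>n. \<phi> n z" sequentially "\<lambda>_. 1" 1] by auto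
      then show ?thesis using True by simp
    qed (simp add: \<phi>z)
  qed
qed

context stresslet_domain
begin

text \<open>
  The energy is defined through an arbitrary representative of the convolution. Any two agree against
  test functions, hence, by approximation, against the indicator function of the domain; so the
  representative may be taken to be \<open>stresslet_pot\<close>.
\<close>

theorem stresslet_energy:
  "g_S_energy S density = (LINT t:{0<..}|lborel. gauss_energy t) / vol\<^sup>2"
proof -
  let ?h = "\<lambda>x. stresslet_pot x / vol"
  define k where "k = g_S_conv S density"
  have k: "is_g_S_conv S density k" unfolding k_def g_S_conv_def by (rule someI[where P = "is_g_S_conv S density", OF stresslet_pot_is_conv])
  obtain \<phi> where \<phi>: "\<And>n. test_function (\<phi> n)" "\<And>n z. 0 \<le> \<phi> n z \<and> \<phi> n z \<le> indicator \<O> z"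
    "\<And>z. (\<lambda>n. \<phi> n z) \<longlonglongrightarrow> indicator \<O> z"
    using open_test_function_approx[OF open_dom bounded] by blast
  have \<phi>m: "\<phi> n \<in> borel_measurable borel" for n
    using \<phi>(1)[of n] Ck_on_imp_continuous[of 0] unfolding test_function_def smooth_on_def
    by (blast intro: borel_measurable_continuous_onI)
  have lim: "(\<lambda>n. \<integral>x. u x * \<phi> n x \<partial>lborel) \<longlonglongrightarrow> (\<integral>x. u x * dom x \<partial>lborel)"
    if u: "u \<in> borel_measurable lborel" "integrable lborel (\<lambda>x. (u x)\<^sup>2)" for u
  proof (rule integral_dominated_convergence)
    note [measurable] = u(1) \<phi>m
    show "(\<lambda>x. u x * dom x) \<in> borel_measurable lborel" "\<And>n. (\<lambda>x. u x * \<phi> n x) \<in> borel_measurable lborel" by measurable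
    show "integrable lborel (\<lambda>x. (u x)\<^sup>2 + dom x)" using u(2) integrable_dom by simp
    show "AE x in lborel. norm (u x * \<phi> n x) \<le> (u x)\<^sup>2 + dom x" for n
    proof (intro AE_I2)
      fix x
      have d: "\<bar>\<phi> n x\<bar> \<le> dom x" using \<phi>(2)[of n x] by (simp add: dom_def)
      have "\<bar>u x * \<phi> n x\<bar> \<le> \<bar>u x\<bar> * dom x" unfolding abs_mult using d by (intro mult_left_mono) auto
      also have "\<dots> \<le> (u x)\<^sup>2 + dom x"
      proof (cases "x \<in> \<O>")
        case True
        have "0 \<le> (\<bar>u x\<bar> - 1)\<^sup>2" by simp
        then have "2 * \<bar>u x\<bar> \<le> (u x)\<^sup>2 + 1" by (simp add: power2_eq_square algebra_simps)
        then show ?thesis using True zero_le_power2[of "u x"] by (simp add: dom_def)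
      qed (simp add: dom_def)
      finally show "norm (u x * \<phi> n x) \<le> (u x)\<^sup>2 + dom x" by simp
    qed
    show "AE x in lborel. (\<lambda>n. u x * \<phi> n x) \<longlonglongrightarrow> u x * dom x"
      unfolding dom_def by (intro AE_I2 tendsto_intros \<phi>(3))
  qed
  have km: "k \<in> borel_measurable lborel" "integrable lborel (\<lambda>x. (k x)\<^sup>2)"
    using k unfolding is_g_S_conv_def by auto
  have hm: "?h \<in> borel_measurable lborel" "integrable lborel (\<lambda>x. (?h x)\<^sup>2)"
    using stresslet_pot_is_conv unfolding is_g_S_conv_def by auto
  have "(\<integral>x. k x * \<phi> n x \<partial>lborel) = (\<integral>x. ?h x * \<phi> n x \<partial>lborel)" for n
    using k stresslet_pot_is_conv \<phi>(1)[of n] unfolding is_g_S_conv_def by simp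
  then have "(\<integral>x. k x * dom x \<partial>lborel) = (\<integral>x. ?h x * dom x \<partial>lborel)"
    using LIMSEQ_unique[OF lim[OF km]] lim[OF hm] by simp
  also have "\<dots> = (\<integral>x. stresslet_pot x * dom x \<partial>lborel) / vol" by simp
  also have "(\<integral>x. stresslet_pot x * dom x \<partial>lborel) = (LINT t:{0<..}|lborel. gauss_energy t)"
    unfolding gauss_energy_def by (rule stresslet_pot_pairing(1)[OF integrable_dom dom_range(3)])
  finally have "(\<integral>x. k x * dom x \<partial>lborel) = (LINT t:{0<..}|lborel. gauss_energy t) / vol" .
  then show ?thesis
    unfolding g_S_energy_def k_def[symmetric] density_def by (simp add: power2_eq_square)
qed

lemma gauss_energy_integrable: "set_integrable lborel {0<..} gauss_energy"
  unfolding gauss_energy_def[abs_def] by (rule stresslet_pot_pairing(2)[OF integrable_dom dom_range(3)])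

end

section \<open>Lattice cells\<close>

definition cell_center :: "real^3 \<Rightarrow> real \<Rightarrow> int^3 \<Rightarrow> real^3" where
  "cell_center a \<epsilon> k = \<epsilon> *\<^sub>R (int_vec k - a)"

text \<open>
  The space is partitioned into half-open cubes of side \<open>\<epsilon>\<close> centred at the lattice points; this is the
  index of the cube that contains \<open>y\<close>.
\<close>

definition cell_index :: "real^3 \<Rightarrow> real \<Rightarrow> real^3 \<Rightarrow> int^3" where
  "cell_index a \<epsilon> y = (\<chi> i. \<lfloor>y $ i / \<epsilon> + a $ i + 1/2\<rfloor>)"

lemma cell_index_iff:
  assumes e: "\<epsilon> > 0"
  shows "cell_index a \<epsilon> y = k \<longleftrightarrow>
    (\<forall>i. cell_center a \<epsilon> k $ i - \<epsilon> / 2 \<le> y $ i \<and> y $ i < cell_center a \<epsilon> k $ i + \<epsilon> / 2)"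
proof -
  have "\<lfloor>y $ i / \<epsilon> + a $ i + 1/2\<rfloor> = k $ i \<longleftrightarrow>
      cell_center a \<epsilon> k $ i - \<epsilon> / 2 \<le> y $ i \<and> y $ i < cell_center a \<epsilon> k $ i + \<epsilon> / 2" for i
    using e unfolding floor_eq_iff cell_center_def by (simp add: field_simps)
  then show ?thesis by (simp add: cell_index_def vec_eq_iff)
qed

lemma cell_index_near:
  assumes e: "\<epsilon> > 0"
  shows "norm (y - cell_center a \<epsilon> (cell_index a \<epsilon> y)) < \<epsilon>"
proof -
  let ?c = "cell_center a \<epsilon> (cell_index a \<epsilon> y)"
  have "\<bar>(y - ?c) $ i\<bar> \<le> \<epsilon> / 2" for i
  proof -
    have "?c $ i - \<epsilon> / 2 \<le> y $ i \<and> y $ i < ?c $ i + \<epsilon> / 2"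
      using cell_index_iff[OF e, of a y "cell_index a \<epsilon> y"] by blast
    then show ?thesis unfolding vector_minus_component by linarith
  qed
  then have "((y - ?c) $ i)\<^sup>2 \<le> (\<epsilon> / 2)\<^sup>2" for i by (metis abs_ge_zero power2_abs power_mono)
  from this[of 1] this[of 2] this[of 3] have "(norm (y - ?c))\<^sup>2 \<le> 3 * (\<epsilon> / 2)\<^sup>2" unfolding norm3_sq by linarith
  also have "\<dots> < \<epsilon>\<^sup>2" using e by (simp add: power2_eq_square)
  finally show ?thesis using e by (simp add: power2_less_imp_less)
qed

lemma cell_center_diff:
  "cell_center a \<epsilon> j - cell_center a \<epsilon> k = \<epsilon> *\<^sub>R int_vec (j - k)"
  by (simp add: cell_center_def vec_eq_iff algebra_simps)

lemma measurable_cell: "{y. cell_index a \<epsilon> y = k} \<in> sets borel"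
proof -
  have "{y. cell_index a \<epsilon> y = k} = {y \<in> space borel. \<forall>i. \<lfloor>y $ i / \<epsilon> + a $ i + 1/2\<rfloor> = k $ i}"
    by (auto simp: cell_index_def vec_eq_iff)
  also have "\<dots> \<in> sets borel" by measurable
  finally show ?thesis .
qed

lemma emeasure_cell:
  assumes e: "\<epsilon> > 0"
  shows "emeasure lborel {y. cell_index a \<epsilon> y = k} = ennreal (\<epsilon> ^ 3)"
proof (rule antisym)
  let ?l = "\<chi> i. cell_center a \<epsilon> k $ i - \<epsilon> / 2" and ?u = "\<chi> i. cell_center a \<epsilon> k $ i + \<epsilon> / 2"
  have lu: "?l \<bullet> b \<le> ?u \<bullet> b" if "b \<in> Basis" for b
    using that e by (auto simp: Basis_vec_def inner_axis)
  have p: "(\<Prod>b\<in>Basis. (?u - ?l) \<bullet> b) = \<epsilon> ^ 3"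
  proof -
    have "(\<Prod>b\<in>Basis. (?u - ?l) \<bullet> b) = (\<Prod>b\<in>(Basis :: (real^3) set). \<epsilon>)"
      by (intro prod.cong) (auto simp: Basis_vec_def inner_axis)
    then show ?thesis by simp
  qed
  have "emeasure lborel {y. cell_index a \<epsilon> y = k} \<le> emeasure lborel (cbox ?l ?u)"
    by (rule emeasure_mono) (auto simp: cell_index_iff[OF e] mem_box_cart less_imp_le)
  also have "\<dots> = ennreal (\<epsilon> ^ 3)" using lu p by (subst emeasure_lborel_cbox) auto
  finally show "emeasure lborel {y. cell_index a \<epsilon> y = k} \<le> ennreal (\<epsilon> ^ 3)" .
  have "ennreal (\<epsilon> ^ 3) = emeasure lborel (box ?l ?u)" using lu p by (subst emeasure_lborel_box) auto
  also have "\<dots> \<le> emeasure lborel {y. cell_index a \<epsilon> y = k}"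
    by (rule emeasure_mono) (auto simp: cell_index_iff[OF e] mem_box_cart less_imp_le measurable_cell)
  finally show "ennreal (\<epsilon> ^ 3) \<le> emeasure lborel {y. cell_index a \<epsilon> y = k}" .
qed

lemma countable_int_vec: "countable (UNIV :: (int^3) set)"
proof (rule countableI')
  show "inj (\<lambda>k :: int^3. to_nat (k $ 1, k $ 2, k $ 3))"
    by (auto simp: inj_def vec_eq_iff forall_3)
qed

lemma measurable_cell_index [measurable]: "cell_index a \<epsilon> \<in> borel \<rightarrow>\<^sub>M count_space UNIV"
  unfolding measurable_count_space_eq_countable[OF countable_int_vec]
  using measurable_cell by (auto simp: vimage_def)

text \<open>
  The push-forward of Lebesgue measure is \<open>\<epsilon>\<^sup>3\<close> times counting measure, so lattice sums are
  integrals of step functions.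
\<close>

lemma distr_cell_index:
  assumes e: "\<epsilon> > 0"
  shows "distr lborel (count_space UNIV) (cell_index a \<epsilon>) = density (count_space UNIV) (\<lambda>_. ennreal (\<epsilon> ^ 3))"
proof (rule measure_eqI_countable[OF _ _ countable_int_vec])
  fix k :: "int^3"
  have "emeasure (distr lborel (count_space UNIV) (cell_index a \<epsilon>)) {k} = emeasure lborel {y. cell_index a \<epsilon> y = k}"
    by (subst emeasure_distr) (auto simp: vimage_def)
  also have "\<dots> = ennreal (\<epsilon> ^ 3)" by (rule emeasure_cell[OF e])
  also have "\<dots> = emeasure (density (count_space UNIV) (\<lambda>_. ennreal (\<epsilon> ^ 3))) {k}"
    by (subst emeasure_density) (auto simp: nn_integral_cmult)
  finally show "emeasure (distr lborel (count_space UNIV) (cell_index a \<epsilon>)) {k} = emeasure (density (count_space UNIV) (\<lambda>_. ennreal (\<epsilon> ^ 3))) {k}" .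
qed auto

lemma cell_integral:
  fixes f :: "int^3 \<Rightarrow> real"
  assumes e: "\<epsilon> > 0"
  shows "integrable lborel (\<lambda>y. f (cell_index a \<epsilon> y)) \<longleftrightarrow> integrable (count_space UNIV) f"
    and "(\<integral>y. f (cell_index a \<epsilon> y) \<partial>lborel) = \<epsilon> ^ 3 * (\<integral>k. f k \<partial>count_space UNIV)"
proof -
  have m: "cell_index a \<epsilon> \<in> lborel \<rightarrow>\<^sub>M count_space UNIV" by simp
  have "integrable lborel (\<lambda>y. f (cell_index a \<epsilon> y)) \<longleftrightarrow> integrable (distr lborel (count_space UNIV) (cell_index a \<epsilon>)) f"
    by (rule integrable_distr_eq[OF m, symmetric]) simp
  also have "\<dots> \<longleftrightarrow> integrable (count_space UNIV) (\<lambda>k. \<epsilon> ^ 3 * f k)"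
    unfolding distr_cell_index[OF e] by (subst integrable_density) (use e in auto)
  finally show "integrable lborel (\<lambda>y. f (cell_index a \<epsilon> y)) \<longleftrightarrow> integrable (count_space UNIV) f"
    using e by simp
  have "(\<integral>y. f (cell_index a \<epsilon> y) \<partial>lborel) = (\<integral>k. f k \<partial>distr lborel (count_space UNIV) (cell_index a \<epsilon>))"
    by (rule integral_distr[OF m, symmetric]) simp
  also have "\<dots> = (\<integral>k. \<epsilon> ^ 3 * f k \<partial>count_space UNIV)"
    unfolding distr_cell_index[OF e] by (subst integral_density) (use e in auto)
  finally show "(\<integral>y. f (cell_index a \<epsilon> y) \<partial>lborel) = \<epsilon> ^ 3 * (\<integral>k. f k \<partial>count_space UNIV)" by simp
qed

lemma cell_sum:
  fixes f :: "int^3 \<Rightarrow> real"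
  assumes e: "\<epsilon> > 0" and J: "finite J"
  shows "integrable lborel (\<lambda>y. indicator J (cell_index a \<epsilon> y) * f (cell_index a \<epsilon> y))"
    and "(\<integral>y. indicator J (cell_index a \<epsilon> y) * f (cell_index a \<epsilon> y) \<partial>lborel) = \<epsilon> ^ 3 * (\<Sum>k\<in>J. f k)"
proof -
  have fin: "finite {k. indicator J k * f k \<noteq> 0}" by (rule finite_subset[OF _ J]) (auto simp: indicator_def split: if_splits)
  have i: "integrable (count_space UNIV) (\<lambda>k. indicator J k * f k)"
  proof -
    have "integrable (count_space UNIV) (\<lambda>k. \<Sum>j\<in>J. f j * indicator {j} k)" by auto
    moreover have "(\<Sum>j\<in>J. f j * indicator {j} k) = indicator J k * f k" for k
      using J by (simp add: indicator_def if_distrib[of "\<lambda>z. f _ * z"] sum.delta' cong: if_cong)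
    ultimately show ?thesis by simp
  qed
  then show "integrable lborel (\<lambda>y. indicator J (cell_index a \<epsilon> y) * f (cell_index a \<epsilon> y))"
    using cell_integral(1)[OF e, of "\<lambda>k. indicator J k * f k" a] by simp
  have "(\<integral>k. indicator J k * f k \<partial>count_space UNIV) = (\<Sum>k | indicator J k * f k \<noteq> 0. indicator J k * f k)"
    using fin by (subst lebesgue_integral_count_space_finite_support) auto
  also have "\<dots> = (\<Sum>k\<in>J. f k)"
    by (rule sum.mono_neutral_cong_left[OF J]) (auto simp: indicator_def split: if_splits)
  finally show "(\<integral>y. indicator J (cell_index a \<epsilon> y) * f (cell_index a \<epsilon> y) \<partial>lborel) = \<epsilon> ^ 3 * (\<Sum>k\<in>J. f k)"
    using cell_integral(2)[OF e, of "\<lambda>k. indicator J k * f k" a] by simp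
qed

text \<open>
  A point of the cell of \<open>k \<noteq> 0\<close> has at most twice the distance from the origin that the centre has,
  so the sum is dominated by the integral of a wider Gaussian. The cell of \<open>0\<close> must be left out: for
  \<open>t\<epsilon>\<^sup>2\<close> large its term alone would exceed the bound.
\<close>

lemma lattice_gauss_le:
  assumes e: "\<epsilon> > 0" and t: "t > 0"
  defines "h \<equiv> \<lambda>k. if k = 0 then 0 else exp (- (t * (norm (\<epsilon> *\<^sub>R int_vec k))\<^sup>2))"
  shows "integrable (count_space UNIV) h"
    and "\<epsilon> ^ 3 * (\<integral>k. h k \<partial>count_space UNIV) \<le> 8 * (pi * sqrt pi) / (t * sqrt t)"
proof -
  have b: "\<bar>h (cell_index 0 \<epsilon> y)\<bar> \<le> exp (- (1/4 * t * (norm y)\<^sup>2))" for y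
  proof (cases "cell_index 0 \<epsilon> y = 0")
    case False
    let ?k = "cell_index 0 \<epsilon> y"
    have "norm y \<le> norm (y - cell_center 0 \<epsilon> ?k) + norm (cell_center 0 \<epsilon> ?k)"
      using norm_triangle_ineq[of "y - cell_center 0 \<epsilon> ?k" "cell_center 0 \<epsilon> ?k"] by simp
    also have "\<dots> \<le> \<epsilon> * 1 + norm (\<epsilon> *\<^sub>R int_vec ?k)"
      using cell_index_near[OF e, of y 0] by (simp add: cell_center_def)
    also have "\<dots> \<le> \<epsilon> * norm (int_vec ?k) + norm (\<epsilon> *\<^sub>R int_vec ?k)"
      using one_le_norm_int_vec[OF False] e by (intro add_right_mono mult_left_mono) auto
    also have "\<dots> = 2 * norm (\<epsilon> *\<^sub>R int_vec ?k)" using e by simp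
    finally have "(norm y)\<^sup>2 \<le> (2 * norm (\<epsilon> *\<^sub>R int_vec ?k))\<^sup>2" by (rule power_mono) simp
    then have "1/4 * (norm y)\<^sup>2 \<le> (norm (\<epsilon> *\<^sub>R int_vec ?k))\<^sup>2" by (simp add: power2_eq_square)
    then have "t * (1/4 * (norm y)\<^sup>2) \<le> t * (norm (\<epsilon> *\<^sub>R int_vec ?k))\<^sup>2" using t by (intro mult_left_mono) auto
    then show ?thesis using False by (simp add: h_def)
  qed (simp add: h_def)
  have gi: "integrable lborel (\<lambda>y::real^3. exp (- (1/4 * t * (norm y)\<^sup>2)))"
    by (rule gauss3_integral) (use t in simp)
  have hi: "integrable lborel (\<lambda>y. h (cell_index 0 \<epsilon> y))"
    by (rule Bochner_Integration.integrable_bound[OF gi])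
      (use b in \<open>auto intro: measurable_compose[OF measurable_cell_index]\<close>)
  then show "integrable (count_space UNIV) h" using cell_integral(1)[OF e] by blast
  have "\<epsilon> ^ 3 * (\<integral>k. h k \<partial>count_space UNIV) = (\<integral>y. h (cell_index 0 \<epsilon> y) \<partial>lborel)"
    by (rule cell_integral(2)[OF e, symmetric])
  also have "\<dots> \<le> (\<integral>y. exp (- (1/4 * t * (norm y)\<^sup>2)) \<partial>(lborel :: (real^3) measure))"
    by (rule integral_mono[OF hi gi]) (use b in \<open>auto intro: order_trans[OF abs_ge_self]\<close>)
  also have "\<dots> = pi * sqrt pi / (1/4 * t * sqrt (1/4 * t))"
    using gauss3_integral(2)[of "1/4 * t"] t by simp
  also have "\<dots> = 8 * (pi * sqrt pi) / (t * sqrt t)" using t by (simp add: real_sqrt_divide)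
  finally show "\<epsilon> ^ 3 * (\<integral>k. h k \<partial>count_space UNIV) \<le> 8 * (pi * sqrt pi) / (t * sqrt t)" .
qed

lemma stresslet_gauss_scale:
  assumes e: "\<epsilon> > 0" and t: "t > 0"
  shows "\<epsilon> * stresslet_gauss S t (\<epsilon> *\<^sub>R z) = stresslet_gauss S (\<epsilon>\<^sup>2 * t) z"
proof -
  have q: "quad S (\<epsilon> *\<^sub>R z) = \<epsilon>\<^sup>2 * quad S z"
    unfolding quad_inner by (simp add: matrix_vector_mult_scaleR power2_eq_square)
  have m: "norm (S *v (\<epsilon> *\<^sub>R z)) = \<epsilon> * norm (S *v z)" using e by (simp add: matrix_vector_mult_scaleR)
  have r: "sqrt (\<epsilon>\<^sup>2 * t) = \<epsilon> * sqrt t" using e by (simp add: real_sqrt_mult)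
  have x: "exp (- (pi * t * (norm (\<epsilon> *\<^sub>R z))\<^sup>2)) = exp (- (pi * (\<epsilon>\<^sup>2 * t) * (norm z)\<^sup>2))"
    by (simp add: power_mult_distrib mult_ac)
  show ?thesis unfolding stresslet_gauss_def q m r x
    by (simp only: power_mult_distrib) (simp add: power2_eq_square algebra_simps)
qed

section \<open>Sums over particles as integrals\<close>

locale particle_system = stresslet_domain +
  fixes a :: "real^3"
begin

definition sites :: "real \<Rightarrow> (int^3) set" where
  "sites \<epsilon> = {k. ball (cell_center a \<epsilon> k) \<epsilon> \<subseteq> \<O>}"

text \<open>
  The indicator function of the union of the cells of the particles. It turns sums over particles
  into integrals and is dominated by the indicator function of the domain, because a particle keeps
  distance \<open>\<epsilon>\<close> from the complement, more than the radius of its cell.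
\<close>

definition occupied :: "real \<Rightarrow> real^3 \<Rightarrow> real" where
  "occupied \<epsilon> y = indicator (sites \<epsilon>) (cell_index a \<epsilon> y)"

abbreviation "pos \<epsilon> y \<equiv> cell_center a \<epsilon> (cell_index a \<epsilon> y)"

text \<open>
  \<open>-\<epsilon>(a + k) = \<epsilon>(-k - a)\<close>, and \<open>k \<mapsto> -k\<close> permutes \<open>\<int>\<^sup>3\<close>.
\<close>

lemma particles_eq: "particles a \<O> \<epsilon> = cell_center a \<epsilon> ` sites \<epsilon>"
proof -
  have r: "- (\<epsilon> *\<^sub>R (a + int_vec k)) = cell_center a \<epsilon> (- k)" for k
    by (simp add: cell_center_def vec_eq_iff algebra_simps)
  have "(\<lambda>p. - (\<epsilon> *\<^sub>R p)) ` lattice a = range (\<lambda>k. cell_center a \<epsilon> (- k))"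
    unfolding lattice_def image_image r ..
  also have "\<dots> = range (cell_center a \<epsilon>)"
    using surj_uminus[where 'a = "int^3"] by (metis (no_types, lifting) image_comp comp_apply image_cong)
  finally show ?thesis unfolding particles_def sites_def by auto
qed

lemma cell_center_inj: "\<epsilon> > 0 \<Longrightarrow> inj (cell_center a \<epsilon>)"
  by (auto simp: inj_def cell_center_def vec_eq_iff)

lemma measurable_occupied [measurable]: "occupied \<epsilon> \<in> borel_measurable borel"
  unfolding occupied_def by (rule measurable_compose[OF measurable_cell_index]) simp

lemma measurable_pos [measurable]: "pos \<epsilon> \<in> borel_measurable borel"
  by (rule measurable_compose[OF measurable_cell_index]) simp

lemma occupied_le_dom:
  assumes "\<epsilon> > 0" shows "0 \<le> occupied \<epsilon> y" "occupied \<epsilon> y \<le> dom y"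
proof -
  show "0 \<le> occupied \<epsilon> y" by (simp add: occupied_def)
  have "y \<in> ball (pos \<epsilon> y) \<epsilon>" using cell_index_near[OF assms, of y a] by (simp add: dist_norm norm_minus_commute)
  then show "occupied \<epsilon> y \<le> dom y" by (auto simp: occupied_def dom_def indicator_def sites_def)
qed

lemma finite_sites:
  assumes e: "\<epsilon> > 0" shows "finite (sites \<epsilon>)"
proof -
  obtain B where B: "\<And>x. x \<in> \<O> \<Longrightarrow> norm x \<le> B" using bounded by (auto simp: bounded_iff)
  define M where "M = \<lceil>B / \<epsilon> + norm a\<rceil>"
  have "sites \<epsilon> \<subseteq> {k. \<forall>i. k $ i \<in> {-M..M}}"
  proof clarify
    fix k :: "int^3" and i assume "k \<in> sites \<epsilon>"
    then have "cell_center a \<epsilon> k \<in> \<O>" using e by (auto simp: sites_def)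
    then have "norm (\<epsilon> *\<^sub>R (int_vec k - a)) \<le> B" using B unfolding cell_center_def by blast
    then have "\<epsilon> * norm (int_vec k - a) \<le> B" unfolding norm_scaleR abs_of_pos[OF e] .
    then have "norm (int_vec k - a) \<le> B / \<epsilon>" using e by (simp add: field_simps)
    moreover have "norm (int_vec k) \<le> norm (int_vec k - a) + norm a"
      using norm_triangle_ineq[of "int_vec k - a" a] by simp
    moreover have "\<bar>int_vec k $ i\<bar> \<le> norm (int_vec k)" by (rule component_le_norm_cart)
    ultimately have "\<bar>real_of_int (k $ i)\<bar> \<le> B / \<epsilon> + norm a" by simp
    then have "real_of_int (\<bar>k $ i\<bar>) \<le> of_int M" unfolding M_def by linarith
    then have "\<bar>k $ i\<bar> \<le> M" by (simp only: of_int_le_iff)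
    then show "k $ i \<in> {-M..M}" by auto
  qed
  moreover have "finite {k :: int^3. \<forall>i. k $ i \<in> {-M..M}}"
  proof (rule inj_on_finite[where f = "\<lambda>k. (k $ 1, k $ 2, k $ 3)"])
    show "finite ({-M..M} \<times> {-M..M} \<times> {-M..M})" by simp
  qed (auto simp: inj_on_def vec_eq_iff forall_3)
  ultimately show ?thesis by (rule finite_subset)
qed

lemma pos_tendsto:
  assumes e: "\<And>n. \<epsilon> n > 0" "\<epsilon> \<longlonglongrightarrow> 0"
  shows "(\<lambda>n. pos (\<epsilon> n) y) \<longlonglongrightarrow> y"
proof -
  have "(\<lambda>n. pos (\<epsilon> n) y - y) \<longlonglongrightarrow> 0"
  proof (rule Lim_null_comparison[OF _ e(2)])
    show "\<forall>\<^sub>F n in sequentially. norm (pos (\<epsilon> n) y - y) \<le> \<epsilon> n"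
      using cell_index_near[OF e(1)] by (auto intro!: always_eventually less_imp_le simp: norm_minus_commute)
  qed
  then show ?thesis by (rule LIM_zero_cancel)
qed

lemma occupied_tendsto:
  assumes e: "\<And>n. \<epsilon> n > 0" "\<epsilon> \<longlonglongrightarrow> 0"
  shows "(\<lambda>n. occupied (\<epsilon> n) y) \<longlonglongrightarrow> dom y"
proof (cases "y \<in> \<O>")
  case True
  then obtain r where r: "r > 0" "ball y r \<subseteq> \<O>" using open_dom by (auto simp: open_contains_ball)
  have "\<forall>\<^sub>F n in sequentially. \<epsilon> n < r / 2" using order_tendstoD(2)[OF e(2), of "r / 2"] r(1) by simp
  then have "\<forall>\<^sub>F n in sequentially. occupied (\<epsilon> n) y = dom y"
  proof eventually_elim
    case (elim n)
    have "ball (pos (\<epsilon> n) y) (\<epsilon> n) \<subseteq> ball y r"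
    proof
      fix z assume "z \<in> ball (pos (\<epsilon> n) y) (\<epsilon> n)"
      moreover have "dist y (pos (\<epsilon> n) y) < \<epsilon> n" using cell_index_near[OF e(1)[of n], of y a] by (simp add: dist_norm)
      moreover have "dist y z \<le> dist y (pos (\<epsilon> n) y) + dist (pos (\<epsilon> n) y) z" by (rule dist_triangle)
      ultimately show "z \<in> ball y r" using elim by simp
    qed
    then show ?case using r True by (auto simp: occupied_def dom_def sites_def)
  qed
  then show ?thesis by (rule tendsto_eventually)
next
  case False
  have "occupied (\<epsilon> n) y = 0" for n using occupied_le_dom[OF e(1)[of n], of y] False by (simp add: dom_def)
  then show ?thesis using False by (simp add: dom_def)
qed

text \<open>
  The volume of the cells of the particles, \<open>N \<epsilon>\<^sup>3\<close>.
\<close>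

definition filling :: "real \<Rightarrow> real" where
  "filling \<epsilon> = \<epsilon> ^ 3 * real (card (sites \<epsilon>))"

lemma filling_integral:
  assumes e: "\<epsilon> > 0" shows "integrable lborel (occupied \<epsilon>)" "(\<integral>y. occupied \<epsilon> y \<partial>lborel) = filling \<epsilon>"
  using cell_sum[OF e finite_sites[OF e], where f = "\<lambda>_. 1" and a = a] by (simp_all add: occupied_def[abs_def] filling_def)

lemma filling_bounds:
  assumes e: "\<epsilon> > 0" shows "0 \<le> filling \<epsilon>" "filling \<epsilon> \<le> vol"
proof -
  show "0 \<le> filling \<epsilon>" using e by (simp add: filling_def)
  show "filling \<epsilon> \<le> vol"
    unfolding filling_integral(2)[OF e, symmetric] integral_dom[symmetric]
    by (rule integral_mono) (use filling_integral[OF e] integrable_dom occupied_le_dom[OF e] in auto)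
qed

lemma filling_tendsto:
  assumes e: "\<And>n. \<epsilon> n > 0" "\<epsilon> \<longlonglongrightarrow> 0"
  shows "(\<lambda>n. filling (\<epsilon> n)) \<longlonglongrightarrow> vol"
  unfolding filling_integral(2)[OF e(1), symmetric] integral_dom[symmetric]
proof (rule integral_dominated_convergence[OF _ _ integrable_dom])
  show "AE x in lborel. norm (occupied (\<epsilon> n) x) \<le> dom x" for n using occupied_le_dom[OF e(1)] by simp
qed (use occupied_tendsto[OF e] in auto)

text \<open>
  The normalisation \<open>\<epsilon>\<^sup>6\<close> makes this a double Riemann sum; \<open>1/N\<^sup>2\<close> is recovered from \<open>filling\<close>.
\<close>

definition pair_sum :: "(real^3 \<Rightarrow> real) \<Rightarrow> real \<Rightarrow> real" where
  "pair_sum g \<epsilon> = \<epsilon> ^ 6 * (\<Sum>j\<in>sites \<epsilon>. \<Sum>k\<in>sites \<epsilon>. g (cell_center a \<epsilon> j - cell_center a \<epsilon> k))"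

lemma pair_sum_integral:
  assumes e: "\<epsilon> > 0"
  shows "pair_sum g \<epsilon> = (\<integral>x. occupied \<epsilon> x * (\<integral>y. occupied \<epsilon> y * g (pos \<epsilon> x - pos \<epsilon> y) \<partial>lborel) \<partial>lborel)"
proof -
  note c = cell_sum(2)[OF e finite_sites[OF e], where a = a]
  have "(\<integral>y. occupied \<epsilon> y * g (z - pos \<epsilon> y) \<partial>lborel) = \<epsilon> ^ 3 * (\<Sum>k\<in>sites \<epsilon>. g (z - cell_center a \<epsilon> k))" for z
    unfolding occupied_def by (rule c)
  then have "(\<integral>x. occupied \<epsilon> x * (\<integral>y. occupied \<epsilon> y * g (pos \<epsilon> x - pos \<epsilon> y) \<partial>lborel) \<partial>lborel)
     = (\<integral>x. indicator (sites \<epsilon>) (cell_index a \<epsilon> x) * (\<epsilon> ^ 3 * (\<Sum>k\<in>sites \<epsilon>. g (pos \<epsilon> x - cell_center a \<epsilon> k))) \<partial>lborel)"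
    by (simp add: occupied_def)
  also have "\<dots> = \<epsilon> ^ 3 * (\<Sum>j\<in>sites \<epsilon>. \<epsilon> ^ 3 * (\<Sum>k\<in>sites \<epsilon>. g (cell_center a \<epsilon> j - cell_center a \<epsilon> k)))"
    by (rule c)
  also have "\<dots> = pair_sum g \<epsilon>"
    unfolding pair_sum_def sum_distrib_left[symmetric] mult.assoc[symmetric] power_add[symmetric] by simp
  finally show ?thesis by simp
qed

text \<open>
  Dominated convergence, first in \<open>y\<close> and then in \<open>x\<close>: cell centres converge to the point, and the
  occupied cells fill the domain.
\<close>

lemma pair_sum_tendsto:
  assumes e: "\<And>n. \<epsilon> n > 0" "\<epsilon> \<longlonglongrightarrow> 0" and t: "t > 0"
  shows "(\<lambda>n. pair_sum (stresslet_gauss S t) (\<epsilon> n)) \<longlonglongrightarrow> gauss_energy t"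
proof -
  let ?g = "stresslet_gauss S t"
  obtain C where C: "0 \<le> C" "\<And>t z. 0 < t \<Longrightarrow> \<bar>stresslet_gauss S t z\<bar> \<le> C * sqrt t * exp (- (2 * t * (norm z)\<^sup>2))"
    using stresslet_gauss_bound by metis
  have b: "\<bar>?g z\<bar> \<le> C * sqrt t" for z
    using C(1) t by (auto intro!: order_trans[OF C(2)[OF t, of z]] mult_left_le)
  have ob: "\<bar>occupied (\<epsilon> n) y * u\<bar> \<le> D * dom y" if "\<bar>u\<bar> \<le> D" for n y u D
    using mult_mono[OF occupied_le_dom(2)[OF e(1)[of n], of y] that] occupied_le_dom(1)[OF e(1), of n y] dom_range[of y]
    by (simp add: abs_mult mult.commute)
  have "continuous_on UNIV ?g" unfolding stresslet_gauss_def by (intro continuous_intros)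
  then have gc: "isCont ?g z" for z by (simp add: continuous_on_eq_continuous_at)
  have inner: "(\<lambda>n. \<integral>y. occupied (\<epsilon> n) y * ?g (pos (\<epsilon> n) x - pos (\<epsilon> n) y) \<partial>lborel) \<longlonglongrightarrow> (\<integral>y. dom y * ?g (x - y) \<partial>lborel)" for x
  proof (rule integral_dominated_convergence)
    show "integrable lborel (\<lambda>y. C * sqrt t * dom y)" using integrable_dom by simp
    show "AE y in lborel. norm (occupied (\<epsilon> n) y * ?g (pos (\<epsilon> n) x - pos (\<epsilon> n) y)) \<le> C * sqrt t * dom y" for n
      using ob[OF b] by simp
    show "AE y in lborel. (\<lambda>n. occupied (\<epsilon> n) y * ?g (pos (\<epsilon> n) x - pos (\<epsilon> n) y)) \<longlonglongrightarrow> dom y * ?g (x - y)"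
      by (intro AE_I2 tendsto_mult occupied_tendsto[OF e] isCont_tendsto_compose[OF gc] tendsto_diff pos_tendsto[OF e])
  qed measurable
  have ib: "\<bar>\<integral>y. occupied (\<epsilon> n) y * ?g (z - pos (\<epsilon> n) y) \<partial>lborel\<bar> \<le> C * sqrt t * vol" for n z
  proof -
    have "norm (\<integral>y. occupied (\<epsilon> n) y * ?g (z - pos (\<epsilon> n) y) \<partial>lborel) \<le> (\<integral>y. C * sqrt t * dom y \<partial>lborel)"
      by (rule norm_integral_le) (use integrable_dom ob[OF b] in auto)
    then show ?thesis by (simp add: integral_dom)
  qed
  have mi: "(\<lambda>x. occupied (\<epsilon> n) x * (\<integral>y. occupied (\<epsilon> n) y * ?g (pos (\<epsilon> n) x - pos (\<epsilon> n) y) \<partial>lborel)) \<in> borel_measurable lborel" for n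
  proof -
    have "(\<lambda>x. \<integral>y. occupied (\<epsilon> n) y * ?g (pos (\<epsilon> n) x - pos (\<epsilon> n) y) \<partial>lborel) \<in> borel_measurable lborel"
      by (rule lborel.borel_measurable_lebesgue_integral) measurable
    then show ?thesis by measurable
  qed
  have "(\<lambda>n. \<integral>x. occupied (\<epsilon> n) x * (\<integral>y. occupied (\<epsilon> n) y * ?g (pos (\<epsilon> n) x - pos (\<epsilon> n) y) \<partial>lborel) \<partial>lborel)
      \<longlonglongrightarrow> (\<integral>x. dom x * (\<integral>y. dom y * ?g (x - y) \<partial>lborel) \<partial>lborel)"
  proof (rule integral_dominated_convergence[OF _ mi])
    show "integrable lborel (\<lambda>y. C * sqrt t * vol * dom y)" using integrable_dom by simp
    show "AE x in lborel. norm (occupied (\<epsilon> n) x * (\<integral>y. occupied (\<epsilon> n) y * ?g (pos (\<epsilon> n) x - pos (\<epsilon> n) y) \<partial>lborel)) \<le> C * sqrt t * vol * dom x" for n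
      using ob[OF ib] by simp
    show "AE x in lborel. (\<lambda>n. occupied (\<epsilon> n) x * (\<integral>y. occupied (\<epsilon> n) y * ?g (pos (\<epsilon> n) x - pos (\<epsilon> n) y) \<partial>lborel)) \<longlonglongrightarrow> dom x * (\<integral>y. dom y * ?g (x - y) \<partial>lborel)"
      by (intro AE_I2 tendsto_mult occupied_tendsto[OF e] inner)
    have "(\<lambda>x. \<integral>y. dom y * ?g (x - y) \<partial>lborel) \<in> borel_measurable lborel"
      by (rule lborel.borel_measurable_lebesgue_integral) measurable
    then show "(\<lambda>x. dom x * (\<integral>y. dom y * ?g (x - y) \<partial>lborel)) \<in> borel_measurable lborel" by measurable
  qed
  moreover have "(\<integral>x. dom x * (\<integral>y. dom y * ?g (x - y) \<partial>lborel) \<partial>lborel) = gauss_energy t"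
    unfolding gauss_energy_def gauss_pot_def by (simp add: mult.commute)
  ultimately show ?thesis unfolding pair_sum_integral[OF e(1)] by simp
qed

end

section \<open>Comparison with the full lattice sum\<close>

context particle_system
begin

lemma stresslet_gauss_zero: "stresslet_gauss S t 0 = 0"
  by (simp add: stresslet_gauss_def quad_inner)

text \<open>
  The diagonal contributes nothing to the Gaussian sums, and is excluded from the sum of the kernel.
\<close>

lemma pair_sum_time_integral:
  assumes e: "\<epsilon> > 0"
  shows "set_integrable lborel {0<..} (\<lambda>t. pair_sum (stresslet_gauss S t) \<epsilon>)"
    and "(LINT t:{0<..}|lborel. pair_sum (stresslet_gauss S t) \<epsilon>) =
      \<epsilon> ^ 6 * (\<Sum>x\<in>particles a \<O> \<epsilon>. \<Sum>y\<in>particles a \<O> \<epsilon> - {x}. g_S S (x - y))"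
proof -
  let ?c = "cell_center a \<epsilon>" and ?K = "sites \<epsilon>"
  note fin = finite_sites[OF e]
  have ne: "?c j - ?c k \<noteq> 0" if "k \<in> ?K - {j}" for j k
    using that injD[OF cell_center_inj[OF e], of j k] by auto
  note T = g_S_time_integral[OF S ne]
  have eq: "pair_sum (stresslet_gauss S t) \<epsilon> = \<epsilon> ^ 6 * (\<Sum>j\<in>?K. \<Sum>k\<in>?K - {j}. stresslet_gauss S t (?c j - ?c k))" for t
  proof -
    have "(\<Sum>k\<in>?K. stresslet_gauss S t (?c j - ?c k)) = (\<Sum>k\<in>?K - {j}. stresslet_gauss S t (?c j - ?c k))" if "j \<in> ?K" for j
      using that by (subst sum.remove[OF fin that]) (simp add: stresslet_gauss_zero)
    then show ?thesis unfolding pair_sum_def by simp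
  qed
  have i: "integrable lborel (\<lambda>t. indicator {0<..} t * stresslet_gauss S t (?c j - ?c k))" if "k \<in> ?K - {j}" for j k
    using T(1)[OF that] by (simp add: set_integrable_def)
  have eq': "indicator {0<..} t * pair_sum (stresslet_gauss S t) \<epsilon>
      = \<epsilon> ^ 6 * (\<Sum>j\<in>?K. \<Sum>k\<in>?K - {j}. indicator {0<..} t * stresslet_gauss S t (?c j - ?c k))" for t
    unfolding eq by (simp add: sum_distrib_left mult_ac)
  show "set_integrable lborel {0<..} (\<lambda>t. pair_sum (stresslet_gauss S t) \<epsilon>)"
    unfolding set_integrable_def real_scaleR_def eq'
    by (intro integrable_mult_right Bochner_Integration.integrable_sum i)
  have "(LINT t:{0<..}|lborel. pair_sum (stresslet_gauss S t) \<epsilon>)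
      = \<epsilon> ^ 6 * (\<integral>t. (\<Sum>j\<in>?K. \<Sum>k\<in>?K - {j}. indicator {0<..} t * stresslet_gauss S t (?c j - ?c k)) \<partial>lborel)"
    unfolding set_lebesgue_integral_def real_scaleR_def eq' by (rule integral_mult_right_zero)
  also have "(\<integral>t. (\<Sum>j\<in>?K. \<Sum>k\<in>?K - {j}. indicator {0<..} t * stresslet_gauss S t (?c j - ?c k)) \<partial>lborel)
      = (\<Sum>j\<in>?K. \<integral>t. (\<Sum>k\<in>?K - {j}. indicator {0<..} t * stresslet_gauss S t (?c j - ?c k)) \<partial>lborel)"
    by (intro Bochner_Integration.integral_sum Bochner_Integration.integrable_sum i)
  also have "\<dots> = (\<Sum>j\<in>?K. \<Sum>k\<in>?K - {j}. \<integral>t. indicator {0<..} t * stresslet_gauss S t (?c j - ?c k) \<partial>lborel)"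
    by (intro sum.cong refl Bochner_Integration.integral_sum i)
  also have "\<dots> = (\<Sum>j\<in>?K. \<Sum>k\<in>?K - {j}. g_S S (?c j - ?c k))"
    using T(2) by (intro sum.cong refl) (auto simp: set_lebesgue_integral_def)
  also have "\<dots> = (\<Sum>j\<in>?K. \<Sum>y\<in>particles a \<O> \<epsilon> - {?c j}. g_S S (?c j - y))"
  proof (intro sum.cong refl)
    fix j
    have inj: "inj_on ?c A" for A using cell_center_inj[OF e] by (auto intro: inj_on_subset)
    have "particles a \<O> \<epsilon> - {?c j} = ?c ` (?K - {j})"
      unfolding particles_eq using cell_center_inj[OF e] by (auto simp: inj_def)
    then show "(\<Sum>k\<in>?K - {j}. g_S S (?c j - ?c k)) = (\<Sum>y\<in>particles a \<O> \<epsilon> - {?c j}. g_S S (?c j - y))"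
      by (simp add: sum.reindex[OF inj])
  qed
  also have "\<dots> = (\<Sum>x\<in>particles a \<O> \<epsilon>. \<Sum>y\<in>particles a \<O> \<epsilon> - {x}. g_S S (x - y))"
  proof -
    have inj: "inj_on ?c ?K" using cell_center_inj[OF e] by (auto intro: inj_on_subset)
    have "(\<Sum>x\<in>?c ` ?K. f x) = (\<Sum>j\<in>?K. f (?c j))" for f :: "_ \<Rightarrow> real" by (simp add: sum.reindex[OF inj])
    then show ?thesis unfolding particles_eq[symmetric] by simp
  qed
  finally show "(LINT t:{0<..}|lborel. pair_sum (stresslet_gauss S t) \<epsilon>) =
      \<epsilon> ^ 6 * (\<Sum>x\<in>particles a \<O> \<epsilon>. \<Sum>y\<in>particles a \<O> \<epsilon> - {x}. g_S S (x - y))" .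
qed

lemma pair_sum_bound:
  obtains C where "0 \<le> C" "\<And>t \<epsilon>. 0 < t \<Longrightarrow> 0 < \<epsilon> \<Longrightarrow> \<bar>pair_sum (stresslet_gauss S t) \<epsilon>\<bar> \<le> C * sqrt t"
proof -
  obtain C where C: "0 \<le> C" "\<And>t z. 0 < t \<Longrightarrow> \<bar>stresslet_gauss S t z\<bar> \<le> C * sqrt t * exp (- (2 * t * (norm z)\<^sup>2))"
    using stresslet_gauss_bound by metis
  show ?thesis
  proof (rule that[of "C * vol\<^sup>2"])
    fix t \<epsilon> :: real assume t: "0 < t" and e: "0 < \<epsilon>"
    have b: "\<bar>stresslet_gauss S t z\<bar> \<le> C * sqrt t" for z
      using C(1) t by (auto intro!: order_trans[OF C(2)[OF t, of z]] mult_left_le)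
    let ?K = "sites \<epsilon>"
    have "\<bar>\<Sum>j\<in>?K. \<Sum>k\<in>?K. stresslet_gauss S t (cell_center a \<epsilon> j - cell_center a \<epsilon> k)\<bar> \<le> (\<Sum>j\<in>?K. \<Sum>k\<in>?K. C * sqrt t)"
      by (intro order_trans[OF sum_abs] sum_mono b)
    also have "\<dots> = C * sqrt t * (real (card ?K))\<^sup>2" by (simp add: power2_eq_square)
    finally have "\<epsilon> ^ 6 * \<bar>\<Sum>j\<in>?K. \<Sum>k\<in>?K. stresslet_gauss S t (cell_center a \<epsilon> j - cell_center a \<epsilon> k)\<bar> \<le> \<epsilon> ^ 6 * (C * sqrt t * (real (card ?K))\<^sup>2)"
      using e by (intro mult_left_mono) auto
    also have "\<dots> = C * sqrt t * (filling \<epsilon>)\<^sup>2"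
      by (simp add: filling_def power_mult_distrib power_mult[symmetric])
    also have "\<dots> \<le> C * sqrt t * vol\<^sup>2"
      using filling_bounds[OF e] C t by (intro mult_left_mono power_mono) auto
    finally show "\<bar>pair_sum (stresslet_gauss S t) \<epsilon>\<bar> \<le> C * vol\<^sup>2 * sqrt t"
      using e by (simp add: pair_sum_def abs_mult mult_ac)
  qed (use C in simp)
qed

text \<open>
  If \<open>j\<close> is occupied but \<open>j - k\<close> is not, every point of the cell of \<open>j\<close> is within
  \<open>2\<epsilon> + \<epsilon>|k| \<le> 3\<epsilon>|k|\<close> of the complement of the domain.
\<close>

lemma boundary_sites:
  assumes e: "\<epsilon> > 0" and k: "k \<noteq> 0"
  shows "\<epsilon> ^ 3 * real (card {j \<in> sites \<epsilon>. j - k \<notin> sites \<epsilon>}) \<le> 3 * tube_const * norm (\<epsilon> *\<^sub>R int_vec k)"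
proof -
  define J where "J = {j \<in> sites \<epsilon>. j - k \<notin> sites \<epsilon>}"
  let ?s = "3 * norm (\<epsilon> *\<^sub>R int_vec k)"
  have nk: "\<epsilon> \<le> norm (\<epsilon> *\<^sub>R int_vec k)" using one_le_norm_int_vec[OF k] e by simp
  have J: "finite J" using finite_sites[OF e] by (simp add: J_def)
  have sub: "y \<in> inner_tube \<O> ?s" if y: "cell_index a \<epsilon> y \<in> J" for y
  proof -
    define j where "j = cell_index a \<epsilon> y"
    have j: "j \<in> sites \<epsilon>" "j - k \<notin> sites \<epsilon>" using y by (auto simp: J_def j_def)
    have d: "dist y (cell_center a \<epsilon> j) < \<epsilon>" using cell_index_near[OF e, of y a] by (simp add: dist_norm j_def)
    then have yO: "y \<in> \<O>" using j(1) by (auto simp: sites_def dist_commute)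
    obtain p where p: "dist (cell_center a \<epsilon> (j - k)) p < \<epsilon>" "p \<notin> \<O>" using j(2) unfolding sites_def mem_Collect_eq subset_iff mem_ball by blast
    have "dist (cell_center a \<epsilon> j) (cell_center a \<epsilon> (j - k)) = norm (\<epsilon> *\<^sub>R int_vec k)"
      unfolding dist_norm cell_center_diff by simp
    then have "dist y p \<le> ?s"
      using d p(1) nk dist_triangle[of y p "cell_center a \<epsilon> j"] dist_triangle[of "cell_center a \<epsilon> j" p "cell_center a \<epsilon> (j - k)"] by linarith
    then show ?thesis using yO p(2) by (auto simp: inner_tube_def)
  qed
  have "\<epsilon> ^ 3 * real (card J) = (\<integral>y. indicator J (cell_index a \<epsilon> y) * 1 \<partial>lborel)"
    by (subst cell_sum(2)[OF e J]) simp
  also have "\<dots> \<le> (\<integral>y. indicator (inner_tube \<O> ?s) y \<partial>lborel)"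
  proof (rule integral_mono)
    show "integrable lborel (\<lambda>y. indicator J (cell_index a \<epsilon> y) * (1::real))" by (rule cell_sum(1)[OF e J])
    show "integrable lborel (indicator (inner_tube \<O> ?s) :: _ \<Rightarrow> real)"
      using inner_tube_finite by (intro integrable_real_indicator) (auto simp: fmeasurable_def)
    show "indicator J (cell_index a \<epsilon> y) * (1::real) \<le> indicator (inner_tube \<O> ?s) y" for y
      using sub[of y] by (auto simp: indicator_def)
  qed
  also have "\<dots> = measure lborel (inner_tube \<O> ?s)" by simp
  also have "\<dots> \<le> tube_const * ?s" using nk e by (intro tube_const) linarith
  finally show ?thesis by (simp add: J_def mult_ac)
qed

text \<open>
  If every particle saw the full lattice, the sum would be \<open>filling \<epsilon>\<close> times
  \<open>\<epsilon>\<^sup>3 \<Sum>\<^sub>k \<gamma>\<^sub>t(\<epsilon>k) = \<epsilon>\<^sup>2 \<Gamma>(\<epsilon>\<^sup>2t)\<close>. A lattice vector \<open>k\<close> is missed by those particles whose translate by \<open>-k\<close>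
  is not a particle. They fill a volume \<open>O(\<epsilon>|k|)\<close>, and \<open>|z||\<gamma>\<^sub>t(z)|\<close> is bounded by a Gaussian
  at \<open>z = \<epsilon>k\<close>.
\<close>

lemma pair_sum_deviation:
  obtains C where "0 \<le> C" "\<And>t \<epsilon>. 0 < t \<Longrightarrow> 0 < \<epsilon> \<Longrightarrow>
    \<bar>pair_sum (stresslet_gauss S t) \<epsilon> - filling \<epsilon> * (\<epsilon>\<^sup>2 * lattice_stresslet S (\<epsilon>\<^sup>2 * t))\<bar> \<le> C / (t * sqrt t)"
proof -
  obtain C where C: "0 \<le> C" "\<And>t z. 0 < t \<Longrightarrow> norm z * \<bar>stresslet_gauss S t z\<bar> \<le> C * exp (- (t * (norm z)\<^sup>2))"
    using stresslet_gauss_bound by metis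
  show ?thesis
  proof (rule that[of "3 * tube_const * C * (8 * (pi * sqrt pi))"])
    fix t \<epsilon> :: real assume t: "0 < t" and e: "0 < \<epsilon>"
    let ?K = "sites \<epsilon>" and ?\<mu> = "count_space (UNIV :: (int^3) set)"
    note fin = finite_sites[OF e]
    define G where "G = (\<lambda>k. stresslet_gauss S t (\<epsilon> *\<^sub>R int_vec k))"
    define B where "B = (\<lambda>k. real (card {j \<in> ?K. j - k \<notin> ?K}))"
    define h where "h = (\<lambda>k. if k = 0 then 0 else exp (- (t * (norm (\<epsilon> *\<^sub>R int_vec k))\<^sup>2)))"
    have st: "0 < \<epsilon>\<^sup>2 * t" using e t by simp
    have Gs: "G k = stresslet_gauss S (\<epsilon>\<^sup>2 * t) (int_vec k) / \<epsilon>" for k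
      using stresslet_gauss_scale[OF e t, of S "int_vec k"] e by (simp add: G_def field_simps)
    have Gi: "integrable ?\<mu> G" unfolding Gs[abs_def] using integrable_lattice_stresslet[OF S st] by simp
    have GI: "(\<integral>k. G k \<partial>?\<mu>) = lattice_stresslet S (\<epsilon>\<^sup>2 * t) / \<epsilon>" unfolding Gs[abs_def] lattice_stresslet_def by simp
    have Gi': "integrable ?\<mu> (\<lambda>k. G k * indicator A k)" for A
      by (rule Bochner_Integration.integrable_bound[OF Gi]) (auto simp: indicator_def)
    \<comment> \<open>The interaction of one particle with all others as a sum over difference vectors.\<close>
    have row: "(\<Sum>k\<in>?K. stresslet_gauss S t (cell_center a \<epsilon> j - cell_center a \<epsilon> k)) = (\<integral>k. G k * indicator ((\<lambda>k. j - k) ` ?K) k \<partial>?\<mu>)" for j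
    proof -
      have "(\<integral>k. G k * indicator ((\<lambda>k. j - k) ` ?K) k \<partial>?\<mu>) = (\<Sum>k | G k * indicator ((\<lambda>k. j - k) ` ?K) k \<noteq> 0. G k * indicator ((\<lambda>k. j - k) ` ?K) k)"
        by (subst lebesgue_integral_count_space_finite_support) (auto intro: finite_subset[OF _ finite_imageI[OF fin, of "\<lambda>k. j - k"]] simp: indicator_def split: if_splits)
      also have "\<dots> = (\<Sum>k\<in>(\<lambda>k. j - k) ` ?K. G k)"
        by (rule sum.mono_neutral_cong_left) (auto simp: fin indicator_def split: if_splits)
      also have "\<dots> = (\<Sum>k\<in>?K. G (j - k))" by (subst sum.reindex) (auto simp: inj_on_def)
      finally show ?thesis by (simp add: G_def cell_center_diff)
    qed
    have dev: "(\<Sum>j\<in>?K. (\<integral>k. G k \<partial>?\<mu>) - (\<integral>k. G k * indicator ((\<lambda>k. j - k) ` ?K) k \<partial>?\<mu>)) = (\<integral>k. G k * B k \<partial>?\<mu>)"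
    proof -
      have c: "G k - G k * indicator ((\<lambda>k. j - k) ` ?K) k = G k * indicator {k. j - k \<notin> ?K} k" for j k
      proof -
        have "k \<in> (\<lambda>k. j - k) ` ?K \<longleftrightarrow> j - k \<in> ?K" by (auto intro!: image_eqI[of _ _ "j - k"])
        then show ?thesis by (auto simp: indicator_def)
      qed
      have "(\<Sum>j\<in>?K. (\<integral>k. G k \<partial>?\<mu>) - (\<integral>k. G k * indicator ((\<lambda>k. j - k) ` ?K) k \<partial>?\<mu>))
         = (\<Sum>j\<in>?K. \<integral>k. G k * indicator {k. j - k \<notin> ?K} k \<partial>?\<mu>)"
        unfolding c[symmetric] by (intro sum.cong refl Bochner_Integration.integral_diff[symmetric] Gi Gi')
      also have "\<dots> = (\<integral>k. (\<Sum>j\<in>?K. G k * indicator {k. j - k \<notin> ?K} k) \<partial>?\<mu>)"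
        by (intro Bochner_Integration.integral_sum[symmetric] Gi')
      also have "\<dots> = (\<integral>k. G k * B k \<partial>?\<mu>)"
      proof (intro Bochner_Integration.integral_cong refl)
        fix k
        have "(\<Sum>j\<in>?K. G k * indicator {k. j - k \<notin> ?K} k) = G k * (\<Sum>j\<in>?K. indicator {j. j - k \<notin> ?K} j)"
          by (simp add: sum_distrib_left indicator_def)
        also have "(\<Sum>j\<in>?K. indicator {j. j - k \<notin> ?K} j) = B k"
          using fin by (simp add: B_def indicator_def sum.If_cases Int_def)
        finally show "(\<Sum>j\<in>?K. G k * indicator {k. j - k \<notin> ?K} k) = G k * B k" .
      qed
      finally show ?thesis .
    qed
    have key: "filling \<epsilon> * (\<epsilon>\<^sup>2 * lattice_stresslet S (\<epsilon>\<^sup>2 * t)) - pair_sum (stresslet_gauss S t) \<epsilon> = \<epsilon> ^ 6 * (\<integral>k. G k * B k \<partial>?\<mu>)"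
    proof -
      have "\<epsilon> ^ 6 * (\<integral>k. G k * B k \<partial>?\<mu>) = \<epsilon> ^ 6 * (real (card ?K) * (lattice_stresslet S (\<epsilon>\<^sup>2 * t) / \<epsilon>)) - pair_sum (stresslet_gauss S t) \<epsilon>"
        unfolding dev[symmetric] pair_sum_def row GI by (simp add: sum_subtractf right_diff_distrib)
      moreover have "\<epsilon> ^ 6 * (real (card ?K) * (lattice_stresslet S (\<epsilon>\<^sup>2 * t) / \<epsilon>)) = filling \<epsilon> * (\<epsilon>\<^sup>2 * lattice_stresslet S (\<epsilon>\<^sup>2 * t))"
        using e by (simp add: filling_def power_numeral_reduce)
      ultimately show ?thesis by simp
    qed
    \<comment> \<open>At \<open>k = 0\<close> both sides vanish, since \<open>\<gamma>\<^sub>t(0) = 0\<close>.\<close>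
    have pt: "\<bar>\<epsilon> ^ 3 * (G k * B k)\<bar> \<le> 3 * tube_const * C * h k" for k
    proof (cases "k = 0")
      case False
      have "\<bar>\<epsilon> ^ 3 * (G k * B k)\<bar> = \<bar>G k\<bar> * (\<epsilon> ^ 3 * B k)" using e by (simp add: abs_mult B_def)
      also have "\<dots> \<le> \<bar>G k\<bar> * (3 * tube_const * norm (\<epsilon> *\<^sub>R int_vec k))"
        unfolding B_def by (intro mult_left_mono boundary_sites e False) simp
      also have "\<dots> = 3 * tube_const * (norm (\<epsilon> *\<^sub>R int_vec k) * \<bar>G k\<bar>)" by simp
      also have "\<dots> \<le> 3 * tube_const * (C * h k)"
        using C(2)[OF t, of "\<epsilon> *\<^sub>R int_vec k"] tube_const(1) False by (intro mult_left_mono) (auto simp: G_def h_def)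
      finally show ?thesis by simp
    qed (simp add: h_def G_def int_vec_def zero_vec_def[symmetric] stresslet_gauss_zero)
    have hi: "integrable ?\<mu> h" unfolding h_def by (rule lattice_gauss_le(1)[OF e t])
    have "norm (\<integral>k. \<epsilon> ^ 3 * (G k * B k) \<partial>?\<mu>) \<le> (\<integral>k. 3 * tube_const * C * h k \<partial>?\<mu>)"
      by (rule norm_integral_le) (use hi pt in auto)
    then have b: "\<epsilon> ^ 3 * \<bar>\<integral>k. G k * B k \<partial>?\<mu>\<bar> \<le> 3 * tube_const * C * (\<integral>k. h k \<partial>?\<mu>)"
      using e by (simp add: abs_mult)
    have "\<bar>filling \<epsilon> * (\<epsilon>\<^sup>2 * lattice_stresslet S (\<epsilon>\<^sup>2 * t)) - pair_sum (stresslet_gauss S t) \<epsilon>\<bar> = \<epsilon> ^ 3 * (\<epsilon> ^ 3 * \<bar>\<integral>k. G k * B k \<partial>?\<mu>\<bar>)"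
      unfolding key using e by (simp add: abs_mult mult.assoc[symmetric] power_add[symmetric])
    also have "\<dots> \<le> \<epsilon> ^ 3 * (3 * tube_const * C * (\<integral>k. h k \<partial>?\<mu>))" using e b by (intro mult_left_mono) auto
    also have "\<dots> = 3 * tube_const * C * (\<epsilon> ^ 3 * (\<integral>k. h k \<partial>?\<mu>))" by simp
    also have "\<dots> \<le> 3 * tube_const * C * (8 * (pi * sqrt pi) / (t * sqrt t))"
      using C(1) tube_const(1) lattice_gauss_le(2)[OF e t] unfolding h_def by (intro mult_left_mono) auto
    finally show "\<bar>pair_sum (stresslet_gauss S t) \<epsilon> - filling \<epsilon> * (\<epsilon>\<^sup>2 * lattice_stresslet S (\<epsilon>\<^sup>2 * t))\<bar> \<le> 3 * tube_const * C * (8 * (pi * sqrt pi)) / (t * sqrt t)"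
      by (simp add: abs_minus_commute)
  qed (use C tube_const in simp)
qed

end

section \<open>The limit of the discrete interaction\<close>

lemma scaled_tail_integral:
  fixes f :: "real \<Rightarrow> real"
  assumes f: "set_integrable lborel {0<..} f" and e: "\<epsilon> > 0"
  shows "set_integrable lborel {1<..} (\<lambda>t. \<epsilon>\<^sup>2 * f (\<epsilon>\<^sup>2 * t))"
    and "(LINT t:{1<..}|lborel. \<epsilon>\<^sup>2 * f (\<epsilon>\<^sup>2 * t)) = (LINT s:{\<epsilon>\<^sup>2<..}|lborel. f s)"
proof -
  have e2: "\<epsilon>\<^sup>2 > 0" using e by simp
  have "set_integrable lborel {\<epsilon>\<^sup>2<..} f"
    by (rule set_integrable_subset[OF f]) (use e2 in auto)
  then have i: "integrable lborel (\<lambda>s. indicator {\<epsilon>\<^sup>2<..} s * f s)" by (simp add: set_integrable_def)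
  have ind: "indicator {\<epsilon>\<^sup>2<..} (0 + \<epsilon>\<^sup>2 * t) = (indicator {1<..} t :: real)" for t
    using e2 by (simp add: indicator_def)
  have "integrable lborel (\<lambda>t. indicator {\<epsilon>\<^sup>2<..} (0 + \<epsilon>\<^sup>2 * t) * f (0 + \<epsilon>\<^sup>2 * t))"
    using lborel_integrable_real_affine[OF i, of "\<epsilon>\<^sup>2" 0] e by simp
  then have i': "integrable lborel (\<lambda>t. indicator {1<..} t * f (\<epsilon>\<^sup>2 * t))" unfolding ind by simp
  show "set_integrable lborel {1<..} (\<lambda>t. \<epsilon>\<^sup>2 * f (\<epsilon>\<^sup>2 * t))"
    using integrable_mult_right[OF i', of "\<epsilon>\<^sup>2"] by (simp add: set_integrable_def mult_ac)
  have "(LINT s:{\<epsilon>\<^sup>2<..}|lborel. f s) = \<bar>\<epsilon>\<^sup>2\<bar> * (\<integral>t. indicator {\<epsilon>\<^sup>2<..} (0 + \<epsilon>\<^sup>2 * t) * f (0 + \<epsilon>\<^sup>2 * t) \<partial>lborel)"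
    unfolding set_lebesgue_integral_def using e by (subst lborel_integral_real_affine[of "\<epsilon>\<^sup>2" _ 0]) auto
  also have "\<dots> = \<epsilon>\<^sup>2 * (\<integral>t. indicator {1<..} t * f (\<epsilon>\<^sup>2 * t) \<partial>lborel)" unfolding ind by simp
  also have "\<dots> = (\<integral>t. \<epsilon>\<^sup>2 * (indicator {1<..} t * f (\<epsilon>\<^sup>2 * t)) \<partial>lborel)" by (rule integral_mult_right_zero[symmetric])
  also have "\<dots> = (LINT t:{1<..}|lborel. \<epsilon>\<^sup>2 * f (\<epsilon>\<^sup>2 * t))"
    unfolding set_lebesgue_integral_def by (simp add: mult_ac)
  finally show "(LINT t:{1<..}|lborel. \<epsilon>\<^sup>2 * f (\<epsilon>\<^sup>2 * t)) = (LINT s:{\<epsilon>\<^sup>2<..}|lborel. f s)" by simp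
qed

lemma tail_integral_tendsto:
  fixes f :: "real \<Rightarrow> real" and \<epsilon> :: "nat \<Rightarrow> real"
  assumes f: "set_integrable lborel {0<..} f" and e: "\<And>n. \<epsilon> n > 0" "\<epsilon> \<longlonglongrightarrow> 0"
  shows "(\<lambda>n. LINT s:{(\<epsilon> n)\<^sup>2<..}|lborel. f s) \<longlonglongrightarrow> (LINT s:{0<..}|lborel. f s)"
  unfolding set_lebesgue_integral_def
proof (rule integral_dominated_convergence)
  have i: "integrable lborel (\<lambda>s. indicator {0<..} s *\<^sub>R f s)" using f by (simp add: set_integrable_def)
  then show "(\<lambda>s. indicator {0<..} s *\<^sub>R f s) \<in> borel_measurable lborel" by (rule borel_measurable_integrable)
  show "integrable lborel (\<lambda>s. \<bar>indicator {0<..} s *\<^sub>R f s\<bar>)" using integrable_abs[OF i] .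
  fix n
  have "set_integrable lborel {(\<epsilon> n)\<^sup>2<..} f" by (rule set_integrable_subset[OF f]) (auto intro: le_less_trans[OF zero_le_power2])
  then show "(\<lambda>s. indicator {(\<epsilon> n)\<^sup>2<..} s *\<^sub>R f s) \<in> borel_measurable lborel"
    unfolding set_integrable_def by (rule borel_measurable_integrable)
  show "AE s in lborel. norm (indicator {(\<epsilon> n)\<^sup>2<..} s *\<^sub>R f s) \<le> \<bar>indicator {0<..} s *\<^sub>R f s\<bar>"
    by (intro AE_I2) (auto simp: indicator_def intro: le_less_trans[OF zero_le_power2])
next
  have e2: "(\<lambda>n. (\<epsilon> n)\<^sup>2) \<longlonglongrightarrow> 0" using tendsto_power[OF e(2), of 2] by simp
  show "AE s in lborel. (\<lambda>n. indicator {(\<epsilon> n)\<^sup>2<..} s *\<^sub>R f s) \<longlonglongrightarrow> indicator {0<..} s *\<^sub>R f s"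
  proof (intro AE_I2)
    fix s :: real
    have "\<forall>\<^sub>F n in sequentially. indicator {(\<epsilon> n)\<^sup>2<..} s *\<^sub>R f s = indicator {0<..} s *\<^sub>R f s"
    proof (cases "0 < s")
      case True
      from order_tendstoD(2)[OF e2 this] show ?thesis by eventually_elim (use True in simp)
    next
      case False
      then have "\<not> (\<epsilon> n)\<^sup>2 < s" for n using zero_le_power2[of "\<epsilon> n"] by linarith
      then show ?thesis using False by (simp add: indicator_def)
    qed
    then show "(\<lambda>n. indicator {(\<epsilon> n)\<^sup>2<..} s *\<^sub>R f s) \<longlonglongrightarrow> indicator {0<..} s *\<^sub>R f s" by (rule tendsto_eventually)
  qed
qed

context particle_system
begin

text \<open>
  Near \<open>t = 0\<close> the sums are bounded by \<open>C\<surd>t\<close>; beyond \<open>t = 1\<close> they are \<open>O(t\<^bsup>-3/2\<^esup>)\<close> after subtraction of the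
  lattice term. The subtracted term tends to \<open>0\<close> pointwise, so the remaining limit is the continuous
  energy, while its integral is that of \<open>\<Gamma>\<close> over \<open>(\<epsilon>\<^sup>2, \<infinity>)\<close> times \<open>filling \<epsilon>\<close>.
\<close>

theorem interaction_tendsto:
  assumes e: "\<And>n. \<epsilon> n > 0" "\<epsilon> \<longlonglongrightarrow> 0"
  shows "(\<lambda>n. LINT t:{0<..}|lborel. pair_sum (stresslet_gauss S t) (\<epsilon> n))
    \<longlonglongrightarrow> (LINT t:{0<..}|lborel. gauss_energy t) + vol * (LINT t:{0<..}|lborel. lattice_stresslet S t)"
proof -
  define P where "P = (\<lambda>n t. pair_sum (stresslet_gauss S t) (\<epsilon> n))"
  define Q where "Q = (\<lambda>n t. filling (\<epsilon> n) * ((\<epsilon> n)\<^sup>2 * lattice_stresslet S ((\<epsilon> n)\<^sup>2 * t)))"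
  \<comment> \<open>The lattice term is subtracted for \<open>t > 1\<close> only: the deviation bound is not integrable at \<open>0\<close>.\<close>
  define F where "F = (\<lambda>n t. indicator {0<..} t * P n t - indicator {1<..} t * Q n t)"
  have L: "set_integrable lborel {0<..} (lattice_stresslet S)" by (rule lattice_stresslet_integral(1)[OF S])
  obtain C where C: "0 \<le> C" "\<And>t \<epsilon>. 0 < t \<Longrightarrow> 0 < \<epsilon> \<Longrightarrow> \<bar>pair_sum (stresslet_gauss S t) \<epsilon>\<bar> \<le> C * sqrt t"
    using pair_sum_bound by metis
  obtain D where D: "0 \<le> D" "\<And>t \<epsilon>. 0 < t \<Longrightarrow> 0 < \<epsilon> \<Longrightarrow>
      \<bar>pair_sum (stresslet_gauss S t) \<epsilon> - filling \<epsilon> * (\<epsilon>\<^sup>2 * lattice_stresslet S (\<epsilon>\<^sup>2 * t))\<bar> \<le> D / (t * sqrt t)"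
    using pair_sum_deviation by metis
  obtain K where K: "0 \<le> K" "\<And>t. 0 < t \<Longrightarrow> \<bar>lattice_stresslet S t\<bar> \<le> K * exp (- t)"
    using lattice_stresslet_bound[OF S] by metis
  have Pi: "integrable lborel (\<lambda>t. indicator {0<..} t * P n t)" for n
    using pair_sum_time_integral(1)[OF e(1)] by (simp add: set_integrable_def P_def)
  have Qi: "integrable lborel (\<lambda>t. indicator {1<..} t * Q n t)" for n
    using integrable_mult_right[of "filling (\<epsilon> n)", OF scaled_tail_integral(1)[OF L e(1)[of n], unfolded set_integrable_def]]
    by (simp add: Q_def mult_ac)
  have QI: "(\<integral>t. indicator {1<..} t * Q n t \<partial>lborel) = filling (\<epsilon> n) * (LINT s:{(\<epsilon> n)\<^sup>2<..}|lborel. lattice_stresslet S s)" for n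
  proof -
    have "(\<integral>t. indicator {1<..} t * Q n t \<partial>lborel) = (\<integral>t. filling (\<epsilon> n) * (indicator {1<..} t * ((\<epsilon> n)\<^sup>2 * lattice_stresslet S ((\<epsilon> n)\<^sup>2 * t))) \<partial>lborel)"
      by (simp add: Q_def mult_ac)
    also have "\<dots> = filling (\<epsilon> n) * (LINT t:{1<..}|lborel. (\<epsilon> n)\<^sup>2 * lattice_stresslet S ((\<epsilon> n)\<^sup>2 * t))"
      unfolding set_lebesgue_integral_def real_scaleR_def by (rule integral_mult_right_zero)
    finally show ?thesis unfolding scaled_tail_integral(2)[OF L e(1)] .
  qed
  have Fb: "\<bar>F n t\<bar> \<le> indicator {0<..} t * ((C + D) * time_bound t)" for n t
  proof -
    consider "t \<le> 0" | "0 < t" "t \<le> 1" | "1 < t" by linarith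
    then show ?thesis
    proof cases
      case 2
      have "\<bar>F n t\<bar> \<le> C * sqrt t" using C(2)[OF 2(1) e(1)] 2 by (simp add: F_def P_def)
      also have "\<dots> \<le> (C + D) * time_bound t"
        using sqrt_le_time_bound(1)[OF 2] C(1) D(1) 2 by (intro mult_mono) auto
      finally show ?thesis using 2 by simp
    next
      case 3
      have "\<bar>F n t\<bar> \<le> D * (1 / (t * sqrt t))" using D(2)[of t "\<epsilon> n"] e(1) 3 by (simp add: F_def P_def Q_def)
      also have "\<dots> \<le> (C + D) * time_bound t"
        using inverse_le_time_bound[OF 3] C(1) D(1) 3 by (intro mult_mono) auto
      finally show ?thesis using 3 by simp
    qed (simp add: F_def)
  qed
  have Qlim: "(\<lambda>n. Q n t) \<longlonglongrightarrow> 0" if t: "0 < t" for t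
  proof (rule Lim_null_comparison)
    have "\<bar>Q n t\<bar> \<le> vol * K * (\<epsilon> n)\<^sup>2" for n
    proof -
      have s: "0 < (\<epsilon> n)\<^sup>2 * t" using e(1)[of n] t by simp
      have "\<bar>lattice_stresslet S ((\<epsilon> n)\<^sup>2 * t)\<bar> \<le> K"
        using s K(1) by (intro order_trans[OF K(2)[OF s]] mult_left_le) auto
      then have "filling (\<epsilon> n) * ((\<epsilon> n)\<^sup>2 * \<bar>lattice_stresslet S ((\<epsilon> n)\<^sup>2 * t)\<bar>) \<le> vol * ((\<epsilon> n)\<^sup>2 * K)"
        using filling_bounds[OF e(1)[of n]] by (intro mult_mono mult_left_mono) auto
      then show ?thesis using filling_bounds(1)[OF e(1)[of n]] by (simp add: Q_def abs_mult mult_ac)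
    qed
    then show "\<forall>\<^sub>F n in sequentially. norm (Q n t) \<le> vol * K * (\<epsilon> n)\<^sup>2" by simp
    have "(\<lambda>n. vol * K * (\<epsilon> n)\<^sup>2) \<longlonglongrightarrow> vol * K * 0\<^sup>2" by (intro tendsto_intros e(2))
    then show "(\<lambda>n. vol * K * (\<epsilon> n)\<^sup>2) \<longlonglongrightarrow> 0" by simp
  qed
  have "(\<lambda>n. \<integral>t. F n t \<partial>lborel) \<longlonglongrightarrow> (\<integral>t. indicator {0<..} t * gauss_energy t \<partial>lborel)"
  proof (rule integral_dominated_convergence[OF _ _ integrable_time_bound])
    show "AE t in lborel. norm (F n t) \<le> indicator {0<..} t * ((C + D) * time_bound t)" for n
      using Fb by simp
    show "F n \<in> borel_measurable lborel" for n
      unfolding F_def by (intro borel_measurable_integrable Bochner_Integration.integrable_diff Pi Qi)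
    show "(\<lambda>t. indicator {0<..} t * gauss_energy t) \<in> borel_measurable lborel"
      using gauss_energy_integrable unfolding set_integrable_def by (auto dest: borel_measurable_integrable)
    show "AE t in lborel. (\<lambda>n. F n t) \<longlonglongrightarrow> indicator {0<..} t * gauss_energy t"
    proof (intro AE_I2)
      fix t :: real
      show "(\<lambda>n. F n t) \<longlonglongrightarrow> indicator {0<..} t * gauss_energy t"
      proof (cases "0 < t")
        case True
        have "(\<lambda>n. F n t) \<longlonglongrightarrow> indicator {0<..} t * gauss_energy t - indicator {1<..} t * 0"
          unfolding F_def P_def by (intro tendsto_diff tendsto_mult tendsto_const pair_sum_tendsto e True Qlim)
        then show ?thesis by simp
      qed (simp add: F_def)
    qed
  qed
  moreover have "(\<integral>t. F n t \<partial>lborel) = (LINT t:{0<..}|lborel. P n t) - filling (\<epsilon> n) * (LINT s:{(\<epsilon> n)\<^sup>2<..}|lborel. lattice_stresslet S s)" for n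
    unfolding F_def QI[symmetric] by (subst Bochner_Integration.integral_diff[OF Pi Qi]) (simp add: set_lebesgue_integral_def)
  ultimately have "(\<lambda>n. (LINT t:{0<..}|lborel. P n t) - filling (\<epsilon> n) * (LINT s:{(\<epsilon> n)\<^sup>2<..}|lborel. lattice_stresslet S s))
      \<longlonglongrightarrow> (LINT t:{0<..}|lborel. gauss_energy t)" by (simp add: set_lebesgue_integral_def)
  from tendsto_add[OF this tendsto_mult[OF filling_tendsto[OF e] tail_integral_tendsto[OF L e]]]
  show ?thesis by (simp add: P_def)
qed

lemma V_N_tendsto:
  "((\<lambda>\<epsilon>. V_N S a \<O> \<epsilon>) \<longlongrightarrow> 75 / (16 * pi) * (LINT t:{0<..}|lborel. lattice_stresslet S t)) (at_right 0)"
  unfolding tendsto_at_iff_sequentially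
proof (intro allI impI)
  fix \<epsilon> :: "nat \<Rightarrow> real" assume "\<forall>n. \<epsilon> n \<in> {0<..} - {0}" and e2: "\<epsilon> \<longlonglongrightarrow> 0"
  then have e1: "\<epsilon> n > 0" for n by auto
  let ?L = "LINT t:{0<..}|lborel. lattice_stresslet S t" and ?E = "LINT t:{0<..}|lborel. gauss_energy t"
  let ?P = "\<lambda>n. LINT t:{0<..}|lborel. pair_sum (stresslet_gauss S t) (\<epsilon> n)"
  have V: "V_N S a \<O> (\<epsilon> n) = 75 * vol / (16 * pi) * (?P n / (filling (\<epsilon> n))\<^sup>2 - ?E / vol\<^sup>2)" for n
  proof -
    have card: "card (particles a \<O> (\<epsilon> n)) = card (sites (\<epsilon> n))"
      unfolding particles_eq using cell_center_inj[OF e1] by (intro card_image) (auto intro: inj_on_subset)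
    have d: "(\<lambda>x. indicator \<O> x / vol) = density" by (simp add: density_def dom_def fun_eq_iff)
    have "(filling (\<epsilon> n))\<^sup>2 = (\<epsilon> n) ^ 6 * (real (card (sites (\<epsilon> n))))\<^sup>2"
      by (simp add: filling_def power_mult_distrib power_mult[symmetric])
    then have "?P n / (filling (\<epsilon> n))\<^sup>2 = 1 / (real (card (sites (\<epsilon> n))))\<^sup>2 *
        (\<Sum>x\<in>particles a \<O> (\<epsilon> n). \<Sum>y\<in>particles a \<O> (\<epsilon> n) - {x}. g_S S (x - y))"
      unfolding pair_sum_time_integral(2)[OF e1] using e1[of n] by simp
    then show ?thesis unfolding V_N_def Let_def card vol_def[symmetric] d stresslet_energy by simp
  qed
  have "(\<lambda>n. 75 * vol / (16 * pi) * (?P n / (filling (\<epsilon> n))\<^sup>2 - ?E / vol\<^sup>2))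
     \<longlonglongrightarrow> 75 * vol / (16 * pi) * ((?E + vol * ?L) / vol\<^sup>2 - ?E / vol\<^sup>2)"
    by (intro tendsto_mult tendsto_diff tendsto_divide tendsto_power tendsto_const interaction_tendsto filling_tendsto e1 e2)
      (use vol_pos in simp)
  also have "75 * vol / (16 * pi) * ((?E + vol * ?L) / vol\<^sup>2 - ?E / vol\<^sup>2) = 75 / (16 * pi) * ?L"
    using vol_pos by (simp add: field_simps power2_eq_square)
  finally show "((\<lambda>\<epsilon>. V_N S a \<O> \<epsilon>) \<circ> \<epsilon>) \<longlonglongrightarrow> 75 / (16 * pi) * ?L" by (simp add: o_def V)
qed

end

theorem proposition5p5:
  fixes a1 :: "real^3" and \<O> :: "(real^3) set" and S :: "real^3^3" and a :: real
  assumes "\<forall>i. - 1/2 < a1 $ i \<and> a1 $ i < 1/2"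
    and "smooth_open \<O>" and "bounded \<O>" and "\<O> \<noteq> {}"
    and "transpose S = S" and "trace S = 0"
    and "is_hasimoto_constant a"
  defines "\<alpha> \<equiv> 5/2 * (1 - 60 * a)" and "\<beta> \<equiv> 5/2 * (1 + 40 * a)"
  shows "((\<lambda>\<epsilon>. V_N S a1 \<O> \<epsilon>) \<longlongrightarrow>
           \<alpha> * (\<Sum>i\<in>UNIV. (S $ i $ i)\<^sup>2) + \<beta> * (\<Sum>i\<in>UNIV. \<Sum>j\<in>UNIV - {i}. (S $ i $ j)\<^sup>2))
         (at_right 0)"
proof -
  interpret particle_system S \<O> a1
    by standard (use assms in auto)
  have "75 / (16 * pi) * (LINT t:{0<..}|lborel. lattice_stresslet S t) = \<alpha> * diag_sq S + \<beta> * offdiag_sq S"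
    unfolding lattice_stresslet_integral(2)[OF S] hasimoto_constant_theta[OF assms(7)] \<alpha>_def \<beta>_def
    by (simp add: field_simps power2_eq_square)
  then show ?thesis using V_N_tendsto unfolding diag_sq_def offdiag_sq_def by simp
qed

end
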